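(* Let $(F,R,\mu,\rho)$ be a space with resistance form satisfying UVD and let $\alpha\in(0,1)$, as in the context. Let $G\subseteq F$ be a compact subset with $\mu(G)>0$. There exist random constants $c_1,c_2$ and a deterministic constant $t_F>0$ such that \[ 0<c_1 \leq \inf_{x\in G} p_t^{\nu}(x,x) \leq c_2<\infty, \qquad \forall\, 0<t<t_F, \qquad \mathbf{P}\mbox{-a.s.} \]
   Context: Resistance forms. Let $F$ be a non-empty set. A pair $(\mathcal{E},\mathcal{F})$ is a resistance form on $F$ if: (RF1) $\mathcal{F}$ is a linear space of functions $F\to\mathbb{R}$ containing constants and $\mathcal{E}$ is a non-negative symmetric quadratic form on $\mathcal{F}$ with $\mathcal{E}(f,f)=0$ iff $f$ is constant; (RF2) $\mathcal{F}$ modulo constants, with inner product $\mathcal{E}$, is a Hilbert space; (RF3) for $x\neq y$ there is $f\in\mathcal{F}$ with $f(x)\neq f(y)$; (RF4) $R(x,y):=\sup\{|f(x)-f(y)|^2/\mathcal{E}(f,f): f\in\mathcal{F},\ \mathcal{E}(f,f)>0\}<\infty$ for all $x,y\in F$; (RF5) if $\bar f:=(f\wedge 1)\vee 0$ then $\bar f\in\mathcal{F}$ and $\mathcal{E}(\bar f,\bar f)\le\mathcal{E}(f,f)$ for all $f\in\mathcal{F}$. Then $R$ is a metric on $F$, the resistance metric. With $C_0(F)$ the compactly supported $R$-continuous functions, the form is regular if $\mathcal{F}\cap C_0(F)$ is dense in $C_0(F)$ in supremum norm. Standing assumptions. $F$ carries a regular resistance form with resistance metric $R$, closed bounded sets in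 $(F,R)$ are compact, $\mu$ is a locally finite, non-atomic Borel regular measure on $(F,R)$ of full support, and $\rho\in F$ is a marked point. The associated regular Dirichlet form $(\mathcal{E},\mathcal{D})$ on $L^2(F,\mu)$ ($\mathcal{D}$ the closure of $\mathcal{F}\cap C_0(F)$ with respect to $\mathcal{E}(f,f)+\int f^2d\mu$) is assumed recurrent. $X=((X_t)_{t\ge0},(P_x)_{x\in F})$ is the associated Hunt process, with jointly measurable local times $(L_t(x))_{x\in F,t\ge0}$ (densities of occupation measure with respect to $\mu$). FIN process. For $\alpha\in(0,1)$ let $\nu(dx)=\sum_i v_i\delta_{x_i}(dx)$, where $(v_i,x_i)_{i\in\mathbb{N}}$ is the Poisson point process on $(0,\infty)\times F$ with intensity $\alpha v^{-1-\alpha}dv\,\mu(dx)$, built under a probability measure $\mathbf{P}$. Set $A^\nu_t:=\int_F L_t(x)\nu(dx)$, $\tau^\nu(t):=\inf\{s>0:A^\nu_s>t\}$, and $X^\nu_t:=X_{\tau^\nu(t)}$. For $\mathbf{P}$-a.e. $\nu$, $X^\nu$ admits a jointly continuous transition density $(p^\nu_t(x,y))_{x,y\in F,t>0}$ with respect to $\nu$. "Random" means depending on the realisation of $\nu$. Condition UVD. With $B_R(x,r):=\{y\in F:R(x,y)<r\}$ and $R_F:=\sup_{x,y\in F}R(x,y)\in(0,\infty]$: there exist constants $c_d,c_l,c_u\in(0,\infty)$ and a non-decreasing $v:(0,\infty)\to(0,\infty)$ with $v(2r)\le c_dv(r)$ for all $r\in(0,R_F+1)$ such that $c_lv(r)\le\mu(B_R(x,r))\le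 c_uv(r)$ for all $x\in F$, $r\in(0,R_F+1)$. *)

theory Defs
  imports "HOL-Probability.Probability"
begin

section \<open>Resistance forms\<close>

text \<open>The set carrying the form is the universe of the (automatically non-empty) type \<open>'a\<close>.
  The quadratic form is given through its symmetric bilinear form \<open>\<E>\<close>, of which only the values on
  \<open>\<F>\<close> matter.\<close>

text \<open>The supremum is taken in the extended half-line, so that it is \<open>0\<close>, and not an unspecified
  real number, should there be no function of positive energy.\<close>

definition resistance ::
    "(('a \<Rightarrow> real) \<Rightarrow> ('a \<Rightarrow> real) \<Rightarrow> real) \<Rightarrow> ('a \<Rightarrow> real) set \<Rightarrow> 'a \<Rightarrow> 'a \<Rightarrow> ennreal" where
  "resistance \<E> \<F> x y = (SUP f\<in>{f \<in> \<F>. \<E> f f > 0}. ennreal (\<bar>f x - f y\<bar>\<^sup>2 / \<E> f f))"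

text \<open>\<open>complete\<close> is the completeness of \<open>\<F>\<close> modulo constants, stated with representatives;
  that \<open>\<E>\<close> is an inner product on this quotient is contained in the preceding assumptions.\<close>

locale resistance_form =
  fixes \<E> :: "('a \<Rightarrow> real) \<Rightarrow> ('a \<Rightarrow> real) \<Rightarrow> real"
    and \<F> :: "('a \<Rightarrow> real) set"
  assumes const_mem: "\<And>c. (\<lambda>x. c) \<in> \<F>"
    and lincomb_mem: "\<And>f g a b. f \<in> \<F> \<Longrightarrow> g \<in> \<F> \<Longrightarrow> (\<lambda>x. a * f x + b * g x) \<in> \<F>"
    and sym: "\<And>f g. f \<in> \<F> \<Longrightarrow> g \<in> \<F> \<Longrightarrow> \<E> f g = \<E> g f"
    and lincomb: "\<And>f g h a b. f \<in> \<F> \<Longrightarrow> g \<in> \<F> \<Longrightarrow> h \<in> \<F> \<Longrightarrow>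
        \<E> (\<lambda>x. a * f x + b * g x) h = a * \<E> f h + b * \<E> g h"
    and nonneg: "\<And>f. f \<in> \<F> \<Longrightarrow> 0 \<le> \<E> f f"
    and zero_iff: "\<And>f. f \<in> \<F> \<Longrightarrow> \<E> f f = 0 \<longleftrightarrow> (\<exists>c. \<forall>x. f x = c)"
    and complete: "\<And>u :: nat \<Rightarrow> 'a \<Rightarrow> real. (\<forall>n. u n \<in> \<F>) \<Longrightarrow>
        (\<forall>e>0. \<exists>N. \<forall>m\<ge>N. \<forall>n\<ge>N. \<E> (\<lambda>x. u m x - u n x) (\<lambda>x. u m x - u n x) < e) \<Longrightarrow>
        \<exists>f\<in>\<F>. (\<lambda>n. \<E> (\<lambda>x. u n x - f x) (\<lambda>x. u n x - f x)) \<longlonglongrightarrow> 0"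
    and separating: "\<And>x y. x \<noteq> y \<Longrightarrow> \<exists>f\<in>\<F>. f x \<noteq> f y"
    and resistance_finite: "\<And>x y. resistance \<E> \<F> x y < \<infinity>"
    and unit_contraction: "\<And>f. f \<in> \<F> \<Longrightarrow> (\<lambda>x. max (min (f x) 1) 0) \<in> \<F> \<and>
        \<E> (\<lambda>x. max (min (f x) 1) 0) (\<lambda>x. max (min (f x) 1) 0) \<le> \<E> f f"

definition compactly_supported :: "('a::topological_space \<Rightarrow> real) set" where
  "compactly_supported = {f. continuous_on UNIV f \<and> compact (closure {x. f x \<noteq> 0})}"

text \<open>\<open>dist_eq\<close> makes the metric of the type the resistance metric of the form, so that all
  topological notions refer to it. As a measure on the Borel sets has exactly one Borel
  regular extension to an outer measure on all subsets, \<open>sets_borel\<close> renders Borel regularity.\<close>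

locale resistance_space = resistance_form \<E> \<F>
  for \<E> :: "('a::metric_space \<Rightarrow> real) \<Rightarrow> ('a \<Rightarrow> real) \<Rightarrow> real"
    and \<F> :: "('a \<Rightarrow> real) set" +
  fixes \<mu> :: "'a measure"
  assumes dist_eq: "\<And>x y. ennreal (dist x y) = resistance \<E> \<F> x y"
    and regular: "\<And>f e. f \<in> compactly_supported \<Longrightarrow> 0 < e \<Longrightarrow>
        \<exists>g \<in> \<F> \<inter> compactly_supported. \<forall>x. \<bar>f x - g x\<bar> < e"
    and closed_bounded_compact: "\<And>S :: 'a set. closed S \<Longrightarrow> bounded S \<Longrightarrow> compact S"
    and sets_borel: "sets \<mu> = sets borel"
    and locally_finite: "\<And>x. \<exists>r>0. emeasure \<mu> (ball x r) < \<infinity>"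
    and non_atomic: "\<And>A. A \<in> sets \<mu> \<Longrightarrow> emeasure \<mu> A > 0 \<Longrightarrow>
        \<exists>B\<in>sets \<mu>. B \<subseteq> A \<and> emeasure \<mu> B > 0 \<and> emeasure \<mu> (A - B) > 0"
    and full_support: "\<And>U. open U \<Longrightarrow> U \<noteq> {} \<Longrightarrow> emeasure \<mu> U > 0"

definition resistance_diameter ::
    "(('a \<Rightarrow> real) \<Rightarrow> ('a \<Rightarrow> real) \<Rightarrow> real) \<Rightarrow> ('a \<Rightarrow> real) set \<Rightarrow> ennreal" where
  "resistance_diameter \<E> \<F> = (SUP x. SUP y. resistance \<E> \<F> x y)"

definition resistance_ball ::
    "(('a \<Rightarrow> real) \<Rightarrow> ('a \<Rightarrow> real) \<Rightarrow> real) \<Rightarrow> ('a \<Rightarrow> real) set \<Rightarrow> 'a \<Rightarrow> real \<Rightarrow> 'a set" where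
  "resistance_ball \<E> \<F> x r = {y. resistance \<E> \<F> x y < ennreal r}"

definition UVD ::
    "(('a \<Rightarrow> real) \<Rightarrow> ('a \<Rightarrow> real) \<Rightarrow> real) \<Rightarrow> ('a \<Rightarrow> real) set \<Rightarrow> 'a measure \<Rightarrow> bool" where
  "UVD \<E> \<F> \<mu> \<longleftrightarrow> (\<exists>(c_d::real) (c_l::real) (c_u::real) (v :: real \<Rightarrow> real).
     0 < c_d \<and> 0 < c_l \<and> 0 < c_u \<and>
     (\<forall>r>0. 0 < v r) \<and> mono_on {0<..} v \<and>
     (\<forall>r>0. ennreal r < resistance_diameter \<E> \<F> + 1 \<longrightarrow>
        v (2 * r) \<le> c_d * v r \<and>
        (\<forall>x. ennreal (c_l * v r) \<le> emeasure \<mu> (resistance_ball \<E> \<F> x r) \<and>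
             emeasure \<mu> (resistance_ball \<E> \<F> x r) \<le> ennreal (c_u * v r))))"


section \<open>The Dirichlet form and recurrence\<close>

text \<open>The space \<open>\<F> \<inter> L\<^sup>2(\<mu>)\<close> is complete for \<open>\<E>(f,f) + \<integral>f\<^sup>2 d\<mu>\<close>, so the closure can be taken
  inside it. Its elements are genuine (continuous) functions rather than classes.\<close>

definition dirichlet_domain ::
    "(('a::topological_space \<Rightarrow> real) \<Rightarrow> ('a \<Rightarrow> real) \<Rightarrow> real) \<Rightarrow> ('a \<Rightarrow> real) set \<Rightarrow>
      'a measure \<Rightarrow> ('a \<Rightarrow> real) set" where
  "dirichlet_domain \<E> \<F> \<mu> = {f \<in> \<F>. integrable \<mu> (\<lambda>x. (f x)\<^sup>2) \<and>
     (\<exists>u :: nat \<Rightarrow> 'a \<Rightarrow> real. (\<forall>n. u n \<in> \<F> \<inter> compactly_supported) \<and>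
        (\<lambda>n. \<E> (\<lambda>x. f x - u n x) (\<lambda>x. f x - u n x) + (\<integral>x. (f x - u n x)\<^sup>2 \<partial>\<mu>)) \<longlonglongrightarrow> 0)}"

text \<open>\<open>u = G\<^sub>\<beta> f\<close>, where \<open>G\<close> is the resolvent of the Dirichlet form on \<open>L\<^sup>2(\<mu>)\<close>; by Riesz'
  theorem there is exactly one such \<open>u\<close> for every \<open>f\<close> in \<open>L\<^sup>2(\<mu>)\<close> and \<open>\<beta> > 0\<close>.\<close>

definition is_resolvent ::
    "(('a::topological_space \<Rightarrow> real) \<Rightarrow> ('a \<Rightarrow> real) \<Rightarrow> real) \<Rightarrow> ('a \<Rightarrow> real) set \<Rightarrow>
      'a measure \<Rightarrow> real \<Rightarrow> ('a \<Rightarrow> real) \<Rightarrow> ('a \<Rightarrow> real) \<Rightarrow> bool" where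
  "is_resolvent \<E> \<F> \<mu> \<beta> f u \<longleftrightarrow> u \<in> dirichlet_domain \<E> \<F> \<mu> \<and>
     (\<forall>g\<in>dirichlet_domain \<E> \<F> \<mu>. \<E> u g + \<beta> * (\<integral>x. u x * g x \<partial>\<mu>) = (\<integral>x. f x * g x \<partial>\<mu>))"

text \<open>Recurrence: the Green operator \<open>G f = \<integral>\<^sub>0\<^sup>\<infinity> T\<^sub>t f dt = lim\<^sub>\<beta>\<^sub>\<rightarrow>\<^sub>0 G\<^sub>\<beta> f\<close> (an increasing limit)
  takes a.e. only the values \<open>0\<close> and \<open>\<infinity>\<close>. It is enough to consider non-negative \<open>f\<close> in
  \<open>L\<^sup>1(\<mu>) \<inter> L\<^sup>2(\<mu>)\<close>, every non-negative integrable \<open>f\<close> being the increasing limit of the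
  functions \<open>min f n\<close>.\<close>

definition recurrent_form ::
    "(('a::topological_space \<Rightarrow> real) \<Rightarrow> ('a \<Rightarrow> real) \<Rightarrow> real) \<Rightarrow> ('a \<Rightarrow> real) set \<Rightarrow>
      'a measure \<Rightarrow> bool" where
  "recurrent_form \<E> \<F> \<mu> \<longleftrightarrow>
     (\<forall>f. (\<forall>x. 0 \<le> f x) \<and> integrable \<mu> f \<and> integrable \<mu> (\<lambda>x. (f x)\<^sup>2) \<longrightarrow>
       (\<exists>u :: nat \<Rightarrow> 'a \<Rightarrow> real. (\<forall>n. is_resolvent \<E> \<F> \<mu> (1 / real (Suc n)) f (u n)) \<and>
          (AE x in \<mu>. (SUP n. ennreal (u n x)) = 0 \<or> (SUP n. ennreal (u n x)) = \<infinity>)))"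


section \<open>Hunt processes and local times\<close>

text \<open>Recurrent Dirichlet forms are conservative, so the processes below have infinite life time
  and no cemetery state is needed.\<close>

definition natural_events ::
    "'o measure \<Rightarrow> (real \<Rightarrow> 'o \<Rightarrow> 'a::topological_space) \<Rightarrow> real \<Rightarrow> 'o set set" where
  "natural_events M X t = sigma_sets (space M)
     {X s -` A \<inter> space M | s A. 0 \<le> s \<and> s \<le> t \<and> A \<in> sets borel}"

definition natural_events_right ::
    "'o measure \<Rightarrow> (real \<Rightarrow> 'o \<Rightarrow> 'a::topological_space) \<Rightarrow> real \<Rightarrow> 'o set set" where
  "natural_events_right M X t = (\<Inter>u\<in>{t<..}. natural_events M X u)"

definition is_stopping_time ::
    "'o measure \<Rightarrow> (real \<Rightarrow> 'o \<Rightarrow> 'a::topological_space) \<Rightarrow> ('o \<Rightarrow> ennreal) \<Rightarrow> bool" where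
  "is_stopping_time M X T \<longleftrightarrow>
     (\<forall>t\<ge>0. {w \<in> space M. T w \<le> ennreal t} \<in> natural_events_right M X t)"

definition stopped_events ::
    "'o measure \<Rightarrow> (real \<Rightarrow> 'o \<Rightarrow> 'a::topological_space) \<Rightarrow> ('o \<Rightarrow> ennreal) \<Rightarrow> 'o set set" where
  "stopped_events M X T = {\<Lambda> \<in> sets M. \<forall>t\<ge>0.
     \<Lambda> \<inter> {w \<in> space M. T w \<le> ennreal t} \<in> natural_events_right M X t}"

text \<open>Time parameters are real; only times \<open>t \<ge> 0\<close> matter. \<open>sets_M\<close> says that the sigma-algebra is
  generated by the process.\<close>

locale hunt_process =
  fixes M :: "'o measure"
    and X :: "real \<Rightarrow> 'o \<Rightarrow> 'a::metric_space"
    and \<theta> :: "real \<Rightarrow> 'o \<Rightarrow> 'o"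
    and P :: "'a \<Rightarrow> 'o measure"
  assumes sets_M: "sets M = sigma_sets (space M)
        {X s -` A \<inter> space M | s A. 0 \<le> s \<and> A \<in> sets borel}"
    and kernel: "P \<in> borel \<rightarrow>\<^sub>M prob_algebra M"
    and shift_space: "\<And>t w. 0 \<le> t \<Longrightarrow> w \<in> space M \<Longrightarrow> \<theta> t w \<in> space M"
    and shift: "\<And>s t w. 0 \<le> s \<Longrightarrow> 0 \<le> t \<Longrightarrow> w \<in> space M \<Longrightarrow> X s (\<theta> t w) = X (s + t) w"
    and right_continuous: "\<And>t w. 0 \<le> t \<Longrightarrow> w \<in> space M \<Longrightarrow>
        ((\<lambda>s. X s w) \<longlongrightarrow> X t w) (at_right t)"
    and left_limits: "\<And>t w. 0 < t \<Longrightarrow> w \<in> space M \<Longrightarrow>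
        \<exists>l. ((\<lambda>s. X s w) \<longlongrightarrow> l) (at_left t)"
    and normal: "\<And>z. AE w in P z. X 0 w = z"
    and strong_markov: "\<And>z T \<Lambda> s A. is_stopping_time M X T \<Longrightarrow> \<Lambda> \<in> stopped_events M X T \<Longrightarrow>
        0 \<le> s \<Longrightarrow> A \<in> sets borel \<Longrightarrow>
        emeasure (P z) {w \<in> \<Lambda>. T w < \<infinity> \<and> X (enn2real (T w) + s) w \<in> A} =
        (\<integral>\<^sup>+ w \<in> {w \<in> \<Lambda>. T w < \<infinity>}.
           emeasure (P (X (enn2real (T w)) w)) (X s -` A \<inter> space M) \<partial>P z)"
    and quasi_left_continuous: "\<And>z (T :: nat \<Rightarrow> 'o \<Rightarrow> ennreal) S.
        (\<forall>n. is_stopping_time M X (T n)) \<Longrightarrow>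
        (\<forall>w\<in>space M. incseq (\<lambda>n. T n w) \<and> (\<lambda>n. T n w) \<longlonglongrightarrow> S w) \<Longrightarrow>
        (AE w in P z. S w < \<infinity> \<longrightarrow>
           (\<lambda>n. X (enn2real (T n w)) w) \<longlonglongrightarrow> X (enn2real (S w)) w)"

text \<open>The process is associated with the Dirichlet form: its resolvent is a version of the
  resolvent of the form (equivalently, by uniqueness of Laplace transforms, its transition
  semigroup is a version of the \<open>L\<^sup>2\<close>-semigroup of the form).\<close>

definition associated_process ::
    "(('a::metric_space \<Rightarrow> real) \<Rightarrow> ('a \<Rightarrow> real) \<Rightarrow> real) \<Rightarrow> ('a \<Rightarrow> real) set \<Rightarrow> 'a measure \<Rightarrow>
      (real \<Rightarrow> 'o \<Rightarrow> 'a) \<Rightarrow> ('a \<Rightarrow> 'o measure) \<Rightarrow> bool" where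
  "associated_process \<E> \<F> \<mu> X P \<longleftrightarrow>
     (\<forall>\<beta>>0. \<forall>f. f \<in> borel_measurable borel \<and> bounded (range f) \<and> integrable \<mu> (\<lambda>x. (f x)\<^sup>2) \<longrightarrow>
       (\<exists>u. is_resolvent \<E> \<F> \<mu> \<beta> f u \<and>
         (AE x in \<mu>. (LINT t:{0..}|lborel. exp (- \<beta> * t) * (\<integral>w. f (X t w) \<partial>P x)) = u x)))"

text \<open>Local times: for every point \<open>y\<close> a continuous additive functional \<open>L\<^sub>t(y)\<close> (adapted up to null
  sets), which together form an occupation density with respect to \<open>\<mu>\<close>. The functional for each \<open>y\<close>
  may have its own exceptional null set; no continuity in \<open>y\<close> is required.\<close>

locale local_times =
  fixes \<mu> :: "'a::metric_space measure"
    and M :: "'o measure"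
    and X :: "real \<Rightarrow> 'o \<Rightarrow> 'a"
    and \<theta> :: "real \<Rightarrow> 'o \<Rightarrow> 'o"
    and P :: "'a \<Rightarrow> 'o measure"
    and L :: "real \<Rightarrow> 'a \<Rightarrow> 'o \<Rightarrow> real"
  assumes jointly_measurable: "(\<lambda>(t, y, w). L t y w)
        \<in> borel_measurable (restrict_space borel {0..} \<Otimes>\<^sub>M borel \<Otimes>\<^sub>M M)"
    and adapted: "\<And>z y t. 0 \<le> t \<Longrightarrow>
        \<exists>g \<in> borel_measurable (sigma (space M) (natural_events M X t)). AE w in P z. L t y w = g w"
    and increasing: "\<And>z y. AE w in P z. L 0 y w = 0 \<and> mono_on {0..} (\<lambda>t. L t y w) \<and>
        continuous_on {0..} (\<lambda>t. L t y w)"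
    and additive: "\<And>z y. AE w in P z. \<forall>s\<ge>0. \<forall>t\<ge>0. L (s + t) y w = L s y w + L t y (\<theta> s w)"
    and occupation_density: "\<And>z. AE w in P z. \<forall>t\<ge>0. \<forall>A\<in>sets borel.
        emeasure lborel {s \<in> {0..t}. X s w \<in> A} = (\<integral>\<^sup>+ y \<in> A. ennreal (L t y w) \<partial>\<mu>)"


section \<open>Poisson point processes and the FIN process\<close>

definition point_count :: "(nat \<Rightarrow> 'w \<Rightarrow> 'b) \<Rightarrow> 'b set \<Rightarrow> 'w \<Rightarrow> ennreal" where
  "point_count \<xi> B \<omega> = emeasure (count_space UNIV) {i. \<xi> i \<omega> \<in> B}"

locale poisson_point_process = prob_space W
  for W :: "'w measure" +
  fixes \<xi> :: "nat \<Rightarrow> 'w \<Rightarrow> 'b" and m :: "'b measure"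
  assumes points_measurable: "\<And>i. \<xi> i \<in> W \<rightarrow>\<^sub>M m"
    and poisson_counts: "\<And>B k. B \<in> sets m \<Longrightarrow> emeasure m B < \<infinity> \<Longrightarrow>
        prob {\<omega> \<in> space W. point_count \<xi> B \<omega> = of_nat k} =
          exp (- measure m B) * measure m B ^ k / fact k"
    and independent_counts: "\<And>(B :: nat \<Rightarrow> 'b set) n. (\<forall>j<n. B j \<in> sets m) \<Longrightarrow>
        disjoint_family_on B {..<n} \<Longrightarrow>
        indep_vars (\<lambda>_. borel) (\<lambda>j. point_count \<xi> (B j)) {..<n}"

definition fin_intensity :: "real \<Rightarrow> 'a::topological_space measure \<Rightarrow> (real \<times> 'a) measure" where
  "fin_intensity \<alpha> \<mu> =
     density lborel (\<lambda>v. ennreal (indicator {0<..} v * (\<alpha> * v powr (- 1 - \<alpha>)))) \<Otimes>\<^sub>M \<mu>"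

text \<open>The measure \<open>\<nu> = \<Sum>\<^sub>i v\<^sub>i \<delta>\<^bsub>x\<^sub>i\<^esub>\<close>, as the image of the measure with weights \<open>v\<^sub>i\<close> on the indices.\<close>

definition atomic_measure :: "(nat \<Rightarrow> real \<times> 'a::topological_space) \<Rightarrow> 'a measure" where
  "atomic_measure c =
     distr (density (count_space UNIV) (\<lambda>i. ennreal (fst (c i)))) borel (\<lambda>i. snd (c i))"

definition clock :: "(real \<Rightarrow> 'a \<Rightarrow> 'o \<Rightarrow> real) \<Rightarrow> 'a measure \<Rightarrow> real \<Rightarrow> 'o \<Rightarrow> ennreal" where
  "clock L \<nu> t w = (\<integral>\<^sup>+ x. ennreal (L t x w) \<partial>\<nu>)"

definition inverse_clock :: "(real \<Rightarrow> 'a \<Rightarrow> 'o \<Rightarrow> real) \<Rightarrow> 'a measure \<Rightarrow> real \<Rightarrow> 'o \<Rightarrow> ennreal" where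
  "inverse_clock L \<nu> t w = Inf {ennreal s | s. 0 < s \<and> clock L \<nu> s w > ennreal t}"

text \<open>\<open>None\<close> is the cemetery, where the process is when the inverse clock is infinite.\<close>

definition time_changed ::
    "(real \<Rightarrow> 'o \<Rightarrow> 'a) \<Rightarrow> (real \<Rightarrow> 'a \<Rightarrow> 'o \<Rightarrow> real) \<Rightarrow> 'a measure \<Rightarrow> real \<Rightarrow> 'o \<Rightarrow> 'a option" where
  "time_changed X L \<nu> t w =
     (if inverse_clock L \<nu> t w = \<infinity> then None else Some (X (enn2real (inverse_clock L \<nu> t w)) w))"

text \<open>The completion is needed because the local times have regular paths only almost surely, so the
  event in question is measurable only up to null sets.\<close>

definition jointly_continuous_transition_density ::
    "(real \<Rightarrow> 'o \<Rightarrow> 'a option) \<Rightarrow> ('a \<Rightarrow> 'o measure) \<Rightarrow> 'a::metric_space measure \<Rightarrow>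
      (real \<Rightarrow> 'a \<Rightarrow> 'a \<Rightarrow> real) \<Rightarrow> bool" where
  "jointly_continuous_transition_density Y P \<nu> p \<longleftrightarrow>
     continuous_on ({0<..} \<times> UNIV \<times> UNIV) (\<lambda>(t, x, y). p t x y) \<and>
     (\<forall>t>0. \<forall>x y. 0 \<le> p t x y) \<and>
     (\<forall>t>0. \<forall>x. \<forall>A\<in>sets borel.
        emeasure (completion (P x)) {w \<in> space (P x). Y t w \<in> Some ` A} =
          (\<integral>\<^sup>+ y \<in> A. ennreal (p t x y) \<partial>\<nu>))"

end

theory Submission
  imports Defs
begin

text \<open>Let \<open>Y\<close> be the time-changed process, \<open>(v\<^sub>i, y\<^sub>i)\<close> the atoms of \<open>\<nu>\<close> and \<open>p\<close> the transition density of
\<open>Y\<close>. The bounds hold with \<open>t\<^sub>F = 1\<close>, and three properties of \<open>p\<close> give them.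

\<^item> \<open>v\<^sub>i p\<^sub>t(x,y\<^sub>i) \<le> P\<^sub>x(Y\<^sub>t = y\<^sub>i) \<le> 1\<close>. As the weights have infinite intensity near \<open>0\<close>, a set of positive
  measure almost surely contains an atom, and an atom \<open>y\<^sub>i\<close> in \<open>G\<close> bounds the infimum by \<open>1 / v\<^sub>i\<close>.
\<^item> \<open>t \<mapsto> p\<^sub>t(x,x)\<close> is non-increasing, so that \<open>p\<^sub>1(x,x)\<close> is a lower bound for all \<open>t < 1\<close>.
\<^item> \<open>p\<^sub>1(x,x) > 0\<close>, so that the minimum of this continuous function over the compact set \<open>G\<close> is positive.

If \<open>p\<close> is symmetric and satisfies the Chapman-Kolmogorov equation at the atoms, then
\<open>q(t) = p\<^sub>t(y\<^sub>i,y\<^sub>i)\<close> satisfies \<open>q(s+t)\<^sup>2 \<le> q(2s) q(2t)\<close> by the Cauchy-Schwarz inequality; being bounded,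
it cannot increase (locale \<open>symmetric_chain\<close>). In the same way \<open>v\<^sub>k p\<^sub>s(x,y\<^sub>k)\<^sup>2 \<le> p\<^sub>2\<^sub>s(x,x)\<close>. Continuity and the
density of the atoms carry both statements from atoms to all points. If \<open>p\<^sub>T(x,x) = 0\<close>, repeated halving of \<open>T\<close>
and monotonicity give \<open>p\<^sub>t(x,y\<^sub>k) = 0\<close> for all \<open>t\<close> and \<open>k\<close>; then the local time of \<open>X\<close> at every atom vanishes,
so the resolvent density \<open>g\<^sub>1(x,\<cdot>)\<close> of \<open>X\<close> vanishes at all atoms, hence everywhere. This is absurd, as
its integral is the expected discounted time that \<open>X\<close> spends in the whole space.

Symmetry and the Chapman-Kolmogorov equation come from the Laplace transform of \<open>p\<close>. For \<open>\<kappa> > 0\<close> let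
\<open>g\<^sub>\<kappa>(x,y)\<close> be the resolvent density of \<open>X\<close>. It is symmetric because the form is, and it is
bounded and continuous because the volume condition makes \<open>(h(x))\<^sup>2\<close> a bounded multiple of
\<open>\<E>(h,h) + \<kappa> \<integral>h\<^sup>2 d\<mu>\<close>. For almost all \<open>y\<close> and then all \<open>x\<close> it is the expected discounted local time at \<open>y\<close>
(lemma \<open>expected_discounted_local\<close>), and the random atoms avoid the exceptional set. Killing \<open>X\<close> at rate
\<open>\<beta>\<close> in the clock \<open>A = \<Sum>\<^sub>i v\<^sub>i L(y\<^sub>i)\<close> gives a kernel \<open>V\<close> with
\<open>g\<^sub>\<kappa>(x,y\<^sub>j) = V(x,y\<^sub>j) + \<beta> \<Sum>\<^sub>i v\<^sub>i V(x,y\<^sub>i) g\<^sub>\<kappa>(y\<^sub>i,y\<^sub>j)\<close>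
(lemma \<open>green_decomposition\<close>): the local time accumulated after the killing time is evaluated by the Markov
property at the inverse clock, which is obtained from deterministic times by dyadic approximation from above,
and the clock grows only while \<open>X\<close> sits at an atom. This equation forces \<open>V\<close> to be symmetric and to satisfy the
resolvent equation in \<open>\<beta>\<close>. As \<open>\<kappa>\<close> decreases to \<open>0\<close>, \<open>V\<close> increases to \<open>\<integral> e\<^sup>-\<^sup>\<beta>\<^sup>t p\<^sub>t(x,y\<^sub>j) dt\<close>
(lemma \<open>killed_green_laplace\<close>), and both properties pass to the limit.\<close>

section \<open>Uniqueness of Laplace transforms\<close>

text \<open>Polynomials are dense in the continuous functions on the unit interval, and these
  determine a finite measure.\<close>

lemma finite_measure_eq_of_moments:
  fixes M N :: "real measure"
  assumes M: "finite_borel_measure M" and N: "finite_borel_measure N"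
    and M01: "AE x in M. 0 \<le> x \<and> x \<le> 1" and N01: "AE x in N. 0 \<le> x \<and> x \<le> 1"
    and moments: "\<And>k::nat. (\<integral>x. x ^ k \<partial>M) = (\<integral>x. x ^ k \<partial>N)"
  shows "M = N"
proof (rule cdf_unique'[OF M N], rule ext)
  interpret M: finite_borel_measure M by fact
  interpret N: finite_borel_measure N by fact
  fix a :: real
  \<comment> \<open>Continuous functions that decrease to the indicator of the half-line.\<close>
  define h where "h n x = max 0 (min 1 (1 - real n * (x - a)))" for n :: nat and x :: real
  have h_bound: "\<bar>h n x\<bar> \<le> 1" for n x by (auto simp: h_def)
  have h_cont: "continuous_on UNIV (h n)" for n unfolding h_def by (intro continuous_intros)
  have h_meas: "h n \<in> borel_measurable borel" for n
    by (rule borel_measurable_continuous_onI[OF h_cont])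
  have h_lim: "(\<lambda>n. h n x) \<longlonglongrightarrow> indicator {..a} x" for x
  proof (cases "x \<le> a")
    case True
    then have "h n x = 1" for n by (auto simp: h_def mult_nonneg_nonpos)
    with True show ?thesis by simp
  next
    case False
    obtain n0 where n0: "real n0 > 1 / (x - a)" using reals_Archimedean2 by blast
    have "\<forall>\<^sub>F n in sequentially. h n x = 0"
      unfolding eventually_sequentially
    proof (intro exI allI impI)
      fix n assume "n \<ge> n0"
      then have "real n0 * (x - a) \<le> real n * (x - a)" using False by (intro mult_right_mono) auto
      moreover have "1 < real n0 * (x - a)" using n0 False by (simp add: field_simps)
      ultimately have "1 - real n * (x - a) \<le> 0" by linarith
      then show "h n x = 0" unfolding h_def by linarith
    qed
    with False show ?thesis by (simp add: tendsto_eventually)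
  qed
  have int_h: "(\<integral>x. h n x \<partial>M) = (\<integral>x. h n x \<partial>N)" for n
  proof (rule ccontr)
    assume neq: "(\<integral>x. h n x \<partial>M) \<noteq> (\<integral>x. h n x \<partial>N)"
    define K where "K = measure M UNIV + measure N UNIV + 1"
    have K: "K > 0" by (auto simp: K_def intro: add_nonneg_pos)
    define e where "e = \<bar>(\<integral>x. h n x \<partial>M) - (\<integral>x. h n x \<partial>N)\<bar> / K"
    have e: "e > 0" using neq K by (simp add: e_def)
    obtain g where g: "real_polynomial_function g" "\<And>x. x \<in> {0..1} \<Longrightarrow> \<bar>h n x - g x\<bar> < e"
      using Stone_Weierstrass_real_polynomial_function[of "{0..1}" "h n" e] e
        continuous_on_subset[OF h_cont] by (metis compact_Icc subset_UNIV)
    obtain b m where gb: "g = (\<lambda>x. \<Sum>i\<le>m. b i * x ^ i)"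
      using g(1) real_polynomial_function_imp_sum by blast
    have close: "\<bar>(\<integral>x. h n x \<partial>L) - (\<integral>x. g x \<partial>L)\<bar> \<le> e * measure L UNIV"
       and pw: "integrable L (\<lambda>x. x ^ i)"
      if L: "finite_borel_measure L" and ae: "AE x in L. 0 \<le> x \<and> x \<le> 1" for L i
    proof -
      interpret L: finite_borel_measure L by fact
      note L.M_is_borel[measurable_cong]
      have pw: "integrable L (\<lambda>x. x ^ i)" for i
      proof (rule L.integrable_const_bound)
        show "AE x in L. norm (x ^ i) \<le> 1"
          using ae by eventually_elim (auto simp: power_le_one)
      qed measurable
      then have ig: "integrable L g" unfolding gb by auto
      have ih: "integrable L (h n)"
        by (rule L.integrable_const_bound[where B=1]) (use h_bound h_meas in auto)
      have "\<bar>(\<integral>x. h n x \<partial>L) - (\<integral>x. g x \<partial>L)\<bar> = \<bar>\<integral>x. h n x - g x \<partial>L\<bar>"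
        using ig ih by simp
      also have "\<dots> \<le> (\<integral>x. \<bar>h n x - g x\<bar> \<partial>L)" by simp
      also have "\<dots> \<le> (\<integral>x. e \<partial>L)"
      proof (rule integral_mono_AE)
        show "AE x in L. \<bar>h n x - g x\<bar> \<le> e"
          using ae by eventually_elim (use g(2) in \<open>auto simp: less_imp_le\<close>)
      qed (use ig ih in auto)
      also have "\<dots> = e * measure L UNIV" by (simp add: L.borel_UNIV)
      finally show "\<bar>(\<integral>x. h n x \<partial>L) - (\<integral>x. g x \<partial>L)\<bar> \<le> e * measure L UNIV" .
      show "integrable L (\<lambda>x. x ^ i)" by fact
    qed
    have "(\<integral>x. g x \<partial>M) = (\<integral>x. g x \<partial>N)"
      unfolding gb using pw[OF M M01] pw[OF N N01] moments by simp
    then have "\<bar>(\<integral>x. h n x \<partial>M) - (\<integral>x. h n x \<partial>N)\<bar> \<le> e * measure M UNIV + e * measure N UNIV"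
      using close[OF M M01] close[OF N N01] by linarith
    also have "\<dots> < e * K" using e by (simp add: K_def algebra_simps)
    also have "\<dots> = \<bar>(\<integral>x. h n x \<partial>M) - (\<integral>x. h n x \<partial>N)\<bar>" using K by (simp add: e_def)
    finally show False by simp
  qed
  have lim: "(\<lambda>n. \<integral>x. h n x \<partial>L) \<longlonglongrightarrow> measure L {..a}" if "finite_borel_measure L" for L
  proof -
    interpret L: finite_borel_measure L by fact
    note L.M_is_borel[measurable_cong] h_meas[measurable]
    have "(\<lambda>n. \<integral>x. h n x \<partial>L) \<longlonglongrightarrow> (\<integral>x. indicator {..a} x \<partial>L)"
      by (rule integral_dominated_convergence[where w="\<lambda>_. 1"])
        (use h_lim h_bound in auto)
    then show ?thesis by (simp add: L.borel_UNIV)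
  qed
  show "cdf M a = cdf N a"
    unfolding cdf_def
    using LIMSEQ_unique[OF lim[OF M]] lim[OF N] int_h by simp
qed

text \<open>The substitution \<open>x = e\<^sup>-\<^sup>t\<close> turns the transforms at the positive integers into the moments of
  a measure on the unit interval.\<close>

lemma AE_eq_of_laplace_eq:
  fixes f g :: "real \<Rightarrow> ennreal"
  assumes f[measurable]: "f \<in> borel_measurable borel" and g[measurable]: "g \<in> borel_measurable borel"
    and eq: "\<And>k::nat. (\<integral>\<^sup>+t\<in>{0<..}. exp (- real (Suc k) * t) * f t \<partial>lborel) =
                       (\<integral>\<^sup>+t\<in>{0<..}. exp (- real (Suc k) * t) * g t \<partial>lborel)"
    and fin: "(\<integral>\<^sup>+t\<in>{0<..}. exp (- t) * f t \<partial>lborel) < \<infinity>"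
  shows "AE t in lborel. 0 < t \<longrightarrow> f t = g t"
proof -
  \<comment> \<open>The integrable density, and its image on the unit interval.\<close>
  define D where "D F = density lborel (\<lambda>t. indicator {0<..} t * (ennreal (exp (- t)) * F t))" for F :: "real \<Rightarrow> ennreal"
  define E where "E F = distr (D F) borel (\<lambda>t. exp (- t))" for F :: "real \<Rightarrow> ennreal"
  have tot: "emeasure (D F) UNIV = (\<integral>\<^sup>+t\<in>{0<..}. exp (- t) * F t \<partial>lborel)"
    if [measurable]: "F \<in> borel_measurable borel" for F :: "real \<Rightarrow> ennreal"
    by (simp add: D_def emeasure_density mult_ac)
  have fin_g: "(\<integral>\<^sup>+t\<in>{0<..}. exp (- t) * g t \<partial>lborel) < \<infinity>" using eq[of 0] fin by simp
  have fbm: "finite_borel_measure (E F)"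
    if [measurable]: "F \<in> borel_measurable borel" and "(\<integral>\<^sup>+t\<in>{0<..}. exp (- t) * F t \<partial>lborel) < \<infinity>" for F :: "real \<Rightarrow> ennreal"
  proof -
    have "emeasure (D F) UNIV \<noteq> \<infinity>" using that(2) tot[OF that(1)] by simp
    moreover have "space (D F) = UNIV" by (simp add: D_def)
    ultimately have "finite_measure (D F)" by (intro finite_measureI) simp
    then have "finite_measure (E F)" unfolding E_def
      by (rule finite_measure.finite_measure_distr) (simp add: D_def)
    then show ?thesis by (simp add: finite_borel_measure_def finite_borel_measure_axioms_def E_def)
  qed
  have ae: "AE x in E F. 0 \<le> x \<and> x \<le> 1" if [measurable]: "F \<in> borel_measurable borel" for F :: "real \<Rightarrow> ennreal"
  proof -
    have "AE t in D F. 0 < t"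
      unfolding D_def by (subst AE_density) (auto split: split_indicator)
    then show ?thesis unfolding E_def
      by (subst AE_distr_iff) (auto simp: D_def elim!: eventually_mono)
  qed
  have mom: "(\<integral>x. x ^ k \<partial>E F) = enn2real (\<integral>\<^sup>+t\<in>{0<..}. exp (- real (Suc k) * t) * F t \<partial>lborel)"
    if [measurable]: "F \<in> borel_measurable borel" for F :: "real \<Rightarrow> ennreal" and k
  proof -
    have "(\<integral>x. x ^ k \<partial>E F) = (\<integral>t. exp (- t) ^ k \<partial>D F)"
      unfolding E_def by (subst integral_distr) (auto simp: D_def)
    also have "\<dots> = enn2real (\<integral>\<^sup>+t. exp (- t) ^ k \<partial>D F)"
      by (subst integral_eq_nn_integral) (auto simp: D_def)
    also have "(\<integral>\<^sup>+t. ennreal (exp (- t) ^ k) \<partial>D F) = (\<integral>\<^sup>+t\<in>{0<..}. exp (- real (Suc k) * t) * F t \<partial>lborel)"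
    proof -
      have *: "ennreal (exp (- t)) * F t * ennreal (exp (- t) ^ k) = ennreal (exp (- (real (Suc k) * t))) * F t" for t
      proof -
        have "exp (- t) * exp (- t) ^ k = exp (- t) ^ Suc k" by simp
        also have "\<dots> = exp (real (Suc k) * (- t))" by (rule exp_of_nat_mult[symmetric])
        finally have "ennreal (exp (- t)) * ennreal (exp (- t) ^ k) = ennreal (exp (- (real (Suc k) * t)))"
          by (simp add: ennreal_mult[symmetric] del: of_nat_Suc)
        then show ?thesis by (metis mult.assoc mult.commute)
      qed
      show ?thesis
        unfolding D_def
        by (subst nn_integral_density) (auto intro!: nn_integral_cong simp: * simp del: of_nat_Suc split: split_indicator)
    qed
    finally show ?thesis .
  qed
  have "E f = E g"
    by (rule finite_measure_eq_of_moments[OF fbm fbm ae ae])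
      (use fin fin_g f g in \<open>simp_all only: mom eq\<close>)
  then have "distr (E f) borel (\<lambda>x. - ln x) = distr (E g) borel (\<lambda>x. - ln x)" by simp
  then have "distr (D f) borel (\<lambda>x. x) = distr (D g) borel (\<lambda>x. x)"
    unfolding E_def by (simp add: distr_distr D_def comp_def)
  then have "D f = D g" using distr_id2[of borel "D f"] distr_id2[of borel "D g"] by (simp add: D_def)
  then have "AE t in lborel. indicator {0<..} t * (ennreal (exp (- t)) * f t) = indicator {0<..} t * (ennreal (exp (- t)) * g t)"
    unfolding D_def by (intro sigma_finite_measure.density_unique[OF sigma_finite_lborel]) auto
  then show ?thesis
    by (rule eventually_mono) (auto simp: ennreal_mult_cancel_left split: split_indicator_asm)
qed

section \<open>Perturbation of symmetric kernels\<close>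

lemma suminf_swap_ennreal:
  fixes f :: "nat \<Rightarrow> nat \<Rightarrow> ennreal"
  shows "(\<Sum>i. \<Sum>j. f i j) = (\<Sum>j. \<Sum>i. f i j)"
proof -
  have "(\<Sum>i. \<Sum>j. f i j) = (\<integral>\<^sup>+i. (\<Sum>j. f i j) \<partial>count_space UNIV)"
    by (simp add: nn_integral_count_space_nat)
  also have "\<dots> = (\<Sum>j. \<integral>\<^sup>+i. f i j \<partial>count_space UNIV)"
    by (rule nn_integral_suminf) simp
  finally show ?thesis by (simp add: nn_integral_count_space_nat)
qed

text \<open>Composition of kernels on a countable set with masses \<open>n\<close>. Extended values keep all the
  rearrangements below free of summability conditions.\<close>

definition kernel_prod :: "(nat \<Rightarrow> ennreal) \<Rightarrow> (nat \<Rightarrow> nat \<Rightarrow> ennreal) \<Rightarrow> (nat \<Rightarrow> nat \<Rightarrow> ennreal) \<Rightarrow> nat \<Rightarrow> nat \<Rightarrow> ennreal" where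
  "kernel_prod n A B i j = (\<Sum>k. A i k * n k * B k j)"

lemma kernel_prod_assoc:
  "kernel_prod n (kernel_prod n A B) C i j = kernel_prod n A (kernel_prod n B C) i j"
proof -
  have "kernel_prod n (kernel_prod n A B) C i j = (\<Sum>l. \<Sum>k. A i k * n k * B k l * n l * C l j)"
    unfolding kernel_prod_def by (simp only: ennreal_suminf_multc)
  also have "\<dots> = (\<Sum>k. \<Sum>l. A i k * n k * B k l * n l * C l j)" by (rule suminf_swap_ennreal)
  also have "\<dots> = kernel_prod n A (kernel_prod n B C) i j"
    unfolding kernel_prod_def by (simp only: mult.assoc ennreal_suminf_cmult)
  finally show ?thesis .
qed

lemma kernel_prod_add_right:
  "kernel_prod n A (\<lambda>k l. B k l + c * C k l) i j = kernel_prod n A B i j + c * kernel_prod n A C i j"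
proof -
  have "kernel_prod n A (\<lambda>k l. B k l + c * C k l) i j = (\<Sum>k. A i k * n k * B k j + c * (A i k * n k * C k j))"
    unfolding kernel_prod_def by (intro suminf_cong) (simp only: distrib_left distrib_right mult_ac)
  then show ?thesis
    by (simp add: kernel_prod_def suminf_add[symmetric] ennreal_suminf_cmult)
qed

lemma kernel_prod_transpose: "kernel_prod n A B i j = kernel_prod n (\<lambda>k l. B l k) (\<lambda>k l. A l k) j i"
  unfolding kernel_prod_def by (intro suminf_cong) (simp only: mult_ac)

lemma kernel_prod_add_left:
  "kernel_prod n (\<lambda>k l. B k l + c * C k l) A i j = kernel_prod n B A i j + c * kernel_prod n C A i j"
proof -
  have "kernel_prod n (\<lambda>k l. B k l + c * C k l) A i j = (\<Sum>k. B i k * n k * A k j + c * (C i k * n k * A k j))"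
    unfolding kernel_prod_def by (intro suminf_cong) (simp only: distrib_right mult.assoc)
  then show ?thesis
    by (simp add: kernel_prod_def suminf_add[symmetric] ennreal_suminf_cmult)
qed

text \<open>If \<open>u = V + c V N u\<close>, then \<open>u = V\<^sup>T + c u N V\<^sup>T\<close> by symmetry of \<open>u\<close>. Inserting one of these equations
  into the product \<open>V N u\<close> and the other into \<open>u N V\<^sup>T\<close> expands both products to the same sum, and
  finiteness of \<open>u\<close> permits cancellation.\<close>

lemma perturbed_kernel_symmetric:
  assumes sym: "\<And>i j. u i j = u j i" and fin: "\<And>i j. u i j < \<infinity>"
    and pert: "\<And>i j. u i j = V i j + c * kernel_prod n V u i j"
  shows "V i j = V j i"
proof -
  let ?V' = "\<lambda>k l. V l k"
  have u1: "u = (\<lambda>k l. V k l + c * kernel_prod n V u k l)" using pert by blast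
  have u2p: "u k l = ?V' k l + c * kernel_prod n u ?V' k l" for k l
  proof -
    have "kernel_prod n V u l k = kernel_prod n u ?V' k l"
      by (subst kernel_prod_transpose) (simp add: sym[symmetric])
    moreover have "u k l = V l k + c * kernel_prod n V u l k" using pert[of l k] sym[of k l] by simp
    ultimately show ?thesis by simp
  qed
  then have u2: "u = (\<lambda>k l. ?V' k l + c * kernel_prod n u ?V' k l)" by blast
  have "kernel_prod n V u i j = kernel_prod n V (\<lambda>k l. ?V' k l + c * kernel_prod n u ?V' k l) i j"
    using u2 by simp
  also have "\<dots> = kernel_prod n V ?V' i j + c * kernel_prod n (kernel_prod n V u) ?V' i j"
    by (simp add: kernel_prod_add_right kernel_prod_assoc)
  also have "\<dots> = kernel_prod n (\<lambda>k l. V k l + c * kernel_prod n V u k l) ?V' i j"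
    by (simp add: kernel_prod_add_left)
  also have "\<dots> = kernel_prod n u ?V' i j" using u1 by simp
  finally have eq: "kernel_prod n V u i j = kernel_prod n u ?V' i j" .
  define K where "K = c * kernel_prod n V u i j"
  have e1: "u i j = V i j + K" unfolding K_def by (rule pert)
  have e2: "u i j = V j i + K" unfolding K_def eq by (rule u2p)
  have "K \<noteq> \<infinity>" using e1 fin[of i j] by auto
  moreover have "K + V i j = K + V j i" unfolding add.commute[of K] e1[symmetric] by (rule e2)
  ultimately show ?thesis
    using ennreal_add_left_cancel by blast
qed

text \<open>Two killing rates applied to the same symmetric kernel \<open>u\<close>: expanding \<open>u\<close> through \<open>a\<close>
  and through \<open>b\<close> produces the same triple product, which cancels in the difference.\<close>

lemma perturbed_kernel_resolvent_equation:
  fixes \<beta> \<gamma> :: real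
  assumes sym: "\<And>i j. u i j = u j i" and fin: "\<And>i j. u i j < \<infinity>"
    and a: "\<And>i j. u i j = a i j + ennreal \<beta> * kernel_prod n a u i j"
    and b: "\<And>i j. u i j = b i j + ennreal \<gamma> * kernel_prod n b u i j"
    and "0 < \<gamma>" "\<gamma> < \<beta>"
  shows "b i j = a i j + ennreal (\<beta> - \<gamma>) * kernel_prod n a b i j"
proof -
  have bsym: "b k l = b l k" for k l by (rule perturbed_kernel_symmetric[OF sym fin b])
  have u1: "u = (\<lambda>k l. a k l + ennreal \<beta> * kernel_prod n a u k l)" using a by blast
  have u2: "u = (\<lambda>k l. b k l + ennreal \<gamma> * kernel_prod n u b k l)"
  proof (intro ext)
    fix k l
    have "kernel_prod n b u l k = kernel_prod n u b k l"
      by (subst kernel_prod_transpose) (simp add: sym[symmetric] bsym[symmetric])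
    then show "u k l = b k l + ennreal \<gamma> * kernel_prod n u b k l"
      using b[of l k] sym[of k l] bsym[of k l] by simp
  qed
  \<comment> \<open>Both expansions of \<open>u\<close> contain \<open>\<beta> \<gamma> Q\<close>, and the remaining terms give the claim.\<close>
  define P where "P = kernel_prod n a b i j"
  define Q where "Q = kernel_prod n (kernel_prod n a u) b i j"
  have "kernel_prod n a u i j = P + ennreal \<gamma> * Q"
    using arg_cong[OF u2, of "\<lambda>u. kernel_prod n a u i j"]
    by (simp add: kernel_prod_add_right P_def Q_def kernel_prod_assoc)
  then have e1: "u i j = a i j + ennreal \<beta> * (P + ennreal \<gamma> * Q)" using a by simp
  have "kernel_prod n u b i j = P + ennreal \<beta> * Q"
    using arg_cong[OF u1, of "\<lambda>u. kernel_prod n u b i j"]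
    by (simp add: kernel_prod_add_left P_def Q_def)
  then have e2: "u i j = b i j + ennreal \<gamma> * (P + ennreal \<beta> * Q)"
    using fun_cong[OF fun_cong[OF u2], of i j] by simp
  \<comment> \<open>Every term is bounded by \<open>u\<close>, so that the computation takes place in the reals.\<close>
  have ufin: "u i j \<noteq> top" using fin[of i j] by simp
  have fins: "a i j \<noteq> top" "P \<noteq> top" "Q \<noteq> top"
    using ufin assms(5,6) unfolding e1 by (auto simp: ennreal_mult_eq_top_iff)
  have finb: "b i j \<noteq> top" using ufin unfolding e2 by auto
  obtain ra where ra: "a i j = ennreal ra" "0 \<le> ra" using fins(1) by (cases "a i j") auto
  obtain rp where rp: "P = ennreal rp" "0 \<le> rp" using fins(2) by (cases P) auto
  obtain rq where rq: "Q = ennreal rq" "0 \<le> rq" using fins(3) by (cases Q) auto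
  obtain rb where rb: "b i j = ennreal rb" "0 \<le> rb" using finb by (cases "b i j") auto
  note r = ra rb rp rq
  have "ennreal (ra + \<beta> * (rp + \<gamma> * rq)) = ennreal (rb + \<gamma> * (rp + \<beta> * rq))"
    using e1 e2 r assms(5,6) by (simp add: ennreal_mult)
  then have "ra + \<beta> * (rp + \<gamma> * rq) = rb + \<gamma> * (rp + \<beta> * rq)"
    using r assms(5,6) by (subst (asm) ennreal_inj) auto
  then have "rb = ra + (\<beta> - \<gamma>) * rp" by (simp add: algebra_simps)
  then show ?thesis
    using r assms(5,6) by (simp add: P_def[symmetric] ennreal_mult)
qed

section \<open>Symmetric transition functions on a countable set\<close>

definition laplace :: "(real \<Rightarrow> ennreal) \<Rightarrow> real \<Rightarrow> ennreal" where
  "laplace f b = (\<integral>\<^sup>+t\<in>{0<..}. ennreal (exp (- b * t)) * f t \<partial>lborel)"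

lemma laplace_eq_imp_AE_eq:
  fixes f g :: "real \<Rightarrow> ennreal" and c :: real
  assumes [measurable]: "f \<in> borel_measurable borel" "g \<in> borel_measurable borel"
    and eq: "\<And>k::nat. laplace f (c + real (Suc k)) = laplace g (c + real (Suc k))"
    and fin: "laplace f (c + 1) < \<infinity>"
  shows "AE t in lborel. 0 < t \<longrightarrow> f t = g t"
proof -
  have *: "ennreal (exp (- real (Suc k) * t)) * (ennreal (exp (- c * t)) * F t) = ennreal (exp (- (c + real (Suc k)) * t)) * F t"
    for k t and F :: "real \<Rightarrow> ennreal"
  proof -
    have "exp (- real (Suc k) * t) * exp (- c * t) = exp (- (c + real (Suc k)) * t)"
      by (simp add: exp_add[symmetric] algebra_simps)
    then have "ennreal (exp (- real (Suc k) * t)) * ennreal (exp (- c * t)) = ennreal (exp (- (c + real (Suc k)) * t))"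
      by (simp add: ennreal_mult[symmetric] del: of_nat_Suc)
    then show ?thesis by (metis mult.assoc)
  qed
  have "AE t in lborel. 0 < t \<longrightarrow> ennreal (exp (- c * t)) * f t = ennreal (exp (- c * t)) * g t"
  proof (rule AE_eq_of_laplace_eq)
    fix k :: nat
    show "(\<integral>\<^sup>+t\<in>{0<..}. exp (- real (Suc k) * t) * (ennreal (exp (- c * t)) * f t) \<partial>lborel) =
          (\<integral>\<^sup>+t\<in>{0<..}. exp (- real (Suc k) * t) * (ennreal (exp (- c * t)) * g t) \<partial>lborel)"
      using eq[of k] unfolding laplace_def * .
  next
    show "(\<integral>\<^sup>+t\<in>{0<..}. exp (- t) * (ennreal (exp (- c * t)) * f t) \<partial>lborel) < \<infinity>"
      using fin *[of 0 _ f] unfolding laplace_def by simp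
  qed measurable
  then show ?thesis
    by (rule eventually_mono) (auto simp: ennreal_mult_cancel_left)
qed

text \<open>The integral form of the resolvent equation: the double transform of \<open>f (s + t)\<close>
  is the difference quotient of the transform of \<open>f\<close>.\<close>

lemma laplace_shift:
  fixes f :: "real \<Rightarrow> ennreal" and b c :: real
  assumes [measurable]: "f \<in> borel_measurable borel" and bc: "c < b"
  shows "ennreal (b - c) * laplace (\<lambda>s. laplace (\<lambda>t. f (s + t)) c) b + laplace f b = laplace f c"
proof -
  \<comment> \<open>In the variables \<open>s\<close> and \<open>r = s + t\<close> the inner integral over \<open>s\<close> is elementary.\<close>
  define w where "w s r = (if 0 < s \<and> s < r then ennreal (exp (- b * s) * exp (- c * (r - s))) else 0)" for s r
  have [measurable]: "(\<lambda>(s, r). w s r) \<in> borel_measurable (borel \<Otimes>\<^sub>M borel)"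
    unfolding w_def by measurable
  have inner: "ennreal (exp (- b * s)) * laplace (\<lambda>t. f (s + t)) c * indicator {0<..} s = (\<integral>\<^sup>+r. f r * w s r \<partial>lborel)" for s
  proof (cases "0 < s")
    case True
    have "laplace (\<lambda>t. f (s + t)) c = (\<integral>\<^sup>+t. (\<lambda>r. ennreal (exp (- c * (r - s))) * f r * indicator {0<..} (r - s)) (s + 1 * t) \<partial>lborel)"
      unfolding laplace_def by simp
    also have "\<dots> = (\<integral>\<^sup>+r. ennreal (exp (- c * (r - s))) * f r * indicator {0<..} (r - s) \<partial>lborel)"
      using nn_integral_real_affine[of "\<lambda>r. ennreal (exp (- c * (r - s))) * f r * indicator {0<..} (r - s)" 1 s]
      by simp
    finally have "ennreal (exp (- b * s)) * laplace (\<lambda>t. f (s + t)) c =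
        (\<integral>\<^sup>+r. ennreal (exp (- b * s)) * (ennreal (exp (- c * (r - s))) * f r * indicator {0<..} (r - s)) \<partial>lborel)"
      by (simp add: nn_integral_cmult)
    also have "\<dots> = (\<integral>\<^sup>+r. f r * w s r \<partial>lborel)"
      using True by (intro nn_integral_cong) (auto simp: w_def ennreal_mult mult_ac split: split_indicator)
    finally show ?thesis using True by simp
  qed (simp add: w_def)
  have ker: "ennreal (b - c) * (\<integral>\<^sup>+s. w s r \<partial>lborel)
      = indicator {0<..} r * ennreal (exp (- c * r) - exp (- b * r))" (is "?l = ?r") for r
  proof (cases "0 < r")
    case False
    then have "(\<lambda>s. w s r) = (\<lambda>s. 0)" by (auto simp: w_def)
    with False show ?thesis by simp
  next
    case True
    let ?F = "\<lambda>s. - exp (- c * r - (b - c) * s)"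
    have "?l = (\<integral>\<^sup>+s. ennreal (b - c) * w s r \<partial>lborel)"
      by (rule nn_integral_cmult[symmetric]) measurable
    also have "\<dots> = (\<integral>\<^sup>+s. ennreal ((b - c) * exp (- c * r - (b - c) * s)) * indicator {0..r} s \<partial>lborel)"
    proof (rule nn_integral_cong_AE)
      have "AE s in lborel. s \<noteq> 0 \<and> s \<noteq> r"
        by (intro AE_conjI AE_lborel_singleton)
      then show "AE s in lborel. ennreal (b - c) * w s r =
         ennreal ((b - c) * exp (- c * r - (b - c) * s)) * indicator {0..r} s"
      proof eventually_elim
        case (elim s)
        have "exp (- b * s) * exp (- c * (r - s)) = exp (- c * r - (b - c) * s)"
          by (simp add: exp_add[symmetric] algebra_simps)
        then show ?case using elim bc
          by (auto split: split_indicator simp: ennreal_mult[symmetric] w_def)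
      qed
    qed
    also have "\<dots> = ennreal (?F r - ?F 0)"
      by (rule nn_integral_FTC_Icc)
        (use True bc in \<open>auto intro!: derivative_eq_intros simp: algebra_simps\<close>)
    also have "?F r - ?F 0 = exp (- c * r) - exp (- b * r)" by (simp add: algebra_simps)
    finally show ?thesis using True by simp
  qed
  have "laplace (\<lambda>s. laplace (\<lambda>t. f (s + t)) c) b = (\<integral>\<^sup>+s. \<integral>\<^sup>+r. f r * w s r \<partial>lborel \<partial>lborel)"
    by (subst laplace_def) (simp only: inner)
  also have "\<dots> = (\<integral>\<^sup>+r. \<integral>\<^sup>+s. f r * w s r \<partial>lborel \<partial>lborel)"
    by (rule lborel_pair.Fubini'[symmetric]) measurable
  also have "\<dots> = (\<integral>\<^sup>+r. f r * (\<integral>\<^sup>+s. w s r \<partial>lborel) \<partial>lborel)"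
    by (intro nn_integral_cong nn_integral_cmult) measurable
  also have "ennreal (b - c) * \<dots> = (\<integral>\<^sup>+r. ennreal (b - c) * (f r * (\<integral>\<^sup>+s. w s r \<partial>lborel)) \<partial>lborel)"
    by (rule nn_integral_cmult[symmetric]) measurable
  also have "\<dots> = (\<integral>\<^sup>+r. f r * (indicator {0<..} r * ennreal (exp (- c * r) - exp (- b * r))) \<partial>lborel)"
    by (intro nn_integral_cong) (metis ker mult.left_commute)
  finally have e: "ennreal (b - c) * laplace (\<lambda>s. laplace (\<lambda>t. f (s + t)) c) b = (\<integral>\<^sup>+r. f r * (indicator {0<..} r * ennreal (exp (- c * r) - exp (- b * r))) \<partial>lborel)" .
  show ?thesis
    unfolding e unfolding laplace_def
  proof (subst nn_integral_add[symmetric])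
    show "(\<integral>\<^sup>+r. f r * (indicator {0<..} r * ennreal (exp (- c * r) - exp (- b * r))) + ennreal (exp (- b * r)) * f r * indicator {0<..} r \<partial>lborel)
       = (\<integral>\<^sup>+t\<in>{0<..}. ennreal (exp (- c * t)) * f t \<partial>lborel)"
    proof (rule nn_integral_cong)
      fix r :: real
      have "ennreal (exp (- c * r) - exp (- b * r)) + ennreal (exp (- b * r)) = ennreal (exp (- c * r))" if "0 < r"
        using that bc by (subst ennreal_plus[symmetric]) auto
      then show "f r * (indicator {0<..} r * ennreal (exp (- c * r) - exp (- b * r))) + ennreal (exp (- b * r)) * f r * indicator {0<..} r
          = ennreal (exp (- c * r)) * f r * indicator {0<..} r"
        by (auto split: split_indicator simp: distrib_left[symmetric] mult.commute[of _ "f r"])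
    qed
  qed measurable
qed

text \<open>Identities of Laplace transforms hold for almost all times only; this and the next lemma
  recover all times from them.\<close>

lemma AE_lborel_imp_dense:
  assumes ae: "AE t in lborel. 0 < t \<longrightarrow> P t" and ab: "0 \<le> a" "a < (b::real)"
  shows "\<exists>t. a < t \<and> t < b \<and> P t"
proof (rule ccontr)
  assume "\<not> ?thesis"
  with ae have "AE t in lborel. t \<notin> {a<..<b}"
    by (rule_tac eventually_mono) (use ab in auto)
  then have "{a<..<b} \<in> null_sets lborel"
    by (subst (asm) AE_iff_null_sets[symmetric]) auto
  then have "emeasure lborel {a<..<b} = 0" by auto
  with ab show False by simp
qed

lemma le_of_AE_le:
  fixes f g :: "real \<Rightarrow> real"
  assumes "AE t in lborel. 0 < t \<longrightarrow> f t \<le> g t" "continuous_on {0<..} f" "continuous_on {0<..} g" "0 < t"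
  shows "f t \<le> g t"
proof (rule ccontr)
  assume "\<not> ?thesis"
  then have neg: "g t - f t < 0" by simp
  have "((\<lambda>s. g s - f s) \<longlongrightarrow> g t - f t) (at t within {0<..})"
    using assms(2-4) by (auto simp: continuous_on_def intro!: tendsto_diff)
  then have "((\<lambda>s. g s - f s) \<longlongrightarrow> g t - f t) (at t)"
    using assms(4) by (subst (asm) at_within_open) auto
  then have "\<forall>\<^sub>F s in at t. g s - f s < 0" using neg by (rule order_tendstoD)
  then obtain d where d: "d > 0" "\<And>s. s \<noteq> t \<Longrightarrow> dist s t < d \<Longrightarrow> g s - f s < 0"
    unfolding eventually_at by auto
  obtain s where "t < s" "s < t + d" "f s \<le> g s"
    using AE_lborel_imp_dense[OF assms(1), of t "t + d"] assms(4) d(1) by auto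
  with d(2)[of s] show False by (auto simp: dist_real_def)
qed

text \<open>\<open>V b\<close> stands for the resolvent of a symmetric Markov process on a countable set with masses
  \<open>n\<close>, and \<open>q\<close> for its transition density. Only the transforms of \<open>q\<close> are tied together; the
  semigroup property of \<open>q\<close> itself is a consequence.\<close>

locale symmetric_chain =
  fixes q :: "nat \<Rightarrow> nat \<Rightarrow> real \<Rightarrow> real" and n :: "nat \<Rightarrow> real"
    and V :: "real \<Rightarrow> nat \<Rightarrow> nat \<Rightarrow> ennreal"
  assumes q_nonneg: "\<And>i j t. 0 < t \<Longrightarrow> 0 \<le> q i j t"
    and q_cont: "\<And>i j. continuous_on {0<..} (q i j)"
    and n_pos: "\<And>i. 0 < n i"
    and V_laplace: "\<And>b i j. 0 < b \<Longrightarrow> V b i j = laplace (\<lambda>t. ennreal (q i j t)) b"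
    and V_finite: "\<And>b i j. 0 < b \<Longrightarrow> V b i j < \<infinity>"
    and V_sym: "\<And>b i j. 0 < b \<Longrightarrow> V b i j = V b j i"
    and V_resolvent: "\<And>b c i j. 0 < c \<Longrightarrow> c < b \<Longrightarrow>
        V c i j = V b i j + ennreal (b - c) * kernel_prod (\<lambda>k. ennreal (n k)) (V b) (V c) i j"
    and q_bounded: "\<And>i. \<exists>B. \<forall>t>0. q i i t \<le> B"
begin

text \<open>The value \<open>0\<close> at non-positive times makes the density measurable on the whole line.\<close>

definition q_ext where "q_ext i j t = (if 0 < t then ennreal (q i j t) else 0)"

lemma q_ext_measurable[measurable]: "q_ext i j \<in> borel_measurable borel"
proof -
  have "(\<lambda>t. indicator {0<..} t *\<^sub>R q i j t) \<in> borel_measurable borel"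
    by (rule borel_measurable_continuous_on_indicator) (use q_cont in auto)
  then have "(\<lambda>t. ennreal (indicator {0<..} t *\<^sub>R q i j t)) \<in> borel_measurable borel" by measurable
  moreover have "(\<lambda>t. ennreal (indicator {0<..} t *\<^sub>R q i j t)) = q_ext i j"
    by (auto simp: q_ext_def split: split_indicator)
  ultimately show ?thesis by simp
qed

lemma V_eq: "0 < b \<Longrightarrow> V b i j = laplace (q_ext i j) b"
  unfolding V_laplace laplace_def by (auto intro!: nn_integral_cong simp: q_ext_def split: split_indicator)

lemma q_sym: assumes "0 < t" shows "q i j t = q j i t"
proof -
  have ae: "AE t in lborel. 0 < t \<longrightarrow> q_ext i j t = q_ext j i t"
  proof (rule laplace_eq_imp_AE_eq[where c=0])
    show "laplace (q_ext i j) (0 + real (Suc k)) = laplace (q_ext j i) (0 + real (Suc k))" for k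
      using V_sym[of "real (Suc k)" i j] by (simp add: V_eq del: of_nat_Suc)
    show "laplace (q_ext i j) (0 + 1) < \<infinity>" using V_finite[of 1 i j] by (simp add: V_eq)
  qed measurable
  then have eq: "AE t in lborel. 0 < t \<longrightarrow> q i j t = q j i t"
    by (rule eventually_mono) (auto simp: q_ext_def q_nonneg)
  show ?thesis
    by (intro antisym le_of_AE_le[OF _ q_cont q_cont assms] eventually_mono[OF eq]) auto
qed

lemma laplace_cmult: "f \<in> borel_measurable borel \<Longrightarrow> laplace (\<lambda>t. f t * c) b = laplace f b * c"
  unfolding laplace_def
  by (subst nn_integral_multc[symmetric]) (auto intro!: nn_integral_cong simp: mult_ac)

lemma laplace_suminf: "(\<And>k. f k \<in> borel_measurable borel) \<Longrightarrow> laplace (\<lambda>t. \<Sum>k. f k t) b = (\<Sum>k. laplace (f k) b)"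
proof -
  assume [measurable]: "\<And>k. f k \<in> borel_measurable borel"
  have "laplace (\<lambda>t. \<Sum>k. f k t) b = (\<integral>\<^sup>+t. (\<Sum>k. ennreal (exp (- b * t)) * f k t * indicator {0<..} t) \<partial>lborel)"
    unfolding laplace_def by (simp only: ennreal_suminf_cmult ennreal_suminf_multc)
  also have "\<dots> = (\<Sum>k. laplace (f k) b)"
    unfolding laplace_def by (rule nn_integral_suminf) measurable
  finally show ?thesis .
qed

text \<open>Both sides have the same double Laplace transform by the resolvent equation; uniqueness is
  applied first in \<open>s\<close> and then in \<open>t\<close>. The exceptional set in \<open>t\<close> depends on \<open>s\<close>.\<close>

lemma chapman_kolmogorov_AE:
  "AE s in lborel. 0 < s \<longrightarrow> (AE t in lborel. 0 < t \<longrightarrow>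
     q_ext i j (s + t) = (\<Sum>k. q_ext i k s * ennreal (n k) * q_ext k j t))"
proof -
  have one: "AE s in lborel. 0 < s \<longrightarrow> laplace (\<lambda>t. q_ext i j (s + t)) c = (\<Sum>k. q_ext i k s * ennreal (n k) * laplace (q_ext k j) c)"
    if c: "0 < c" for c
  proof (rule laplace_eq_imp_AE_eq[where c=c])
    have m: "(\<lambda>(s, t). q_ext i j (s + t)) \<in> borel_measurable (borel \<Otimes>\<^sub>M borel)" by measurable
    show "(\<lambda>s. laplace (\<lambda>t. q_ext i j (s + t)) c) \<in> borel_measurable borel"
      unfolding laplace_def by measurable
    show "(\<lambda>s. \<Sum>k. q_ext i k s * ennreal (n k) * laplace (q_ext k j) c) \<in> borel_measurable borel"
      by measurable
    have key: "laplace (\<lambda>s. laplace (\<lambda>t. q_ext i j (s + t)) c) b = kernel_prod (\<lambda>k. ennreal (n k)) (V b) (V c) i j"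
      (is "?L = ?R") if b: "c < b" for b
    proof -
      have e: "ennreal (b - c) * ?L + V b i j = ennreal (b - c) * ?R + V b i j"
        using laplace_shift[OF q_ext_measurable b, of i j] V_resolvent[OF c b, of i j] b c
        by (simp add: V_eq add.commute)
      have "ennreal (b - c) * ?L = ennreal (b - c) * ?R"
        using e V_finite[of b i j] b c
          ennreal_add_left_cancel[of "V b i j" "ennreal (b - c) * ?L" "ennreal (b - c) * ?R"]
        unfolding add.commute[of _ "V b i j"] by auto
      then show ?thesis using b by (simp add: ennreal_mult_cancel_left)
    qed
    show "laplace (\<lambda>s. laplace (\<lambda>t. q_ext i j (s + t)) c) (c + real (Suc k)) =
        laplace (\<lambda>s. \<Sum>k. q_ext i k s * ennreal (n k) * laplace (q_ext k j) c) (c + real (Suc k))" for k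
      using c by (simp add: key kernel_prod_def laplace_suminf laplace_cmult mult.assoc V_eq del: of_nat_Suc)
    have "ennreal (c + 1 - c) * kernel_prod (\<lambda>k. ennreal (n k)) (V (c + 1)) (V c) i j \<le> V c i j"
      using V_resolvent[of c "c + 1" i j] c by simp
    also have "\<dots> < \<infinity>" using V_finite c by simp
    finally show "laplace (\<lambda>s. laplace (\<lambda>t. q_ext i j (s + t)) c) (c + 1) < \<infinity>"
      by (subst key) simp_all
  qed
  have "AE s in lborel. \<forall>m::nat. 0 < s \<longrightarrow> laplace (\<lambda>t. q_ext i j (s + t)) (real (Suc m))
      = (\<Sum>k. q_ext i k s * ennreal (n k) * laplace (q_ext k j) (real (Suc m)))"
    unfolding AE_all_countable using one by (simp del: of_nat_Suc)
  then show ?thesis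
  proof eventually_elim
    case (elim s)
    show ?case
    proof
      assume s: "0 < s"
      show "AE t in lborel. 0 < t \<longrightarrow> q_ext i j (s + t) = (\<Sum>k. q_ext i k s * ennreal (n k) * q_ext k j t)"
      proof (rule laplace_eq_imp_AE_eq[where c=0])
        fix m :: nat
        have "laplace (\<lambda>t. \<Sum>k. q_ext i k s * ennreal (n k) * q_ext k j t) (real (Suc m)) =
            (\<Sum>k. laplace (\<lambda>t. q_ext k j t * (q_ext i k s * ennreal (n k))) (real (Suc m)))"
          by (subst laplace_suminf[symmetric]) (auto simp: mult_ac)
        also have "\<dots> = (\<Sum>k. q_ext i k s * ennreal (n k) * laplace (q_ext k j) (real (Suc m)))"
          by (subst laplace_cmult) (auto simp: mult_ac)
        also have "\<dots> = laplace (\<lambda>t. q_ext i j (s + t)) (real (Suc m))" using elim s by metis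
        finally show "laplace (\<lambda>t. q_ext i j (s + t)) (0 + real (Suc m)) = laplace (\<lambda>t. \<Sum>k. q_ext i k s * ennreal (n k) * q_ext k j t) (0 + real (Suc m))"
          by simp
      next
        have "laplace (\<lambda>t. q_ext i j (s + t)) 1 \<le> ennreal (exp s) * laplace (q_ext i j) 1"
        proof -
          have "laplace (\<lambda>t. q_ext i j (s + t)) 1 = (\<integral>\<^sup>+t. (\<lambda>r. ennreal (exp (- (r - s))) * q_ext i j r * indicator {0<..} (r - s)) (s + 1 * t) \<partial>lborel)"
            unfolding laplace_def by simp
          also have "\<dots> = (\<integral>\<^sup>+r. ennreal (exp (- (r - s))) * q_ext i j r * indicator {0<..} (r - s) \<partial>lborel)"
            using nn_integral_real_affine[of "\<lambda>r. ennreal (exp (- (r - s))) * q_ext i j r * indicator {0<..} (r - s)" 1 s]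
            by simp
          also have "\<dots> \<le> (\<integral>\<^sup>+r. ennreal (exp s) * (ennreal (exp (- 1 * r)) * q_ext i j r * indicator {0<..} r) \<partial>lborel)"
          proof (rule nn_integral_mono)
            fix r :: real
            have "ennreal (exp (- (r - s))) = ennreal (exp s) * ennreal (exp (- r))"
              by (simp add: ennreal_mult[symmetric] exp_add[symmetric])
            then show "ennreal (exp (- (r - s))) * q_ext i j r * indicator {0<..} (r - s) \<le>
               ennreal (exp s) * (ennreal (exp (- 1 * r)) * q_ext i j r * indicator {0<..} r)"
              using s by (auto split: split_indicator simp: mult_ac)
          qed
          also have "\<dots> = ennreal (exp s) * laplace (q_ext i j) 1"
            unfolding laplace_def by (rule nn_integral_cmult) measurable
          finally show ?thesis .
        qed
        also have "\<dots> < \<infinity>" using V_finite[of 1 i j] by (simp add: V_eq ennreal_mult_less_top)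
        finally show "laplace (\<lambda>t. q_ext i j (s + t)) (0 + 1) < \<infinity>" by simp
      qed measurable
    qed
  qed
qed

text \<open>The infinite sum need not be continuous in the times, but its finite partial sums are, so
  that this one-sided form of the Chapman-Kolmogorov equation holds at all times.\<close>

lemma partial_sum_le:
  assumes s: "0 < s" and t: "0 < t" and K: "finite K"
  shows "(\<Sum>k\<in>K. q i k s * n k * q k j t) \<le> q i j (s + t)"
proof -
  have c1: "continuous_on {0<..} (\<lambda>s. \<Sum>k\<in>K. q i k s * n k * q k j t)" for t
    by (intro continuous_intros q_cont)
  have c2: "continuous_on {0<..} (\<lambda>t. \<Sum>k\<in>K. q i k s * n k * q k j t)" for s
    by (intro continuous_intros q_cont)
  have c3: "continuous_on {0<..} (\<lambda>s. q i j (s + t))" if "0 \<le> t" for t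
    by (rule continuous_on_compose2[OF q_cont]) (use that in \<open>auto intro!: continuous_intros\<close>)
  have c4: "continuous_on {0<..} (\<lambda>t. q i j (s + t))" if "0 \<le> s" for s
    by (rule continuous_on_compose2[OF q_cont]) (use that in \<open>auto intro!: continuous_intros\<close>)
  have "AE s in lborel. 0 < s \<longrightarrow> (\<Sum>k\<in>K. q i k s * n k * q k j t) \<le> q i j (s + t)"
    using chapman_kolmogorov_AE[of i j]
  proof eventually_elim
    case (elim s)
    show ?case
    proof
      assume s: "0 < s"
      with elim have ae: "AE t in lborel. 0 < t \<longrightarrow> q_ext i j (s + t) = (\<Sum>k. q_ext i k s * ennreal (n k) * q_ext k j t)" by blast
      have "AE t in lborel. 0 < t \<longrightarrow> (\<Sum>k\<in>K. q i k s * n k * q k j t) \<le> q i j (s + t)"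
        using ae
      proof eventually_elim
        case (elim t)
        show ?case
        proof
          assume t: "0 < t"
          have nn: "0 \<le> q i k s * n k * q k j t" for k using q_nonneg s t n_pos by (simp add: less_imp_le)
          have "ennreal (\<Sum>k\<in>K. q i k s * n k * q k j t) = (\<Sum>k\<in>K. q_ext i k s * ennreal (n k) * q_ext k j t)"
            using nn s t q_nonneg n_pos
            by (subst sum_ennreal[symmetric]) (auto simp: q_ext_def ennreal_mult less_imp_le)
          also have "\<dots> \<le> (\<Sum>k. q_ext i k s * ennreal (n k) * q_ext k j t)"
            by (rule sum_le_suminf) (use K in auto)
          also have "\<dots> = q_ext i j (s + t)" using elim t by simp
          finally show "(\<Sum>k\<in>K. q i k s * n k * q k j t) \<le> q i j (s + t)"
            using s t q_nonneg[of "s + t" i j] by (simp add: q_ext_def ennreal_le_iff)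
        qed
      qed
      then show "(\<Sum>k\<in>K. q i k s * n k * q k j t) \<le> q i j (s + t)"
        by (rule le_of_AE_le[OF _ c2 c4]) (use s t in auto)
    qed
  qed
  then show ?thesis
    by (rule le_of_AE_le[OF _ c1 c3]) (use s t in auto)
qed

lemma diag_lower: "0 < s \<Longrightarrow> n k * (q i k s)\<^sup>2 \<le> q i i (2 * s)"
  using partial_sum_le[of s s "{k}" i i] q_sym[of s i k] by (simp add: power2_eq_square mult_ac)

text \<open>The Cauchy-Schwarz inequality for the Chapman-Kolmogorov sum.\<close>

lemma log_convex:
  assumes s: "0 < s" and t: "0 < t"
  shows "(q i i (s + t))\<^sup>2 \<le> q i i (2 * s) * q i i (2 * t)"
proof -
  have c1: "continuous_on {0<..} (\<lambda>s. q i i (2 * s) * q i i (2 * t))" for t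
    by (intro continuous_intros continuous_on_compose2[OF q_cont]) auto
  have c2: "continuous_on {0<..} (\<lambda>t. q i i (2 * s) * q i i (2 * t))" for s
    by (intro continuous_intros continuous_on_compose2[OF q_cont]) auto
  have c3: "continuous_on {0<..} (\<lambda>s. (q i i (s + t))\<^sup>2)" if "0 \<le> t" for t
    by (intro continuous_intros continuous_on_compose2[OF q_cont]) (use that in auto)
  have c4: "continuous_on {0<..} (\<lambda>t. (q i i (s + t))\<^sup>2)" if "0 \<le> s" for s
    by (intro continuous_intros continuous_on_compose2[OF q_cont]) (use that in auto)
  have "AE s in lborel. 0 < s \<longrightarrow> (q i i (s + t))\<^sup>2 \<le> q i i (2 * s) * q i i (2 * t)"
    using chapman_kolmogorov_AE[of i i]
  proof eventually_elim
    case (elim s)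
    show ?case
    proof
      assume s: "0 < s"
      with elim have ae: "AE t in lborel. 0 < t \<longrightarrow> q_ext i i (s + t) = (\<Sum>k. q_ext i k s * ennreal (n k) * q_ext k i t)" by blast
      have "AE t in lborel. 0 < t \<longrightarrow> (q i i (s + t))\<^sup>2 \<le> q i i (2 * s) * q i i (2 * t)"
        using ae
      proof eventually_elim
        case (elim t)
        show ?case
        proof
          assume t: "0 < t"
          have nn: "0 \<le> q i k s * n k * q k i t" for k using q_nonneg s t n_pos by (simp add: less_imp_le)
          define R where "R = sqrt (q i i (2 * s) * q i i (2 * t))"
          have R: "0 \<le> R" unfolding R_def using q_nonneg s t by simp
          have part: "(\<Sum>k<m. q i k s * n k * q k i t) \<le> R" for m
          proof -
            \<comment> \<open>The symmetry of \<open>q\<close> turns both sums of squares into Chapman-Kolmogorov sums on the diagonal.\<close>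
            let ?a = "\<lambda>k. sqrt (n k) * q i k s" and ?b = "\<lambda>k. sqrt (n k) * q k i t"
            have "(\<Sum>k<m. ?a k * ?b k)\<^sup>2 \<le> (\<Sum>k<m. (?a k)\<^sup>2) * (\<Sum>k<m. (?b k)\<^sup>2)"
              by (rule Cauchy_Schwarz_ineq_sum)
            also have "(\<Sum>k<m. (?a k)\<^sup>2) = (\<Sum>k<m. q i k s * n k * q k i s)"
              using n_pos q_sym[OF s] by (intro sum.cong) (auto simp: power2_eq_square less_imp_le)
            also have "(\<Sum>k<m. (?b k)\<^sup>2) = (\<Sum>k<m. q i k t * n k * q k i t)"
              using n_pos q_sym[OF t, of i] by (intro sum.cong) (auto simp: power2_eq_square less_imp_le)
            also have "(\<Sum>k<m. q i k s * n k * q k i s) * (\<Sum>k<m. q i k t * n k * q k i t) \<le> q i i (2 * s) * q i i (2 * t)"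
            proof (rule mult_mono)
              show "(\<Sum>k<m. q i k s * n k * q k i s) \<le> q i i (2 * s)"
                using partial_sum_le[OF s s, of "{..<m}" i i] by simp
              show "(\<Sum>k<m. q i k t * n k * q k i t) \<le> q i i (2 * t)"
                using partial_sum_le[OF t t, of "{..<m}" i i] by simp
              show "0 \<le> q i i (2 * s)" using q_nonneg s by simp
              show "0 \<le> (\<Sum>k<m. q i k t * n k * q k i t)"
                by (intro sum_nonneg mult_nonneg_nonneg) (use q_nonneg t n_pos in \<open>auto simp: less_imp_le\<close>)
            qed
            finally have "sqrt ((\<Sum>k<m. ?a k * ?b k)\<^sup>2) \<le> R" unfolding R_def by (rule real_sqrt_le_mono)
            moreover have "(\<Sum>k<m. ?a k * ?b k) = (\<Sum>k<m. q i k s * n k * q k i t)"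
              using n_pos by (intro sum.cong) (auto simp: less_imp_le)
            ultimately show ?thesis by simp
          qed
          have "q_ext i i (s + t) = (\<Sum>k. q_ext i k s * ennreal (n k) * q_ext k i t)" using elim t by simp
          also have "\<dots> \<le> ennreal R"
          proof (rule suminf_le_const)
            fix m
            have "(\<Sum>k<m. q_ext i k s * ennreal (n k) * q_ext k i t) = ennreal (\<Sum>k<m. q i k s * n k * q k i t)"
              using nn s t q_nonneg n_pos
              by (subst sum_ennreal[symmetric]) (auto simp: q_ext_def ennreal_mult less_imp_le)
            also have "\<dots> \<le> ennreal R" using part by (rule ennreal_leI)
            finally show "(\<Sum>k<m. q_ext i k s * ennreal (n k) * q_ext k i t) \<le> ennreal R" .
          qed auto
          finally have "q i i (s + t) \<le> R" using s t R by (simp add: q_ext_def)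
          then have "(q i i (s + t))\<^sup>2 \<le> R\<^sup>2" using q_nonneg s t by (intro power_mono) auto
          then show "(q i i (s + t))\<^sup>2 \<le> q i i (2 * s) * q i i (2 * t)"
            unfolding R_def using q_nonneg s t by simp
        qed
      qed
      then show "(q i i (s + t))\<^sup>2 \<le> q i i (2 * s) * q i i (2 * t)"
        by (rule le_of_AE_le[OF _ c4 c2]) (use s t in auto)
    qed
  qed
  then show ?thesis
    by (rule le_of_AE_le[OF _ c3 c1]) (use s t in auto)
qed

text \<open>A bounded log-convex function cannot increase.\<close>

lemma diag_antimono:
  assumes "0 < s" "s \<le> t"
  shows "q i i t \<le> q i i s"
proof (rule ccontr)
  assume neg: "\<not> ?thesis"
  then have st: "s < t" using assms by (cases "s = t") auto
  define h where "h = t - s"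
  have h: "h > 0" using st by (simp add: h_def)
  \<comment> \<open>Along this arithmetic progression a single increase would force geometric growth.\<close>
  define Q where "Q k = q i i (s + real k * h)" for k :: nat
  have Qn: "0 \<le> Q k" for k unfolding Q_def using assms h by (intro q_nonneg) (simp add: add_pos_nonneg)
  have lc: "(Q (Suc k))\<^sup>2 \<le> Q k * Q (Suc (Suc k))" for k
  proof -
    have "((s + real k * h) / 2) + ((s + real (Suc (Suc k)) * h) / 2) = s + real (Suc k) * h"
      by (simp add: field_simps)
    moreover have "0 < s + real k * h" "0 < s + real (Suc (Suc k)) * h"
      using assms h by (auto intro!: add_pos_nonneg)
    moreover have "2 * ((s + real k * h) / 2) = s + real k * h"
      "2 * ((s + real (Suc (Suc k)) * h) / 2) = s + real (Suc (Suc k)) * h" by simp_all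
    ultimately show ?thesis
      using log_convex[of "(s + real k * h) / 2" "(s + real (Suc (Suc k)) * h) / 2" i]
      unfolding Q_def by (metis half_gt_zero)
  qed
  have Q01: "Q 0 < Q 1" using neg by (simp add: Q_def h_def)
  have Q0: "0 < Q 0"
  proof (rule ccontr)
    assume "\<not> 0 < Q 0"
    then have "Q 0 = 0" using Qn[of 0] by simp
    then have "Q 1 = 0" using lc[of 0] by simp
    with Q01 \<open>Q 0 = 0\<close> show False by simp
  qed
  define r where "r = Q 1 / Q 0"
  have r: "r > 1" using Q01 Q0 by (simp add: r_def)
  have grow: "0 < Q k \<and> r * Q k \<le> Q (Suc k)" for k
  proof (induction k)
    case 0
    then show ?case using Q0 by (simp add: r_def)
  next
    case (Suc k)
    then have pos: "0 < Q (Suc k)" using r by (smt (verit, best) mult_pos_pos)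
    have "r * Q (Suc k) * Q k \<le> Q (Suc k) * Q (Suc k)"
      using Suc pos by (simp add: mult.commute mult.left_commute mult_left_mono)
    also have "\<dots> \<le> Q (Suc (Suc k)) * Q k" using lc[of k] by (simp add: power2_eq_square mult.commute)
    finally show ?case using Suc pos by (simp add: mult_le_cancel_right)
  qed
  have "r ^ k * Q 0 \<le> Q k" for k
  proof (induction k)
    case (Suc k)
    have "r ^ Suc k * Q 0 = r * (r ^ k * Q 0)" by simp
    also have "\<dots> \<le> r * Q k" using Suc r by (intro mult_left_mono) auto
    also have "\<dots> \<le> Q (Suc k)" using grow by blast
    finally show ?case .
  qed simp
  moreover obtain B where B: "\<And>t. 0 < t \<Longrightarrow> q i i t \<le> B" using q_bounded by blast
  moreover have "Q k \<le> B" for k unfolding Q_def using assms h by (intro B) (simp add: add_pos_nonneg)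
  ultimately have bd: "r ^ k \<le> B / Q 0" for k
    using Q0 by (simp add: pos_le_divide_eq) (meson order_trans)
  obtain k where "B / Q 0 < r ^ k" using real_arch_pow[OF r] by blast
  with bd[of k] show False by simp
qed

end

section \<open>The Markov property at fixed times\<close>

context hunt_process begin

lemma prob_space_P: "prob_space (P x)" and sets_P: "sets (P x) = sets M" and space_P: "space (P x) = space M"
proof -
  have *: "P x \<in> space (prob_algebra M)" using measurable_space[OF kernel, of x] by simp
  then show "prob_space (P x)" "sets (P x) = sets M" by (auto simp: space_prob_algebra)
  then show "space (P x) = space M" using sets_eq_imp_space_eq by blast
qed

lemmas sets_P_cong[measurable_cong] = sets_P

lemma kernel_subprob[measurable]: "P \<in> borel \<rightarrow>\<^sub>M subprob_algebra M"
  using kernel by (rule measurable_prob_algebraD)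

lemma X_measurable: "0 \<le> t \<Longrightarrow> X t \<in> M \<rightarrow>\<^sub>M borel"
proof (rule measurableI)
  fix A :: "'a set" assume "A \<in> sets borel" "0 \<le> t"
  then show "X t -` A \<inter> space M \<in> sets M"
    unfolding sets_M by (intro sigma_sets.Basic) blast
qed simp

text \<open>The sigma-algebra of \<open>M\<close> is generated by the coordinates of the process.\<close>

lemma measurable_into_M:
  assumes sp: "\<And>a. a \<in> space N \<Longrightarrow> f a \<in> space M"
    and X: "\<And>s. 0 \<le> s \<Longrightarrow> (\<lambda>a. X s (f a)) \<in> N \<rightarrow>\<^sub>M borel"
  shows "f \<in> N \<rightarrow>\<^sub>M M"
proof -
  have "sets M = sets (sigma (space M) {X s -` A \<inter> space M | s A. 0 \<le> s \<and> A \<in> sets borel})"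
    unfolding sets_M by (rule sets_measure_of[symmetric]) auto
  moreover have "f \<in> N \<rightarrow>\<^sub>M sigma (space M) {X s -` A \<inter> space M | s A. 0 \<le> s \<and> A \<in> sets borel}"
  proof (rule measurable_measure_of)
    fix B assume "B \<in> {X s -` A \<inter> space M | s A. 0 \<le> s \<and> A \<in> sets borel}"
    then obtain s A where B: "B = X s -` A \<inter> space M" "0 \<le> s" "A \<in> sets borel" by auto
    have "f -` B \<inter> space N = (\<lambda>a. X s (f a)) -` A \<inter> space N" using B sp by auto
    also have "\<dots> \<in> sets N" using X[OF B(2)] B(3) by (rule measurable_sets)
    finally show "f -` B \<inter> space N \<in> sets N" .
  qed (use sp in auto)
  ultimately show ?thesis using measurable_cong_sets[OF refl] by blast
qed

lemma shift_measurable: "0 \<le> t \<Longrightarrow> \<theta> t \<in> M \<rightarrow>\<^sub>M M"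
proof (rule measurable_into_M)
  fix s :: real assume s: "0 \<le> s" and t: "0 \<le> t"
  have "X (s + t) \<in> M \<rightarrow>\<^sub>M borel" using X_measurable s t by simp
  then show "(\<lambda>w. X s (\<theta> t w)) \<in> M \<rightarrow>\<^sub>M borel"
    by (rule measurable_cong[THEN iffD1, rotated]) (simp add: shift s t)
qed (rule shift_space)

lemma natural_events_mono: "s \<le> t \<Longrightarrow> natural_events M X s \<subseteq> natural_events M X t"
  unfolding natural_events_def by (intro sigma_sets_mono') (blast intro: order_trans)

lemma natural_events_sets: "A \<in> natural_events M X t \<Longrightarrow> A \<in> sets M"
proof -
  have "natural_events M X t \<subseteq> sets M"
    unfolding natural_events_def sets_M by (intro sigma_sets_mono') blast
  then show "A \<in> natural_events M X t \<Longrightarrow> A \<in> sets M" by blast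
qed

lemma sigma_algebra_natural: "sigma_algebra (space M) (natural_events M X t)"
  unfolding natural_events_def by (rule sigma_algebra_sigma_sets) auto

lemma X_natural_event: "0 \<le> s \<Longrightarrow> s \<le> t \<Longrightarrow> A \<in> sets borel \<Longrightarrow> X s -` A \<inter> space M \<in> natural_events M X t"
  unfolding natural_events_def by (rule sigma_sets.Basic) auto

text \<open>The Markov property is needed at deterministic times only, where the events of the past
  are those of the uncompleted natural filtration.\<close>

lemma const_stopping: "0 \<le> t \<Longrightarrow> is_stopping_time M X (\<lambda>_. ennreal t)"
  unfolding is_stopping_time_def natural_events_right_def
proof (intro allI impI INT_I)
  fix s u :: real
  interpret sigma_algebra "space M" "natural_events M X u" by (rule sigma_algebra_natural)
  show "{w \<in> space M. ennreal t \<le> ennreal s} \<in> natural_events M X u"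
    by (cases "ennreal t \<le> ennreal s") auto
qed

lemma natural_stopped: "0 \<le> t \<Longrightarrow> \<Lambda> \<in> natural_events M X t \<Longrightarrow> \<Lambda> \<in> stopped_events M X (\<lambda>_. ennreal t)"
  unfolding stopped_events_def natural_events_right_def
proof (intro CollectI conjI allI impI INT_I)
  fix s u :: real
  assume t: "0 \<le> t" and L: "\<Lambda> \<in> natural_events M X t" and s: "0 \<le> s" and u: "u \<in> {s<..}"
  interpret sigma_algebra "space M" "natural_events M X u" by (rule sigma_algebra_natural)
  have LM: "\<Lambda> \<subseteq> space M" using natural_events_sets[OF L] sets.sets_into_space by blast
  show "\<Lambda> \<inter> {w \<in> space M. ennreal t \<le> ennreal s} \<in> natural_events M X u"
  proof (cases "t \<le> s")
    case True
    then have "\<Lambda> \<in> natural_events M X u" using natural_events_mono[of t u] L u by auto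
    moreover have "\<Lambda> \<inter> {w \<in> space M. ennreal t \<le> ennreal s} = \<Lambda>" using LM True by (auto intro: ennreal_leI)
    ultimately show ?thesis by simp
  next
    case False
    then have "\<Lambda> \<inter> {w \<in> space M. ennreal t \<le> ennreal s} = {}" using s by (auto simp: ennreal_le_iff)
    then show ?thesis by simp
  qed
qed (rule natural_events_sets)

lemma markov_one_time:
  assumes t: "0 \<le> t" and s: "0 \<le> s" and L: "\<Lambda> \<in> natural_events M X t" and f[measurable]: "f \<in> borel_measurable borel"
  shows "(\<integral>\<^sup>+w\<in>\<Lambda>. f (X (t + s) w) \<partial>P z) = (\<integral>\<^sup>+w\<in>\<Lambda>. (\<integral>\<^sup>+v. f (X s v) \<partial>P (X t w)) \<partial>P z)"
proof -
  have Ls[measurable]: "\<Lambda> \<in> sets M" by (rule natural_events_sets[OF L])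
  have ts: "0 \<le> t + s" using t s by simp
  note [measurable] = X_measurable[OF t] X_measurable[OF s] X_measurable[OF ts]
  have km: "(\<lambda>x. \<integral>\<^sup>+v. g (X s v) \<partial>P x) \<in> borel_measurable borel" if [measurable]: "g \<in> borel_measurable borel" for g :: "'a \<Rightarrow> ennreal"
    by (rule nn_integral_measurable_subprob_algebra2[where N=M]) measurable
  show ?thesis using f
  proof (induction f rule: borel_measurable_induct)
    case (cong f g)
    then have "f = g" by auto
    with cong show ?case by simp
  next
    case (set A)
    then have A[measurable]: "A \<in> sets borel" by simp
    have "(\<integral>\<^sup>+w\<in>\<Lambda>. indicator A (X (t + s) w) \<partial>P z) = (\<integral>\<^sup>+w. indicator {w \<in> \<Lambda>. X (t + s) w \<in> A} w \<partial>P z)"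
      by (intro nn_integral_cong) (auto split: split_indicator)
    also have "{w \<in> \<Lambda>. X (t + s) w \<in> A} = \<Lambda> \<inter> (X (t + s) -` A \<inter> space M)" using sets.sets_into_space[OF Ls] by auto
    also have "(\<integral>\<^sup>+w. indicator (\<Lambda> \<inter> (X (t + s) -` A \<inter> space M)) w \<partial>P z) = emeasure (P z) (\<Lambda> \<inter> (X (t + s) -` A \<inter> space M))"
      by (rule nn_integral_indicator) (simp add: sets_P sets.Int[OF Ls] measurable_sets[OF X_measurable[OF ts] A])
    also have "\<Lambda> \<inter> (X (t + s) -` A \<inter> space M) = {w \<in> \<Lambda>. ennreal t < \<infinity> \<and> X (enn2real (ennreal t) + s) w \<in> A}"
      using t sets.sets_into_space[OF Ls] by auto
    also have "emeasure (P z) \<dots> = (\<integral>\<^sup>+ w \<in> {w \<in> \<Lambda>. ennreal t < \<infinity>}. emeasure (P (X (enn2real (ennreal t)) w)) (X s -` A \<inter> space M) \<partial>P z)"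
      by (rule strong_markov[OF const_stopping[OF t] natural_stopped[OF t L] s A])
    also have "\<dots> = (\<integral>\<^sup>+w\<in>\<Lambda>. (\<integral>\<^sup>+v. indicator A (X s v) \<partial>P (X t w)) \<partial>P z)"
    proof (rule nn_integral_cong)
      fix w
      have "(\<integral>\<^sup>+v. indicator A (X s v) \<partial>P (X t w)) = (\<integral>\<^sup>+v. indicator (X s -` A \<inter> space M) v \<partial>P (X t w))"
        by (intro nn_integral_cong) (auto simp: space_P split: split_indicator)
      also have "\<dots> = emeasure (P (X t w)) (X s -` A \<inter> space M)"
        by (rule nn_integral_indicator) (simp add: sets_P measurable_sets[OF X_measurable[OF s] A])
      finally show "emeasure (P (X (enn2real (ennreal t)) w)) (X s -` A \<inter> space M) * indicator {w \<in> \<Lambda>. ennreal t < \<infinity>} w =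
         (\<integral>\<^sup>+v. indicator A (X s v) \<partial>P (X t w)) * indicator \<Lambda> w"
        using t by simp
    qed
    finally show ?case .
  next
    case (mult f c)
    have [measurable]: "f \<in> borel_measurable borel" by fact
    note [measurable] = km[of f]
    show ?case using mult.IH
      by (simp add: nn_integral_cmult mult.assoc)
  next
    case (add f g)
    have [measurable]: "f \<in> borel_measurable borel" "g \<in> borel_measurable borel" by fact+
    note [measurable] = km[of f] km[of g]
    show ?case using add.IH
      by (simp add: nn_integral_add distrib_right)
  next
    case (seq U)
    have [measurable]: "\<And>i. U i \<in> borel_measurable borel" by fact
    note [measurable] = km[of "U _"]
    have inc: "incseq U" by fact
    have "(\<integral>\<^sup>+w\<in>\<Lambda>. (SUP i. U i) (X (t + s) w) \<partial>P z) = (\<integral>\<^sup>+w. (SUP i. U i (X (t + s) w) * indicator \<Lambda> w) \<partial>P z)"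
      by (simp add: SUP_mult_right_ennreal image_comp)
    also have "\<dots> = (SUP i. \<integral>\<^sup>+w\<in>\<Lambda>. U i (X (t + s) w) \<partial>P z)"
      by (rule nn_integral_monotone_convergence_SUP)
        (use inc in \<open>auto simp: incseq_def le_fun_def intro!: mult_right_mono\<close>)
    also have "\<dots> = (SUP i. \<integral>\<^sup>+w\<in>\<Lambda>. (\<integral>\<^sup>+v. U i (X s v) \<partial>P (X t w)) \<partial>P z)" using seq.IH by simp
    also have "\<dots> = (\<integral>\<^sup>+w. (SUP i. (\<integral>\<^sup>+v. U i (X s v) \<partial>P (X t w)) * indicator \<Lambda> w) \<partial>P z)"
      by (rule nn_integral_monotone_convergence_SUP[symmetric])
        (use inc in \<open>auto simp: incseq_def le_fun_def intro!: mult_right_mono nn_integral_mono\<close>)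
    also have "\<dots> = (\<integral>\<^sup>+w\<in>\<Lambda>. (\<integral>\<^sup>+v. (SUP i. U i) (X s v) \<partial>P (X t w)) \<partial>P z)"
    proof (rule nn_integral_cong)
      fix w
      have "(\<integral>\<^sup>+v. (SUP i. U i) (X s v) \<partial>P (X t w)) = (\<integral>\<^sup>+v. (SUP i. U i (X s v)) \<partial>P (X t w))"
        by (simp add: image_comp)
      also have "\<dots> = (SUP i. \<integral>\<^sup>+v. U i (X s v) \<partial>P (X t w))"
        by (rule nn_integral_monotone_convergence_SUP)
          (use inc in \<open>auto simp: incseq_def le_fun_def\<close>)
      finally show "(SUP i. (\<integral>\<^sup>+v. U i (X s v) \<partial>P (X t w)) * indicator \<Lambda> w) = (\<integral>\<^sup>+v. (SUP i. U i) (X s v) \<partial>P (X t w)) * indicator \<Lambda> w"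
        by (simp add: SUP_mult_right_ennreal)
    qed
    finally show ?case .
  qed
qed

text \<open>The offset \<open>c\<close> lets the induction over the set of times strip off the first time
  and restart there.\<close>

definition cylinder :: "real set \<Rightarrow> (real \<Rightarrow> 'a set) \<Rightarrow> real \<Rightarrow> 'o set" where
  "cylinder J A c = {w \<in> space M. \<forall>s\<in>J. X (s - c) w \<in> A s}"

lemma cylinder_sets:
  assumes "finite J" "\<And>s. s \<in> J \<Longrightarrow> c \<le> s" "\<And>s. A s \<in> sets borel"
  shows "cylinder J A c \<in> sets M"
proof -
  have "cylinder J A c = space M \<inter> (\<Inter>s\<in>J. X (s - c) -` A s \<inter> space M)" if "J \<noteq> {}" using that by (auto simp: cylinder_def)
  moreover have "(\<Inter>s\<in>J. X (s - c) -` A s \<inter> space M) \<in> sets M" if "J \<noteq> {}"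
    using assms that by (intro sets.finite_INT) (auto intro!: measurable_sets[OF X_measurable])
  ultimately show ?thesis by (cases "J = {}") (auto simp: cylinder_def)
qed

lemma markov_cylinder:
  assumes "finite J" and A: "\<And>s. A s \<in> sets borel"
  shows "(\<And>s. s \<in> J \<Longrightarrow> c \<le> s) \<Longrightarrow> 0 \<le> t \<Longrightarrow> \<Lambda> \<in> natural_events M X t \<Longrightarrow>
    emeasure (P z) (\<Lambda> \<inter> (\<theta> t -` cylinder J A c \<inter> space M)) = (\<integral>\<^sup>+w\<in>\<Lambda>. emeasure (P (X t w)) (cylinder J A c) \<partial>P z)"
  using assms(1)
proof (induction J arbitrary: c t \<Lambda> z rule: finite_linorder_min_induct)
  case empty
  have "cylinder {} A c = space M" by (auto simp: cylinder_def)
  moreover have "\<Lambda> \<subseteq> space M" "\<Lambda> \<in> sets M" using natural_events_sets[OF empty(3)] sets.sets_into_space by auto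
  moreover have "emeasure (P x) (space M) = 1" for x using prob_space.emeasure_space_1[OF prob_space_P[of x]] by (simp add: space_P)
  moreover have "\<theta> t -` space M \<inter> space M = space M" using shift_space empty by auto
  ultimately show ?case by (simp add: Int_absorb2 nn_integral_indicator)
next
  case (insert b J)
  have bc: "c \<le> b" and t: "0 \<le> t" and L: "\<Lambda> \<in> natural_events M X t" using insert.prems by auto
  have bJ: "\<And>s. s \<in> J \<Longrightarrow> b \<le> s" using insert.hyps by (meson less_imp_le)
  let ?E = "cylinder J A b" and ?d = "b - c"
  have d: "0 \<le> ?d" using bc by simp
  have LM: "\<Lambda> \<subseteq> space M" "\<Lambda> \<in> sets M" using natural_events_sets[OF L] sets.sets_into_space by auto
  have Em[measurable]: "?E \<in> sets M" by (rule cylinder_sets) (use insert.hyps bJ A in auto)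
  have km[measurable]: "(\<lambda>x. emeasure (P x) ?E) \<in> borel_measurable borel"
    by (rule measurable_emeasure_kernel[OF kernel_subprob Em])
  have [measurable]: "A b \<in> sets borel" by (rule A)
  let ?g = "\<lambda>x. indicator (A b) x * emeasure (P x) ?E"
  have gm: "?g \<in> borel_measurable borel" by measurable
  have split: "cylinder (insert b J) A c = (X ?d -` A b \<inter> space M) \<inter> (\<theta> ?d -` ?E \<inter> space M)"
    using d bJ by (auto simp: cylinder_def shift shift_space)
  have one: "emeasure (P x) (cylinder (insert b J) A c) = (\<integral>\<^sup>+v. ?g (X ?d v) \<partial>P x)" for x
  proof -
    have "emeasure (P x) (cylinder (insert b J) A c) = (\<integral>\<^sup>+w\<in>X ?d -` A b \<inter> space M. emeasure (P (X ?d w)) ?E \<partial>P x)"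
      unfolding split by (rule insert.IH[OF bJ d]) (use X_natural_event[OF d] A in auto)
    also have "\<dots> = (\<integral>\<^sup>+v. ?g (X ?d v) \<partial>P x)"
      by (intro nn_integral_cong) (auto split: split_indicator simp: space_P)
    finally show ?thesis .
  qed
  have L2: "\<Lambda> \<inter> (X (t + ?d) -` A b \<inter> space M) \<in> natural_events M X (t + ?d)"
  proof -
    interpret sigma_algebra "space M" "natural_events M X (t + ?d)" by (rule sigma_algebra_natural)
    show ?thesis using natural_events_mono[of t "t + ?d"] L X_natural_event[of "t + ?d" "t + ?d" "A b"] A d t by auto
  qed
  have td: "0 \<le> t + ?d" using t d by simp
  have "\<Lambda> \<inter> (\<theta> t -` cylinder (insert b J) A c \<inter> space M) = (\<Lambda> \<inter> (X (t + ?d) -` A b \<inter> space M)) \<inter> (\<theta> (t + ?d) -` ?E \<inter> space M)"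
  proof -
    have 1: "X (s - c) (\<theta> t w) = X (t + (s - c)) w" if "s \<in> insert b J" "w \<in> space M" for s w
    proof -
      have "c \<le> s" using that insert.prems(1) by blast
      then show ?thesis using shift[of "s - c" t w] t that by (simp add: add.commute)
    qed
    have 2: "X (s - b) (\<theta> (t + ?d) w) = X (t + (s - c)) w" if "s \<in> J" "w \<in> space M" for s w
      using that t d bJ by (subst shift) (auto simp: algebra_simps)
    show ?thesis using d t LM(1) by (auto simp: cylinder_def shift_space 1 2)
  qed
  also have "emeasure (P z) \<dots> = (\<integral>\<^sup>+w\<in>\<Lambda> \<inter> (X (t + ?d) -` A b \<inter> space M). emeasure (P (X (t + ?d) w)) ?E \<partial>P z)"
    by (rule insert.IH[OF bJ td L2])
  also have "\<dots> = (\<integral>\<^sup>+w\<in>\<Lambda>. ?g (X (t + ?d) w) \<partial>P z)"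
    by (intro nn_integral_cong) (auto split: split_indicator simp: space_P)
  also have "\<dots> = (\<integral>\<^sup>+w\<in>\<Lambda>. (\<integral>\<^sup>+v. ?g (X ?d v) \<partial>P (X t w)) \<partial>P z)"
    by (rule markov_one_time[OF t d L gm])
  also have "\<dots> = (\<integral>\<^sup>+w\<in>\<Lambda>. emeasure (P (X t w)) (cylinder (insert b J) A c) \<partial>P z)" by (simp only: one)
  finally show ?case .
qed

text \<open>The events satisfying the identity form a Dynkin system, and cylinder events are a
  generator that is stable under intersections.\<close>

lemma markov_event:
  assumes t: "0 \<le> t" and L: "\<Lambda> \<in> natural_events M X t" and E: "E \<in> sets M"
  shows "emeasure (P z) (\<Lambda> \<inter> (\<theta> t -` E \<inter> space M)) = (\<integral>\<^sup>+w\<in>\<Lambda>. emeasure (P (X t w)) E \<partial>P z)"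
proof -
  have Ls[measurable]: "\<Lambda> \<in> sets M" by (rule natural_events_sets[OF L])
  note [measurable] = shift_measurable[OF t] X_measurable[OF t]
  interpret Pz: prob_space "P z" by (rule prob_space_P)
  have pe: "emeasure (P x) (space M) = 1" for x using prob_space.emeasure_space_1[OF prob_space_P[of x]] by (simp add: space_P)
  have km: "(\<lambda>x. emeasure (P x) E) \<in> borel_measurable borel" if "E \<in> sets M" for E
    by (rule measurable_emeasure_kernel[OF kernel_subprob that])
  let ?I = "\<lambda>E. (\<integral>\<^sup>+w\<in>\<Lambda>. emeasure (P (X t w)) E \<partial>P z)"
  let ?G = "{cylinder J A 0 | J A. finite J \<and> (\<forall>s\<in>J. 0 \<le> s) \<and> (\<forall>s. A s \<in> sets borel)}"
  have gen: "sets M = sigma_sets (space M) ?G"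
  proof
    show "sets M \<subseteq> sigma_sets (space M) ?G"
      unfolding sets_M
    proof (rule sigma_sets_mono, safe)
      fix s :: real and A :: "'a set" assume "0 \<le> s" "A \<in> sets borel"
      then have "cylinder {s} (\<lambda>_. A) 0 \<in> ?G" by blast
      then have "cylinder {s} (\<lambda>_. A) 0 \<in> sigma_sets (space M) ?G" by (rule sigma_sets.Basic)
      then show "X s -` A \<inter> space M \<in> sigma_sets (space M) ?G" by (simp add: cylinder_def vimage_def Int_def conj_commute)
    qed
    show "sigma_sets (space M) ?G \<subseteq> sets M"
      by (rule sets.sigma_sets_subset) (auto intro!: cylinder_sets)
  qed
  have int: "Int_stable ?G"
  proof (rule Int_stableI, safe)
    fix J J' :: "real set" and A A' :: "real \<Rightarrow> 'a set" assume J: "finite J" "\<forall>s\<in>J. 0 \<le> (s::real)" "finite J'" "\<forall>s\<in>J'. 0 \<le> s"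
      and A: "\<forall>s. A s \<in> sets borel" "\<forall>s. A' s \<in> sets borel"
    let ?A = "\<lambda>s. (if s \<in> J then A s else UNIV) \<inter> (if s \<in> J' then A' s else UNIV)"
    have "cylinder J A 0 \<inter> cylinder J' A' 0 = cylinder (J \<union> J') ?A 0" by (auto simp: cylinder_def)
    then show "\<exists>Ja Aa. cylinder J A 0 \<inter> cylinder J' A' 0 = cylinder Ja Aa 0 \<and> finite Ja \<and> (\<forall>s\<in>Ja. 0 \<le> s) \<and> (\<forall>s. Aa s \<in> sets borel)"
      using J A by (intro exI[of _ "J \<union> J'"] exI[of _ ?A]) auto
  qed
  have LI: "\<Lambda> \<inter> (\<theta> t -` E \<inter> space M) \<in> sets M" if "E \<in> sets M" for E
    using that by (intro sets.Int measurable_sets[OF shift_measurable[OF t]] Ls)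
  have "?G \<subseteq> Pow (space M)" by (auto simp: cylinder_def)
  with int show ?thesis using E unfolding gen
  proof (induction rule: sigma_sets_induct_disjoint)
    case (basic A)
    then obtain J B where "A = cylinder J B 0" "finite J" "\<forall>s\<in>J. 0 \<le> s" "\<And>s. B s \<in> sets borel" by blast
    then show ?case using markov_cylinder[of J B 0 t \<Lambda> z] t L by simp
  next
    case empty
    show ?case by simp
  next
    case (compl A)
    then have AM[measurable]: "A \<in> sets M" using gen by simp
    have [simp]: "?I (space M) = emeasure (P z) \<Lambda>" by (simp add: pe nn_integral_indicator)
    note [measurable] = km[OF AM]
    have "\<Lambda> \<inter> (\<theta> t -` (space M - A) \<inter> space M) = \<Lambda> - (\<Lambda> \<inter> (\<theta> t -` A \<inter> space M))"
      using sets.sets_into_space[OF Ls] shift_space t by auto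
    then have "emeasure (P z) (\<Lambda> \<inter> (\<theta> t -` (space M - A) \<inter> space M)) = emeasure (P z) \<Lambda> - emeasure (P z) (\<Lambda> \<inter> (\<theta> t -` A \<inter> space M))"
      using LI[OF AM] Ls by (simp add: emeasure_Diff sets_P)
    also have "\<dots> = ?I (space M) - ?I A" using compl by simp
    also have "\<dots> = (\<integral>\<^sup>+w. emeasure (P (X t w)) (space M) * indicator \<Lambda> w - emeasure (P (X t w)) A * indicator \<Lambda> w \<partial>P z)"
    proof (rule nn_integral_diff[symmetric])
      have "?I A \<le> ?I (space M)"
        using sets.sets_into_space[OF AM] by (intro nn_integral_mono mult_right_mono emeasure_mono) (auto simp: sets_P)
      also have "\<dots> < \<infinity>" by (simp add: less_top[symmetric])
      finally show "?I A \<noteq> \<infinity>" by simp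
      show "AE w in P z. emeasure (P (X t w)) A * indicator \<Lambda> w \<le> emeasure (P (X t w)) (space M) * indicator \<Lambda> w"
        using sets.sets_into_space[OF AM] by (intro AE_I2 mult_right_mono emeasure_mono) (auto simp: sets_P)
    qed (auto simp: pe)
    also have "\<dots> = ?I (space M - A)"
    proof (rule nn_integral_cong)
      fix w
      have "emeasure (P (X t w)) (space M - A) = emeasure (P (X t w)) (space M) - emeasure (P (X t w)) A"
        using prob_space.emeasure_le_1[OF prob_space_P[of "X t w"], of A]
        by (intro emeasure_Diff) (auto simp: sets_P top_unique intro: sets.sets_into_space[OF AM, THEN subsetD])
      then show "emeasure (P (X t w)) (space M) * indicator \<Lambda> w - emeasure (P (X t w)) A * indicator \<Lambda> w = emeasure (P (X t w)) (space M - A) * indicator \<Lambda> w"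
        by (auto split: split_indicator)
    qed
    finally show ?case .
  next
    case (union A)
    have AM[measurable]: "\<And>i. A i \<in> sets M" using union gen by auto
    note [measurable] = km[OF AM]
    have dis: "disjoint_family (\<lambda>i. \<Lambda> \<inter> (\<theta> t -` A i \<inter> space M))" using union(1) by (auto simp: disjoint_family_on_def)
    have "\<Lambda> \<inter> (\<theta> t -` (\<Union>i. A i) \<inter> space M) = (\<Union>i. \<Lambda> \<inter> (\<theta> t -` A i \<inter> space M))" by auto
    then have "emeasure (P z) (\<Lambda> \<inter> (\<theta> t -` (\<Union>i. A i) \<inter> space M)) = (\<Sum>i. emeasure (P z) (\<Lambda> \<inter> (\<theta> t -` A i \<inter> space M)))"
      using suminf_emeasure[OF _ dis, of "P z"] LI[OF AM] by (simp add: sets_P image_subset_iff)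
    also have "\<dots> = (\<Sum>i. ?I (A i))" using union by simp
    also have "\<dots> = (\<integral>\<^sup>+w. (\<Sum>i. emeasure (P (X t w)) (A i) * indicator \<Lambda> w) \<partial>P z)"
      by (rule nn_integral_suminf[symmetric]) measurable
    also have "\<dots> = ?I (\<Union>i. A i)"
      using suminf_emeasure[OF _ union(1), of "P _"] AM by (intro nn_integral_cong) (simp add: sets_P image_subset_iff)
    finally show ?case .
  qed
qed

lemma kernel_integral_measurable:
  assumes [measurable]: "F \<in> borel_measurable M"
  shows "(\<lambda>x. \<integral>\<^sup>+v. F v \<partial>P x) \<in> borel_measurable borel"
  by (rule nn_integral_measurable_subprob_algebra2[where N=M]) measurable

lemma markov:
  assumes t: "0 \<le> t" and L: "\<Lambda> \<in> natural_events M X t" and F: "F \<in> borel_measurable M"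
  shows "(\<integral>\<^sup>+w\<in>\<Lambda>. F (\<theta> t w) \<partial>P z) = (\<integral>\<^sup>+w\<in>\<Lambda>. (\<integral>\<^sup>+v. F v \<partial>P (X t w)) \<partial>P z)"
proof -
  have Ls[measurable]: "\<Lambda> \<in> sets M" by (rule natural_events_sets[OF L])
  note [measurable] = shift_measurable[OF t] X_measurable[OF t]
  let ?N = "distr (density (P z) (indicator \<Lambda>)) M (\<theta> t)"
  let ?K = "density (P z) (indicator \<Lambda>) \<bind> (\<lambda>w. P (X t w))"
  have sub: "subprob_space (density (P z) (indicator \<Lambda>))"
  proof
    have "emeasure (density (P z) (indicator \<Lambda>)) (space M) = emeasure (P z) \<Lambda>"
      using sets.sets_into_space[OF Ls] by (subst emeasure_density) (auto simp: sets_P indicator_inter_arith[symmetric] Int_absorb2 Int_absorb1 nn_integral_indicator sets_P)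
    then show "emeasure (density (P z) (indicator \<Lambda>)) (space (density (P z) (indicator \<Lambda>))) \<le> 1"
      using prob_space.emeasure_le_1[OF prob_space_P[of z], of \<Lambda>] by (simp add: space_P)
    show "space (density (P z) (indicator \<Lambda>)) \<noteq> {}"
      using prob_space.not_empty[OF prob_space_P[of z]] by simp
  qed
  have eq: "?N = ?K"
  proof (rule measure_eqI)
    show "sets ?N = sets ?K"
      using prob_space.not_empty[OF prob_space_P[of z]] by (subst sets_bind[where N=M]) (auto simp: sets_P)
    fix E assume "E \<in> sets ?N"
    then have E[measurable]: "E \<in> sets M" by simp
    have "emeasure ?N E = (\<integral>\<^sup>+w. indicator \<Lambda> w * indicator (\<theta> t -` E \<inter> space M) w \<partial>P z)"
      by (subst emeasure_distr) (auto simp: emeasure_density space_P)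
    also have "\<dots> = emeasure (P z) (\<Lambda> \<inter> (\<theta> t -` E \<inter> space M))"
      by (subst indicator_inter_arith[symmetric], rule nn_integral_indicator)
        (simp add: sets_P sets.Int[OF Ls] measurable_sets[OF shift_measurable[OF t] E])
    also have "\<dots> = (\<integral>\<^sup>+w\<in>\<Lambda>. emeasure (P (X t w)) E \<partial>P z)"
      by (rule markov_event[OF t L E])
    also have "\<dots> = (\<integral>\<^sup>+w. emeasure (P (X t w)) E \<partial>density (P z) (indicator \<Lambda>))"
      using measurable_compose[OF X_measurable[OF t] measurable_emeasure_kernel[OF kernel_subprob E]]
      by (subst nn_integral_density) (simp_all add: mult.commute)
    also have "\<dots> = emeasure ?K E"
    proof (rule emeasure_bind[symmetric])
      show "space (density (P z) (indicator \<Lambda>)) \<noteq> {}"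
        using prob_space.not_empty[OF prob_space_P[of z]] by simp
      show "(\<lambda>w. P (X t w)) \<in> density (P z) (indicator \<Lambda>) \<rightarrow>\<^sub>M subprob_algebra M"
        using measurable_compose[OF X_measurable[OF t] kernel_subprob] by simp
    qed (rule E)
    finally show "emeasure ?N E = emeasure ?K E" .
  qed
  have "(\<integral>\<^sup>+w\<in>\<Lambda>. F (\<theta> t w) \<partial>P z) = (\<integral>\<^sup>+v. F v \<partial>?N)"
    using F by (subst nn_integral_distr) (auto simp: nn_integral_density mult.commute)
  also have "\<dots> = (\<integral>\<^sup>+w. (\<integral>\<^sup>+v. F v \<partial>P (X t w)) \<partial>density (P z) (indicator \<Lambda>))"
    unfolding eq using F by (subst nn_integral_bind[where B=M]) auto
  also have "\<dots> = (\<integral>\<^sup>+w\<in>\<Lambda>. (\<integral>\<^sup>+v. F v \<partial>P (X t w)) \<partial>P z)"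
    using kernel_integral_measurable[OF F] by (subst nn_integral_density) (auto simp: mult.commute)
  finally show ?thesis .
qed

end

section \<open>The Green kernel of a resistance form\<close>

lemma tendsto_of_abs_bound:
  fixes f :: "'b \<Rightarrow> real"
  assumes "\<And>x. \<bar>f x - c\<bar> \<le> g x" "(g \<longlongrightarrow> 0) F"
  shows "(f \<longlongrightarrow> c) F"
proof -
  have "((\<lambda>x. f x - c) \<longlongrightarrow> 0) F"
    by (rule Lim_null_comparison[OF always_eventually assms(2)]) (use assms(1) in simp)
  then show ?thesis by (simp add: LIM_zero_iff)
qed

locale resistance_process =
  resistance_space \<E> \<F> \<mu> + hunt_process M X \<theta> P + local_times \<mu> M X \<theta> P L
  for \<E> :: "('a::metric_space \<Rightarrow> real) \<Rightarrow> ('a \<Rightarrow> real) \<Rightarrow> real"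
    and \<F> :: "('a \<Rightarrow> real) set" and \<mu> :: "'a measure"
    and M :: "'o measure" and X :: "real \<Rightarrow> 'o \<Rightarrow> 'a" and \<theta> :: "real \<Rightarrow> 'o \<Rightarrow> 'o" and P :: "'a \<Rightarrow> 'o measure"
    and L :: "real \<Rightarrow> 'a \<Rightarrow> 'o \<Rightarrow> real" +
  assumes associated: "associated_process \<E> \<F> \<mu> X P" and uvd: "UVD \<E> \<F> \<mu>"
begin

lemmas sets_mu_cong[measurable_cong] = sets_borel

lemma space_mu: "space \<mu> = UNIV"
  using sets_eq_imp_space_eq[OF sets_borel] by simp

text \<open>The definition of the resistance as a supremum, cleared of the quotient.\<close>

lemma energy_oscillation: assumes f: "f \<in> \<F>" shows "(f x - f y)\<^sup>2 \<le> dist x y * \<E> f f"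
proof (cases "\<E> f f = 0")
  case True
  then obtain c where "\<forall>x. f x = c" using zero_iff[OF f] by auto
  with True show ?thesis by simp
next
  case False
  then have pos: "\<E> f f > 0" using nonneg[OF f] by simp
  have "ennreal (\<bar>f x - f y\<bar>\<^sup>2 / \<E> f f) \<le> resistance \<E> \<F> x y"
    unfolding resistance_def by (rule SUP_upper) (use f pos in auto)
  then have "\<bar>f x - f y\<bar>\<^sup>2 / \<E> f f \<le> dist x y" unfolding dist_eq[symmetric] by (simp add: ennreal_le_iff)
  then show ?thesis using pos by (simp add: pos_divide_le_eq)
qed

lemma form_continuous: assumes f: "f \<in> \<F>" shows "continuous_on UNIV f"
proof -
  have "(f \<longlongrightarrow> f x) (at x)" for x
  proof -
    have "((\<lambda>y. sqrt (dist y x * \<E> f f)) \<longlongrightarrow> sqrt (dist x x * \<E> f f)) (at x)"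
      by (intro tendsto_intros)
    then have "((\<lambda>y. sqrt (dist y x * \<E> f f)) \<longlongrightarrow> 0) (at x)" by simp
    moreover have "\<bar>f y - f x\<bar> \<le> sqrt (dist y x * \<E> f f)" for y
      using energy_oscillation[OF f, of y x] by (simp add: real_le_rsqrt)
    ultimately show ?thesis by (rule tendsto_of_abs_bound[rotated])
  qed
  then show ?thesis by (auto simp: continuous_on_def)
qed

lemma form_measurable: "f \<in> \<F> \<Longrightarrow> f \<in> borel_measurable borel"
  by (intro borel_measurable_continuous_onI form_continuous)

text \<open>The radius \<open>1/2\<close> lies below \<open>R\<^sub>F + 1\<close> whatever the diameter is, so that the volume
  condition applies at this scale.\<close>

lemma uniform_ball_measure:
  "\<exists>m>0. \<forall>x. ennreal m \<le> emeasure \<mu> (ball x (1/2)) \<and> emeasure \<mu> (ball x (1/2)) < \<infinity>"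
proof -
  have rb: "resistance_ball \<E> \<F> x r = ball x r" for x and r :: real
    unfolding resistance_ball_def dist_eq[symmetric] by (auto simp: ennreal_less_iff)
  \<comment> \<open>The diameter may be \<open>0\<close>, so the radius has to be below \<open>1\<close>.\<close>
  have "ennreal (1/2) < 1" using ennreal_less_iff[of "1/2" 1] by simp
  also have "1 \<le> resistance_diameter \<E> \<F> + 1" by simp
  finally have r: "ennreal (1/2) < resistance_diameter \<E> \<F> + 1" .
  obtain c_l c_u and v :: "real \<Rightarrow> real" where c: "0 < c_l" "\<forall>r>0. 0 < v r"
    and b: "\<forall>r>0. ennreal r < resistance_diameter \<E> \<F> + 1 \<longrightarrow>
        (\<forall>x. ennreal (c_l * v r) \<le> emeasure \<mu> (resistance_ball \<E> \<F> x r) \<and>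
             emeasure \<mu> (resistance_ball \<E> \<F> x r) \<le> ennreal (c_u * v r))"
    using uvd unfolding UVD_def by blast
  have "\<forall>x. ennreal (c_l * v (1/2)) \<le> emeasure \<mu> (ball x (1/2)) \<and> emeasure \<mu> (ball x (1/2)) \<le> ennreal (c_u * v (1/2))"
    using b[rule_format, of "1/2"] r rb by simp
  then show ?thesis using c
    by (intro exI[of _ "c_l * v (1/2)"]) (auto intro: le_less_trans)
qed

lemma bounded_finite_measure: assumes "bounded S" shows "emeasure \<mu> S < \<infinity>"
proof -
  have "compact (closure S)" using assms by (intro closed_bounded_compact) auto
  then obtain K where K: "finite K" "closure S \<subseteq> (\<Union>x\<in>K. ball x (1/2))"
    unfolding compact_eq_totally_bounded by (meson half_gt_zero zero_less_one)
  have "emeasure \<mu> S \<le> emeasure \<mu> (\<Union>x\<in>K. ball x (1/2))"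
    using K closure_subset[of S] by (intro emeasure_mono) (auto simp: sets_borel)
  also have "\<dots> \<le> (\<Sum>x\<in>K. emeasure \<mu> (ball x (1/2)))"
    using K by (intro emeasure_subadditive_finite) (auto simp: sets_borel)
  also have "\<dots> < \<infinity>" using uniform_ball_measure K(1) by (auto simp: ennreal_sum_less_top less_top)
  finally show ?thesis .
qed

lemma sigma_finite_mu: "sigma_finite_measure \<mu>"
proof
  let ?A = "range (\<lambda>n::nat. ball undefined (real n))"
  have "\<Union> ?A = (UNIV :: 'a set)"
    using reals_Archimedean2 by (fastforce simp: dist_commute)
  then show "\<exists>A. countable A \<and> A \<subseteq> sets \<mu> \<and> \<Union> A = space \<mu> \<and> (\<forall>a\<in>A. emeasure \<mu> a \<noteq> \<infinity>)"
    using bounded_finite_measure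
    by (intro exI[of _ ?A]) (auto simp: space_mu sets_borel less_top[symmetric])
qed

lemma separable: "\<exists>D::'a set. countable D \<and> (\<forall>x e. 0 < e \<longrightarrow> (\<exists>d\<in>D. dist x d < e))"
proof -
  have "\<exists>K. finite K \<and> cball (undefined::'a) (real n) \<subseteq> (\<Union>x\<in>K. ball x (inverse (real (Suc m))))" for n m :: nat
  proof -
    have "compact (cball (undefined::'a) (real n))" by (intro closed_bounded_compact) auto
    then have tb: "\<exists>K. finite K \<and> cball (undefined::'a) (real n) \<subseteq> (\<Union>x\<in>K. ball (x::'a) e)" if "0 < e" for e
      unfolding compact_eq_totally_bounded using that by blast
    show ?thesis by (rule tb) simp
  qed
  then obtain K where K: "\<And>n m. finite (K n m)" "\<And>n m. cball (undefined::'a) (real n) \<subseteq> (\<Union>x\<in>K n m. ball x (inverse (real (Suc m))))"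
    by metis
  let ?D = "\<Union>n m. K n m"
  have "countable ?D" using K(1) by (intro countable_UN) (auto intro: countable_finite)
  moreover have "\<exists>d\<in>?D. dist x d < e" if e: "0 < e" for x e
  proof -
    obtain m where m: "inverse (real (Suc m)) < e" using reals_Archimedean[OF e] by blast
    obtain n where "dist undefined x \<le> real n" using real_arch_simple by blast
    then have "x \<in> cball undefined (real n)" by simp
    then obtain d where "d \<in> K n m" "x \<in> ball d (inverse (real (Suc m)))" using K(2)[of n m] by blast
    then have "d \<in> ?D" "dist x d < e" using m by (auto simp: dist_commute)
    then show ?thesis by blast
  qed
  ultimately show ?thesis by blast
qed

definition ball_vol :: real where "ball_vol = (SOME m. 0 < m \<and> (\<forall>x. ennreal m \<le> emeasure \<mu> (ball x (1/2))))"

lemma ball_vol: "0 < ball_vol" "ennreal ball_vol \<le> emeasure \<mu> (ball x (1/2))"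
proof -
  have "\<exists>m. 0 < m \<and> (\<forall>x. ennreal m \<le> emeasure \<mu> (ball x (1/2)))" using uniform_ball_measure by blast
  from someI_ex[OF this] show "0 < ball_vol" "ennreal ball_vol \<le> emeasure \<mu> (ball x (1/2))"
    unfolding ball_vol_def by blast+
qed

definition energy :: "real \<Rightarrow> ('a \<Rightarrow> real) \<Rightarrow> real" where
  "energy k h = \<E> h h + k * (\<integral>x. (h x)\<^sup>2 \<partial>\<mu>)"

text \<open>The constant of the embedding of the form domain into the bounded functions.\<close>

definition sup_const :: "real \<Rightarrow> real" where "sup_const k = max 1 (2 / (ball_vol * k))"

lemma sup_const_pos: "0 < sup_const k" unfolding sup_const_def by simp

lemma energy_nonneg: "h \<in> \<F> \<Longrightarrow> 0 \<le> k \<Longrightarrow> 0 \<le> energy k h"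
  unfolding energy_def using nonneg by simp

text \<open>On the ball of radius \<open>1/2\<close> the function differs from its value at the centre by at most the
  energy; averaging over the ball brings in the \<open>L\<^sup>2\<close> norm divided by the volume.\<close>

lemma sup_le_energy:
  assumes h: "h \<in> \<F>" and int: "integrable \<mu> (\<lambda>x. (h x)\<^sup>2)" and k: "0 < k"
  shows "(h x)\<^sup>2 \<le> sup_const k * energy k h"
proof -
  let ?B = "ball x (1/2)"
  have Bf: "emeasure \<mu> ?B < \<infinity>" by (rule bounded_finite_measure) simp
  have Bs: "?B \<in> sets \<mu>" by (simp add: sets_borel)
  define b where "b = measure \<mu> ?B"
  have "emeasure \<mu> ?B = ennreal b" using Bf by (simp add: b_def emeasure_eq_ennreal_measure less_top)
  then have b: "ball_vol \<le> b" using ball_vol(2)[of x] by (simp add: ennreal_le_iff b_def)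
  have "b * (h x)\<^sup>2 = (\<integral>y. (h x)\<^sup>2 * indicator ?B y \<partial>\<mu>)"
    using Bs by (simp add: b_def space_mu)
  also have "\<dots> \<le> (\<integral>y. \<E> h h * indicator ?B y + 2 * (h y)\<^sup>2 \<partial>\<mu>)"
  proof (rule integral_mono)
    show "integrable \<mu> (\<lambda>y. (h x)\<^sup>2 * indicator ?B y)" "integrable \<mu> (\<lambda>y. \<E> h h * indicator ?B y + 2 * (h y)\<^sup>2)"
      using Bs Bf int by auto
    fix y
    show "(h x)\<^sup>2 * indicator ?B y \<le> \<E> h h * indicator ?B y + 2 * (h y)\<^sup>2"
    proof (cases "y \<in> ?B")
      case True
      have "(h x)\<^sup>2 \<le> 2 * (h x - h y)\<^sup>2 + 2 * (h y)\<^sup>2"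
        using zero_le_power2[of "h x - 2 * h y"] by (simp add: power2_eq_square algebra_simps)
      also have "2 * (h x - h y)\<^sup>2 \<le> 2 * (dist x y * \<E> h h)" using energy_oscillation[OF h] by simp
      also have "\<dots> \<le> \<E> h h" using True nonneg[OF h] mult_right_mono[of "dist x y" "1/2" "\<E> h h"] by simp
      finally show ?thesis using True by simp
    qed simp
  qed
  also have "\<dots> = b * \<E> h h + 2 * (\<integral>y. (h y)\<^sup>2 \<partial>\<mu>)"
    using Bs Bf int by (simp add: b_def space_mu)
  finally have "(h x)\<^sup>2 \<le> \<E> h h + 2 / b * (\<integral>y. (h y)\<^sup>2 \<partial>\<mu>)"
    using b ball_vol(1) by (simp add: field_simps)
  also have "\<dots> \<le> sup_const k * \<E> h h + sup_const k * (k * (\<integral>y. (h y)\<^sup>2 \<partial>\<mu>))"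
  proof (rule add_mono)
    show "\<E> h h \<le> sup_const k * \<E> h h"
      using nonneg[OF h] mult_right_mono[of 1 "sup_const k" "\<E> h h"] by (simp add: sup_const_def)
    have "2 / b \<le> 2 / ball_vol" using b ball_vol(1) by (simp add: frac_le)
    also have "\<dots> = 2 / (ball_vol * k) * k" using k by simp
    also have "\<dots> \<le> sup_const k * k" using k by (intro mult_right_mono) (auto simp: sup_const_def)
    finally have "2 / b * (\<integral>y. (h y)\<^sup>2 \<partial>\<mu>) \<le> sup_const k * k * (\<integral>y. (h y)\<^sup>2 \<partial>\<mu>)"
      by (rule mult_right_mono) simp
    then show "2 / b * (\<integral>y. (h y)\<^sup>2 \<partial>\<mu>) \<le> sup_const k * (k * (\<integral>y. (h y)\<^sup>2 \<partial>\<mu>))" by (simp add: mult.assoc)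
  qed
  finally show ?thesis by (simp add: energy_def distrib_left)
qed

text \<open>An approximate Dirac mass at \<open>y\<close>.\<close>

definition bump :: "nat \<Rightarrow> 'a \<Rightarrow> 'a \<Rightarrow> real" where
  "bump n y x = indicator (ball y (inverse (real (Suc n)))) x / measure \<mu> (ball y (inverse (real (Suc n))))"

lemma ball_measure_pos: "0 < r \<Longrightarrow> 0 < measure \<mu> (ball y r)"
  using full_support[of "ball y r"] bounded_finite_measure[of "ball y r"]
  by (simp add: measure_def enn2real_positive_iff)

lemma bump_average:
  assumes g: "g \<in> borel_measurable borel" and close: "\<And>z. dist y z < inverse (real (Suc n)) \<Longrightarrow> \<bar>g z - c\<bar> \<le> e"
  shows "\<bar>(\<integral>x. bump n y x * g x \<partial>\<mu>) - c\<bar> \<le> e" and "integrable \<mu> (\<lambda>x. bump n y x * g x)"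
proof -
  let ?B = "ball y (inverse (real (Suc n)))"
  have Bf: "emeasure \<mu> ?B < \<infinity>" by (rule bounded_finite_measure) simp
  have Bs[measurable]: "?B \<in> sets borel" by simp
  have p: "0 < measure \<mu> ?B" by (rule ball_measure_pos) simp
  note [measurable] = g
  have i1: "integrable \<mu> (\<lambda>x. indicator ?B x * (g x - c))"
  proof (rule Bochner_Integration.integrable_bound)
    show "integrable \<mu> (\<lambda>x. e * indicator ?B x)" using Bf by (simp add: sets_borel)
    show "AE x in \<mu>. norm (indicator ?B x * (g x - c)) \<le> norm (e * indicator ?B x)"
      using close by (intro AE_I2) (fastforce split: split_indicator)
  qed measurable
  have i2: "integrable \<mu> (\<lambda>x. bump n y x * c)" using Bf by (simp add: bump_def sets_borel)
  have eq: "bump n y x * g x = bump n y x * c + indicator ?B x * (g x - c) / measure \<mu> ?B" for x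
    by (simp only: bump_def times_divide_eq_left right_diff_distrib diff_divide_distrib)
  show int: "integrable \<mu> (\<lambda>x. bump n y x * g x)"
    unfolding eq using i1 i2 by auto
  have "(\<integral>x. bump n y x * c \<partial>\<mu>) = c"
    using p by (simp add: bump_def space_mu)
  then have "(\<integral>x. bump n y x * g x \<partial>\<mu>) - c = (\<integral>x. indicator ?B x * (g x - c) \<partial>\<mu>) / measure \<mu> ?B"
    unfolding eq using i1 i2 by simp
  moreover have "\<bar>\<integral>x. indicator ?B x * (g x - c) \<partial>\<mu>\<bar> \<le> e * measure \<mu> ?B"
  proof -
    have "\<bar>\<integral>x. indicator ?B x * (g x - c) \<partial>\<mu>\<bar> \<le> (\<integral>x. \<bar>indicator ?B x * (g x - c)\<bar> \<partial>\<mu>)" by (rule integral_abs_bound)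
    also have "\<dots> \<le> (\<integral>x. e * indicator ?B x \<partial>\<mu>)"
      by (rule integral_mono) (use i1 Bf close in \<open>auto simp: sets_borel split: split_indicator\<close>)
    finally show ?thesis by (simp add: space_mu)
  qed
  ultimately show "\<bar>(\<integral>x. bump n y x * g x \<partial>\<mu>) - c\<bar> \<le> e"
    using p by (simp add: abs_divide pos_divide_le_eq)
qed

lemma resolvent_exists:
  assumes k: "0 < k" and f[measurable]: "f \<in> borel_measurable borel" and "bounded (range f)" and "integrable \<mu> (\<lambda>x. (f x)\<^sup>2)"
  obtains u where "is_resolvent \<E> \<F> \<mu> k f u"
    "AE x in \<mu>. (LINT t:{0..}|lborel. exp (- k * t) * (\<integral>w. f (X t w) \<partial>P x)) = u x"
  using associated assms unfolding associated_process_def by blast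

text \<open>The resolvent is positive almost everywhere because it is an expectation, hence
  everywhere by continuity and full support.\<close>

lemma bump_resolvent_exists:
  assumes k: "0 < k" shows "\<exists>u. is_resolvent \<E> \<F> \<mu> k (bump n y) u \<and> (\<forall>x. 0 \<le> u x)"
proof -
  have Bf: "emeasure \<mu> (ball y (inverse (real (Suc n)))) < \<infinity>" by (rule bounded_finite_measure) simp
  have m: "bump n y \<in> borel_measurable borel" unfolding bump_def[abs_def]
    by (intro borel_measurable_divide borel_measurable_indicator borel_measurable_const) simp
  have bd: "bounded (range (bump n y))"
    by (rule boundedI[where B="1 / measure \<mu> (ball y (inverse (real (Suc n))))"])
      (auto simp: bump_def divide_right_mono split: split_indicator)
  have "(bump n y x)\<^sup>2 = indicator (ball y (inverse (real (Suc n)))) x / (measure \<mu> (ball y (inverse (real (Suc n)))))\<^sup>2" for x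
    by (simp add: bump_def power_divide split: split_indicator)
  then have i: "integrable \<mu> (\<lambda>x. (bump n y x)\<^sup>2)" using Bf by (simp add: sets_borel)
  obtain u where u: "is_resolvent \<E> \<F> \<mu> k (bump n y) u"
    "AE x in \<mu>. (LINT t:{0..}|lborel. exp (- k * t) * (\<integral>w. bump n y (X t w) \<partial>P x)) = u x"
    using resolvent_exists[OF k m bd i] by blast
  have bn: "0 \<le> bump n y z" for z by (simp add: bump_def)
  have "AE x in \<mu>. 0 \<le> u x" using u(2)
  proof eventually_elim
    case (elim x)
    have "0 \<le> (LINT t:{0..}|lborel. exp (- k * t) * (\<integral>w. bump n y (X t w) \<partial>P x))"
      unfolding set_lebesgue_integral_def
      by (intro integral_nonneg_AE AE_I2 scaleR_nonneg_nonneg mult_nonneg_nonneg) (auto simp: bn)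
    then show ?case using elim by simp
  qed
  moreover have uc: "continuous_on UNIV u" using u(1) form_continuous unfolding is_resolvent_def dirichlet_domain_def by auto
  ultimately have "0 \<le> u x" for x
  proof -
    assume ae: "AE x in \<mu>. 0 \<le> u x"
    let ?U = "{x. u x < 0}"
    have op: "open ?U" using uc by (intro open_Collect_less continuous_on_const)
    have U: "?U = {x \<in> space \<mu>. \<not> 0 \<le> u x}" by (auto simp: space_mu)
    have "{x \<in> space \<mu>. 0 \<le> u x} = UNIV - ?U" by (auto simp: space_mu)
    then have "{x \<in> space \<mu>. 0 \<le> u x} \<in> sets \<mu>" using op by (simp add: sets_borel)
    with ae have "emeasure \<mu> ?U = 0" unfolding U using AE_E2 by blast
    with full_support[OF op] have "?U = {}" by auto
    then show ?thesis by (metis (mono_tags, lifting) empty_Collect_eq not_less)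
  qed
  with u(1) show ?thesis by blast
qed

definition pre_green :: "real \<Rightarrow> nat \<Rightarrow> 'a \<Rightarrow> 'a \<Rightarrow> real" where
  "pre_green k n y = (SOME u. is_resolvent \<E> \<F> \<mu> k (bump n y) u \<and> (\<forall>x. 0 \<le> u x))"

lemma pre_green: assumes "0 < k" shows "is_resolvent \<E> \<F> \<mu> k (bump n y) (pre_green k n y)" "0 \<le> pre_green k n y x"
  using someI_ex[OF bump_resolvent_exists[OF assms, of n y]] unfolding pre_green_def by blast+

lemma pre_green_mem:
  assumes "0 < k"
  shows "pre_green k n y \<in> dirichlet_domain \<E> \<F> \<mu>" "pre_green k n y \<in> \<F>" "integrable \<mu> (\<lambda>x. (pre_green k n y x)\<^sup>2)"
  using pre_green(1)[OF assms, of n y] unfolding is_resolvent_def dirichlet_domain_def by auto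

lemma pre_green_test:
  assumes "0 < k" "g \<in> dirichlet_domain \<E> \<F> \<mu>"
  shows "\<E> (pre_green k n y) g + k * (\<integral>x. pre_green k n y x * g x \<partial>\<mu>) = (\<integral>x. bump n y x * g x \<partial>\<mu>)"
  using pre_green(1)[OF assms(1), of n y] assms(2) unfolding is_resolvent_def by blast

lemma form_diff:
  assumes u: "u \<in> \<F>" and v: "v \<in> \<F>"
  shows "(\<lambda>x. u x - v x) \<in> \<F>" "\<E> (\<lambda>x. u x - v x) (\<lambda>x. u x - v x) = \<E> u u - 2 * \<E> u v + \<E> v v"
proof -
  have eq: "(\<lambda>x. u x - v x) = (\<lambda>x. 1 * u x + (-1) * v x)" by auto
  show d: "(\<lambda>x. u x - v x) \<in> \<F>" unfolding eq by (rule lincomb_mem[OF u v])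
  have l: "\<E> (\<lambda>x. u x - v x) h = \<E> u h - \<E> v h" if "h \<in> \<F>" for h
    unfolding eq using lincomb[OF u v that, of 1 "-1"] by simp
  have "\<E> (\<lambda>x. u x - v x) (\<lambda>x. u x - v x) = \<E> u (\<lambda>x. u x - v x) - \<E> v (\<lambda>x. u x - v x)" by (rule l[OF d])
  also have "\<dots> = \<E> (\<lambda>x. u x - v x) u - \<E> (\<lambda>x. u x - v x) v" by (simp add: sym[OF u d] sym[OF v d])
  also have "\<dots> = \<E> u u - 2 * \<E> u v + \<E> v v" using l[OF u] l[OF v] sym[OF u v] by simp
  finally show "\<E> (\<lambda>x. u x - v x) (\<lambda>x. u x - v x) = \<E> u u - 2 * \<E> u v + \<E> v v" .
qed

lemma square_integrable_prod:
  assumes [measurable]: "u \<in> borel_measurable borel" "v \<in> borel_measurable borel"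
    and "integrable \<mu> (\<lambda>x. (u x)\<^sup>2)" "integrable \<mu> (\<lambda>x. (v x :: real)\<^sup>2)"
  shows "integrable \<mu> (\<lambda>x. u x * v x)"
proof (rule Bochner_Integration.integrable_bound)
  show "integrable \<mu> (\<lambda>x. (u x)\<^sup>2 + (v x)\<^sup>2)" using assms by auto
  show "AE x in \<mu>. norm (u x * v x) \<le> norm ((u x)\<^sup>2 + (v x)\<^sup>2)"
  proof (rule AE_I2)
    fix x
    have "2 * \<bar>u x * v x\<bar> \<le> (u x)\<^sup>2 + (v x)\<^sup>2"
      using zero_le_power2[of "\<bar>u x\<bar> - \<bar>v x\<bar>"] by (simp add: power2_eq_square algebra_simps abs_mult)
    then show "norm (u x * v x) \<le> norm ((u x)\<^sup>2 + (v x)\<^sup>2)" by simp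
  qed
qed measurable

lemma bump_form_close:
  assumes "h \<in> \<F>" shows "\<bar>(\<integral>x. bump n y x * h x \<partial>\<mu>) - h y\<bar> \<le> sqrt (inverse (real (Suc n)) * \<E> h h)"
    and "integrable \<mu> (\<lambda>x. bump n y x * h x)"
proof -
  have "\<bar>h z - h y\<bar> \<le> sqrt (inverse (real (Suc n)) * \<E> h h)" if "dist y z < inverse (real (Suc n))" for z
  proof -
    have "(h z - h y)\<^sup>2 \<le> dist z y * \<E> h h" by (rule energy_oscillation[OF assms])
    also have "\<dots> \<le> inverse (real (Suc n)) * \<E> h h"
      using that nonneg[OF assms] by (intro mult_right_mono) (auto simp: dist_commute)
    finally show ?thesis by (intro real_le_rsqrt) simp
  qed
  from bump_average[OF form_measurable[OF assms] this]
  show "\<bar>(\<integral>x. bump n y x * h x \<partial>\<mu>) - h y\<bar> \<le> sqrt (inverse (real (Suc n)) * \<E> h h)"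
    "integrable \<mu> (\<lambda>x. bump n y x * h x)" by blast+
qed

text \<open>Testing the resolvent equation with the solution itself gives that the energy equals the
  average of the solution near \<open>y\<close>, which is at most the square root of a multiple of the energy.\<close>

lemma energy_pre_green_le: assumes k: "0 < k" shows "energy k (pre_green k n y) \<le> sup_const k" "pre_green k n y x \<le> sup_const k"
proof -
  let ?u = "pre_green k n y" let ?e = "energy k ?u" let ?C = "sup_const k"
  have C: "0 < ?C" by (rule sup_const_pos)
  have e0: "0 \<le> ?e" using energy_nonneg pre_green_mem[OF k] k by simp
  have sup: "\<bar>?u x\<bar> \<le> sqrt (?C * ?e)" for x
    using sup_le_energy[OF pre_green_mem(2,3)[OF k] k] by (intro real_le_rsqrt) simp
  have "?e = (\<integral>x. bump n y x * ?u x \<partial>\<mu>)"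
    using pre_green_test[OF k pre_green_mem(1)[OF k], of n y n y] by (simp add: energy_def power2_eq_square)
  also have "\<bar>(\<integral>x. bump n y x * ?u x \<partial>\<mu>) - 0\<bar> \<le> sqrt (?C * ?e)"
    using sup by (intro bump_average form_measurable pre_green_mem[OF k]) simp
  ultimately have "?e \<le> sqrt (?C * ?e)" by simp
  then have "?e\<^sup>2 \<le> (sqrt (?C * ?e))\<^sup>2" using e0 by (rule power_mono)
  then have "?e * ?e \<le> ?C * ?e" using e0 C by (simp add: power2_eq_square)
  then show le: "?e \<le> ?C"
    using e0 C by (cases "?e = 0") (simp_all add: mult_le_cancel_right)
  have "sqrt (?C * ?e) \<le> sqrt (?C * ?C)" using le C by (intro real_sqrt_le_mono mult_left_mono) auto
  then show "?u x \<le> ?C" using sup[of x] C by simp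
qed

text \<open>By symmetry the mixed terms agree, so that the energy of the difference \<open>d\<close> is the difference
  of two averages of \<open>d\<close> near \<open>y\<close>. These are close because \<open>d\<close> is Hoelder continuous in terms of its
  energy.\<close>

lemma pre_green_cauchy:
  assumes k: "0 < k"
  shows "\<bar>pre_green k n y x - pre_green k m y x\<bar> \<le> sqrt (sup_const k) * (sqrt (inverse (real (Suc n))) + sqrt (inverse (real (Suc m))))"
proof -
  let ?u = "pre_green k n y" and ?v = "pre_green k m y"
  note u = pre_green_mem[OF k, of n y] and v = pre_green_mem[OF k, of m y]
  note um = form_measurable[OF u(2)] and vm = form_measurable[OF v(2)]
  let ?d = "\<lambda>x. ?u x - ?v x"
  have d: "?d \<in> \<F>" by (rule form_diff[OF u(2) v(2)])
  have iuv: "integrable \<mu> (\<lambda>x. ?u x * ?v x)" by (rule square_integrable_prod[OF um vm u(3) v(3)])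
  have sq: "(?d x)\<^sup>2 = (?u x)\<^sup>2 - 2 * (?u x * ?v x) + (?v x)\<^sup>2" for x by (simp add: power2_eq_square algebra_simps)
  have di: "integrable \<mu> (\<lambda>x. (?d x)\<^sup>2)" unfolding sq using iuv u(3) v(3) by auto
  have ds: "(\<integral>x. (?d x)\<^sup>2 \<partial>\<mu>) = (\<integral>x. ?u x * ?u x \<partial>\<mu>) - 2 * (\<integral>x. ?u x * ?v x \<partial>\<mu>) + (\<integral>x. ?v x * ?v x \<partial>\<mu>)"
    unfolding sq using iuv u(3) v(3) by (simp add: power2_eq_square)
  let ?I = "\<lambda>n g. (\<integral>x. bump n y x * g x \<partial>\<mu>)"
  have uu: "\<E> ?u ?u + k * (\<integral>x. ?u x * ?u x \<partial>\<mu>) = ?I n ?u" by (rule pre_green_test[OF k u(1)])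
  have uv: "\<E> ?u ?v + k * (\<integral>x. ?u x * ?v x \<partial>\<mu>) = ?I n ?v" by (rule pre_green_test[OF k v(1)])
  have vu: "\<E> ?u ?v + k * (\<integral>x. ?u x * ?v x \<partial>\<mu>) = ?I m ?u"
    using pre_green_test[OF k u(1), of m y] sym[OF u(2) v(2)] by (simp add: mult.commute)
  have vv: "\<E> ?v ?v + k * (\<integral>x. ?v x * ?v x \<partial>\<mu>) = ?I m ?v" by (rule pre_green_test[OF k v(1)])
  have "energy k ?d = (\<E> ?u ?u + k * (\<integral>x. ?u x * ?u x \<partial>\<mu>)) - 2 * (\<E> ?u ?v + k * (\<integral>x. ?u x * ?v x \<partial>\<mu>)) + (\<E> ?v ?v + k * (\<integral>x. ?v x * ?v x \<partial>\<mu>))"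
    unfolding energy_def ds form_diff(2)[OF u(2) v(2)] by (simp add: algebra_simps)
  also have "\<dots> = (?I n ?u - ?I n ?v) - (?I m ?u - ?I m ?v)" 
  proof -
    have eq: "?I m ?u = ?I n ?v" using uv vu by simp
    show ?thesis by (simp only: uu uv vv eq)
  qed
  also have "?I n ?u - ?I n ?v = ?I n ?d"
    using bump_form_close(2)[OF u(2)] bump_form_close(2)[OF v(2)] by (simp add: right_diff_distrib)
  also have "?I m ?u - ?I m ?v = ?I m ?d"
    using bump_form_close(2)[OF u(2)] bump_form_close(2)[OF v(2)] by (simp add: right_diff_distrib)
  finally have e: "energy k ?d = ?I n ?d - ?I m ?d" .
  define s where "s = sqrt (inverse (real (Suc n))) + sqrt (inverse (real (Suc m)))"
  have s: "0 \<le> s" by (simp add: s_def)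
  have e0: "0 \<le> energy k ?d" using energy_nonneg[OF d] k by simp
  have Ee: "\<E> ?d ?d \<le> energy k ?d" using k by (simp add: energy_def)
  have "energy k ?d \<le> sqrt (inverse (real (Suc n)) * \<E> ?d ?d) + sqrt (inverse (real (Suc m)) * \<E> ?d ?d)"
    unfolding e using bump_form_close(1)[OF d, of n y] bump_form_close(1)[OF d, of m y] by linarith
  also have "\<dots> = s * sqrt (\<E> ?d ?d)" by (simp add: s_def real_sqrt_mult distrib_right)
  also have "\<dots> \<le> s * sqrt (energy k ?d)" using Ee s by (intro mult_left_mono) auto
  finally have le: "energy k ?d \<le> s * sqrt (energy k ?d)" .
  define z where "z = sqrt (energy k ?d)"
  have "z * z \<le> s * z" using le e0 by (simp add: z_def)
  moreover have "0 \<le> z" using e0 by (simp add: z_def)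
  ultimately have "z \<le> s" using s by (cases "z = 0") (simp_all add: mult_le_cancel_right)
  then have es: "sqrt (energy k ?d) \<le> s" by (simp add: z_def)
  have "(?d x)\<^sup>2 \<le> sup_const k * energy k ?d" by (rule sup_le_energy[OF d di k])
  then have "\<bar>?d x\<bar> \<le> sqrt (sup_const k * energy k ?d)" by (intro real_le_rsqrt) simp
  also have "\<dots> \<le> sqrt (sup_const k) * s"
    using es sup_const_pos[of k] by (simp add: real_sqrt_mult)
  finally show ?thesis by (simp add: s_def)
qed

text \<open>The resolvent density of the process. It is the reproducing kernel of the form
  \<open>energy k\<close>, obtained as a limit of resolvents of approximate Dirac masses because
  only the existence of resolvents of functions is given.\<close>

definition green :: "real \<Rightarrow> 'a \<Rightarrow> 'a \<Rightarrow> real" where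
  "green k x y = lim (\<lambda>n. pre_green k n y x)"

lemma radius_null: "(\<lambda>n. sqrt (inverse (real (Suc n)))) \<longlonglongrightarrow> 0"
  using tendsto_real_sqrt[OF LIMSEQ_inverse_real_of_nat] by simp

lemma pre_green_tendsto: assumes k: "0 < k" shows "(\<lambda>n. pre_green k n y x) \<longlonglongrightarrow> green k x y"
proof -
  let ?C = "sqrt (sup_const k)"
  have C: "0 < ?C" using sup_const_pos by simp
  have "Cauchy (\<lambda>n. pre_green k n y x)"
  proof (rule metric_CauchyI)
    fix e :: real assume e: "0 < e"
    have "\<forall>\<^sub>F n in sequentially. sqrt (inverse (real (Suc n))) < e / (2 * ?C)"
      using order_tendstoD(2)[OF radius_null, of "e / (2 * ?C)"] e C by simp
    then obtain N where N: "\<And>n. n \<ge> N \<Longrightarrow> sqrt (inverse (real (Suc n))) < e / (2 * ?C)"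
      by (auto simp: eventually_sequentially)
    have "dist (pre_green k n y x) (pre_green k m y x) < e" if "n \<ge> N" "m \<ge> N" for n m
    proof -
      have "sqrt (inverse (real (Suc n))) + sqrt (inverse (real (Suc m))) < e / ?C"
        using N[OF that(1)] N[OF that(2)] C by (simp add: field_simps)
      then have "?C * (sqrt (inverse (real (Suc n))) + sqrt (inverse (real (Suc m)))) < e"
        using C by (simp add: pos_less_divide_eq mult.commute)
      with pre_green_cauchy[OF k, of n y x m] show ?thesis by (simp add: dist_real_def)
    qed
    then show "\<exists>N. \<forall>m\<ge>N. \<forall>n\<ge>N. dist (pre_green k m y x) (pre_green k n y x) < e" by blast
  qed
  then show ?thesis unfolding green_def by (intro convergent_LIMSEQ_iff[THEN iffD1] Cauchy_convergent)
qed

lemma green_nonneg: assumes k: "0 < k" shows "0 \<le> green k x y"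
  by (rule LIMSEQ_le_const[OF pre_green_tendsto[OF k]]) (use pre_green(2)[OF k] in blast)

lemma green_le: assumes k: "0 < k" shows "green k x y \<le> sup_const k"
  by (rule LIMSEQ_le_const2[OF pre_green_tendsto[OF k]]) (use energy_pre_green_le(2)[OF k] in blast)

lemma pre_green_energy_le: assumes k: "0 < k" shows "\<E> (pre_green k n y) (pre_green k n y) \<le> sup_const k"
proof -
  have "0 \<le> k * (\<integral>x. (pre_green k n y x)\<^sup>2 \<partial>\<mu>)" using k by simp
  then show ?thesis using energy_pre_green_le(1)[OF k, of n y] unfolding energy_def by linarith
qed

lemma green_oscillation: assumes k: "0 < k"
  shows "\<bar>green k x y - green k x' y\<bar> \<le> sqrt (dist x x' * sup_const k)"
proof (rule LIMSEQ_le_const2)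
  show "(\<lambda>n. \<bar>pre_green k n y x - pre_green k n y x'\<bar>) \<longlonglongrightarrow> \<bar>green k x y - green k x' y\<bar>"
    by (intro tendsto_intros pre_green_tendsto k)
  have "\<bar>pre_green k n y x - pre_green k n y x'\<bar> \<le> sqrt (dist x x' * sup_const k)" for n
  proof (rule real_le_rsqrt)
    have "(pre_green k n y x - pre_green k n y x')\<^sup>2 \<le> dist x x' * \<E> (pre_green k n y) (pre_green k n y)"
      by (rule energy_oscillation[OF pre_green_mem(2)[OF k]])
    also have "\<dots> \<le> dist x x' * sup_const k" using pre_green_energy_le[OF k] by (intro mult_left_mono) auto
    finally show "\<bar>pre_green k n y x - pre_green k n y x'\<bar>\<^sup>2 \<le> dist x x' * sup_const k" by simp
  qed
  then show "\<exists>N. \<forall>n\<ge>N. \<bar>pre_green k n y x - pre_green k n y x'\<bar> \<le> sqrt (dist x x' * sup_const k)" by blast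
qed

lemma bump_pairing_tendsto:
  assumes h: "h \<in> \<F>" shows "(\<lambda>n. \<integral>x. bump n y x * h x \<partial>\<mu>) \<longlonglongrightarrow> h y"
proof -
  have "(\<lambda>n. sqrt (inverse (real (Suc n))) * sqrt (\<E> h h)) \<longlonglongrightarrow> 0 * sqrt (\<E> h h)"
    by (intro tendsto_intros radius_null)
  moreover have "\<bar>(\<integral>x. bump n y x * h x \<partial>\<mu>) - h y\<bar> \<le> sqrt (inverse (real (Suc n))) * sqrt (\<E> h h)" for n
    using bump_form_close(1)[OF h, of n y] by (simp add: real_sqrt_mult)
  ultimately show ?thesis by (intro tendsto_of_abs_bound[where c="h y"]) simp_all
qed

text \<open>Both sides are limits of the pairing of the resolvent of one bump with another bump, which
  is symmetric.\<close>

lemma green_sym: assumes k: "0 < k" shows "green k x y = green k y x"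
proof -
  have lim: "(\<lambda>n. \<integral>z. bump n x z * pre_green k n y z \<partial>\<mu>) \<longlonglongrightarrow> green k x y" for x y
  proof -
    have t: "(\<lambda>n. sqrt (inverse (real (Suc n))) * sqrt (sup_const k)) \<longlonglongrightarrow> 0"
      using tendsto_mult_left_zero[OF radius_null] .
    have b: "norm ((\<integral>z. bump n x z * pre_green k n y z \<partial>\<mu>) - pre_green k n y x) \<le> sqrt (inverse (real (Suc n))) * sqrt (sup_const k)" for n
    proof -
      have "norm ((\<integral>z. bump n x z * pre_green k n y z \<partial>\<mu>) - pre_green k n y x) \<le> sqrt (inverse (real (Suc n)) * \<E> (pre_green k n y) (pre_green k n y))"
        using bump_form_close(1)[OF pre_green_mem(2)[OF k]] by simp
      also have "\<dots> \<le> sqrt (inverse (real (Suc n)) * sup_const k)"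
        using pre_green_energy_le[OF k] by (intro real_sqrt_le_mono mult_left_mono) auto
      finally show ?thesis by (simp add: real_sqrt_mult)
    qed
    have "(\<lambda>n. (\<integral>z. bump n x z * pre_green k n y z \<partial>\<mu>) - pre_green k n y x) \<longlonglongrightarrow> 0"
      by (rule tendsto_of_abs_bound[where c=0, OF _ t]) (use b in \<open>simp only: diff_zero real_norm_def\<close>)
    from tendsto_add[OF this pre_green_tendsto[OF k, of y x]] show ?thesis by simp
  qed
  have "(\<integral>z. bump n x z * pre_green k n y z \<partial>\<mu>) = (\<integral>z. bump n y z * pre_green k n x z \<partial>\<mu>)" for n
    using pre_green_test[OF k pre_green_mem(1)[OF k], of n x n y] pre_green_test[OF k pre_green_mem(1)[OF k], of n y n x]
      sym[OF pre_green_mem(2)[OF k] pre_green_mem(2)[OF k], of n x n y] by (simp add: mult.commute)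
  with lim[of x y] lim[of y x] show ?thesis by (metis (no_types, lifting) LIMSEQ_unique ext)
qed

lemma green_continuous: assumes k: "0 < k" shows "continuous_on UNIV (\<lambda>p. green k (fst p) (snd p))"
proof -
  have "((\<lambda>p. green k (fst p) (snd p)) \<longlongrightarrow> green k (fst q) (snd q)) (at q)" for q
  proof -
    let ?g = "\<lambda>p. sqrt (dist (fst p) (fst q) * sup_const k) + sqrt (dist (snd p) (snd q) * sup_const k)"
    have "(?g \<longlongrightarrow> sqrt (dist (fst q) (fst q) * sup_const k) + sqrt (dist (snd q) (snd q) * sup_const k)) (at q)"
      by (intro tendsto_intros)
    then have g0: "(?g \<longlongrightarrow> 0) (at q)" by simp
    have "\<bar>green k (fst p) (snd p) - green k (fst q) (snd q)\<bar> \<le> ?g p" for p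
    proof -
      have "\<bar>green k (fst p) (snd p) - green k (fst q) (snd p)\<bar> \<le> sqrt (dist (fst p) (fst q) * sup_const k)"
        by (rule green_oscillation[OF k])
      moreover have "\<bar>green k (snd p) (fst q) - green k (snd q) (fst q)\<bar> \<le> sqrt (dist (snd p) (snd q) * sup_const k)"
        by (rule green_oscillation[OF k])
      ultimately show ?thesis
        using green_sym[OF k, of "fst q" "snd p"] green_sym[OF k, of "fst q" "snd q"] by simp
    qed
    then show ?thesis by (rule tendsto_of_abs_bound[OF _ g0])
  qed
  then show ?thesis by (auto simp: continuous_on_def)
qed

text \<open>The bump pairs with the resolvent of the indicator of \<open>A\<close> in the same way as its own resolvent
  pairs with \<open>A\<close>; the radius tends to \<open>0\<close>. Boundedness of \<open>A\<close> permits dominated convergence.\<close>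

lemma resolvent_green_AE:
  assumes k: "0 < k" and A[measurable]: "A \<in> sets borel" and bA: "bounded A"
  shows "AE x in \<mu>. (LINT t:{0..}|lborel. exp (- k * t) * (\<integral>w. indicator A (X t w) \<partial>P x)) = (\<integral>y. indicator A y * green k x y \<partial>\<mu>)"
proof -
  have Af: "emeasure \<mu> A < \<infinity>" by (rule bounded_finite_measure[OF bA])
  let ?f = "indicator A :: 'a \<Rightarrow> real"
  have sq: "(?f x)\<^sup>2 = ?f x" for x by (auto split: split_indicator)
  obtain u where u: "is_resolvent \<E> \<F> \<mu> k ?f u"
    "AE x in \<mu>. (LINT t:{0..}|lborel. exp (- k * t) * (\<integral>w. ?f (X t w) \<partial>P x)) = u x"
    by (rule resolvent_exists[OF k, of ?f])
      (use Af in \<open>auto simp: sq sets_borel intro!: boundedI[where B=1] split: split_indicator\<close>)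
  have uF: "u \<in> \<F>" "u \<in> dirichlet_domain \<E> \<F> \<mu>" using u(1) by (auto simp: is_resolvent_def dirichlet_domain_def)
  have "u x = (\<integral>y. ?f y * green k x y \<partial>\<mu>)" for x
  proof (rule LIMSEQ_unique)
    have "(\<integral>z. bump n x z * u z \<partial>\<mu>) = (\<integral>y. ?f y * pre_green k n x y \<partial>\<mu>)" for n
    proof -
      have "\<E> u (pre_green k n x) + k * (\<integral>z. u z * pre_green k n x z \<partial>\<mu>) = (\<integral>y. ?f y * pre_green k n x y \<partial>\<mu>)"
        using u(1) pre_green_mem(1)[OF k] unfolding is_resolvent_def by blast
      then show ?thesis
        using pre_green_test[OF k uF(2), of n x] sym[OF uF(1) pre_green_mem(2)[OF k]] by (simp add: mult.commute)
    qed
    then show "(\<lambda>n. \<integral>y. ?f y * pre_green k n x y \<partial>\<mu>) \<longlonglongrightarrow> u x"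
      using bump_pairing_tendsto[OF uF(1), of x] by simp
    show "(\<lambda>n. \<integral>y. ?f y * pre_green k n x y \<partial>\<mu>) \<longlonglongrightarrow> (\<integral>y. ?f y * green k x y \<partial>\<mu>)"
    proof (rule integral_dominated_convergence[where w="\<lambda>y. sup_const k * ?f y"])
      show "(\<lambda>y. ?f y * pre_green k n x y) \<in> borel_measurable \<mu>" for n
        using form_measurable[OF pre_green_mem(2)[OF k, of n x]] by measurable
      have "(\<lambda>y. lim (\<lambda>n. pre_green k n x y)) \<in> borel_measurable borel"
        using form_measurable[OF pre_green_mem(2)[OF k, of _ x]] by (intro borel_measurable_lim_metric)
      then have [measurable]: "(\<lambda>y. green k y x) \<in> borel_measurable borel" unfolding green_def .
      then have [measurable]: "green k x \<in> borel_measurable borel" using green_sym[OF k, of x] by presburger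
      show "(\<lambda>y. ?f y * green k x y) \<in> borel_measurable \<mu>" by measurable
      show "integrable \<mu> (\<lambda>y. sup_const k * ?f y)" using Af by (simp add: sets_borel)
      show "AE y in \<mu>. (\<lambda>n. ?f y * pre_green k n x y) \<longlonglongrightarrow> ?f y * green k x y"
        using pre_green_tendsto[OF k, of x] green_sym[OF k, of x] by (intro AE_I2 tendsto_mult_left) simp
      show "AE y in \<mu>. norm (?f y * pre_green k n x y) \<le> sup_const k * ?f y" for n
        using pre_green(2)[OF k, of n x] energy_pre_green_le(2)[OF k, of n x]
        by (intro AE_I2) (auto split: split_indicator)
    qed
  qed
  with u(2) show ?thesis by simp
qed

end

section \<open>Discounted occupation and local times\<close>

text \<open>The smallest multiple of \<open>2\<^sup>-\<^sup>n\<close> that is strictly above \<open>t\<close>.\<close>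

definition dyadic_above :: "nat \<Rightarrow> real \<Rightarrow> real" where
  "dyadic_above n t = (real (nat \<lfloor>t * 2 ^ n\<rfloor>) + 1) / 2 ^ n"

lemma dyadic_above:
  assumes "0 \<le> t"
  shows "t < dyadic_above n t" "dyadic_above n t \<le> t + (1/2) ^ n" "dyadic_above (Suc n) t \<le> dyadic_above n t"
proof -
  have f0: "0 \<le> \<lfloor>t * 2 ^ n\<rfloor>" "0 \<le> \<lfloor>t * 2 ^ Suc n\<rfloor>" using assms by auto
  have eq: "dyadic_above m t = (of_int \<lfloor>t * 2 ^ m\<rfloor> + 1) / 2 ^ m" for m
    using assms by (simp add: dyadic_above_def)
  have "t * 2 ^ n < of_int \<lfloor>t * 2 ^ n\<rfloor> + 1" by linarith
  then show "t < dyadic_above n t" unfolding eq by (simp add: pos_less_divide_eq)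
  have "of_int \<lfloor>t * 2 ^ n\<rfloor> + 1 \<le> t * 2 ^ n + 1" by linarith
  also have "\<dots> = (t + (1/2) ^ n) * 2 ^ n" by (simp add: distrib_right power_mult_distrib[symmetric])
  finally show "dyadic_above n t \<le> t + (1/2) ^ n" unfolding eq by (simp add: pos_divide_le_eq)
  have "\<lfloor>t * 2 ^ Suc n\<rfloor> \<le> 2 * \<lfloor>t * 2 ^ n\<rfloor> + 1"
    by (simp add: floor_le_iff) linarith
  then have "real_of_int \<lfloor>t * 2 ^ Suc n\<rfloor> \<le> real_of_int (2 * \<lfloor>t * 2 ^ n\<rfloor> + 1)"
    by (simp only: of_int_le_iff)
  then have "of_int \<lfloor>t * 2 ^ Suc n\<rfloor> + 1 \<le> 2 * (of_int \<lfloor>t * 2 ^ n\<rfloor> + 1 :: real)" by simp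
  then have "(of_int \<lfloor>t * 2 ^ Suc n\<rfloor> + 1) / 2 ^ Suc n \<le> 2 * (of_int \<lfloor>t * 2 ^ n\<rfloor> + 1 :: real) / 2 ^ Suc n"
    by (rule divide_right_mono) simp
  also have "2 * y / 2 ^ Suc n = y / 2 ^ n" for y :: real by simp
  finally show "dyadic_above (Suc n) t \<le> dyadic_above n t" unfolding eq .
qed

lemma dyadic_above_tendsto: "0 \<le> t \<Longrightarrow> filterlim (\<lambda>n. dyadic_above n t) (at_right t) sequentially"
proof -
  assume t: "0 \<le> t"
  have "(\<lambda>n. dyadic_above n t) \<longlonglongrightarrow> t"
  proof (rule tendsto_of_abs_bound)
    show "(\<lambda>n. (1/2) ^ n) \<longlonglongrightarrow> (0::real)" by (rule LIMSEQ_power_zero) simp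
    show "\<bar>dyadic_above n t - t\<bar> \<le> (1/2) ^ n" for n using dyadic_above[OF t, of n] by simp
  qed
  moreover have "dyadic_above n t \<in> {t<..} \<and> dyadic_above n t \<noteq> t" for n
    using dyadic_above(1)[OF t, of n] by auto
  ultimately show ?thesis unfolding filterlim_at by (simp add: always_eventually)
qed

lemma nn_integral_exp_tail:
  assumes "0 < k"
  shows "(\<integral>\<^sup>+t. ennreal (k * exp (- k * t)) * indicator {s<..} t \<partial>lborel) = ennreal (exp (- k * s))"
proof -
  have "(\<integral>\<^sup>+t. ennreal (k * exp (- k * t)) * indicator {s<..} t \<partial>lborel) = (\<integral>\<^sup>+t. ennreal (k * exp (- k * t)) * indicator {s..} t \<partial>lborel)"
  proof (rule nn_integral_cong_AE)
    have "AE t in lborel. t \<noteq> s" by (rule AE_lborel_singleton)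
    then show "AE t in lborel. ennreal (k * exp (- k * t)) * indicator {s<..} t = ennreal (k * exp (- k * t)) * indicator {s..} t"
      by eventually_elim (auto split: split_indicator)
  qed
  also have "\<dots> = ennreal (0 - (- exp (- k * s)))"
  proof (rule nn_integral_FTC_atLeast)
    show "((\<lambda>t. - exp (- k * t)) \<longlongrightarrow> 0) at_top"
    proof -
      have "filterlim (\<lambda>t. - k * t) at_bot at_top"
        using assms by (intro filterlim_tendsto_neg_mult_at_bot[OF tendsto_const] filterlim_ident) auto
      then have "((\<lambda>t. exp (- k * t)) \<longlongrightarrow> 0) at_top"
        by (rule filterlim_compose[OF exp_at_bot])
      from tendsto_minus[OF this] show ?thesis by simp
    qed
  qed (use assms in \<open>auto intro!: derivative_eq_intros\<close>)
  finally show ?thesis by simp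
qed

lemma nn_integral_incseq_SUP:
  assumes "\<And>x n. f n x \<le> f (Suc n) x" "\<And>n. f n \<in> borel_measurable N" "\<And>x. (\<lambda>n. f n x) \<longlonglongrightarrow> (u x :: ennreal)"
  shows "incseq (\<lambda>n. integral\<^sup>N N (f n))" "(SUP n. integral\<^sup>N N (f n)) = integral\<^sup>N N u"
proof -
  have inc: "incseq f" using assms(1) by (auto simp: incseq_Suc_iff le_fun_def)
  then show i: "incseq (\<lambda>n. integral\<^sup>N N (f n))" by (auto simp: incseq_def le_fun_def intro!: nn_integral_mono)
  have "(\<lambda>n. integral\<^sup>N N (f n)) \<longlonglongrightarrow> integral\<^sup>N N u" by (rule nn_integral_LIMSEQ[OF inc assms(2,3)])
  with LIMSEQ_SUP[OF i] show "(SUP n. integral\<^sup>N N (f n)) = integral\<^sup>N N u" by (rule LIMSEQ_unique)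
qed

context resistance_process begin

text \<open>Separability makes continuous functions of two points measurable for the product
  of the Borel sigma-algebras.\<close>

lemma continuous_pair_measurable:
  fixes f :: "'a \<times> 'a \<Rightarrow> real"
  assumes f: "continuous_on UNIV f"
  shows "f \<in> borel_measurable (borel \<Otimes>\<^sub>M borel)"
proof (rule borel_measurableI)
  fix S :: "real set" assume S: "open S"
  have op: "open (f -` S)" using f S by (simp add: continuous_on_open_vimage)
  obtain D :: "'a set" where D: "countable D" "\<And>x e. 0 < e \<Longrightarrow> \<exists>d\<in>D. dist x d < e" using separable by blast
  let ?r = "\<lambda>n. inverse (real (Suc n))"
  let ?K = "{(d, d', n). d \<in> D \<and> d' \<in> D \<and> ball d (?r n) \<times> ball d' (?r n) \<subseteq> f -` S}"
  have cK: "countable ?K"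
    by (rule countable_subset[of _ "D \<times> D \<times> (UNIV::nat set)"]) (use D(1) in auto)
  have "f -` S = (\<Union>(d, d', n)\<in>?K. ball d (?r n) \<times> ball d' (?r n))"
  proof (intro equalityI subsetI)
    fix p assume "p \<in> f -` S"
    then obtain A B where AB: "open A" "open B" "p \<in> A \<times> B" "A \<times> B \<subseteq> f -` S" using open_prod_elim[OF op] by metis
    obtain x y where p: "p = (x, y)" by (cases p)
    obtain a where a: "0 < a" "ball x a \<subseteq> A" using AB p by (meson SigmaE2 open_contains_ball)
    obtain b where b: "0 < b" "ball y b \<subseteq> B" using AB p by (meson SigmaE2 open_contains_ball)
    obtain n where n: "?r n < min a b / 2" using reals_Archimedean[of "min a b / 2"] a b by auto
    obtain d where d: "d \<in> D" "dist x d < ?r n" using D(2)[of "?r n" x] by auto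
    obtain d' where d': "d' \<in> D" "dist y d' < ?r n" using D(2)[of "?r n" y] by auto
    have "ball d (?r n) \<subseteq> ball x a"
    proof
      fix z assume z: "z \<in> ball d (?r n)"
      have "dist x z \<le> dist x d + dist d z" by (rule dist_triangle)
      also have "\<dots> < a" using z d n by simp
      finally show "z \<in> ball x a" by simp
    qed
    moreover have "ball d' (?r n) \<subseteq> ball y b"
    proof
      fix z assume z: "z \<in> ball d' (?r n)"
      have "dist y z \<le> dist y d' + dist d' z" by (rule dist_triangle)
      also have "\<dots> < b" using z d' n by simp
      finally show "z \<in> ball y b" by simp
    qed
    ultimately have sub: "ball d (?r n) \<times> ball d' (?r n) \<subseteq> f -` S" using a(2) b(2) AB(4) by blast
    then have "(d, d', n) \<in> ?K" using d d' by blast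
    moreover have "p \<in> ball d (?r n) \<times> ball d' (?r n)" using d d' p by (simp add: dist_commute)
    ultimately show "p \<in> (\<Union>(d, d', n)\<in>?K. ball d (?r n) \<times> ball d' (?r n))" by blast
  qed blast
  also have "\<dots> \<in> sets (borel \<Otimes>\<^sub>M borel)"
    by (intro sets.countable_UN'[OF cK]) auto
  finally show "f -` S \<inter> space (borel \<Otimes>\<^sub>M borel) \<in> sets (borel \<Otimes>\<^sub>M borel)" by (simp add: space_pair_measure)
qed

lemma green_measurable_pair: "0 < k \<Longrightarrow> (\<lambda>p. green k (fst p) (snd p)) \<in> borel_measurable (borel \<Otimes>\<^sub>M borel)"
  by (intro continuous_pair_measurable green_continuous)

lemma dist_measurable_pair: "(\<lambda>p::'a \<times> 'a. dist (fst p) (snd p)) \<in> borel_measurable (borel \<Otimes>\<^sub>M borel)"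
  by (intro continuous_pair_measurable continuous_intros)

lemma green_continuous_left: "0 < k \<Longrightarrow> continuous_on UNIV (\<lambda>x. green k x y)"
  by (rule continuous_on_compose2[OF green_continuous, of k UNIV "\<lambda>x. (x, y)", simplified])
     (auto intro!: continuous_intros)

text \<open>Negative times are clamped to \<open>0\<close>, so that time ranges over the whole line. Right-continuity
  exhibits the path as a limit of its values at dyadic times.\<close>

lemma X_joint: "(\<lambda>(t, w). X (max 0 t) w) \<in> borel \<Otimes>\<^sub>M M \<rightarrow>\<^sub>M borel"
proof (rule borel_measurable_LIMSEQ_metric)
  fix n
  have 1: "(\<lambda>p. X ((real i + 1) / 2 ^ n) (snd p)) \<in> (borel :: real measure) \<Otimes>\<^sub>M M \<rightarrow>\<^sub>M borel" for i :: nat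
    by (rule measurable_compose[OF measurable_snd X_measurable]) simp
  have 2: "(\<lambda>p. nat \<lfloor>max 0 (fst p :: real) * 2 ^ n\<rfloor>) \<in> borel \<Otimes>\<^sub>M M \<rightarrow>\<^sub>M count_space UNIV" by measurable
  show "(\<lambda>p. X (dyadic_above n (max 0 (fst p))) (snd p)) \<in> borel \<Otimes>\<^sub>M M \<rightarrow>\<^sub>M borel"
    using measurable_compose_countable[OF 1 2] unfolding dyadic_above_def .
next
  fix p assume p: "p \<in> space ((borel :: real measure) \<Otimes>\<^sub>M M)"
  then have w: "snd p \<in> space M" by (auto simp: space_pair_measure)
  show "(\<lambda>n. X (dyadic_above n (max 0 (fst p))) (snd p)) \<longlonglongrightarrow> (case p of (t, w) \<Rightarrow> X (max 0 t) w)"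
    using filterlim_compose[OF right_continuous[OF _ w, of "max 0 (fst p)"] dyadic_above_tendsto[of "max 0 (fst p)"]]
    by (simp add: case_prod_beta)
qed

lemma X_joint_comp:
  assumes "f \<in> borel_measurable N" "g \<in> N \<rightarrow>\<^sub>M M" shows "(\<lambda>x. X (max 0 (f x)) (g x)) \<in> N \<rightarrow>\<^sub>M borel"
  using measurable_compose[OF measurable_Pair[OF assms] X_joint] by simp

lemma L_joint_comp:
  assumes [measurable]: "f \<in> borel_measurable N" "h \<in> N \<rightarrow>\<^sub>M borel" "g \<in> N \<rightarrow>\<^sub>M M"
  shows "(\<lambda>x. L (max 0 (f x)) (h x) (g x)) \<in> borel_measurable N"
proof -
  have "(\<lambda>x. max 0 (f x)) \<in> N \<rightarrow>\<^sub>M restrict_space borel {0..}"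
    by (rule measurable_restrict_space2) auto
  then have "(\<lambda>x. (max 0 (f x), h x, g x)) \<in> N \<rightarrow>\<^sub>M restrict_space borel {0..} \<Otimes>\<^sub>M borel \<Otimes>\<^sub>M M"
    by measurable
  from measurable_compose[OF this jointly_measurable] show ?thesis by simp
qed

definition discounted_occ :: "real \<Rightarrow> 'a set \<Rightarrow> 'o \<Rightarrow> ennreal" where
  "discounted_occ k A w = (\<integral>\<^sup>+t\<in>{0..}. ennreal (exp (- k * t)) * indicator A (X (max 0 t) w) \<partial>lborel)"

text \<open>The discounted local time \<open>\<integral> e\<^sup>-\<^sup>k\<^sup>t dL\<^sub>t(y)\<close>, integrated by parts so that it is
  measurable in \<open>w\<close> without any regularity of the path.\<close>

definition discounted_local :: "real \<Rightarrow> 'a \<Rightarrow> 'o \<Rightarrow> ennreal" where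
  "discounted_local k y w = (\<integral>\<^sup>+t\<in>{0..}. ennreal (k * exp (- k * t)) * ennreal (L (max 0 t) y w) \<partial>lborel)"

lemma discounted_occ_measurable: assumes [measurable]: "A \<in> sets borel" shows "discounted_occ k A \<in> borel_measurable M"
proof -
  note [measurable] = X_joint_comp
  show ?thesis unfolding discounted_occ_def[abs_def] by measurable
qed

lemma discounted_local_measurable_pair: "(\<lambda>(y, w). discounted_local k y w) \<in> borel_measurable (borel \<Otimes>\<^sub>M M)"
proof -
  note [measurable] = L_joint_comp
  show ?thesis unfolding discounted_local_def[abs_def] by measurable
qed

lemma discounted_local_measurable: "discounted_local k y \<in> borel_measurable M"
  using measurable_compose[OF _ discounted_local_measurable_pair, of "\<lambda>w. (y, w)" M k] by simp

lemma sigma_finite_P: "sigma_finite_measure (P x)"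
  using prob_space_P by (rule prob_space_imp_sigma_finite)

lemma sets_X_time: assumes [measurable]: "A \<in> sets borel" and w: "w \<in> space M"
  shows "{s. 0 \<le> s \<and> X (max 0 s) w \<in> A} \<in> sets borel"
proof -
  have [measurable]: "(\<lambda>s. X (max 0 s) w) \<in> borel \<rightarrow>\<^sub>M borel" using X_joint_comp[of "\<lambda>s. s" borel "\<lambda>_. w"] w by simp
  show ?thesis by measurable
qed

lemma discounted_occ_density:
  assumes k: "0 < k" and A[measurable]: "A \<in> sets borel"
  shows "AE w in P x. discounted_occ k A w = (\<integral>\<^sup>+y\<in>A. discounted_local k y w \<partial>\<mu>)"
proof -
  interpret mu: sigma_finite_measure \<mu> by (rule sigma_finite_mu)
  interpret pair_sigma_finite lborel \<mu> ..
  note [measurable] = L_joint_comp X_joint_comp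
  have sp: "AE w in P x. w \<in> space M" using AE_space[of "P x"] by (simp add: space_P)
  show ?thesis using occupation_density[of x] sp
  proof eventually_elim
    case (elim w)
    have w[measurable]: "w \<in> space M" by fact
    have e: "ennreal (exp (- k * s)) = (\<integral>\<^sup>+t. ennreal (k * exp (- k * t)) * indicator {s<..} t \<partial>lborel)" for s
      using nn_integral_exp_tail[OF k] by simp
    have [measurable]: "(\<lambda>s. X (max 0 s) w) \<in> borel \<rightarrow>\<^sub>M borel" by measurable
    have "discounted_occ k A w = (\<integral>\<^sup>+s. (\<integral>\<^sup>+t. ennreal (k * exp (- k * t)) * indicator {s<..} t * (indicator A (X (max 0 s) w) * indicator {0..} s) \<partial>lborel) \<partial>lborel)"
      unfolding discounted_occ_def e by (intro nn_integral_cong, subst nn_integral_multc) (auto simp: mult.assoc)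
    also have "\<dots> = (\<integral>\<^sup>+t. (\<integral>\<^sup>+s. ennreal (k * exp (- k * t)) * indicator {s<..} t * (indicator A (X (max 0 s) w) * indicator {0..} s) \<partial>lborel) \<partial>lborel)"
    proof (rule lborel_pair.Fubini')
      have "(\<lambda>(t, s). ennreal (k * exp (- k * t)) * (if s < t then 1 else 0) * (indicator A (X (max 0 s) w) * indicator {0..} s)) \<in> borel_measurable (borel \<Otimes>\<^sub>M borel)"
        by measurable
      then show "(\<lambda>(t, s). ennreal (k * exp (- k * t)) * indicator {s<..} t * (indicator A (X (max 0 s) w) * indicator {0..} s)) \<in> borel_measurable (lborel \<Otimes>\<^sub>M lborel)"
        by (simp add: indicator_def of_bool_def greaterThan_def cong: if_cong)
    qed
    also have "\<dots> = (\<integral>\<^sup>+t\<in>{0..}. ennreal (k * exp (- k * t)) * (\<integral>\<^sup>+y\<in>A. ennreal (L (max 0 t) y w) \<partial>\<mu>) \<partial>lborel)"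
    proof (rule nn_integral_cong)
      fix t :: real
      show "(\<integral>\<^sup>+s. ennreal (k * exp (- k * t)) * indicator {s<..} t * (indicator A (X (max 0 s) w) * indicator {0..} s) \<partial>lborel)
          = ennreal (k * exp (- k * t)) * (\<integral>\<^sup>+y\<in>A. ennreal (L (max 0 t) y w) \<partial>\<mu>) * indicator {0..} t"
      proof (cases "0 \<le> t")
        case True
        have "(\<integral>\<^sup>+s. ennreal (k * exp (- k * t)) * indicator {s<..} t * (indicator A (X (max 0 s) w) * indicator {0..} s) \<partial>lborel)
          = (\<integral>\<^sup>+s. ennreal (k * exp (- k * t)) * indicator {s\<in>{0..t}. X s w \<in> A} s \<partial>lborel)"
        proof (rule nn_integral_cong_AE)
          have "AE s in lborel. s \<noteq> t" by (rule AE_lborel_singleton)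
          then show "AE s in lborel. ennreal (k * exp (- k * t)) * indicator {s<..} t * (indicator A (X (max 0 s) w) * indicator {0..} s) =
              ennreal (k * exp (- k * t)) * indicator {s\<in>{0..t}. X s w \<in> A} s"
            by eventually_elim (auto split: split_indicator simp: max_def)
        qed
        also have "\<dots> = ennreal (k * exp (- k * t)) * emeasure lborel {s\<in>{0..t}. X s w \<in> A}"
        proof -
          have "{s\<in>{0..t}. X s w \<in> A} = {s. 0 \<le> s \<and> X (max 0 s) w \<in> A} \<inter> {0..t}" by (auto simp: max_def)
          then have "{s\<in>{0..t}. X s w \<in> A} \<in> sets lborel" using sets_X_time[OF A w] by simp
          then show ?thesis by (simp add: nn_integral_cmult_indicator)
        qed
        also have "emeasure lborel {s\<in>{0..t}. X s w \<in> A} = (\<integral>\<^sup>+y\<in>A. ennreal (L t y w) \<partial>\<mu>)"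
          using elim(1) True A by blast
        finally show ?thesis using True by (simp add: max_def)
      next
        case False
        then have z: "(\<lambda>s. ennreal (k * exp (- k * t)) * indicator {s<..} t * (indicator A (X (max 0 s) w) * indicator {0..} s)) = (\<lambda>_. 0)"
          by (intro ext) (auto split: split_indicator)
        show ?thesis unfolding z using False by simp
      qed
    qed
    also have "\<dots> = (\<integral>\<^sup>+t. \<integral>\<^sup>+y. ennreal (k * exp (- k * t)) * ennreal (L (max 0 t) y w) * indicator A y * indicator {0..} t \<partial>\<mu> \<partial>lborel)"
      by (intro nn_integral_cong) (simp add: nn_integral_cmult[symmetric] nn_integral_multc[symmetric] mult.assoc)
    also have "\<dots> = (\<integral>\<^sup>+y. \<integral>\<^sup>+t. ennreal (k * exp (- k * t)) * ennreal (L (max 0 t) y w) * indicator A y * indicator {0..} t \<partial>lborel \<partial>\<mu>)"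
      by (rule Fubini'[symmetric]) measurable
    also have "\<dots> = (\<integral>\<^sup>+y\<in>A. discounted_local k y w \<partial>\<mu>)"
      unfolding discounted_local_def
      by (intro nn_integral_cong) (subst nn_integral_multc[symmetric], auto simp: mult_ac intro!: nn_integral_cong)
    finally show ?case .
  qed
qed

text \<open>The process has an occupation density, so the time spent in a \<open>\<mu>\<close>-null set is \<open>0\<close>.\<close>

lemma null_set_times:
  assumes Z: "Z \<in> null_sets \<mu>"
  shows "AE s in lborel. 0 < s \<longrightarrow> (AE w in P x. X s w \<notin> Z)"
proof -
  have Zs[measurable]: "Z \<in> sets borel" using Z sets_borel by auto
  interpret Px: prob_space "P x" by (rule prob_space_P)
  interpret pair_sigma_finite lborel "P x" ..
  note [measurable] = X_joint_comp
  have "(\<integral>\<^sup>+y\<in>Z. discounted_local 1 y w \<partial>\<mu>) = 0" for w using Z by (rule nn_integral_null_set)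
  then have "AE w in P x. discounted_occ 1 Z w = 0" using discounted_occ_density[of 1 Z x] by simp
  note [measurable] = discounted_occ_measurable[OF Zs, of 1]
  from \<open>AE w in P x. discounted_occ 1 Z w = 0\<close> have "(\<integral>\<^sup>+w. discounted_occ 1 Z w \<partial>P x) = 0"
    by (intro nn_integral_0_iff_AE[THEN iffD2]) measurable
  moreover have "(\<integral>\<^sup>+w. discounted_occ 1 Z w \<partial>P x) = (\<integral>\<^sup>+t. \<integral>\<^sup>+w. ennreal (exp (- 1 * t)) * indicator Z (X (max 0 t) w) * indicator {0..} t \<partial>P x \<partial>lborel)"
    unfolding discounted_occ_def by (rule Fubini') measurable
  ultimately have z: "(\<integral>\<^sup>+t. \<integral>\<^sup>+w. ennreal (exp (- 1 * t)) * indicator Z (X (max 0 t) w) * indicator {0..} t \<partial>P x \<partial>lborel) = 0" by simp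
  have "AE t in lborel. (\<integral>\<^sup>+w. ennreal (exp (- 1 * t)) * indicator Z (X (max 0 t) w) * indicator {0..} t \<partial>P x) = 0"
    by (rule nn_integral_0_iff_AE[THEN iffD1, OF _ z]) measurable
  then show ?thesis
  proof eventually_elim
    case (elim t)
    show ?case
    proof
      assume t: "0 < t"
      have [measurable]: "X t \<in> M \<rightarrow>\<^sub>M borel" using X_measurable t by simp
      from elim have "(\<integral>\<^sup>+w. ennreal (exp (- 1 * t)) * indicator Z (X t w) \<partial>P x) = 0" using t by (simp add: max_def)
      then show "AE w in P x. X t w \<notin> Z"
        by (subst (asm) nn_integral_0_iff_AE) (auto simp: indicator_def elim!: eventually_mono split: if_splits)
    qed
  qed
qed

section \<open>Expectations for every starting point\<close>

text \<open>These properties hold almost surely for each point, with an exceptional set of paths that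
  may depend on the point.\<close>

definition regular_path :: "'a \<Rightarrow> 'o \<Rightarrow> bool" where
  "regular_path y w \<longleftrightarrow> w \<in> space M \<and> L 0 y w = 0 \<and> mono_on {0..} (\<lambda>t. L t y w) \<and> continuous_on {0..} (\<lambda>t. L t y w) \<and>
    (\<forall>s\<ge>0. \<forall>t\<ge>0. L (s + t) y w = L s y w + L t y (\<theta> s w))"

lemma AE_regular_path: "AE w in P x. regular_path y w"
proof -
  have "AE w in P x. w \<in> space M" using AE_space[of "P x"] by (simp add: space_P)
  with increasing[where z=x and y=y] additive[where z=x and y=y] show ?thesis
    unfolding regular_path_def by eventually_elim auto
qed

lemma regular_path_mono: "regular_path y w \<Longrightarrow> 0 \<le> s \<Longrightarrow> s \<le> t \<Longrightarrow> L s y w \<le> L t y w"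
  unfolding regular_path_def mono_on_def by auto

lemma regular_path_nonneg: "regular_path y w \<Longrightarrow> 0 \<le> t \<Longrightarrow> 0 \<le> L t y w"
  using regular_path_mono[of y w 0 t] unfolding regular_path_def by auto

lemma regular_path_shift: "regular_path y w \<Longrightarrow> 0 \<le> s \<Longrightarrow> 0 \<le> t \<Longrightarrow> L t y (\<theta> s w) = L (s + t) y w - L s y w"
  unfolding regular_path_def by auto

lemma discounted_occ_shift:
  assumes t: "0 \<le> t" and w[measurable]: "w \<in> space M" and [measurable]: "A \<in> sets borel"
  shows "ennreal (exp (- k * t)) * discounted_occ k A (\<theta> t w) = (\<integral>\<^sup>+s\<in>{t..}. ennreal (exp (- k * s)) * indicator A (X (max 0 s) w) \<partial>lborel)"
proof -
  note [measurable] = X_joint_comp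
  let ?F = "\<lambda>s. ennreal (exp (- k * s)) * indicator A (X (max 0 s) w) * indicator {t..} s"
  have "(\<integral>\<^sup>+s. ?F s \<partial>lborel) = (\<integral>\<^sup>+u. ?F (t + 1 * u) \<partial>lborel)"
    using nn_integral_real_affine[of ?F 1 t] by simp
  also have "\<dots> = (\<integral>\<^sup>+u. ennreal (exp (- k * t)) * (ennreal (exp (- k * u)) * indicator A (X (max 0 u) (\<theta> t w)) * indicator {0..} u) \<partial>lborel)"
  proof (rule nn_integral_cong)
    fix u :: real
    have "ennreal (exp (- k * (t + 1 * u))) = ennreal (exp (- k * t)) * ennreal (exp (- k * u))"
      by (simp add: ennreal_mult[symmetric] exp_add[symmetric] algebra_simps)
    moreover have "X (max 0 u) (\<theta> t w) = X (max 0 (t + 1 * u)) w" if "0 \<le> u"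
      using shift[of u t w] that t w by (simp add: max_def add.commute)
    ultimately show "?F (t + 1 * u) = ennreal (exp (- k * t)) * (ennreal (exp (- k * u)) * indicator A (X (max 0 u) (\<theta> t w)) * indicator {0..} u)"
      by (cases "0 \<le> u") (auto simp: mult.assoc)
  qed
  also have "\<dots> = ennreal (exp (- k * t)) * discounted_occ k A (\<theta> t w)"
    unfolding discounted_occ_def using shift_space[OF t w] by (intro nn_integral_cmult) measurable
  finally show ?thesis by simp
qed

lemma discounted_local_shift:
  assumes t: "0 \<le> t" and w: "regular_path y w" and k: "0 < k"
  shows "ennreal (exp (- k * t)) * discounted_local k y (\<theta> t w) = (\<integral>\<^sup>+s\<in>{t..}. ennreal (k * exp (- k * s) * (L (max 0 s) y w - L t y w)) \<partial>lborel)"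
proof -
  have wM[measurable]: "w \<in> space M" using w by (simp add: regular_path_def)
  note [measurable] = L_joint_comp
  let ?F = "\<lambda>s. ennreal (k * exp (- k * s) * (L (max 0 s) y w - L t y w)) * indicator {t..} s"
  have "(\<integral>\<^sup>+s. ?F s \<partial>lborel) = (\<integral>\<^sup>+u. ?F (t + 1 * u) \<partial>lborel)"
    using nn_integral_real_affine[of ?F 1 t] by simp
  also have "\<dots> = (\<integral>\<^sup>+u. ennreal (exp (- k * t)) * (ennreal (k * exp (- k * u)) * ennreal (L (max 0 u) y (\<theta> t w)) * indicator {0..} u) \<partial>lborel)"
  proof (rule nn_integral_cong)
    fix u :: real
    show "?F (t + 1 * u) = ennreal (exp (- k * t)) * (ennreal (k * exp (- k * u)) * ennreal (L (max 0 u) y (\<theta> t w)) * indicator {0..} u)"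
    proof (cases "0 \<le> u")
      case True
      have e: "exp (- k * (t + u)) = exp (- k * t) * exp (- k * u)"
        by (simp add: exp_add[symmetric] algebra_simps)
      have l: "L u y (\<theta> t w) = L (t + u) y w - L t y w" by (rule regular_path_shift[OF w t True])
      have n: "0 \<le> L (t + u) y w - L t y w" using regular_path_mono[OF w t, of "t + u"] True by simp
      show ?thesis using True t k n e l
        by (simp add: max_def ennreal_mult mult_ac)
    qed simp
  qed
  also have "\<dots> = ennreal (exp (- k * t)) * discounted_local k y (\<theta> t w)"
    unfolding discounted_local_def using shift_space[OF t wM] by (intro nn_integral_cmult) measurable
  finally show ?thesis by simp
qed

lemma null_times_sequence:
  assumes "AE s in lborel. 0 < s \<longrightarrow> Q s"
  obtains \<tau> :: "nat \<Rightarrow> real" where "\<And>n. 0 < \<tau> n" "\<And>n. Q (\<tau> n)" "decseq \<tau>" "\<tau> \<longlonglongrightarrow> 0"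
proof -
  have "\<exists>t. inverse (real (Suc (Suc n))) < t \<and> t < inverse (real (Suc n)) \<and> Q t" for n
    by (rule AE_lborel_imp_dense[OF assms]) auto
  then obtain \<tau> where \<tau>: "\<And>n. inverse (real (Suc (Suc n))) < \<tau> n" "\<And>n. \<tau> n < inverse (real (Suc n))" "\<And>n. Q (\<tau> n)"
    by metis
  show thesis
  proof
    show p: "0 < \<tau> n" for n using \<tau>(1)[of n] by (meson inverse_positive_iff_positive of_nat_0_less_iff order.strict_trans zero_less_Suc)
    show "Q (\<tau> n)" for n by (rule \<tau>(3))
    show "decseq \<tau>" using \<tau>(1,2) by (intro decseq_SucI) (meson less_imp_le order.strict_trans)
    show "\<tau> \<longlonglongrightarrow> 0"
      by (rule tendsto_of_abs_bound[OF _ LIMSEQ_inverse_real_of_nat]) (use p \<tau>(2) in \<open>simp add: less_imp_le\<close>)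
  qed
qed

text \<open>The resolvent of the form determines expectations only for \<open>\<mu>\<close>-almost every starting
  point. At almost every small time the process is outside the exceptional set; the Markov property at such times
  \<open>\<tau>\<^sub>n \<rightarrow> 0\<close> expresses the expectation of the shifted functional by the continuous function \<open>c\<close>, and
  both sides converge.\<close>

lemma expectation_extends:
  fixes Z :: "'o \<Rightarrow> ennreal" and c :: "'a \<Rightarrow> real"
  assumes Z[measurable]: "Z \<in> borel_measurable M"
    and lim: "\<And>x. AE w in P x. \<forall>\<tau>. (\<forall>n. 0 < \<tau> n) \<and> decseq \<tau> \<and> \<tau> \<longlonglongrightarrow> 0 \<longrightarrow>
      incseq (\<lambda>n. ennreal (exp (- k * \<tau> n)) * Z (\<theta> (\<tau> n) w)) \<and> (SUP n. ennreal (exp (- k * \<tau> n)) * Z (\<theta> (\<tau> n) w)) = Z w"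
    and c: "continuous_on UNIV c" "\<And>x. 0 \<le> c x" "\<And>x. c x \<le> B"
    and ae: "AE x in \<mu>. (\<integral>\<^sup>+w. Z w \<partial>P x) = ennreal (c x)"
  shows "(\<integral>\<^sup>+w. Z w \<partial>P x) = ennreal (c x)"
proof -
  interpret Px: prob_space "P x" by (rule prob_space_P)
  have km: "(\<lambda>x. \<integral>\<^sup>+w. Z w \<partial>P x) \<in> borel_measurable borel" by (rule kernel_integral_measurable[OF Z])
  have cm: "c \<in> borel_measurable borel" by (rule borel_measurable_continuous_onI[OF c(1)])
  let ?N = "{x. (\<integral>\<^sup>+w. Z w \<partial>P x) \<noteq> ennreal (c x)}"
  have Ns: "?N \<in> sets borel" using km cm by measurable
  have "?N = {x \<in> space \<mu>. \<not> ((\<integral>\<^sup>+w. Z w \<partial>P x) = ennreal (c x))}" by (simp add: space_mu)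
  then have N: "?N \<in> null_sets \<mu>" using ae AE_E2[OF ae] Ns by (simp add: null_sets_def sets_borel)
  obtain \<tau> where t: "\<And>n. 0 < \<tau> n" "\<And>n. AE w in P x. X (\<tau> n) w \<notin> ?N" "decseq \<tau>" "\<tau> \<longlonglongrightarrow> 0"
    using null_times_sequence[OF null_set_times[OF N, of x]] by blast
  let ?f = "\<lambda>n w. ennreal (exp (- k * \<tau> n)) * Z (\<theta> (\<tau> n) w)"
  have t0: "0 \<le> \<tau> n" for n using t(1)[of n] by simp
  note [measurable] = shift_measurable[OF t0] X_measurable[OF t0]
  have val: "(\<integral>\<^sup>+w. ?f n w \<partial>P x) = ennreal (exp (- k * \<tau> n) * (\<integral>w. c (X (\<tau> n) w) \<partial>P x))" for n
  proof -
    have sp: "space M \<in> natural_events M X (\<tau> n)" unfolding natural_events_def by (rule sigma_sets_top)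
    have "(\<integral>\<^sup>+w. Z (\<theta> (\<tau> n) w) \<partial>P x) = (\<integral>\<^sup>+w\<in>space M. Z (\<theta> (\<tau> n) w) \<partial>P x)"
      by (intro nn_integral_cong) (simp add: space_P)
    also have "\<dots> = (\<integral>\<^sup>+w\<in>space M. (\<integral>\<^sup>+v. Z v \<partial>P (X (\<tau> n) w)) \<partial>P x)"
      by (rule markov[OF t0 sp Z])
    also have "\<dots> = (\<integral>\<^sup>+w. ennreal (c (X (\<tau> n) w)) \<partial>P x)"
    proof (rule nn_integral_cong_AE)
      have "AE w in P x. w \<in> space M" using AE_space[of "P x"] by (simp add: space_P)
      with t(2)[of n] show "AE w in P x. (\<integral>\<^sup>+v. Z v \<partial>P (X (\<tau> n) w)) * indicator (space M) w = ennreal (c (X (\<tau> n) w))"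
        by eventually_elim auto
    qed
    also have "\<dots> = ennreal (\<integral>w. c (X (\<tau> n) w) \<partial>P x)"
    proof (rule nn_integral_eq_integral)
      show "integrable (P x) (\<lambda>w. c (X (\<tau> n) w))"
        by (rule Px.integrable_const_bound[where B=B]) (use c cm in auto)
    qed (use c in auto)
    finally show ?thesis using c(2) by (simp add: nn_integral_cmult ennreal_mult integral_nonneg_AE)
  qed
  have "(SUP n. \<integral>\<^sup>+w. ?f n w \<partial>P x) = (\<integral>\<^sup>+w. (SUP n. ?f n w) \<partial>P x)"
  proof (rule nn_integral_monotone_convergence_SUP_AE[symmetric])
    fix n show "AE w in P x. ?f n w \<le> ?f (Suc n) w"
      using lim[of x]
    proof eventually_elim
      case (elim w)
      then have "incseq (\<lambda>n. ?f n w)" using t by blast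
      then show ?case by (rule incseq_SucD)
    qed
  qed measurable
  also have "\<dots> = (\<integral>\<^sup>+w. Z w \<partial>P x)"
    using lim[of x] by (intro nn_integral_cong_AE) (use t in \<open>auto elim!: eventually_mono\<close>)
  finally have S: "(SUP n. \<integral>\<^sup>+w. ?f n w \<partial>P x) = (\<integral>\<^sup>+w. Z w \<partial>P x)" .
  have inc: "incseq (\<lambda>n. \<integral>\<^sup>+w. ?f n w \<partial>P x)"
  proof (rule incseq_SucI, rule nn_integral_mono_AE)
    fix n show "AE w in P x. ?f n w \<le> ?f (Suc n) w"
      using lim[of x]
    proof eventually_elim
      case (elim w)
      then have "incseq (\<lambda>n. ?f n w)" using t by blast
      then show ?case by (rule incseq_SucD)
    qed
  qed
  have l1: "(\<lambda>n. ennreal (exp (- k * \<tau> n) * (\<integral>w. c (X (\<tau> n) w) \<partial>P x))) \<longlonglongrightarrow> (\<integral>\<^sup>+w. Z w \<partial>P x)"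
    using LIMSEQ_SUP[OF inc] unfolding S unfolding val .
  have "(\<lambda>n. \<integral>w. c (X (\<tau> n) w) \<partial>P x) \<longlonglongrightarrow> (\<integral>w. c x \<partial>P x)"
  proof (rule integral_dominated_convergence[where w="\<lambda>_. B"])
    have at0: "filterlim \<tau> (at_right 0) sequentially"
    proof -
      have "\<tau> n \<in> {0<..} \<and> \<tau> n \<noteq> 0" for n using t(1)[of n] by simp
      then show ?thesis unfolding filterlim_at using t(4) by (simp add: always_eventually)
    qed
    have "AE w in P x. w \<in> space M" using AE_space[of "P x"] by (simp add: space_P)
    with normal[of x] show "AE w in P x. (\<lambda>n. c (X (\<tau> n) w)) \<longlonglongrightarrow> c x"
    proof eventually_elim
      case (elim w)
      have "(\<lambda>n. X (\<tau> n) w) \<longlonglongrightarrow> X 0 w"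
        using filterlim_compose[OF right_continuous[of 0 w] at0] elim by simp
      then show ?case using continuous_on_tendsto_compose[OF c(1), of "\<lambda>n. X (\<tau> n) w" "X 0 w"] elim by simp
    qed
    show "AE w in P x. norm (c (X (\<tau> n) w)) \<le> B" for n using c by simp
  qed (use cm in auto)
  then have "(\<lambda>n. exp (- k * \<tau> n) * (\<integral>w. c (X (\<tau> n) w) \<partial>P x)) \<longlonglongrightarrow> exp (- k * 0) * (\<integral>w. c x \<partial>P x)"
    by (intro tendsto_intros t(4))
  then have "(\<lambda>n. ennreal (exp (- k * \<tau> n) * (\<integral>w. c (X (\<tau> n) w) \<partial>P x))) \<longlonglongrightarrow> ennreal (c x)"
    using Px.prob_space by (intro tendsto_ennrealI) simp
  with l1 show ?thesis by (rule LIMSEQ_unique)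
qed

lemma discounted_occ_le: assumes k: "0 < k" shows "discounted_occ k A w \<le> ennreal (1 / k)"
proof -
  have "discounted_occ k A w \<le> (\<integral>\<^sup>+t. ennreal (1 / k) * (ennreal (k * exp (- k * t)) * indicator {-1<..} t * indicator {0..} t) \<partial>lborel)"
    unfolding discounted_occ_def
  proof (rule nn_integral_mono)
    fix t :: real
    have "ennreal (exp (- k * t)) = ennreal (1 / k) * ennreal (k * exp (- k * t))"
      using k by (simp add: ennreal_mult[symmetric])
    then show "ennreal (exp (- k * t)) * indicator A (X (max 0 t) w) * indicator {0..} t \<le> ennreal (1 / k) * (ennreal (k * exp (- k * t)) * indicator {-1<..} t * indicator {0..} t)"
      by (auto split: split_indicator)
  qed
  also have "\<dots> = (\<integral>\<^sup>+t. ennreal (1 / k) * (ennreal (k * exp (- k * t)) * indicator {0<..} t) \<partial>lborel)"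
  proof (rule nn_integral_cong_AE)
    have "AE t in lborel. t \<noteq> (0::real)" by (rule AE_lborel_singleton)
    then show "AE t in lborel. ennreal (1 / k) * (ennreal (k * exp (- k * t)) * indicator {-1<..} t * indicator {0..} t) = ennreal (1 / k) * (ennreal (k * exp (- k * t)) * indicator {0<..} t)"
      by eventually_elim (auto split: split_indicator)
  qed
  also have "\<dots> = ennreal (1 / k)"
    using nn_integral_exp_tail[OF k, of 0] by (simp add: nn_integral_cmult)
  finally show ?thesis .
qed

lemma discounted_occ_shift_limit:
  assumes k: "0 < k" and A[measurable]: "A \<in> sets borel" and w: "w \<in> space M"
    and t: "\<And>n. 0 < \<tau> n" "decseq \<tau>" "\<tau> \<longlonglongrightarrow> 0"
  shows "incseq (\<lambda>n. ennreal (exp (- k * \<tau> n)) * discounted_occ k A (\<theta> (\<tau> n) w))"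
    and "(SUP n. ennreal (exp (- k * \<tau> n)) * discounted_occ k A (\<theta> (\<tau> n) w)) = discounted_occ k A w"
proof -
  note [measurable] = X_joint_comp w
  let ?f = "\<lambda>n s. ennreal (exp (- k * s)) * indicator A (X (max 0 s) w) * indicator {\<tau> n..} s"
  let ?u = "\<lambda>s. ennreal (exp (- k * s)) * indicator A (X (max 0 s) w) * indicator {0<..} s"
  have eq: "ennreal (exp (- k * \<tau> n)) * discounted_occ k A (\<theta> (\<tau> n) w) = integral\<^sup>N lborel (?f n)" for n
    using t(1)[of n] w by (intro discounted_occ_shift) auto
  have 1: "?f n s \<le> ?f (Suc n) s" for n s
    using decseq_SucD[OF t(2), of n] by (auto split: split_indicator)
  have 2: "(\<lambda>n. ?f n s) \<longlonglongrightarrow> ?u s" for s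
  proof (cases "0 < s")
    case True
    have "\<forall>\<^sub>F n in sequentially. \<tau> n < s" using order_tendstoD(2)[OF t(3) True] .
    then have "\<forall>\<^sub>F n in sequentially. ?f n s = ?u s" by eventually_elim (use True in auto)
    then show ?thesis by (rule tendsto_eventually)
  next
    case False
    then have "\<not> \<tau> n \<le> s" for n using t(1)[of n] by linarith
    then have "?f n s = ?u s" for n using False by simp
    then show ?thesis by simp
  qed
  have 3: "?f n \<in> borel_measurable lborel" for n by measurable
  note r = nn_integral_incseq_SUP[where f="?f" and u="?u", OF 1 3 2]
  show "incseq (\<lambda>n. ennreal (exp (- k * \<tau> n)) * discounted_occ k A (\<theta> (\<tau> n) w))" unfolding eq by (rule r(1))
  have "(SUP n. integral\<^sup>N lborel (?f n)) = integral\<^sup>N lborel ?u" by (rule r(2))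
  also have "\<dots> = discounted_occ k A w"
    unfolding discounted_occ_def
  proof (rule nn_integral_cong_AE)
    have "AE t in lborel. t \<noteq> (0::real)" by (rule AE_lborel_singleton)
    then show "AE t in lborel. ?u t = ennreal (exp (- k * t)) * indicator A (X (max 0 t) w) * indicator {0..} t"
      by eventually_elim (auto split: split_indicator)
  qed
  finally show "(SUP n. ennreal (exp (- k * \<tau> n)) * discounted_occ k A (\<theta> (\<tau> n) w)) = discounted_occ k A w" unfolding eq .
qed

lemma discounted_local_shift_limit:
  assumes k: "0 < k" and w: "regular_path y w"
    and t: "\<And>n. 0 < \<tau> n" "decseq \<tau>" "\<tau> \<longlonglongrightarrow> 0"
  shows "incseq (\<lambda>n. ennreal (exp (- k * \<tau> n)) * discounted_local k y (\<theta> (\<tau> n) w))"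
    and "(SUP n. ennreal (exp (- k * \<tau> n)) * discounted_local k y (\<theta> (\<tau> n) w)) = discounted_local k y w"
proof -
  have wM[measurable]: "w \<in> space M" using w by (simp add: regular_path_def)
  note [measurable] = L_joint_comp
  let ?f = "\<lambda>n s. ennreal (k * exp (- k * s) * (L (max 0 s) y w - L (\<tau> n) y w)) * indicator {\<tau> n..} s"
  let ?u = "\<lambda>s. ennreal (k * exp (- k * s)) * ennreal (L (max 0 s) y w) * indicator {0..} s"
  have eq: "ennreal (exp (- k * \<tau> n)) * discounted_local k y (\<theta> (\<tau> n) w) = integral\<^sup>N lborel (?f n)" for n
    using t(1)[of n] w k by (intro discounted_local_shift) auto
  have L0: "L 0 y w = 0" using w by (simp add: regular_path_def)
  have 1: "?f n s \<le> ?f (Suc n) s" for n s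
  proof (cases "\<tau> n \<le> s")
    case True
    have "\<tau> (Suc n) \<le> \<tau> n" using decseq_SucD[OF t(2)] .
    moreover have "L (\<tau> (Suc n)) y w \<le> L (\<tau> n) y w"
      using regular_path_mono[OF w _ \<open>\<tau> (Suc n) \<le> \<tau> n\<close>] t(1)[of "Suc n"] by simp
    ultimately show ?thesis using True k by (auto intro!: ennreal_leI mult_left_mono)
  qed simp
  have 2: "(\<lambda>n. ?f n s) \<longlonglongrightarrow> ?u s" for s
  proof (cases "0 < s")
    case True
    have "\<forall>\<^sub>F n in sequentially. \<tau> n < s" using order_tendstoD(2)[OF t(3) True] .
    then have ev: "\<forall>\<^sub>F n in sequentially. ennreal (k * exp (- k * s) * (L s y w - L (\<tau> n) y w)) = ?f n s"
      by eventually_elim (use True in auto)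
    have "(\<lambda>n. L (\<tau> n) y w) \<longlonglongrightarrow> L 0 y w"
      by (rule continuous_on_tendsto_compose[where s="{0..}"])
        (use w t in \<open>auto simp: regular_path_def less_imp_le\<close>)
    then have "(\<lambda>n. k * exp (- k * s) * (L s y w - L (\<tau> n) y w)) \<longlonglongrightarrow> k * exp (- k * s) * (L s y w - 0)"
      unfolding L0 by (intro tendsto_intros)
    then have "(\<lambda>n. ennreal (k * exp (- k * s) * (L s y w - L (\<tau> n) y w))) \<longlonglongrightarrow> ennreal (k * exp (- k * s) * (L s y w - 0))"
      by (rule tendsto_ennrealI)
    also have "ennreal (k * exp (- k * s) * (L s y w - 0)) = ?u s"
      using True k regular_path_nonneg[OF w, of s] by (simp add: ennreal_mult)
    finally show ?thesis using ev by (rule Lim_transform_eventually)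
  next
    case False
    then have "\<not> \<tau> n \<le> s" for n using t(1)[of n] by linarith
    then have "?f n s = ?u s" for n using False L0 by (auto split: split_indicator)
    then show ?thesis by simp
  qed
  have 3: "?f n \<in> borel_measurable lborel" for n by measurable
  note r = nn_integral_incseq_SUP[where f="?f" and u="?u", OF 1 3 2]
  show "incseq (\<lambda>n. ennreal (exp (- k * \<tau> n)) * discounted_local k y (\<theta> (\<tau> n) w))" unfolding eq by (rule r(1))
  show "(SUP n. ennreal (exp (- k * \<tau> n)) * discounted_local k y (\<theta> (\<tau> n) w)) = discounted_local k y w"
    unfolding eq unfolding discounted_local_def by (rule r(2))
qed

lemma green_set_integral:
  assumes k: "0 < k" and A[measurable]: "A \<in> sets borel" and bA: "bounded A"
  defines "c \<equiv> \<lambda>x. (\<integral>y. indicator A y * green k x y \<partial>\<mu>)"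
  shows "ennreal (c x) = (\<integral>\<^sup>+y\<in>A. ennreal (green k x y) \<partial>\<mu>)" "continuous_on UNIV c" "0 \<le> c x" "c x \<le> sup_const k * measure \<mu> A"
proof -
  have Af: "emeasure \<mu> A < \<infinity>" by (rule bounded_finite_measure[OF bA])
  have gm[measurable]: "green k x \<in> borel_measurable borel" for x
    using measurable_compose[OF _ green_measurable_pair[OF k], of "\<lambda>y. (x, y)" borel] by simp
  have int: "integrable \<mu> (\<lambda>y. indicator A y * green k x y)" for x
  proof (rule Bochner_Integration.integrable_bound)
    show "integrable \<mu> (\<lambda>y. sup_const k * indicator A y)" using Af by (simp add: sets_borel)
    show "AE y in \<mu>. norm (indicator A y * green k x y) \<le> norm (sup_const k * indicator A y)"
      using green_nonneg[OF k] green_le[OF k] sup_const_pos[of k] by (intro AE_I2) (auto split: split_indicator)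
  qed measurable
  show "ennreal (c x) = (\<integral>\<^sup>+y\<in>A. ennreal (green k x y) \<partial>\<mu>)"
    unfolding c_def using int[of x] green_nonneg[OF k]
    by (subst nn_integral_eq_integral[symmetric]) (auto intro!: nn_integral_cong split: split_indicator)
  show "0 \<le> c x" unfolding c_def using green_nonneg[OF k] by (intro integral_nonneg_AE AE_I2) auto
  have bound: "(\<integral>y. B * indicator A y \<partial>\<mu>) = B * measure \<mu> A" "integrable \<mu> (\<lambda>y. B * indicator A y)" for B :: real
    using Af by (simp_all add: sets_borel space_mu)
  have "c x \<le> (\<integral>y. sup_const k * indicator A y \<partial>\<mu>)"
    unfolding c_def using int[of x] green_le[OF k] bound(2) by (intro integral_mono) (auto split: split_indicator)
  then show "c x \<le> sup_const k * measure \<mu> A" unfolding bound .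
  have osc: "\<bar>c x' - c x\<bar> \<le> sqrt (dist x' x * sup_const k) * measure \<mu> A" for x x'
  proof -
    have "\<bar>c x' - c x\<bar> = \<bar>\<integral>y. indicator A y * green k x' y - indicator A y * green k x y \<partial>\<mu>\<bar>"
      unfolding c_def using int by simp
    also have "\<dots> \<le> (\<integral>y. \<bar>indicator A y * green k x' y - indicator A y * green k x y\<bar> \<partial>\<mu>)" by (rule integral_abs_bound)
    also have "\<dots> \<le> (\<integral>y. sqrt (dist x' x * sup_const k) * indicator A y \<partial>\<mu>)"
      using int green_oscillation[OF k] bound(2) by (intro integral_mono) (auto split: split_indicator)
    finally show ?thesis unfolding bound .
  qed
  have "(c \<longlongrightarrow> c x) (at x)" for x
  proof (rule tendsto_of_abs_bound[OF osc])
    have "((\<lambda>x'. sqrt (dist x' x * sup_const k) * measure \<mu> A) \<longlongrightarrow> sqrt (dist x x * sup_const k) * measure \<mu> A) (at x)"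
      by (intro tendsto_intros)
    then show "((\<lambda>x'. sqrt (dist x' x * sup_const k) * measure \<mu> A) \<longlongrightarrow> 0) (at x)" by simp
  qed
  then show "continuous_on UNIV c" by (auto simp: continuous_on_def)
qed

lemma expected_discounted_occ:
  assumes k: "0 < k" and A[measurable]: "A \<in> sets borel" and bA: "bounded A"
  shows "(\<integral>\<^sup>+w. discounted_occ k A w \<partial>P x) = (\<integral>\<^sup>+y\<in>A. ennreal (green k x y) \<partial>\<mu>)"
proof -
  note g = green_set_integral[OF k A bA]
  have "(\<integral>\<^sup>+w. discounted_occ k A w \<partial>P x) = ennreal (\<integral>y. indicator A y * green k x y \<partial>\<mu>)"
  proof (rule expectation_extends[where Z="discounted_occ k A" and k=k])
    show "discounted_occ k A \<in> borel_measurable M" by (rule discounted_occ_measurable[OF A])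
    fix x
    have "AE w in P x. w \<in> space M" using AE_space[of "P x"] by (simp add: space_P)
    then show "AE w in P x. \<forall>\<tau>. (\<forall>n. 0 < \<tau> n) \<and> decseq \<tau> \<and> \<tau> \<longlonglongrightarrow> 0 \<longrightarrow>
      incseq (\<lambda>n. ennreal (exp (- k * \<tau> n)) * discounted_occ k A (\<theta> (\<tau> n) w)) \<and> (SUP n. ennreal (exp (- k * \<tau> n)) * discounted_occ k A (\<theta> (\<tau> n) w)) = discounted_occ k A w"
      by eventually_elim (use discounted_occ_shift_limit[OF k A] in blast)
  next
    show "AE x in \<mu>. (\<integral>\<^sup>+w. discounted_occ k A w \<partial>P x) = ennreal (\<integral>y. indicator A y * green k x y \<partial>\<mu>)"
      using resolvent_green_AE[OF k A bA]
    proof eventually_elim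
      case (elim x)
      interpret Px: prob_space "P x" by (rule prob_space_P)
      interpret pair_sigma_finite lborel "P x" ..
      note [measurable] = X_joint_comp
      let ?H = "\<lambda>t. (\<integral>\<^sup>+w. indicator A (X (max 0 t) w) \<partial>P x)"
      have Hm[measurable]: "?H \<in> borel_measurable borel" by measurable
      have H: "(\<integral>w. indicator A (X t w) \<partial>P x) = enn2real (?H t)" if "0 \<le> t" for t
      proof -
        have [measurable]: "X t \<in> M \<rightarrow>\<^sub>M borel" using X_measurable[OF that] .
        show ?thesis using that
          by (subst integral_eq_nn_integral) (auto simp: max_def ennreal_indicator)
      qed
      have H1: "?H t \<le> 1" for t
      proof -
        have "?H t \<le> (\<integral>\<^sup>+w. 1 \<partial>P x)" by (intro nn_integral_mono) (auto split: split_indicator)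
        then show ?thesis by (simp add: Px.emeasure_space_1)
      qed
      have "(\<integral>\<^sup>+w. discounted_occ k A w \<partial>P x) = (\<integral>\<^sup>+t. \<integral>\<^sup>+w. ennreal (exp (- k * t)) * indicator A (X (max 0 t) w) * indicator {0..} t \<partial>P x \<partial>lborel)"
        unfolding discounted_occ_def by (rule Fubini') measurable
      also have "\<dots> = (\<integral>\<^sup>+t. ennreal (exp (- k * t)) * ?H t * indicator {0..} t \<partial>lborel)"
        by (intro nn_integral_cong) (simp add: nn_integral_cmult nn_integral_multc)
      finally have e: "(\<integral>\<^sup>+w. discounted_occ k A w \<partial>P x) = (\<integral>\<^sup>+t. ennreal (exp (- k * t)) * ?H t * indicator {0..} t \<partial>lborel)" .
      have "(LINT t:{0..}|lborel. exp (- k * t) * (\<integral>w. indicator A (X t w) \<partial>P x)) = (\<integral>t. indicator {0..} t * (exp (- k * t) * enn2real (?H t)) \<partial>lborel)"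
        unfolding set_lebesgue_integral_def by (intro Bochner_Integration.integral_cong) (auto simp: H split: split_indicator)
      also have "\<dots> = enn2real (\<integral>\<^sup>+t. ennreal (indicator {0..} t * (exp (- k * t) * enn2real (?H t))) \<partial>lborel)"
        by (rule integral_eq_nn_integral) auto
      also have "(\<integral>\<^sup>+t. ennreal (indicator {0..} t * (exp (- k * t) * enn2real (?H t))) \<partial>lborel) = (\<integral>\<^sup>+w. discounted_occ k A w \<partial>P x)"
      proof -
        have "ennreal (enn2real (?H t)) = ?H t" for t using H1[of t] by (intro ennreal_enn2real) (auto simp: less_top[symmetric] top_unique)
        then show ?thesis unfolding e
          by (intro nn_integral_cong) (auto simp: ennreal_mult split: split_indicator)
      qed
      finally have "enn2real (\<integral>\<^sup>+w. discounted_occ k A w \<partial>P x) = (\<integral>y. indicator A y * green k x y \<partial>\<mu>)" using elim by simp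
      moreover have "(\<integral>\<^sup>+w. discounted_occ k A w \<partial>P x) < top"
      proof -
        have "(\<integral>\<^sup>+w. discounted_occ k A w \<partial>P x) \<le> (\<integral>\<^sup>+w. ennreal (1 / k) \<partial>P x)" by (intro nn_integral_mono discounted_occ_le k)
        also have "\<dots> < top" by (simp add: Px.emeasure_space_1)
        finally show ?thesis .
      qed
      ultimately show ?case by (metis ennreal_enn2real)
    qed
  qed (use g in auto)
  then show ?thesis using g(1) by simp
qed

section \<open>Local times grow only at their point\<close>

lemma expected_discounted_local_AE:
  assumes k: "0 < k"
  shows "AE y in \<mu>. (\<integral>\<^sup>+w. discounted_local k y w \<partial>P x) = ennreal (green k x y)"
proof -
  interpret mu: sigma_finite_measure \<mu> by (rule sigma_finite_mu)
  interpret Px: prob_space "P x" by (rule prob_space_P)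
  interpret pair_sigma_finite \<mu> "P x" ..
  have lm: "(\<lambda>(y, w). discounted_local k y w) \<in> borel_measurable (\<mu> \<Otimes>\<^sub>M P x)"
    using discounted_local_measurable_pair[of k] by (subst measurable_cong_sets[OF sets_pair_measure_cong[OF sets_borel sets_P] refl])
  have gm[measurable]: "green k x \<in> borel_measurable borel"
    using measurable_compose[OF _ green_measurable_pair[OF k], of "\<lambda>y. (x, y)" borel] by simp
  have hm: "(\<lambda>y. \<integral>\<^sup>+w. discounted_local k y w \<partial>P x) \<in> borel_measurable \<mu>"
    using Px.borel_measurable_nn_integral[OF lm] .
  let ?D1 = "density \<mu> (\<lambda>y. \<integral>\<^sup>+w. discounted_local k y w \<partial>P x)" and ?D2 = "density \<mu> (\<lambda>y. ennreal (green k x y))"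
  have bd: "emeasure ?D1 A = emeasure ?D2 A" if A[measurable]: "A \<in> sets borel" and bA: "bounded A" for A
  proof -
    have "emeasure ?D1 A = (\<integral>\<^sup>+y. (\<integral>\<^sup>+w. discounted_local k y w * indicator A y \<partial>P x) \<partial>\<mu>)"
      using hm A discounted_local_measurable[of k] by (simp add: emeasure_density nn_integral_multc sets_borel)
    also have "\<dots> = (\<integral>\<^sup>+w. (\<integral>\<^sup>+y. discounted_local k y w * indicator A y \<partial>\<mu>) \<partial>P x)"
    proof (rule Fubini'[symmetric])
      have "(\<lambda>p. (case p of (y, w) \<Rightarrow> discounted_local k y w) * indicator A (fst p)) \<in> borel_measurable (\<mu> \<Otimes>\<^sub>M P x)"
        using lm by measurable
      then show "(\<lambda>(y, w). discounted_local k y w * indicator A y) \<in> borel_measurable (\<mu> \<Otimes>\<^sub>M P x)"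
        by (simp add: split_beta')
    qed
    also have "\<dots> = (\<integral>\<^sup>+w. discounted_occ k A w \<partial>P x)"
      using discounted_occ_density[OF k A, of x] by (intro nn_integral_cong_AE) (auto elim!: eventually_mono)
    also have "\<dots> = (\<integral>\<^sup>+y\<in>A. ennreal (green k x y) \<partial>\<mu>)" by (rule expected_discounted_occ[OF k A bA])
    also have "\<dots> = emeasure ?D2 A" using A by (simp add: emeasure_density sets_borel)
    finally show ?thesis .
  qed
  have "?D1 = ?D2"
  proof (rule measure_eqI)
    fix A assume "A \<in> sets ?D1"
    then have A: "A \<in> sets borel" by (simp add: sets_borel)
    let ?A = "\<lambda>n. A \<inter> ball undefined (real n)"
    have As: "?A n \<in> sets borel" for n using A by simp
    have inc: "incseq ?A" by (auto simp: incseq_def)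
    have U: "(\<Union>n. ?A n) = A"
    proof -
      have "x \<in> (\<Union>n. ball undefined (real n))" for x :: 'a
        using reals_Archimedean2[of "dist undefined x"] by auto
      then show ?thesis by blast
    qed
    have "emeasure D A = (SUP n. emeasure D (?A n))" if "sets D = sets borel" for D
    proof -
      have "range ?A \<subseteq> sets D" using As that by auto
      from SUP_emeasure_incseq[OF this inc] show ?thesis unfolding U by simp
    qed
    moreover have "emeasure ?D1 (?A n) = emeasure ?D2 (?A n)" for n
      using As by (intro bd) (auto intro: bounded_subset[OF bounded_ball])
    ultimately show "emeasure ?D1 A = emeasure ?D2 A" by (simp add: sets_borel)
  qed simp
  then show ?thesis
    by (intro sigma_finite_measure.density_unique[OF sigma_finite_mu hm]) simp
qed

text \<open>For each \<open>x\<close>, discounted local time and Green kernel are densities of the same measure, hence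
  agree for almost every \<open>y\<close>. Exchanging the exceptional sets and then extending from almost every \<open>x\<close>
  to every \<open>x\<close> leaves a single null set of points \<open>y\<close>.\<close>

lemma expected_discounted_local:
  assumes k: "0 < k"
  shows "AE y in \<mu>. \<forall>x. (\<integral>\<^sup>+w. discounted_local k y w \<partial>P x) = ennreal (green k x y)"
proof -
  interpret mu: sigma_finite_measure \<mu> by (rule sigma_finite_mu)
  interpret pair_sigma_finite \<mu> \<mu> ..
  note [measurable] = green_measurable_pair[OF k]
  have hm: "(\<lambda>(x, y). \<integral>\<^sup>+w. discounted_local k y w \<partial>P x) \<in> borel_measurable (borel \<Otimes>\<^sub>M borel)"
  proof -
    have "(\<lambda>p. \<integral>\<^sup>+w. discounted_local k (snd p) w \<partial>P (fst p)) \<in> borel_measurable (borel \<Otimes>\<^sub>M borel)"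
    proof (rule nn_integral_measurable_subprob_algebra2[where N=M])
      have "(\<lambda>q. (snd (fst q), snd q)) \<in> (borel \<Otimes>\<^sub>M borel) \<Otimes>\<^sub>M M \<rightarrow>\<^sub>M borel \<Otimes>\<^sub>M M" by measurable
      from measurable_compose[OF this discounted_local_measurable_pair[of k]]
      show "(\<lambda>(p, w). discounted_local k (snd p) w) \<in> borel_measurable ((borel \<Otimes>\<^sub>M borel) \<Otimes>\<^sub>M M)" by (simp add: split_beta')
      show "(\<lambda>p. P (fst p)) \<in> borel \<Otimes>\<^sub>M borel \<rightarrow>\<^sub>M subprob_algebra M" by measurable
    qed
    then show ?thesis by (simp add: split_beta')
  qed
  have "{p \<in> space (borel \<Otimes>\<^sub>M borel). (\<integral>\<^sup>+w. discounted_local k (snd p) w \<partial>P (fst p)) = ennreal (green k (fst p) (snd p))} \<in> sets (borel \<Otimes>\<^sub>M borel)"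
    using hm unfolding split_beta' by measurable
  then have m: "{p \<in> space (\<mu> \<Otimes>\<^sub>M \<mu>). (\<integral>\<^sup>+w. discounted_local k (snd p) w \<partial>P (fst p)) = ennreal (green k (fst p) (snd p))} \<in> sets (\<mu> \<Otimes>\<^sub>M \<mu>)"
    using sets_pair_measure_cong[OF sets_borel sets_borel] sets_eq_imp_space_eq[OF sets_pair_measure_cong[OF sets_borel sets_borel]] by simp
  have "AE x in \<mu>. AE y in \<mu>. (\<integral>\<^sup>+w. discounted_local k y w \<partial>P x) = ennreal (green k x y)"
    using expected_discounted_local_AE[OF k] by simp
  then have "AE y in \<mu>. AE x in \<mu>. (\<integral>\<^sup>+w. discounted_local k y w \<partial>P x) = ennreal (green k x y)"
    by (subst (asm) AE_commute) (use m in simp_all)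
  then show ?thesis
  proof eventually_elim
    case (elim y)
    show ?case
    proof
      fix x
      show "(\<integral>\<^sup>+w. discounted_local k y w \<partial>P x) = ennreal (green k x y)"
      proof (rule expectation_extends[where Z="discounted_local k y" and k=k and c="\<lambda>x. green k x y" and B="sup_const k"])
        fix x
        show "AE w in P x. \<forall>\<tau>. (\<forall>n. 0 < \<tau> n) \<and> decseq \<tau> \<and> \<tau> \<longlonglongrightarrow> 0 \<longrightarrow>
          incseq (\<lambda>n. ennreal (exp (- k * \<tau> n)) * discounted_local k y (\<theta> (\<tau> n) w)) \<and> (SUP n. ennreal (exp (- k * \<tau> n)) * discounted_local k y (\<theta> (\<tau> n) w)) = discounted_local k y w"
          using AE_regular_path[where x=x and y=y] by eventually_elim (use discounted_local_shift_limit[OF k] in blast)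
      qed (use elim discounted_local_measurable green_continuous_left[OF k] green_nonneg[OF k] green_le[OF k] in auto)
    qed
  qed
qed

text \<open>Rational times suffice by right-continuity, and they make the event measurable
  jointly in the point and the path.\<close>

definition avoids :: "real \<Rightarrow> real \<Rightarrow> real \<Rightarrow> 'a \<Rightarrow> 'o \<Rightarrow> bool" where
  "avoids a b r y w \<longleftrightarrow> (\<forall>q::rat. a \<le> of_rat q \<and> of_rat q < b \<longrightarrow> r \<le> dist (X (max 0 (of_rat q)) w) y)"

text \<open>The support property of the local time at \<open>y\<close>. Rational parameters make it a countable
  family of conditions.\<close>

definition local_growth :: "'a \<Rightarrow> 'o \<Rightarrow> bool" where
  "local_growth y w \<longleftrightarrow> (\<forall>a b r::rat. 0 \<le> a \<and> a < b \<and> 0 < r \<and> avoids (of_rat a) (of_rat b) (of_rat r) y w \<longrightarrow>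
     L (max 0 (of_rat b)) y w = L (max 0 (of_rat a)) y w)"

lemma avoids_real:
  assumes av: "avoids a b r y w" and w: "w \<in> space M" and a: "0 \<le> a" and s: "a \<le> s" "s < b"
  shows "r \<le> dist (X s w) y"
proof -
  define q where "q n = (SOME q::rat. s < of_rat q \<and> of_rat q < min b (s + inverse (real (Suc n))))" for n
  have q: "s < of_rat (q n) \<and> of_rat (q n) < min b (s + inverse (real (Suc n)))" for n
  proof -
    have "\<exists>q::rat. s < of_rat q \<and> of_rat q < min b (s + inverse (real (Suc n)))"
      using of_rat_dense[of s "min b (s + inverse (real (Suc n)))"] s by auto
    from someI_ex[OF this] show ?thesis unfolding q_def .
  qed
  have "(\<lambda>n. of_rat (q n)) \<longlonglongrightarrow> s"
    by (rule tendsto_of_abs_bound[OF _ LIMSEQ_inverse_real_of_nat])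
      (use q in \<open>smt (verit, best) min_less_iff_conj\<close>)
  moreover have "of_rat (q n) \<in> {s<..} \<and> of_rat (q n) \<noteq> s" for n using q[of n] by auto
  ultimately have fl: "filterlim (\<lambda>n. of_rat (q n)) (at_right s) sequentially"
    unfolding filterlim_at by (simp add: always_eventually)
  have "((\<lambda>s. X s w) \<longlongrightarrow> X s w) (at_right s)"
    using s a w by (intro right_continuous) auto
  from filterlim_compose[OF this fl] have lim: "(\<lambda>n. dist (X (of_rat (q n)) w) y) \<longlonglongrightarrow> dist (X s w) y"
    by (rule tendsto_dist[OF _ tendsto_const])
  have ge: "r \<le> dist (X (of_rat (q n)) w) y" for n
  proof -
    have "max 0 (of_rat (q n)) = (of_rat (q n) :: real)" using q[of n] s a by (intro max_absorb2) linarith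
    then show ?thesis using av[unfolded avoids_def, rule_format, of "q n"] q[of n] s by simp
  qed
  show ?thesis by (rule LIMSEQ_le_const[OF lim]) (use ge in blast)
qed

lemma avoids_measurable:
  "{p \<in> space (borel \<Otimes>\<^sub>M M). avoids a b r (fst p) (snd p)} \<in> sets (borel \<Otimes>\<^sub>M M)"
proof -
  have [measurable]: "(\<lambda>p. dist (X (max 0 (of_rat q)) (snd p)) (fst p)) \<in> borel_measurable (borel \<Otimes>\<^sub>M M)" for q :: rat
  proof -
    have "(\<lambda>p. (X (max 0 (of_rat q)) (snd p), fst p)) \<in> borel \<Otimes>\<^sub>M M \<rightarrow>\<^sub>M borel \<Otimes>\<^sub>M borel"
      using X_measurable[of "max 0 (of_rat q)"] by measurable
    from measurable_compose[OF this dist_measurable_pair] show ?thesis by simp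
  qed
  show ?thesis unfolding avoids_def by measurable
qed

lemma local_growth_measurable:
  "{p \<in> space (borel \<Otimes>\<^sub>M M). local_growth (fst p) (snd p)} \<in> sets (borel \<Otimes>\<^sub>M M)"
proof -
  have [measurable]: "Measurable.pred (borel \<Otimes>\<^sub>M M) (\<lambda>p. avoids a b r (fst p) (snd p))" for a b r
    using avoids_measurable by (simp add: pred_def)
  note [measurable] = L_joint_comp
  show ?thesis unfolding local_growth_def by measurable
qed

text \<open>The time spent in the ball during the interval is \<open>0\<close>, and it is the integral of the
  increments of the local times of its points.\<close>

lemma local_time_constant_on_ball:
  assumes w: "w \<in> space M" and ab: "0 \<le> a'" "a' < b'"
    and oc: "\<forall>t\<ge>0. \<forall>A\<in>sets borel. emeasure lborel {s \<in> {0..t}. X s w \<in> A} = (\<integral>\<^sup>+y\<in>A. ennreal (L t y w) \<partial>\<mu>)"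
    and m: "AE y in \<mu>. 0 \<le> L a' y w \<and> L a' y w \<le> L b' y w"
    and av: "\<And>s. a' \<le> s \<Longrightarrow> s < b' \<Longrightarrow> X s w \<notin> ball d r"
  shows "AE y in \<mu>. y \<in> ball d r \<longrightarrow> L b' y w = L a' y w"
proof -
  let ?B = "ball d r"
  have Bs[measurable]: "?B \<in> sets borel" by simp
  have b0: "0 \<le> b'" using ab by simp
  have mm: "max 0 a' = a'" "max 0 b' = b'" using ab by simp_all
  have [measurable]: "(\<lambda>y. L a' y w) \<in> borel_measurable borel" "(\<lambda>y. L b' y w) \<in> borel_measurable borel"
    using L_joint_comp[of "\<lambda>_. a'" borel "\<lambda>y. y" "\<lambda>_. w"] L_joint_comp[of "\<lambda>_. b'" borel "\<lambda>y. y" "\<lambda>_. w"] w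
    by (simp_all add: mm)
  let ?S = "\<lambda>t. {s\<in>{0..t}. X s w \<in> ?B}"
  have ea: "emeasure lborel (?S a') = (\<integral>\<^sup>+y\<in>?B. ennreal (L a' y w) \<partial>\<mu>)" by (rule oc[rule_format, OF ab(1) Bs])
  have eb: "emeasure lborel (?S b') = (\<integral>\<^sup>+y\<in>?B. ennreal (L b' y w) \<partial>\<mu>)" by (rule oc[rule_format, OF b0 Bs])
  have St: "?S t \<in> sets lborel" for t
  proof -
    have "?S t = {s. 0 \<le> s \<and> X (max 0 s) w \<in> ?B} \<inter> {0..t}" by (auto simp: max_def)
    then show ?thesis using sets_X_time[OF Bs w] by simp
  qed
  have sub: "?S b' \<subseteq> ?S a' \<union> {b'}"
  proof
    fix s assume s: "s \<in> ?S b'"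
    show "s \<in> ?S a' \<union> {b'}"
    proof (cases "s = b'")
      case False
      then have "\<not> a' \<le> s" using av[of s] s by auto
      then show ?thesis using s by auto
    qed simp
  qed
  have "emeasure lborel (?S b') \<le> emeasure lborel (?S a' \<union> {b'})"
    by (rule emeasure_mono[OF sub]) (use St in simp)
  also have "\<dots> \<le> emeasure lborel (?S a') + emeasure lborel {b'}"
    using St by (intro emeasure_subadditive) auto
  finally have le: "(\<integral>\<^sup>+y\<in>?B. ennreal (L b' y w) \<partial>\<mu>) \<le> (\<integral>\<^sup>+y\<in>?B. ennreal (L a' y w) \<partial>\<mu>)"
    unfolding ea eb by simp
  have "emeasure lborel (?S a') \<le> emeasure lborel {0..a'}" by (intro emeasure_mono) auto
  also have "\<dots> < \<infinity>" using ab by simp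
  finally have fin: "(\<integral>\<^sup>+y\<in>?B. ennreal (L a' y w) \<partial>\<mu>) < \<infinity>" unfolding ea .
  have "(\<integral>\<^sup>+y. ennreal (L b' y w) * indicator ?B y - ennreal (L a' y w) * indicator ?B y \<partial>\<mu>)
      = (\<integral>\<^sup>+y\<in>?B. ennreal (L b' y w) \<partial>\<mu>) - (\<integral>\<^sup>+y\<in>?B. ennreal (L a' y w) \<partial>\<mu>)"
  proof (rule nn_integral_diff)
    show "AE y in \<mu>. ennreal (L a' y w) * indicator ?B y \<le> ennreal (L b' y w) * indicator ?B y"
      using m by eventually_elim (auto intro!: mult_right_mono ennreal_leI)
  qed (use fin in auto)
  also have "\<dots> = 0" using le fin by (intro diff_eq_0_ennreal) auto
  finally have z: "(\<integral>\<^sup>+y. ennreal (L b' y w) * indicator ?B y - ennreal (L a' y w) * indicator ?B y \<partial>\<mu>) = 0" .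
  have "AE y in \<mu>. ennreal (L b' y w) * indicator ?B y - ennreal (L a' y w) * indicator ?B y = 0"
    by (rule nn_integral_0_iff_AE[THEN iffD1, OF _ z]) measurable
  with m show ?thesis
  proof eventually_elim
    case (elim y)
    show ?case
    proof
      assume "y \<in> ?B"
      then have "ennreal (L b' y w) - ennreal (L a' y w) = 0" using elim(2) by simp
      then have "ennreal (L b' y w - L a' y w) = 0" using elim(1) by (simp add: ennreal_minus)
      then show "L b' y w = L a' y w" using elim(1) by (simp add: ennreal_eq_0_iff)
    qed
  qed
qed

text \<open>For a path and an interval, balls around the points of a countable dense set cover the points
  from which the path stays away.\<close>

lemma local_growth_AE_AE: "AE w in P x. AE y in \<mu>. local_growth y w"
proof -
  interpret mu: sigma_finite_measure \<mu> by (rule sigma_finite_mu)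
  interpret Px: prob_space "P x" by (rule prob_space_P)
  interpret pair_sigma_finite \<mu> "P x" ..
  note [measurable] = L_joint_comp
  obtain D :: "'a set" where D: "countable D" "\<And>x e. 0 < e \<Longrightarrow> \<exists>d\<in>D. dist x d < e" using separable by blast
  have mono: "AE w in P x. AE y in \<mu>. 0 \<le> L (max 0 (of_rat a)) y w \<and> L (max 0 (of_rat a)) y w \<le> L (max 0 (of_rat b)) y w"
    if ab: "0 \<le> a" "a < b" for a b :: rat
  proof -
    have 1: "0 \<le> (of_rat a :: real)" "(of_rat a :: real) \<le> of_rat b" using ab by (simp_all add: of_rat_less_eq less_imp_le)
    have "AE y in \<mu>. AE w in P x. 0 \<le> L (max 0 (of_rat a)) y w \<and> L (max 0 (of_rat a)) y w \<le> L (max 0 (of_rat b)) y w"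
    proof (rule AE_I2)
      fix y
      show "AE w in P x. 0 \<le> L (max 0 (of_rat a)) y w \<and> L (max 0 (of_rat a)) y w \<le> L (max 0 (of_rat b)) y w"
        using AE_regular_path[where x=x and y=y]
      proof eventually_elim
        case (elim w)
        have "0 \<le> (of_rat b :: real)" using 1 by linarith
        then have "max 0 (of_rat a) = (of_rat a :: real)" "max 0 (of_rat b) = (of_rat b :: real)"
          using 1 by (simp_all only: max_absorb2)
        then show ?case using regular_path_mono[OF elim 1] regular_path_nonneg[OF elim 1(1)] by simp
      qed
    qed
    then show ?thesis
      by (subst (asm) AE_commute) measurable
  qed
  have mono': "AE w in P x. \<forall>a b::rat. 0 \<le> a \<and> a < b \<longrightarrow> (AE y in \<mu>. 0 \<le> L (max 0 (of_rat a)) y w \<and> L (max 0 (of_rat a)) y w \<le> L (max 0 (of_rat b)) y w)"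
    unfolding AE_all_countable
  proof (intro allI)
    fix a b :: rat
    show "AE w in P x. 0 \<le> a \<and> a < b \<longrightarrow> (AE y in \<mu>. 0 \<le> L (max 0 (of_rat a)) y w \<and> L (max 0 (of_rat a)) y w \<le> L (max 0 (of_rat b)) y w)"
    proof (cases "0 \<le> a \<and> a < b")
      case True
      then have "AE w in P x. AE y in \<mu>. 0 \<le> L (max 0 (of_rat a)) y w \<and> L (max 0 (of_rat a)) y w \<le> L (max 0 (of_rat b)) y w"
        using mono by blast
      then show ?thesis by (rule eventually_mono) blast
    next
      case False
      then show ?thesis by (intro AE_I2) blast
    qed
  qed
  have sp: "AE w in P x. w \<in> space M" using AE_space[of "P x"] by (simp add: space_P)
  show ?thesis using occupation_density[where z=x] mono' sp
  proof eventually_elim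
    case (elim w)
    note w = elim(3)
    have "AE y in \<mu>. \<forall>a b r::rat. 0 \<le> a \<and> a < b \<longrightarrow>
        (\<forall>d\<in>D. (\<forall>s. of_rat a \<le> s \<and> s < of_rat b \<longrightarrow> X s w \<notin> ball d (of_rat r / 2)) \<longrightarrow> y \<in> ball d (of_rat r / 2) \<longrightarrow>
          L (max 0 (of_rat b)) y w = L (max 0 (of_rat a)) y w)"
      unfolding AE_all_countable AE_ball_countable[OF D(1)]
    proof (intro allI)
      fix a b r :: rat
      show "AE y in \<mu>. 0 \<le> a \<and> a < b \<longrightarrow>
        (\<forall>d\<in>D. (\<forall>s. of_rat a \<le> s \<and> s < of_rat b \<longrightarrow> X s w \<notin> ball d (of_rat r / 2)) \<longrightarrow> y \<in> ball d (of_rat r / 2) \<longrightarrow>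
          L (max 0 (of_rat b)) y w = L (max 0 (of_rat a)) y w)"
      proof (cases "0 \<le> a \<and> a < b")
        case True
        define a' b' :: real where "a' = of_rat a" and "b' = of_rat b"
        have ab: "0 \<le> a'" "a' < b'" using True by (simp_all add: a'_def b'_def of_rat_less)
        have "AE y in \<mu>. \<forall>d\<in>D. (\<forall>s. a' \<le> s \<and> s < b' \<longrightarrow> X s w \<notin> ball d (of_rat r / 2)) \<longrightarrow> y \<in> ball d (of_rat r / 2) \<longrightarrow>
            L b' y w = L a' y w"
          unfolding AE_ball_countable[OF D(1)]
        proof (intro ballI)
          fix d assume "d \<in> D"
          let ?B = "ball d (of_rat r / 2)"
          show "AE y in \<mu>. (\<forall>s. a' \<le> s \<and> s < b' \<longrightarrow> X s w \<notin> ?B) \<longrightarrow> y \<in> ?B \<longrightarrow> L b' y w = L a' y w"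
          proof (cases "\<forall>s. a' \<le> s \<and> s < b' \<longrightarrow> X s w \<notin> ?B")
            case av: True
            have m: "AE y in \<mu>. 0 \<le> L a' y w \<and> L a' y w \<le> L b' y w"
              using elim(2)[rule_format, of a b] True ab unfolding a'_def b'_def by (simp add: max_absorb2)
            have "AE y in \<mu>. y \<in> ?B \<longrightarrow> L b' y w = L a' y w"
              by (rule local_time_constant_on_ball[OF w ab elim(1) m]) (use av in blast)
            then show ?thesis by (rule eventually_mono) blast
          qed auto
        qed
        then show ?thesis
          by (rule eventually_mono) (use ab in \<open>auto simp: a'_def b'_def max_def\<close>)
      qed auto
    qed
    then show ?case
    proof eventually_elim
      case (elim y)
      show ?case unfolding local_growth_def
      proof (intro allI impI)
        fix a b r :: rat
        assume h: "0 \<le> a \<and> a < b \<and> 0 < r \<and> avoids (of_rat a) (of_rat b) (of_rat r) y w"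
        have r: "0 < (of_rat r :: real)" using h by simp
        obtain d where d: "d \<in> D" "dist y d < of_rat r / 2" using D(2)[of "of_rat r / 2" y] r by auto
        have "X s w \<notin> ball d (of_rat r / 2)" if "of_rat a \<le> s" "s < of_rat b" for s
        proof -
          have "of_rat r \<le> dist (X s w) y"
            using avoids_real[of "of_rat a" "of_rat b" "of_rat r" y w s] h w that by simp
          also have "\<dots> \<le> dist (X s w) d + dist d y" by (rule dist_triangle)
          finally show ?thesis using d by (simp add: dist_commute)
        qed
        moreover have "y \<in> ball d (of_rat r / 2)" using d by (simp add: dist_commute)
        ultimately show "L (max 0 (of_rat b)) y w = L (max 0 (of_rat a)) y w"
          using elim h d(1) by blast
      qed
    qed
  qed
qed

text \<open>Shifting the path by a small positive time loses only a beginning of the interval, which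
  continuity of the local time recovers.\<close>

lemma local_growth_of_shifts:
  assumes w: "regular_path y w" and t: "\<And>n. 0 < \<tau> n" "\<tau> \<longlonglongrightarrow> 0" and g: "\<And>n. local_growth y (\<theta> (\<tau> n) w)"
  shows "local_growth y w"
  unfolding local_growth_def
proof (intro allI impI)
  fix a b r :: rat
  assume h: "0 \<le> a \<and> a < b \<and> 0 < r \<and> avoids (of_rat a) (of_rat b) (of_rat r) y w"
  have wM: "w \<in> space M" using w by (simp add: regular_path_def)
  define a' b' :: real where "a' = of_rat a" and "b' = of_rat b"
  have ab: "0 \<le> a'" "a' < b'" using h by (simp_all add: a'_def b'_def of_rat_less)
  \<comment> \<open>A shift by a time below \<open>c\<close> leaves room for rational times on both sides of \<open>[c, d]\<close>.\<close>
  have const: "L c y w = L d y w" if cd: "a' < c" "c \<le> d" "d < b'" for c d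
  proof -
    have "\<forall>\<^sub>F n in sequentially. \<tau> n < c" using order_tendstoD(2)[OF t(2), of c] ab cd by simp
    then obtain n where n: "\<tau> n < c" by (auto simp: eventually_sequentially)
    define s where "s = \<tau> n"
    have s: "0 < s" "s < c" using n t(1) by (simp_all add: s_def)
    obtain p where p: "max 0 (a' - s) < of_rat p" "of_rat p < c - s"
      using of_rat_dense[of "max 0 (a' - s)" "c - s"] cd s by auto
    obtain q where q: "d - s < of_rat q" "of_rat q < b' - s"
      using of_rat_dense[of "d - s" "b' - s"] cd by auto
    have pq: "0 \<le> p" "p < q"
    proof -
      have "0 < (of_rat p :: real)" using p by simp
      then show "0 \<le> p" by simp
      have "(of_rat p :: real) < of_rat q" using p q cd by linarith
      then show "p < q" by (simp add: of_rat_less)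
    qed
    have "avoids (of_rat p) (of_rat q) (of_rat r) y (\<theta> s w)"
      unfolding avoids_def
    proof (intro allI impI)
      fix u :: rat assume u: "of_rat p \<le> (of_rat u :: real) \<and> (of_rat u :: real) < of_rat q"
      have u0: "0 \<le> (of_rat u :: real)" using u p by linarith
      have "X (of_rat u) (\<theta> s w) = X (of_rat u + s) w" using s u0 wM by (intro shift) auto
      moreover have "of_rat r \<le> dist (X (of_rat u + s) w) y"
        by (rule avoids_real[of a' b']) (use h wM ab u p q in \<open>auto simp: a'_def b'_def\<close>)
      ultimately show "of_rat r \<le> dist (X (max 0 (of_rat u)) (\<theta> s w)) y" using u0 by (simp add: max_def)
    qed
    then have "L (max 0 (of_rat q)) y (\<theta> s w) = L (max 0 (of_rat p)) y (\<theta> s w)"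
      using g[of n] pq h unfolding local_growth_def s_def by blast
    moreover have p0: "0 \<le> (of_rat p :: real)" "0 \<le> (of_rat q :: real)" using pq by auto
    ultimately have eq: "L (s + of_rat q) y w = L (s + of_rat p) y w"
      using regular_path_shift[OF w, of s "of_rat q"] regular_path_shift[OF w, of s "of_rat p"] s by (simp add: max_def)
    have "L (s + of_rat p) y w \<le> L c y w" using regular_path_mono[OF w, of "s + of_rat p" c] p p0 s by simp
    moreover have "L c y w \<le> L d y w" using regular_path_mono[OF w, of c d] cd ab by simp
    moreover have "L d y w \<le> L (s + of_rat q) y w" using regular_path_mono[OF w, of d "s + of_rat q"] q cd ab by simp
    ultimately show ?thesis using eq by linarith
  qed
  define m where "m = (a' + b') / 2"
  have m: "a' < m" "m < b'" using ab by (simp_all add: m_def field_simps)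
  have cont: "continuous_on (closure {a'<..<b'}) (\<lambda>t. L t y w)"
    using w ab unfolding regular_path_def by (auto intro: continuous_on_subset)
  have c1: "L t y w = L m y w" if "t \<in> {a'<..<b'}" for t
  proof (cases "t \<le> m")
    case True
    then show ?thesis using const[of t m] that m by simp
  next
    case False
    then show ?thesis using const[of m t] that m by simp
  qed
  have "L t y w = L m y w" if "t \<in> {a'..b'}" for t
    by (rule continuous_constant_on_closure[OF cont c1]) (use that ab in simp_all)
  then have "L b' y w = L a' y w" using ab by simp
  moreover have "max 0 (of_rat a) = a'" "max 0 (of_rat b) = b'"
    using ab unfolding a'_def[symmetric] b'_def[symmetric] by simp_all
  ultimately show "L (max 0 (of_rat b)) y w = L (max 0 (of_rat a)) y w" by simp
qed

text \<open>As for expectations, the exceptional set of starting points is removed by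
  starting afresh at small times outside of it.\<close>

lemma AE_local_growth: "AE y in \<mu>. \<forall>x. AE w in P x. local_growth y w"
proof -
  interpret mu: sigma_finite_measure \<mu> by (rule sigma_finite_mu)
  interpret mm: pair_sigma_finite \<mu> \<mu> ..
  have sec: "{w \<in> space M. local_growth y w} \<in> sets M" for y
  proof -
    have "Pair y \<in> M \<rightarrow>\<^sub>M borel \<Otimes>\<^sub>M M" by (rule measurable_Pair1') simp
    from measurable_sets[OF this local_growth_measurable]
    have "Pair y -` {p \<in> space (borel \<Otimes>\<^sub>M M). local_growth (fst p) (snd p)} \<inter> space M \<in> sets M" .
    moreover have "Pair y -` {p \<in> space (borel \<Otimes>\<^sub>M M). local_growth (fst p) (snd p)} \<inter> space M = {w \<in> space M. local_growth y w}"
      by (auto simp: space_pair_measure)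
    ultimately show ?thesis by simp
  qed
  let ?e = "\<lambda>x y. emeasure (P x) {w \<in> space M. \<not> local_growth y w}"
  have em: "(\<lambda>p. ?e (fst p) (snd p)) \<in> borel_measurable (borel \<Otimes>\<^sub>M borel)"
  proof -
    have "(\<lambda>p. \<integral>\<^sup>+w. indicator {w \<in> space M. \<not> local_growth (snd p) w} w \<partial>P (fst p)) \<in> borel_measurable (borel \<Otimes>\<^sub>M borel)"
    proof (rule nn_integral_measurable_subprob_algebra2[where N=M])
      have 1: "(\<lambda>q. (snd (fst q), snd q)) \<in> (borel \<Otimes>\<^sub>M borel) \<Otimes>\<^sub>M M \<rightarrow>\<^sub>M borel \<Otimes>\<^sub>M M" by measurable
      have "(\<lambda>z. indicator {p \<in> space (borel \<Otimes>\<^sub>M M). \<not> local_growth (fst p) (snd p)} z) \<in> borel_measurable (borel \<Otimes>\<^sub>M M)"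
        using local_growth_measurable by measurable
      from measurable_compose[OF 1 this]
      show "(\<lambda>(p, w). indicator {w \<in> space M. \<not> local_growth (snd p) w} w) \<in> borel_measurable ((borel \<Otimes>\<^sub>M borel) \<Otimes>\<^sub>M M)"
        by (rule measurable_cong[THEN iffD1, rotated]) (auto simp: space_pair_measure indicator_def)
      show "(\<lambda>p. P (fst p)) \<in> borel \<Otimes>\<^sub>M borel \<rightarrow>\<^sub>M subprob_algebra M" by measurable
    qed
    moreover have "{w \<in> space M. \<not> local_growth y w} \<in> sets M" for y
    proof -
      have "{w \<in> space M. \<not> local_growth y w} = space M - {w \<in> space M. local_growth y w}" by auto
      then show ?thesis using sec[of y] by simp
    qed
    ultimately show ?thesis by (simp add: sets_P)
  qed
  have iff: "(AE w in P x. local_growth y w) \<longleftrightarrow> ?e x y = 0" for x y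
  proof -
    have "{w \<in> space M. \<not> local_growth y w} = space M - {w \<in> space M. local_growth y w}" by auto
    then have "{w \<in> space M. \<not> local_growth y w} \<in> sets M" using sec[of y] by simp
    then show ?thesis by (subst AE_iff_measurable[OF _ refl]) (simp_all add: sets_P space_P)
  qed
  have m: "{p \<in> space (\<mu> \<Otimes>\<^sub>M \<mu>). ?e (fst p) (snd p) = 0} \<in> sets (\<mu> \<Otimes>\<^sub>M \<mu>)"
  proof -
    have "{p \<in> space (borel \<Otimes>\<^sub>M borel). ?e (fst p) (snd p) = 0} \<in> sets (borel \<Otimes>\<^sub>M borel)" using em by measurable
    then show ?thesis
      using sets_pair_measure_cong[OF sets_borel sets_borel] sets_eq_imp_space_eq[OF sets_pair_measure_cong[OF sets_borel sets_borel]] by simp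
  qed
  have "AE x in \<mu>. AE y in \<mu>. ?e x y = 0"
  proof (rule AE_I2)
    fix x
    interpret Px: prob_space "P x" by (rule prob_space_P)
    interpret pair_sigma_finite \<mu> "P x" ..
    have "{p \<in> space (\<mu> \<Otimes>\<^sub>M P x). local_growth (fst p) (snd p)} \<in> sets (\<mu> \<Otimes>\<^sub>M P x)"
      using local_growth_measurable sets_pair_measure_cong[OF sets_borel sets_P] sets_eq_imp_space_eq[OF sets_pair_measure_cong[OF sets_borel sets_P]] by simp
    then have "AE y in \<mu>. AE w in P x. local_growth y w"
      using local_growth_AE_AE[of x] by (subst AE_commute) simp_all
    then show "AE y in \<mu>. ?e x y = 0" unfolding iff .
  qed
  then have "AE y in \<mu>. AE x in \<mu>. ?e x y = 0"
    by (subst (asm) mm.AE_commute) (use m in simp_all)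
  then show ?thesis
  proof eventually_elim
    case (elim y)
    have ym: "(\<lambda>x. ?e x y) \<in> borel_measurable borel"
      using measurable_compose[OF _ em, of "\<lambda>x. (x, y)" borel] by simp
    let ?N = "{x. ?e x y \<noteq> 0}"
    have "?N \<in> sets borel" using ym by measurable
    moreover have "?N = {x \<in> space \<mu>. \<not> (?e x y = 0)}" by (simp add: space_mu)
    ultimately have N: "?N \<in> null_sets \<mu>" using AE_E2[OF elim] by (simp add: null_sets_def sets_borel)
    show ?case
    proof
      fix x
      obtain \<tau> where t: "\<And>n. 0 < \<tau> n" "\<And>n. AE w in P x. X (\<tau> n) w \<notin> ?N" "decseq \<tau>" "\<tau> \<longlonglongrightarrow> 0"
        by (rule null_times_sequence[OF null_set_times[OF N, of x]]) (rule that)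
      have "AE w in P x. local_growth y (\<theta> (\<tau> n) w)" for n
      proof -
        have t0: "0 \<le> \<tau> n" using t(1)[of n] by simp
        note [measurable] = shift_measurable[OF t0] X_measurable[OF t0]
        have bad: "{w \<in> space M. \<not> local_growth y w} \<in> sets M"
        proof -
          have "{w \<in> space M. \<not> local_growth y w} = space M - {w \<in> space M. local_growth y w}" by auto
          then show ?thesis using sec[of y] by simp
        qed
        have sp: "space M \<in> natural_events M X (\<tau> n)" unfolding natural_events_def by (rule sigma_sets_top)
        have "emeasure (P x) (space M \<inter> (\<theta> (\<tau> n) -` {w \<in> space M. \<not> local_growth y w} \<inter> space M)) = (\<integral>\<^sup>+w\<in>space M. ?e (X (\<tau> n) w) y \<partial>P x)"
          by (rule markov_event[OF t0 sp bad])
        also have "\<dots> = (\<integral>\<^sup>+w. 0 \<partial>P x)"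
          using t(2)[of n] by (intro nn_integral_cong_AE) (auto elim!: eventually_mono)
        finally have "emeasure (P x) (\<theta> (\<tau> n) -` {w \<in> space M. \<not> local_growth y w} \<inter> space M) = 0"
          by (simp add: Int_absorb1 Int_commute)
        moreover have "{w \<in> space (P x). \<not> local_growth y (\<theta> (\<tau> n) w)} = \<theta> (\<tau> n) -` {w \<in> space M. \<not> local_growth y w} \<inter> space M"
          using shift_space[OF t0] by (auto simp: space_P)
        moreover have "\<theta> (\<tau> n) -` {w \<in> space M. \<not> local_growth y w} \<inter> space M \<in> sets M"
          using bad by measurable
        ultimately show ?thesis by (intro AE_I[OF subset_refl]) (simp_all add: sets_P)
      qed
      then have "AE w in P x. \<forall>n. local_growth y (\<theta> (\<tau> n) w)" by (simp add: AE_all_countable)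
      with AE_regular_path[where x=x and y=y] show "AE w in P x. local_growth y w"
        by eventually_elim (use local_growth_of_shifts t in blast)
    qed
  qed
qed

end

section \<open>Inverse clocks and Stieltjes measures\<close>

text \<open>A clock vanishes at non-positive times, so that it can be used as the distribution function
  of a measure on the whole line.\<close>

definition clock_fun :: "(real \<Rightarrow> real) \<Rightarrow> bool" where
  "clock_fun A \<longleftrightarrow> mono A \<and> continuous_on UNIV A \<and> (\<forall>s\<le>0. A s = 0)"

definition clock_inv :: "(real \<Rightarrow> real) \<Rightarrow> real \<Rightarrow> real" where
  "clock_inv A t = Inf {s. 0 < s \<and> t < A s}"

text \<open>The times before the total clock mass is exhausted, that is, the life time of the
  time-changed process.\<close>

definition clock_dom :: "(real \<Rightarrow> real) \<Rightarrow> real set" where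
  "clock_dom A = {t. 0 \<le> t \<and> (\<exists>s. t < A s)}"

lemma clock_funD:
  assumes "clock_fun A"
  shows "\<And>x y. x \<le> y \<Longrightarrow> A x \<le> A y" "continuous_on UNIV A" "\<And>s. s \<le> 0 \<Longrightarrow> A s = 0"
proof -
  have d: "mono A \<and> continuous_on UNIV A \<and> (\<forall>s\<le>0. A s = 0)" using assms unfolding clock_fun_def .
  show "\<And>x y. x \<le> y \<Longrightarrow> A x \<le> A y" by (rule monoD[OF d[THEN conjunct1]])
  show "continuous_on UNIV A" by (rule d[THEN conjunct2, THEN conjunct1])
  show "\<And>s. s \<le> 0 \<Longrightarrow> A s = 0" by (rule d[THEN conjunct2, THEN conjunct2, rule_format])
qed

lemma clock_fun_nonneg: assumes A: "clock_fun A" shows "0 \<le> A s"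
proof (cases "s \<le> 0")
  case True
  then show ?thesis using clock_funD(3)[OF A] by simp
next
  case False
  then have "A 0 \<le> A s" by (intro clock_funD(1)[OF A]) simp
  then show ?thesis using clock_funD(3)[OF A, of 0] by simp
qed

lemma clock_fun_pos: assumes A: "clock_fun A" and s: "0 < A s" shows "0 < s"
proof (rule ccontr)
  assume "\<not> 0 < s"
  then have "A s = 0" using clock_funD(3)[OF A] by simp
  with s show False by simp
qed

lemma clock_inv_less_iff:
  assumes A: "clock_fun A" and t: "t \<in> clock_dom A"
  shows "clock_inv A t < s \<longleftrightarrow> t < A s"
proof -
  let ?S = "{s. 0 < s \<and> t < A s}"
  have t0: "0 \<le> t" using t by (simp add: clock_dom_def)
  obtain s0 where s0: "t < A s0" using t unfolding clock_dom_def by blast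
  then have "0 < A s0" using t0 by simp
  then have ne: "?S \<noteq> {}" using s0 clock_fun_pos[OF A] by blast
  have bdd: "bdd_below ?S" by (rule bdd_belowI[of _ 0]) auto
  show ?thesis
  proof
    assume "clock_inv A t < s"
    then obtain u where "t < A u" "u < s" unfolding clock_inv_def using cInf_less_iff[OF ne bdd] by auto
    then show "t < A s" using clock_funD(1)[OF A, of u s] by simp
  next
    assume ts: "t < A s"
    then have "0 < A s" using t0 by simp
    then have s0: "0 < s" by (rule clock_fun_pos[OF A])
    have "open {u. t < A u}" by (intro open_Collect_less continuous_on_const clock_funD(2)[OF A])
    then obtain e where e: "0 < e" "ball s e \<subseteq> {u. t < A u}" using ts unfolding open_contains_ball by blast
    define u where "u = max (s / 2) (s - e / 2)"
    have u: "0 < u" "u < s" "s - u < e" using s0 e by (auto simp: u_def max_def)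
    then have "u \<in> ball s e" by (simp add: dist_real_def)
    then have "u \<in> ?S" using e(2) u by auto
    then have "clock_inv A t \<le> u" unfolding clock_inv_def by (rule cInf_lower[OF _ bdd])
    then show "clock_inv A t < s" using u by simp
  qed
qed

lemma clock_inv_nonneg: assumes A: "clock_fun A" and t: "t \<in> clock_dom A" shows "0 \<le> clock_inv A t"
proof (rule ccontr)
  assume "\<not> ?thesis"
  then have "t < A 0" using clock_inv_less_iff[OF A t, of 0] by simp
  then show False using clock_funD(3)[OF A, of 0] t by (simp add: clock_dom_def)
qed

lemma clock_at_inv: assumes A: "clock_fun A" and t: "t \<in> clock_dom A" shows "A (clock_inv A t) = t"
proof (rule antisym)
  show "A (clock_inv A t) \<le> t" using clock_inv_less_iff[OF A t, of "clock_inv A t"] by simp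
  have "isCont A (clock_inv A t)" using clock_funD(2)[OF A] by (simp add: continuous_on_eq_continuous_at)
  then have "(\<lambda>n. A (clock_inv A t + inverse (real (Suc n)))) \<longlonglongrightarrow> A (clock_inv A t + 0)"
    by (intro isCont_tendsto_compose[where g=A] tendsto_intros LIMSEQ_inverse_real_of_nat) simp
  moreover have "t \<le> A (clock_inv A t + inverse (real (Suc n)))" for n
    using clock_inv_less_iff[OF A t, of "clock_inv A t + inverse (real (Suc n))"] by simp
  ultimately show "t \<le> A (clock_inv A t)" by (intro LIMSEQ_le_const) auto
qed

lemma clock_dom_sets: assumes A: "clock_fun A" shows "clock_dom A \<in> sets borel"
proof -
  have "clock_dom A = (\<Union>n::nat. {0..<A (real n)})"
  proof (intro equalityI subsetI)
    fix t assume "t \<in> clock_dom A"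
    then obtain s where s: "0 \<le> t" "t < A s" by (auto simp: clock_dom_def)
    obtain n where "s \<le> real n" using real_arch_simple by blast
    then have "A s \<le> A (real n)" by (rule clock_funD(1)[OF A])
    with s have "t \<in> {0..<A (real n)}" by simp
    then show "t \<in> (\<Union>n::nat. {0..<A (real n)})" by blast
  qed (auto simp: clock_dom_def)
  then show ?thesis by simp
qed

text \<open>The inverse with the value \<open>0\<close> outside its domain, which is a Borel function on the whole line.\<close>

definition clock_inv0 :: "(real \<Rightarrow> real) \<Rightarrow> real \<Rightarrow> real" where
  "clock_inv0 A t = (if t \<in> clock_dom A then clock_inv A t else 0)"

lemma clock_inv0_measurable: assumes A: "clock_fun A" shows "clock_inv0 A \<in> borel_measurable borel"
proof (rule borel_measurable_iff_less[THEN iffD2], rule allI)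
  fix s
  have "{t \<in> space borel. clock_inv0 A t < s} = (clock_dom A \<inter> {..<A s}) \<union> (if 0 < s then - clock_dom A else {})"
    using clock_inv_less_iff[OF A] by (auto simp: clock_inv0_def)
  then show "{t \<in> space borel. clock_inv0 A t < s} \<in> sets borel" using clock_dom_sets[OF A] by simp
qed

lemma clock_fun_interval:
  assumes A: "clock_fun A"
  shows "\<And>x y. x \<le> y \<Longrightarrow> A x \<le> A y" "\<And>a. continuous (at_right a) A" "\<And>a. isCont A a"
proof -
  show c: "isCont A a" for a using clock_funD(2)[OF A] by (simp add: continuous_on_eq_continuous_at)
  then show "continuous (at_right a) A" for a by (rule continuous_at_imp_continuous_at_within)
qed (rule clock_funD(1)[OF A])

lemma emeasure_clock_Ioc: "clock_fun A \<Longrightarrow> a \<le> b \<Longrightarrow> emeasure (interval_measure A) {a<..b} = ennreal (A b - A a)"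
  by (rule emeasure_interval_measure_Ioc[OF _ clock_fun_interval(1) clock_fun_interval(2)])

lemma sigma_finite_clock: "clock_fun A \<Longrightarrow> sigma_finite_measure (interval_measure A)"
  by (rule sigma_finite_interval_measure[OF clock_fun_interval(1) clock_fun_interval(2)])

lemma emeasure_clock_singleton: assumes "clock_fun A" shows "emeasure (interval_measure A) {a} = 0"
proof -
  have "emeasure (interval_measure A) {a..a} = ennreal (A a - A a)"
    by (rule emeasure_interval_measure_Icc)
      (use clock_fun_interval(1)[OF assms] clock_funD(2)[OF assms] in auto)
  then show ?thesis by simp
qed

lemma measure_eqI_Ioc:
  fixes N1 N2 :: "real measure"
  assumes "sets N1 = sets borel" "sets N2 = sets borel"
    and eq: "\<And>a b. a \<le> b \<Longrightarrow> emeasure N1 {a<..b} = emeasure N2 {a<..b}"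
    and fin: "\<And>a b. emeasure N1 {a<..b} < \<infinity>"
  shows "N1 = N2"
proof (rule measure_eqI_generator_eq[where \<Omega>=UNIV and E="range (\<lambda>(a, b). {a<..b::real})" and A="\<lambda>i. {- real i<..real i}"])
  fix Y assume "Y \<in> range (\<lambda>(a, b). {a<..b::real})"
  then obtain a b where Y: "Y = {a<..b}" by auto
  show "emeasure N1 Y = emeasure N2 Y" unfolding Y using eq[of a b] by (cases "a \<le> b") simp_all
next
  show "(\<Union>i. {- real (i::nat)<..real i}) = UNIV"
    by (rule UN_Ioc_eq_UNIV)
  show "emeasure N1 {- real i<..real i} \<noteq> \<infinity>" for i
    using fin[of "- real i" "real i"] by (rule less_imp_neq)
qed (use assms in \<open>auto simp: borel_sigma_sets_Ioc Int_stable_def\<close>)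

lemma nn_integral_sum_measure:
  fixes m :: "nat \<Rightarrow> real measure" and v :: "nat \<Rightarrow> ennreal"
  assumes m: "\<And>i. sets (m i) = sets borel" and N: "sets N = sets borel"
    and eq: "\<And>B. B \<in> sets borel \<Longrightarrow> emeasure N B = (\<Sum>i. v i * emeasure (m i) B)"
    and f: "f \<in> borel_measurable borel"
  shows "(\<integral>\<^sup>+s. f s \<partial>N) = (\<Sum>i. v i * (\<integral>\<^sup>+s. f s \<partial>m i))"
proof -
  note [measurable_cong] = m N
  show ?thesis using f
  proof (induction f rule: borel_measurable_induct)
    case (cong f g)
    then have "f = g" by auto
    with cong show ?case by simp
  next
    case (set B)
    then show ?case using eq[of B] m N by simp
  next
    case (mult f c)
    have [measurable]: "f \<in> borel_measurable borel" by fact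
    show ?case using mult.IH
      by (simp add: nn_integral_cmult ennreal_suminf_cmult[symmetric] mult.left_commute del: ennreal_suminf_cmult)
  next
    case (add f g)
    have [measurable]: "f \<in> borel_measurable borel" "g \<in> borel_measurable borel" by fact+
    show ?case using add.IH
      by (simp add: nn_integral_add suminf_add distrib_left)
  next
    case (seq U)
    have [measurable]: "\<And>i. U i \<in> borel_measurable borel" by fact
    have inc: "incseq U" by fact
    have mc: "(\<integral>\<^sup>+s. (SUP j. U j) s \<partial>K) = (SUP j. \<integral>\<^sup>+s. U j s \<partial>K)" if "sets K = sets borel" for K
    proof -
      note [measurable_cong] = that
      have "(\<integral>\<^sup>+s. (SUP j. U j) s \<partial>K) = (\<integral>\<^sup>+s. (SUP j. U j s) \<partial>K)" by (simp add: image_comp)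
      also have "\<dots> = (SUP j. \<integral>\<^sup>+s. U j s \<partial>K)" by (rule nn_integral_monotone_convergence_SUP[OF inc]) measurable
      finally show ?thesis .
    qed
    have "(\<Sum>i. v i * (\<integral>\<^sup>+s. (SUP j. U j) s \<partial>m i)) = (\<Sum>i. SUP j. v i * (\<integral>\<^sup>+s. U j s \<partial>m i))"
      by (simp only: mc[OF m] SUP_mult_left_ennreal)
    also have "\<dots> = (SUP j. \<Sum>i. v i * (\<integral>\<^sup>+s. U j s \<partial>m i))"
      by (rule ennreal_suminf_SUP_eq)
        (use inc in \<open>auto simp: incseq_def le_fun_def intro!: mult_left_mono nn_integral_mono\<close>)
    also have "\<dots> = (SUP j. \<integral>\<^sup>+s. U j s \<partial>N)" using seq.IH by simp
    also have "\<dots> = (\<integral>\<^sup>+s. (SUP j. U j) s \<partial>N)" by (rule mc[OF N, symmetric])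
    finally show ?case by simp
  qed
qed

lemma sum_clock_measure:
  assumes A: "clock_fun A" and l: "\<And>i. clock_fun (l i)" and v: "\<And>i. 0 \<le> v i"
    and sum: "\<And>s. ennreal (A s) = (\<Sum>i. ennreal (v i) * ennreal (l i s))" and B: "B \<in> sets borel"
  shows "emeasure (interval_measure A) B = (\<Sum>i. ennreal (v i) * emeasure (interval_measure (l i)) B)"
proof -
  let ?f = "\<lambda>B. \<Sum>i. ennreal (v i) * emeasure (interval_measure (l i)) B"
  define N where "N = measure_of UNIV (sets (borel::real measure)) ?f"
  have sN: "sets N = sets borel" unfolding N_def using sets.sigma_sets_eq[of "borel :: real measure"] by (simp add: sets_measure_of)
  have ca: "countably_additive (sets borel) ?f"
  proof (rule countably_additiveI)
    fix F :: "nat \<Rightarrow> real set" assume F: "range F \<subseteq> sets borel" "disjoint_family F"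
    have "(\<Sum>n. ?f (F n)) = (\<Sum>i. \<Sum>n. ennreal (v i) * emeasure (interval_measure (l i)) (F n))"
      by (rule suminf_swap_ennreal)
    also have "\<dots> = ?f (\<Union>n. F n)"
      using F by (intro suminf_cong) (simp add: suminf_emeasure)
    finally show "(\<Sum>n. ?f (F n)) = ?f (\<Union>n. F n)" .
  qed
  have eN: "emeasure N B = ?f B" if "B \<in> sets borel" for B
    unfolding N_def
    by (rule emeasure_measure_of_sigma)
      (use that ca sets.sigma_algebra_axioms[of "borel :: real measure"] in \<open>auto simp: positive_def\<close>)
  have fs: "(\<Sum>i. ennreal (v i) * ennreal (l i s)) \<noteq> \<infinity>" for s using sum[of s, symmetric] by simp
  have Ioc: "emeasure N {a<..b} = ennreal (A b - A a)" if ab: "a \<le> b" for a b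
  proof -
    have "emeasure N {a<..b} = (\<Sum>i. ennreal (v i) * ennreal (l i b - l i a))"
      using eN[of "{a<..b}"] emeasure_clock_Ioc[OF l ab] by simp
    moreover have "(\<Sum>i. ennreal (v i) * ennreal (l i b - l i a)) + ennreal (A a) = ennreal (A b)"
    proof -
      have "ennreal (v i) * ennreal (l i b - l i a) + ennreal (v i) * ennreal (l i a) = ennreal (v i) * ennreal (l i b)" for i
        using clock_fun_interval(1)[OF l ab, of i] clock_fun_nonneg[OF l, of i a]
        by (simp add: distrib_left[symmetric] ennreal_plus[symmetric] del: ennreal_plus)
      then show ?thesis unfolding sum by (simp add: suminf_add)
    qed
    ultimately have "emeasure N {a<..b} + ennreal (A a) = ennreal (A b - A a) + ennreal (A a)"
      using clock_fun_interval(1)[OF A ab] clock_fun_nonneg[OF A, of a] by (simp add: ennreal_plus[symmetric] del: ennreal_plus)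
    then show ?thesis by (simp add: ennreal_add_left_cancel add.commute)
  qed
  have "interval_measure A = N"
  proof (rule measure_eqI_Ioc)
    fix a b :: real
    show "emeasure (interval_measure A) {a<..b} < \<infinity>"
      using emeasure_clock_Ioc[OF A, of a b] by (cases "a \<le> b") simp_all
    assume "a \<le> b"
    then show "emeasure (interval_measure A) {a<..b} = emeasure N {a<..b}"
      using Ioc emeasure_clock_Ioc[OF A] by simp
  qed (use sN in auto)
  then show ?thesis using eN[OF B] by simp
qed

text \<open>The image of Lebesgue measure under the inverse of a continuous clock is the measure of
  the clock: up to end points, the inverse lies between \<open>a\<close> and \<open>b\<close> exactly when the time
  lies between the values of the clock there.\<close>

lemma clock_change_of_variables:
  assumes A: "clock_fun A" and f[measurable]: "f \<in> borel_measurable borel"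
  shows "(\<integral>\<^sup>+t\<in>clock_dom A. f (clock_inv A t) \<partial>lborel) = (\<integral>\<^sup>+s. f s \<partial>interval_measure A)"
proof -
  note [measurable] = clock_dom_sets[OF A] clock_inv0_measurable[OF A]
  let ?D = "density lborel (indicator (clock_dom A))"
  let ?N = "distr ?D borel (clock_inv0 A)"
  have "(\<integral>\<^sup>+t\<in>clock_dom A. f (clock_inv A t) \<partial>lborel) = (\<integral>\<^sup>+t. indicator (clock_dom A) t * f (clock_inv0 A t) \<partial>lborel)"
    by (intro nn_integral_cong) (auto simp: clock_inv0_def split: split_indicator)
  also have "\<dots> = (\<integral>\<^sup>+s. f s \<partial>?N)"
    by (subst nn_integral_distr) (auto simp: nn_integral_density)
  also have "?N = interval_measure A"
  proof (rule sym, rule measure_eqI_Ioc)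
    fix a b :: real assume ab: "a \<le> b"
    have Aab: "A a \<le> A b" "0 \<le> A a" using clock_fun_interval(1)[OF A ab] clock_fun_nonneg[OF A] by auto
    let ?S = "clock_dom A \<inter> clock_inv0 A -` {a<..b}"
    have S: "?S \<in> sets lborel" using measurable_sets[OF clock_inv0_measurable[OF A], of "{a<..b}"] by simp
    have "emeasure ?N {a<..b} = emeasure ?D (clock_inv0 A -` {a<..b})"
      by (subst emeasure_distr) auto
    also have "\<dots> = emeasure lborel ?S"
      using measurable_sets[OF clock_inv0_measurable[OF A], of "{a<..b}"]
      by (subst emeasure_density) (auto simp: indicator_inter_arith[symmetric] nn_integral_indicator)
    finally have e: "emeasure ?N {a<..b} = emeasure lborel ?S" .
    have "?S \<subseteq> {A a..A b}"
    proof
      fix t assume "t \<in> ?S"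
      then have t: "t \<in> clock_dom A" "a < clock_inv A t" "clock_inv A t \<le> b" by (auto simp: clock_inv0_def)
      have "A (clock_inv A t) \<le> A b" by (rule clock_fun_interval(1)[OF A t(3)])
      moreover have "\<not> t < A a" using clock_inv_less_iff[OF A t(1), of a] t(2) by simp
      ultimately show "t \<in> {A a..A b}" using clock_at_inv[OF A t(1)] by simp
    qed
    then have "emeasure lborel ?S \<le> ennreal (A b - A a)"
      using emeasure_mono[of ?S "{A a..A b}" lborel] Aab by simp
    moreover have "{A a<..<A b} \<subseteq> ?S"
    proof
      fix t assume t: "t \<in> {A a<..<A b}"
      then have d: "t \<in> clock_dom A" using Aab by (auto simp: clock_dom_def)
      have "clock_inv A t < b" using clock_inv_less_iff[OF A d, of b] t by simp
      moreover have "a < clock_inv A t"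
      proof (rule ccontr)
        assume "\<not> a < clock_inv A t"
        then have "A (clock_inv A t) \<le> A a" by (intro clock_fun_interval(1)[OF A]) simp
        with clock_at_inv[OF A d] t show False by simp
      qed
      ultimately show "t \<in> ?S" using d by (simp add: clock_inv0_def)
    qed
    then have "ennreal (A b - A a) \<le> emeasure lborel ?S"
      using emeasure_mono[of "{A a<..<A b}" ?S lborel] S Aab by simp
    ultimately show "emeasure (interval_measure A) {a<..b} = emeasure ?N {a<..b}"
      unfolding e using emeasure_clock_Ioc[OF A ab] by simp
  next
    fix a b :: real
    show "emeasure (interval_measure A) {a<..b} < \<infinity>"
      using emeasure_clock_Ioc[OF A, of a b] by (cases "a \<le> b") simp_all
  qed auto
  finally show ?thesis by simp
qed

text \<open>Integration by parts, in the form of Fubini's theorem for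
  \<open>e\<^sup>-\<^sup>k\<^sup>s = \<integral>\<^sub>s\<^sup>\<infinity> k e\<^sup>-\<^sup>k\<^sup>u du\<close>.\<close>

lemma clock_exp_tail:
  assumes l: "clock_fun l" and k: "0 < k"
  shows "(\<integral>\<^sup>+s. ennreal (exp (- k * s)) * indicator {r<..} s \<partial>interval_measure l)
    = (\<integral>\<^sup>+u\<in>{r..}. ennreal (k * exp (- k * u) * (l u - l r)) \<partial>lborel)"
proof -
  interpret m: sigma_finite_measure "interval_measure l" by (rule sigma_finite_clock[OF l])
  interpret pair_sigma_finite "interval_measure l" lborel ..
  have lm[measurable]: "l \<in> borel_measurable borel"
    by (intro borel_measurable_continuous_onI clock_funD(2)[OF l])
  define F where "F s u = (if r < s \<and> s \<le> u then ennreal (k * exp (- k * u)) else 0)" for s u :: real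
  have Fm[measurable]: "(\<lambda>(s, u). F s u) \<in> borel_measurable (borel \<Otimes>\<^sub>M borel)" unfolding F_def by measurable
  have e: "ennreal (exp (- k * s)) * indicator {r<..} s = (\<integral>\<^sup>+u. F s u \<partial>lborel)" for s
  proof (cases "r < s")
    case True
    have "ennreal (exp (- k * s)) = (\<integral>\<^sup>+t. ennreal (k * exp (- k * t)) * indicator {s<..} t \<partial>lborel)"
      using nn_integral_exp_tail[OF k] by simp
    also have "\<dots> = (\<integral>\<^sup>+u. F s u \<partial>lborel)"
    proof (rule nn_integral_cong_AE)
      have "AE t in lborel. t \<noteq> s" by (rule AE_lborel_singleton)
      then show "AE t in lborel. ennreal (k * exp (- k * t)) * indicator {s<..} t = F s t"
        by eventually_elim (use True in \<open>auto simp: F_def split: split_indicator\<close>)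
    qed
    finally show ?thesis using True by simp
  qed (simp add: F_def)
  have "(\<integral>\<^sup>+s. ennreal (exp (- k * s)) * indicator {r<..} s \<partial>interval_measure l) = (\<integral>\<^sup>+s. \<integral>\<^sup>+u. F s u \<partial>lborel \<partial>interval_measure l)"
    by (simp only: e)
  also have "\<dots> = (\<integral>\<^sup>+u. \<integral>\<^sup>+s. F s u \<partial>interval_measure l \<partial>lborel)"
    by (rule Fubini'[symmetric]) measurable
  also have "\<dots> = (\<integral>\<^sup>+u\<in>{r..}. ennreal (k * exp (- k * u) * (l u - l r)) \<partial>lborel)"
  proof (rule nn_integral_cong)
    fix u :: real
    show "(\<integral>\<^sup>+s. F s u \<partial>interval_measure l) = ennreal (k * exp (- k * u) * (l u - l r)) * indicator {r..} u"
    proof (cases "r \<le> u")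
      case True
      have "(\<integral>\<^sup>+s. F s u \<partial>interval_measure l) = (\<integral>\<^sup>+s. ennreal (k * exp (- k * u)) * indicator {r<..u} s \<partial>interval_measure l)"
        by (intro nn_integral_cong) (auto simp: F_def split: split_indicator)
      also have "\<dots> = ennreal (k * exp (- k * u)) * ennreal (l u - l r)"
        using emeasure_clock_Ioc[OF l True] by (simp add: nn_integral_cmult_indicator)
      finally show ?thesis using True k clock_fun_interval(1)[OF l True] by (simp add: ennreal_mult)
    next
      case False
      then have "F s u = 0" for s by (simp add: F_def)
      with False show ?thesis by simp
    qed
  qed
  finally show ?thesis .
qed

lemma clock_fun_AE_pos: assumes l: "clock_fun l" shows "AE s in interval_measure l. 0 < s"
proof -
  have "AE s in interval_measure l. \<forall>n::nat. s \<notin> {- real n<..0}"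
    unfolding AE_all_countable
  proof
    fix n :: nat
    have "emeasure (interval_measure l) {- real n<..0} = 0"
      using emeasure_clock_Ioc[OF l, of "- real n" 0] clock_funD(3)[OF l] by simp
    then have "{- real n<..0} \<in> null_sets (interval_measure l)" by (simp add: null_sets_def)
    then show "AE s in interval_measure l. s \<notin> {- real n<..0}" by (rule AE_not_in)
  qed
  then show ?thesis
  proof eventually_elim
    case (elim s)
    obtain n where "- s < real n" using reals_Archimedean2 by blast
    then show ?case using elim[rule_format, of n] by auto
  qed
qed

text \<open>Killing at an independent exponential level of rate \<open>b\<close> of the clock \<open>A\<close>: the discounted mass
  of \<open>l\<close> splits into the part before the killing time and the part after it, because
  \<open>1 - exp (- b * A s)\<close> is the integral of \<open>b * exp (- b * t)\<close> over \<open>0 \<le> t < A s\<close>.\<close>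

lemma clock_killing_decomposition:
  assumes A: "clock_fun A" and l: "clock_fun l" and b: "0 < b"
  shows "(\<integral>\<^sup>+s. ennreal (exp (- k * s)) \<partial>interval_measure l) =
    (\<integral>\<^sup>+s. ennreal (exp (- k * s) * exp (- b * A s)) \<partial>interval_measure l) +
    (\<integral>\<^sup>+t\<in>clock_dom A. ennreal (b * exp (- b * t)) *
        (\<integral>\<^sup>+s. ennreal (exp (- k * s)) * indicator {clock_inv A t<..} s \<partial>interval_measure l) \<partial>lborel)"
proof -
  interpret m: sigma_finite_measure "interval_measure l" by (rule sigma_finite_clock[OF l])
  interpret pair_sigma_finite "interval_measure l" lborel ..
  note [measurable] = clock_dom_sets[OF A] clock_inv0_measurable[OF A]
  have Am[measurable]: "A \<in> borel_measurable borel"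
    by (intro borel_measurable_continuous_onI clock_funD(2)[OF A])
  define F where "F s t = ennreal (exp (- k * s)) * (ennreal (b * exp (- b * t)) * (if t \<in> clock_dom A \<and> clock_inv0 A t < s then 1 else 0))" for s t :: real
  have Fm[measurable]: "(\<lambda>(s, t). F s t) \<in> borel_measurable (borel \<Otimes>\<^sub>M borel)" unfolding F_def by measurable
  have one: "ennreal (exp (- b * A s)) + (\<integral>\<^sup>+t. ennreal (b * exp (- b * t)) * indicator {0..<A s} t \<partial>lborel) = 1" for s
  proof -
    have As: "0 \<le> A s" by (rule clock_fun_nonneg[OF A])
    have "(\<integral>\<^sup>+t. ennreal (b * exp (- b * t)) * indicator {0..<A s} t \<partial>lborel) = (\<integral>\<^sup>+t. ennreal (b * exp (- b * t)) * indicator {0..A s} t \<partial>lborel)"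
    proof (rule nn_integral_cong_AE)
      have "AE t in lborel. t \<noteq> A s" by (rule AE_lborel_singleton)
      then show "AE t in lborel. ennreal (b * exp (- b * t)) * indicator {0..<A s} t = ennreal (b * exp (- b * t)) * indicator {0..A s} t"
        by eventually_elim (auto split: split_indicator)
    qed
    also have "\<dots> = ennreal (- exp (- b * A s) - (- exp (- b * 0)))"
      by (rule nn_integral_FTC_Icc) (use As b in \<open>auto intro!: derivative_eq_intros\<close>)
    finally have "(\<integral>\<^sup>+t. ennreal (b * exp (- b * t)) * indicator {0..<A s} t \<partial>lborel) = ennreal (1 - exp (- b * A s))" by simp
    moreover have "exp (- b * A s) \<le> 1" using As b by simp
    ultimately show ?thesis by (simp add: ennreal_plus[symmetric] del: ennreal_plus)
  qed
  have inner: "ennreal (exp (- k * s)) * (\<integral>\<^sup>+t. ennreal (b * exp (- b * t)) * indicator {0..<A s} t \<partial>lborel) = (\<integral>\<^sup>+t. F s t \<partial>lborel)" for s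
  proof -
    have "(\<integral>\<^sup>+t. F s t \<partial>lborel) = (\<integral>\<^sup>+t. ennreal (exp (- k * s)) * (ennreal (b * exp (- b * t)) * indicator {0..<A s} t) \<partial>lborel)"
    proof (rule nn_integral_cong)
      fix t :: real
      have "(t \<in> clock_dom A \<and> clock_inv0 A t < s) \<longleftrightarrow> t \<in> {0..<A s}"
      proof
        assume h: "t \<in> clock_dom A \<and> clock_inv0 A t < s"
        then have "t < A s" using clock_inv_less_iff[OF A, of t s] by (auto simp: clock_inv0_def)
        moreover have "0 \<le> t" using h by (simp add: clock_dom_def)
        ultimately show "t \<in> {0..<A s}" by simp
      next
        assume t: "t \<in> {0..<A s}"
        then have d: "t \<in> clock_dom A" by (auto simp: clock_dom_def)
        then show "t \<in> clock_dom A \<and> clock_inv0 A t < s" using clock_inv_less_iff[OF A d, of s] t by (simp add: clock_inv0_def)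
      qed
      then show "F s t = ennreal (exp (- k * s)) * (ennreal (b * exp (- b * t)) * indicator {0..<A s} t)"
        by (simp add: F_def indicator_def)
    qed
    also have "\<dots> = ennreal (exp (- k * s)) * (\<integral>\<^sup>+t. ennreal (b * exp (- b * t)) * indicator {0..<A s} t \<partial>lborel)"
      by (rule nn_integral_cmult) measurable
    finally show ?thesis by simp
  qed
  have "(\<integral>\<^sup>+s. ennreal (exp (- k * s)) \<partial>interval_measure l) =
      (\<integral>\<^sup>+s. ennreal (exp (- k * s) * exp (- b * A s)) + (\<integral>\<^sup>+t. F s t \<partial>lborel) \<partial>interval_measure l)"
  proof (rule nn_integral_cong)
    fix s
    have "ennreal (exp (- k * s)) = ennreal (exp (- k * s)) * (ennreal (exp (- b * A s)) + (\<integral>\<^sup>+t. ennreal (b * exp (- b * t)) * indicator {0..<A s} t \<partial>lborel))"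
      by (simp only: one mult_1_right)
    then show "ennreal (exp (- k * s)) = ennreal (exp (- k * s) * exp (- b * A s)) + (\<integral>\<^sup>+t. F s t \<partial>lborel)"
      by (simp only: distrib_left inner ennreal_mult exp_ge_zero)
  qed
  also have "\<dots> = (\<integral>\<^sup>+s. ennreal (exp (- k * s) * exp (- b * A s)) \<partial>interval_measure l) + (\<integral>\<^sup>+s. \<integral>\<^sup>+t. F s t \<partial>lborel \<partial>interval_measure l)"
    by (rule nn_integral_add) measurable
  also have "(\<integral>\<^sup>+s. \<integral>\<^sup>+t. F s t \<partial>lborel \<partial>interval_measure l) = (\<integral>\<^sup>+t. \<integral>\<^sup>+s. F s t \<partial>interval_measure l \<partial>lborel)"
    by (rule Fubini'[symmetric]) measurable
  also have "\<dots> = (\<integral>\<^sup>+t\<in>clock_dom A. ennreal (b * exp (- b * t)) *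
        (\<integral>\<^sup>+s. ennreal (exp (- k * s)) * indicator {clock_inv A t<..} s \<partial>interval_measure l) \<partial>lborel)"
  proof (rule nn_integral_cong)
    fix t :: real
    have "(\<integral>\<^sup>+s. F s t \<partial>interval_measure l) = (\<integral>\<^sup>+s. (ennreal (b * exp (- b * t)) * indicator (clock_dom A) t) * (ennreal (exp (- k * s)) * indicator {clock_inv A t<..} s) \<partial>interval_measure l)"
      by (intro nn_integral_cong) (auto simp: F_def clock_inv0_def mult_ac split: split_indicator)
    also have "\<dots> = (ennreal (b * exp (- b * t)) * indicator (clock_dom A) t) * (\<integral>\<^sup>+s. ennreal (exp (- k * s)) * indicator {clock_inv A t<..} s \<partial>interval_measure l)"
      by (rule nn_integral_cmult) measurable
    finally show "(\<integral>\<^sup>+s. F s t \<partial>interval_measure l) = ennreal (b * exp (- b * t)) *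
        (\<integral>\<^sup>+s. ennreal (exp (- k * s)) * indicator {clock_inv A t<..} s \<partial>interval_measure l) * indicator (clock_dom A) t"
      by (simp only: mult_ac)
  qed
  finally show ?thesis .
qed

text \<open>The times at which the path is away from \<open>y\<close> are covered, up to the countably many left
  ends of intervals, by rational intervals on which \<open>l\<close> is constant. A continuous clock does not charge
  countable sets.\<close>

lemma clock_supported_on_level:
  fixes x :: "real \<Rightarrow> 'b::metric_space"
  assumes l: "clock_fun l" and rc: "\<And>s. 0 \<le> s \<Longrightarrow> (x \<longlongrightarrow> x s) (at_right s)"
    and growth: "\<And>a b r::rat. 0 \<le> a \<Longrightarrow> a < b \<Longrightarrow> 0 < r \<Longrightarrow> (\<forall>s. of_rat a \<le> s \<and> s < of_rat b \<longrightarrow> of_rat r \<le> dist (x s) y) \<Longrightarrow>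
      l (of_rat b) = l (of_rat a)"
  shows "AE s in interval_measure l. x s = y"
proof -
  let ?m = "interval_measure l"
  define U where "U = (\<Union>(a, b)\<in>{(a, b). l (of_rat a) = l (of_rat b) \<and> (a::rat) < b}. {of_rat a<..<of_rat b :: real})"
  have "AE s in ?m. \<forall>p::rat \<times> rat. l (of_rat (fst p)) = l (of_rat (snd p)) \<and> fst p < snd p \<longrightarrow> s \<notin> {of_rat (fst p)<..<of_rat (snd p)}"
    unfolding AE_all_countable
  proof
    fix p :: "rat \<times> rat"
    show "AE s in ?m. l (of_rat (fst p)) = l (of_rat (snd p)) \<and> fst p < snd p \<longrightarrow> s \<notin> {of_rat (fst p)<..<of_rat (snd p)}"
    proof (cases "l (of_rat (fst p)) = l (of_rat (snd p)) \<and> fst p < snd p")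
      case True
      have "emeasure ?m {of_rat (fst p)<..of_rat (snd p)} = 0"
        using emeasure_clock_Ioc[OF l, of "of_rat (fst p)" "of_rat (snd p)"] True by (simp add: of_rat_less_eq)
      then have "{of_rat (fst p)<..of_rat (snd p)} \<in> null_sets ?m" by (simp add: null_sets_def)
      then have "AE s in ?m. s \<notin> {of_rat (fst p)<..of_rat (snd p)}" by (rule AE_not_in)
      then show ?thesis by (rule eventually_mono) auto
    qed auto
  qed
  then have nU: "AE s in ?m. s \<notin> U" by (rule eventually_mono) (auto simp: U_def)
  let ?C = "{s. 0 \<le> s \<and> x s \<noteq> y} - U"
  have "\<exists>q::rat. s < of_rat q \<and> {s<..<of_rat q} \<subseteq> U" if s: "0 \<le> s" "x s \<noteq> y" for s
  proof -
    define e where "e = dist (x s) y"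
    have e: "0 < e" using s by (simp add: e_def)
    obtain r :: rat where r: "0 < (of_rat r :: real)" "of_rat r < e / 2" using of_rat_dense[of 0 "e / 2"] e by auto
    have "\<forall>\<^sub>F u in at_right s. dist (x u) (x s) < e / 2" using rc[OF s(1)] e by (intro tendstoD) auto
    then obtain d where d: "s < d" "\<And>u. s < u \<Longrightarrow> u < d \<Longrightarrow> dist (x u) (x s) < e / 2"
      unfolding eventually_at_right_field by blast
    obtain q :: rat where q: "s < of_rat q" "of_rat q < d" using of_rat_dense[OF d(1)] by auto
    have far: "of_rat r \<le> dist (x u) y" if "s < u" "u < d" for u
    proof -
      have "e \<le> dist (x s) (x u) + dist (x u) y" unfolding e_def by (rule dist_triangle)
      then show ?thesis using d(2)[OF that] r by (simp add: dist_commute)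
    qed
    have "{s<..<of_rat q} \<subseteq> U"
    proof
      fix u assume u: "u \<in> {s<..<of_rat q :: real}"
      obtain a :: rat where a: "s < of_rat a" "of_rat a < u" using of_rat_dense[of s u] u by auto
      obtain b :: rat where b: "u < of_rat b" "of_rat b < (of_rat q :: real)" using of_rat_dense[of u "of_rat q"] u by auto
      have "(0::real) < of_rat a" "(of_rat a :: real) < of_rat b" using a b s(1) by linarith+
      then have ab: "0 \<le> a" "a < b" by (auto simp: of_rat_less)
      have "l (of_rat b) = l (of_rat a)"
        by (rule growth[OF ab, of r]) (use r far a b q in auto)
      then show "u \<in> U" unfolding U_def using ab a b by (intro UN_I[of "(a, b)"]) auto
    qed
    with q(1) show ?thesis by blast
  qed
  then obtain f where f: "\<And>s. 0 \<le> s \<Longrightarrow> x s \<noteq> y \<Longrightarrow> s < of_rat (f s) \<and> {s<..<of_rat (f s)} \<subseteq> U" by metis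
  have "inj_on f ?C"
  proof (rule linorder_inj_onI)
    fix s u assume su: "s < u" "s \<in> ?C" "u \<in> ?C"
    show "f s \<noteq> f u"
    proof
      assume "f s = f u"
      then have "u \<in> {s<..<of_rat (f s)}" using f[of u] su by auto
      then have "u \<in> U" using f[of s] su by auto
      with su show False by simp
    qed
  qed auto
  then have "countable ?C" using countableI' by (metis countable_image_inj_eq countableI_type)
  then have "?C \<in> null_sets ?m"
  proof -
    assume c: "countable ?C"
    have "(\<Union>s\<in>?C. {s}) \<in> null_sets ?m"
      by (intro null_sets_UN'[OF c]) (simp add: null_sets_def emeasure_clock_singleton[OF l])
    then show ?thesis by simp
  qed
  then have "AE s in ?m. s \<notin> ?C" by (rule AE_not_in)
  with nU clock_fun_AE_pos[OF l] show ?thesis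
    by eventually_elim auto
qed

section \<open>The Poisson atoms\<close>

locale fin_points = poisson_point_process W \<xi> "fin_intensity \<alpha> \<mu>"
  for W :: "'w measure" and \<xi> :: "nat \<Rightarrow> 'w \<Rightarrow> real \<times> 'a::metric_space" and \<alpha> :: real and \<mu> :: "'a measure" +
  assumes alpha: "0 < \<alpha>" "\<alpha> < 1" and sigma_mu: "sigma_finite_measure \<mu>" and mu_borel: "sets \<mu> = sets borel"
begin

text \<open>The first marginal of the intensity: \<open>fin_intensity\<close> of a rectangle is the product of this
  measure and \<open>\<mu>\<close>.\<close>

definition weight_intensity :: "real set \<Rightarrow> ennreal" where
  "weight_intensity V = (\<integral>\<^sup>+v\<in>V. ennreal (indicator {0<..} v * (\<alpha> * v powr (- 1 - \<alpha>))) \<partial>lborel)"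

lemma sets_intensity: "sets (fin_intensity \<alpha> \<mu>) = sets (borel \<Otimes>\<^sub>M borel)"
  unfolding fin_intensity_def by (intro sets_pair_measure_cong) (simp_all add: mu_borel)

lemma intensity_rectangle:
  assumes "V \<in> sets borel" "B \<in> sets borel"
  shows "emeasure (fin_intensity \<alpha> \<mu>) (V \<times> B) = weight_intensity V * emeasure \<mu> B" "V \<times> B \<in> sets (fin_intensity \<alpha> \<mu>)"
proof -
  interpret sigma_finite_measure \<mu> by (rule sigma_mu)
  have "emeasure (fin_intensity \<alpha> \<mu>) (V \<times> B) = emeasure (density lborel (\<lambda>v. ennreal (indicator {0<..} v * (\<alpha> * v powr (- 1 - \<alpha>))))) V * emeasure \<mu> B"
    unfolding fin_intensity_def using assms by (intro emeasure_pair_measure_Times) (simp_all add: mu_borel)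
  also have "emeasure (density lborel (\<lambda>v. ennreal (indicator {0<..} v * (\<alpha> * v powr (- 1 - \<alpha>))))) V = weight_intensity V"
    unfolding weight_intensity_def using assms by (subst emeasure_density) auto
  finally show "emeasure (fin_intensity \<alpha> \<mu>) (V \<times> B) = weight_intensity V * emeasure \<mu> B" .
  show "V \<times> B \<in> sets (fin_intensity \<alpha> \<mu>)" unfolding sets_intensity using assms by simp
qed

lemma powr_shift: "v powr (- \<alpha> - 1) = v powr (- 1 - \<alpha>)"
  by (rule arg_cong[where f="\<lambda>a. v powr a"]) simp

lemma dyadic_powr: "((1/2) ^ n) powr (- \<alpha>) = (2 powr \<alpha>) ^ n"
proof -
  have "(1/2 :: real) ^ n = 2 powr (- real n)"
    by (simp add: powr_minus powr_realpow power_one_over inverse_eq_divide)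
  then have "((1/2) ^ n) powr (- \<alpha>) = 2 powr (\<alpha> * real n)" by (simp add: powr_powr mult.commute)
  also have "\<dots> = (2 powr \<alpha>) powr real n" by (simp add: powr_powr)
  also have "\<dots> = (2 powr \<alpha>) ^ n" by (rule powr_realpow) simp
  finally show ?thesis .
qed

lemma weight_intensity_Ioc: assumes "0 < a" "a \<le> b" shows "weight_intensity {a<..b} = ennreal (a powr (- \<alpha>) - b powr (- \<alpha>))"
proof -
  have "weight_intensity {a<..b} = (\<integral>\<^sup>+v. ennreal (\<alpha> * v powr (- 1 - \<alpha>)) * indicator {a..b} v \<partial>lborel)"
    unfolding weight_intensity_def
  proof (rule nn_integral_cong_AE)
    have "AE v in lborel. v \<noteq> a" by (rule AE_lborel_singleton)
    then show "AE v in lborel. ennreal (indicator {0<..} v * (\<alpha> * v powr (- 1 - \<alpha>))) * indicator {a<..b} v = ennreal (\<alpha> * v powr (- 1 - \<alpha>)) * indicator {a..b} v"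
      by eventually_elim (use assms in \<open>auto split: split_indicator\<close>)
  qed
  also have "\<dots> = ennreal (- (b powr (- \<alpha>)) - (- (a powr (- \<alpha>))))"
  proof (rule nn_integral_FTC_Icc)
    fix v assume "v \<in> {a..b}"
    then have "0 < v" using assms by simp
    then show "((\<lambda>v. - (v powr (- \<alpha>))) has_real_derivative \<alpha> * v powr (- 1 - \<alpha>)) (at v)"
      by (auto intro!: derivative_eq_intros simp: powr_shift)
  qed (use assms alpha in auto)
  finally show ?thesis by simp
qed

lemma weight_intensity_large: "weight_intensity {1<..} \<le> 1"
proof -
  have "weight_intensity {1<..} \<le> (\<integral>\<^sup>+v. ennreal (\<alpha> * v powr (- 1 - \<alpha>)) * indicator {1..} v \<partial>lborel)"
    unfolding weight_intensity_def by (rule nn_integral_mono) (auto split: split_indicator)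
  also have "\<dots> = ennreal (0 - (- (1 powr (- \<alpha>))))"
  proof (rule nn_integral_FTC_atLeast)
    fix v :: real assume "1 \<le> v"
    then have "0 < v" by simp
    then show "((\<lambda>v. - (v powr (- \<alpha>))) has_real_derivative \<alpha> * v powr (- 1 - \<alpha>)) (at v)"
      by (auto intro!: derivative_eq_intros simp: powr_shift)
    show "0 \<le> \<alpha> * v powr (- 1 - \<alpha>)" using alpha by simp
  next
    have "((\<lambda>v. v powr (- \<alpha>)) \<longlongrightarrow> 0) at_top"
      by (rule tendsto_neg_powr) (use alpha in \<open>auto simp: filterlim_ident\<close>)
    from tendsto_minus[OF this] show "((\<lambda>v. - (v powr (- \<alpha>))) \<longlongrightarrow> 0) at_top" by simp
  qed auto
  finally show ?thesis by simp
qed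

lemma points_measurable_snd: "(\<lambda>\<omega>. snd (\<xi> i \<omega>)) \<in> W \<rightarrow>\<^sub>M borel" and points_measurable_pair: "\<xi> i \<in> W \<rightarrow>\<^sub>M borel \<Otimes>\<^sub>M borel"
proof -
  show "\<xi> i \<in> W \<rightarrow>\<^sub>M borel \<Otimes>\<^sub>M borel"
    using points_measurable[of i] by (simp cong: measurable_cong_sets add: sets_intensity)
  from measurable_compose[OF this measurable_snd] show "(\<lambda>\<omega>. snd (\<xi> i \<omega>)) \<in> W \<rightarrow>\<^sub>M borel" .
qed

lemma point_count_eq: "point_count \<xi> B \<omega> = (\<Sum>i. indicator B (\<xi> i \<omega>))"
proof -
  have "point_count \<xi> B \<omega> = (\<integral>\<^sup>+i. indicator {i. \<xi> i \<omega> \<in> B} i \<partial>count_space UNIV)"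
    unfolding point_count_def by simp
  also have "\<dots> = (\<Sum>i. indicator {i. \<xi> i \<omega> \<in> B} i)" by (rule nn_integral_count_space_nat)
  also have "\<dots> = (\<Sum>i. indicator B (\<xi> i \<omega>))" by (intro suminf_cong) (simp add: indicator_def)
  finally show ?thesis .
qed

lemma point_count_measurable:
  assumes B: "B \<in> sets (borel \<Otimes>\<^sub>M borel)"
  shows "point_count \<xi> B \<in> borel_measurable W"
proof -
  have [measurable]: "(\<lambda>\<omega>. indicator B (\<xi> i \<omega>) :: ennreal) \<in> borel_measurable W" for i
    using measurable_compose[OF points_measurable_pair borel_measurable_indicator[OF B]] .
  show ?thesis unfolding point_count_eq[abs_def] by measurable
qed

lemma avoid_null_set:
  assumes Z: "Z \<in> null_sets \<mu>"
  shows "AE \<omega> in W. \<forall>i. snd (\<xi> i \<omega>) \<notin> Z"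
proof -
  have Zs: "Z \<in> sets borel" using Z mu_borel by auto
  have r: "emeasure (fin_intensity \<alpha> \<mu>) (UNIV \<times> Z) = 0" "UNIV \<times> Z \<in> sets (fin_intensity \<alpha> \<mu>)"
    using intensity_rectangle[of UNIV Z] Zs null_setsD1[OF Z] by simp_all
  have "prob {\<omega> \<in> space W. point_count \<xi> (UNIV \<times> Z) \<omega> = of_nat 0} = 1"
    using poisson_counts[OF r(2), of 0] r(1) by (simp add: measure_def)
  moreover have "{\<omega> \<in> space W. point_count \<xi> (UNIV \<times> Z) \<omega> = of_nat 0} \<in> events"
    using point_count_measurable[of "UNIV \<times> Z"] Zs by measurable
  ultimately have "AE \<omega> in W. point_count \<xi> (UNIV \<times> Z) \<omega> = 0"
    by (subst (asm) prob_Collect_eq_1) simp_all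
  then show ?thesis
  proof eventually_elim
    case (elim \<omega>)
    then have "{i. \<xi> i \<omega> \<in> UNIV \<times> Z} = {}" unfolding point_count_def by (subst (asm) emeasure_count_space_eq_0) auto
    then show ?case by (auto simp: mem_Times_iff)
  qed
qed

text \<open>The number of points with weight in \<open>(2\<^sup>-\<^sup>n, 1]\<close> is Poisson with a parameter that
  tends to infinity with \<open>n\<close>.\<close>

lemma hits_set:
  assumes B[measurable]: "B \<in> sets borel" and pos: "0 < emeasure \<mu> B" and fin: "emeasure \<mu> B < \<infinity>"
  shows "AE \<omega> in W. \<exists>i. snd (\<xi> i \<omega>) \<in> B"
proof -
  note [measurable] = points_measurable_snd
  let ?E = "{\<omega> \<in> space W. \<forall>i. snd (\<xi> i \<omega>) \<notin> B}"
  have E[measurable]: "?E \<in> events" by measurable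
  define b where "b = measure \<mu> B"
  have b1: "emeasure \<mu> B = ennreal b" using fin by (simp add: b_def emeasure_eq_ennreal_measure less_top)
  have b2: "0 < b" using pos unfolding b1 by simp
  note b = b1 b2
  have le: "prob ?E \<le> exp (- ((((1/2)^n) powr (- \<alpha>) - 1) * b))" for n
  proof -
    let ?R = "{(1/2)^n<..1} \<times> B"
    let ?c = "((1/2)^n) powr (- \<alpha>) - 1 :: real"
    have c0: "0 \<le> ?c" using ge_one_powr_ge_zero[of 2 \<alpha>] alpha
      unfolding dyadic_powr by (simp add: one_le_power)
    have "weight_intensity {(1/2)^n<..1::real} = ennreal ?c" using weight_intensity_Ioc[of "(1/2)^n" 1] by (simp add: power_le_one)
    then have r: "emeasure (fin_intensity \<alpha> \<mu>) ?R = ennreal (?c * b)" "?R \<in> sets (fin_intensity \<alpha> \<mu>)"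
      using intensity_rectangle[of "{(1/2)^n<..1}" B] b c0 by (simp_all add: ennreal_mult)
    have "prob {\<omega> \<in> space W. point_count \<xi> ?R \<omega> = of_nat 0} = exp (- (?c * b))"
      using poisson_counts[OF r(2), of 0] r(1) c0 b by (simp add: measure_def)
    moreover have "prob ?E \<le> prob {\<omega> \<in> space W. point_count \<xi> ?R \<omega> = of_nat 0}"
    proof (rule finite_measure_mono)
      show "{\<omega> \<in> space W. point_count \<xi> ?R \<omega> = of_nat 0} \<in> events"
        using point_count_measurable[of ?R] by measurable
      show "?E \<subseteq> {\<omega> \<in> space W. point_count \<xi> ?R \<omega> = of_nat 0}"
      proof safe
        fix \<omega> assume "\<forall>i. snd (\<xi> i \<omega>) \<notin> B"
        then have "\<xi> i \<omega> \<notin> ?R" for i by (simp add: mem_Times_iff)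
        then have "{i. \<xi> i \<omega> \<in> ?R} = {}" by auto
        then show "point_count \<xi> ?R \<omega> = of_nat 0" unfolding point_count_def by simp
      qed
    qed
    ultimately show ?thesis by simp
  qed
  have l0: "(\<lambda>n. exp (- (b * (- 1 + (2 powr \<alpha>) ^ n)))) \<longlonglongrightarrow> 0"
  proof (rule filterlim_compose[OF exp_at_bot])
    have t: "filterlim (\<lambda>n. (2 powr \<alpha>) ^ n :: real) at_top sequentially"
      unfolding filterlim_at_top eventually_sequentially
    proof
      fix z :: real
      have c: "1 < 2 powr \<alpha>" using alpha by simp
      obtain N where N: "z < (2 powr \<alpha>) ^ N" using real_arch_pow[OF c] by blast
      have "z \<le> (2 powr \<alpha>) ^ n" if "n \<ge> N" for n
        using power_increasing[OF that, of "2 powr \<alpha>"] c N by linarith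
      then show "\<exists>N. \<forall>n\<ge>N. z \<le> (2 powr \<alpha>) ^ n" by blast
    qed
    have "filterlim (\<lambda>n. b * (- 1 + (2 powr \<alpha>) ^ n)) at_top sequentially"
      by (rule filterlim_tendsto_pos_mult_at_top[OF tendsto_const b(2) filterlim_tendsto_add_at_top[OF tendsto_const t]])
    then show "filterlim (\<lambda>n. - (b * (- 1 + (2 powr \<alpha>) ^ n))) at_bot sequentially"
      unfolding filterlim_uminus_at_top .
  qed
  have eq: "(\<lambda>n. exp (- ((((1/2)^n) powr (- \<alpha>) - 1) * b))) = (\<lambda>n. exp (- (b * (- 1 + (2 powr \<alpha>) ^ n))))"
    unfolding dyadic_powr by (intro ext arg_cong[where f=exp]) (simp add: right_diff_distrib left_diff_distrib distrib_left)
  have lim: "(\<lambda>n. exp (- ((((1/2)^n) powr (- \<alpha>) - 1) * b))) \<longlonglongrightarrow> 0" unfolding eq by (rule l0)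
  have "prob ?E \<le> 0" by (rule LIMSEQ_le_const[OF lim]) (use le in blast)
  then have "prob ?E = 0" using measure_nonneg[of W ?E] by linarith
  then have "AE \<omega> in W. \<not> (\<forall>i. snd (\<xi> i \<omega>) \<notin> B)"
    by (subst (asm) prob_eq_0[OF E]) (auto elim!: eventually_mono)
  then show ?thesis by (rule eventually_mono) blast
qed

lemma expected_point_count:
  assumes B: "B \<in> sets (fin_intensity \<alpha> \<mu>)" and fin: "emeasure (fin_intensity \<alpha> \<mu>) B < \<infinity>"
  shows "(\<integral>\<^sup>+\<omega>. point_count \<xi> B \<omega> \<partial>W) = emeasure (fin_intensity \<alpha> \<mu>) B"
proof -
  define r where "r = measure (fin_intensity \<alpha> \<mu>) B"
  have l: "0 \<le> r" "emeasure (fin_intensity \<alpha> \<mu>) B = ennreal r" using fin by (simp_all add: r_def emeasure_eq_ennreal_measure less_top)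
  have cm[measurable]: "point_count \<xi> B \<in> borel_measurable W" using B unfolding sets_intensity by (rule point_count_measurable)
  let ?E = "\<lambda>k::nat. {\<omega> \<in> space W. point_count \<xi> B \<omega> = of_nat k}"
  have E[measurable]: "?E k \<in> events" for k by measurable
  have pE: "prob (?E k) = exp (- r) * (r ^ k / fact k)" for k
    using poisson_counts[OF B fin, of k] by (simp add: r_def)
  have s1: "(\<lambda>k. r ^ k / fact k) sums exp r"
    using exp_converges[of r] by (simp add: divide_inverse mult.commute)
  have dis: "disjoint_family ?E" by (auto simp: disjoint_family_on_def)
  have "(\<lambda>k. prob (?E k)) sums prob (\<Union>k. ?E k)" by (rule finite_measure_UNION) (use E dis in auto)
  moreover have "(\<lambda>k. prob (?E k)) sums (exp (- r) * exp r)" unfolding pE by (rule sums_mult[OF s1])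
  ultimately have "prob (\<Union>k. ?E k) = exp (- r) * exp r" by (rule sums_unique2)
  also have "\<dots> = 1" by (simp add: exp_minus)
  finally have "prob (\<Union>k. ?E k) = 1" .
  then have "AE \<omega> in W. \<omega> \<in> (\<Union>k. ?E k)" by (rule AE_prob_1)
  then have "(\<integral>\<^sup>+\<omega>. point_count \<xi> B \<omega> \<partial>W) = (\<integral>\<^sup>+\<omega>. (\<Sum>k. of_nat k * indicator (?E k) \<omega>) \<partial>W)"
  proof (intro nn_integral_cong_AE, eventually_elim)
    case (elim \<omega>)
    then obtain k where k: "\<omega> \<in> ?E k" by blast
    have "(\<Sum>j. of_nat j * indicator (?E j) \<omega> :: ennreal) = (\<Sum>j\<in>{k}. of_nat j * indicator (?E j) \<omega>)"
      by (rule suminf_finite) (use k in auto)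
    also have "\<dots> = of_nat k" using k by (subst sum.insert) simp_all
    finally have "(\<Sum>j. of_nat j * indicator (?E j) \<omega> :: ennreal) = of_nat k" .
    moreover have "point_count \<xi> B \<omega> = of_nat k" using k by blast
    ultimately show ?case by (rule trans[OF _ sym, rotated])
  qed
  also have "\<dots> = (\<Sum>k. \<integral>\<^sup>+\<omega>. of_nat k * indicator (?E k) \<omega> \<partial>W)" by (rule nn_integral_suminf) measurable
  also have "\<dots> = (\<Sum>k. ennreal (real k * (exp (- r) * (r ^ k / fact k))))"
  proof (rule suminf_cong)
    fix k
    have "(\<integral>\<^sup>+\<omega>. of_nat k * indicator (?E k) \<omega> \<partial>W) = of_nat k * emeasure W (?E k)" by (rule nn_integral_cmult_indicator[OF E])
    also have "\<dots> = ennreal (real k) * ennreal (prob (?E k))" by (simp add: emeasure_eq_measure ennreal_of_nat_eq_real_of_nat)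
    also have "\<dots> = ennreal (real k * (exp (- r) * (r ^ k / fact k)))" unfolding pE by (rule ennreal_mult[symmetric]) (use l in auto)
    finally show "(\<integral>\<^sup>+\<omega>. of_nat k * indicator (?E k) \<omega> \<partial>W) = ennreal (real k * (exp (- r) * (r ^ k / fact k)))" .
  qed
  also have "\<dots> = ennreal r"
  proof (rule suminf_ennreal_eq)
    have "(\<lambda>k. r * (exp (- r) * (r ^ k / fact k))) sums (r * (exp (- r) * exp r))" by (intro sums_mult s1)
    moreover have "(\<lambda>k. r * (exp (- r) * (r ^ k / fact k))) = (\<lambda>k. real (Suc k) * (exp (- r) * (r ^ Suc k / fact (Suc k))))"
      by (intro ext) (simp add: field_simps del: of_nat_Suc)
    moreover have "r * (exp (- r) * exp r) = r" by (simp add: exp_minus)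
    ultimately have "(\<lambda>k. real (Suc k) * (exp (- r) * (r ^ Suc k / fact (Suc k)))) sums r" by (simp only:)
    then show "(\<lambda>k. real k * (exp (- r) * (r ^ k / fact k))) sums r" by (subst (asm) sums_Suc_iff) simp
    show "0 \<le> real k * (exp (- r) * (r ^ k / fact k))" for k using l by simp
  qed
  finally show ?thesis using l by simp
qed

text \<open>There are finitely many points with weight above \<open>1\<close>, and the weights in the
  dyadic bands below \<open>1\<close> have expected sums of order \<open>2 powr ((\<alpha> - 1) * k)\<close>, which is summable as \<open>\<alpha> < 1\<close>.\<close>

lemma locally_finite_mass:
  assumes K[measurable]: "K \<in> sets borel" and fin: "emeasure \<mu> K < \<infinity>"
  shows "AE \<omega> in W. (\<Sum>i. ennreal (fst (\<xi> i \<omega>)) * indicator K (snd (\<xi> i \<omega>))) < \<infinity>"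
proof -
  let ?large = "{1 :: real<..} \<times> K"
  let ?band = "\<lambda>k. {(1/2 :: real) ^ Suc k<..(1/2) ^ k} \<times> K"
  have bs: "?band k \<in> sets (borel \<Otimes>\<^sub>M borel)" for k by simp
  have ls: "?large \<in> sets (borel \<Otimes>\<^sub>M borel)" by simp
  define b where "b = measure \<mu> K"
  have b: "emeasure \<mu> K = ennreal b" "0 \<le> b"
    using fin by (simp_all add: b_def emeasure_eq_ennreal_measure less_top)
  have large: "emeasure (fin_intensity \<alpha> \<mu>) ?large < \<infinity>"
  proof -
    have "emeasure (fin_intensity \<alpha> \<mu>) ?large \<le> 1 * emeasure \<mu> K"
      unfolding intensity_rectangle(1)[of "{1<..}" K, simplified] by (rule mult_right_mono[OF weight_intensity_large]) simp
    then show ?thesis using fin by simp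
  qed
  have "AE \<omega> in W. point_count \<xi> ?large \<omega> \<noteq> \<infinity>"
    by (rule nn_integral_PInf_AE[OF point_count_measurable[OF ls]])
      (use expected_point_count[of ?large] large intensity_rectangle(2)[of "{1<..}" K] in simp)
  moreover have "AE \<omega> in W. (\<Sum>k. ennreal ((1/2)^k) * point_count \<xi> (?band k) \<omega>) \<noteq> \<infinity>"
  proof (rule nn_integral_PInf_AE)
    note [measurable] = point_count_measurable[OF bs]
    show "(\<lambda>\<omega>. \<Sum>k. ennreal ((1/2)^k) * point_count \<xi> (?band k) \<omega>) \<in> borel_measurable W" by measurable
    define q where "q = 2 powr (\<alpha> - 1)"
    have q: "0 < q" "q < 1" using alpha powr_less_mono[of "\<alpha> - 1" 0 2] by (simp_all add: q_def)
    have band_bound: "(\<integral>\<^sup>+\<omega>. ennreal ((1/2)^k) * point_count \<xi> (?band k) \<omega> \<partial>W) \<le> ennreal (2 powr \<alpha> * b * q ^ k)" for k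
    proof -
      have "weight_intensity {(1/2) ^ Suc k<..(1/2) ^ k} = ennreal (((1/2) ^ Suc k) powr (- \<alpha>) - ((1/2) ^ k) powr (- \<alpha>))"
        by (rule weight_intensity_Ioc) (simp_all add: power_decreasing)
      also have "\<dots> \<le> ennreal (((1/2) ^ Suc k) powr (- \<alpha>))" by (intro ennreal_leI) simp
      also have "((1/2) ^ Suc k) powr (- \<alpha>) = (2 powr \<alpha>) ^ Suc k"
        by (rule dyadic_powr)
      finally have w: "weight_intensity {(1/2) ^ Suc k<..(1/2) ^ k} \<le> ennreal ((2 powr \<alpha>) ^ Suc k)" .
      have le: "emeasure (fin_intensity \<alpha> \<mu>) (?band k) \<le> ennreal ((2 powr \<alpha>) ^ Suc k) * ennreal b"
      proof -
        have r: "emeasure (fin_intensity \<alpha> \<mu>) (?band k) = weight_intensity {(1/2) ^ Suc k<..(1/2) ^ k} * emeasure \<mu> K"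
          by (rule intensity_rectangle(1)[OF _ K]) simp
        show ?thesis unfolding r b(1) using w by (rule mult_right_mono) simp
      qed
      have "(\<integral>\<^sup>+\<omega>. ennreal ((1/2)^k) * point_count \<xi> (?band k) \<omega> \<partial>W) = ennreal ((1/2)^k) * (\<integral>\<^sup>+\<omega>. point_count \<xi> (?band k) \<omega> \<partial>W)"
        by (rule nn_integral_cmult) measurable
      also have "(\<integral>\<^sup>+\<omega>. point_count \<xi> (?band k) \<omega> \<partial>W) = emeasure (fin_intensity \<alpha> \<mu>) (?band k)"
      proof (rule expected_point_count)
        show "?band k \<in> sets (fin_intensity \<alpha> \<mu>)" by (rule intensity_rectangle(2)) simp_all
        show "emeasure (fin_intensity \<alpha> \<mu>) (?band k) < \<infinity>" using le by (rule le_less_trans) (simp add: ennreal_mult_less_top)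
      qed
      also have "ennreal ((1/2)^k) * \<dots> \<le> ennreal ((1/2)^k) * (ennreal ((2 powr \<alpha>) ^ Suc k) * ennreal b)"
        using le by (rule mult_left_mono) simp
      also have "\<dots> = ennreal ((1/2)^k * ((2 powr \<alpha>) ^ Suc k * b))" using b by (simp add: ennreal_mult)
      also have "(1/2)^k * ((2 powr \<alpha>) ^ Suc k * b) = 2 powr \<alpha> * b * q ^ k"
      proof -
        have q_ext: "q = 2 powr \<alpha> / 2" by (simp add: q_def powr_diff)
        show ?thesis unfolding q_ext by (simp add: power_divide)
      qed
      finally show ?thesis .
    qed
    have "(\<integral>\<^sup>+\<omega>. (\<Sum>k. ennreal ((1/2)^k) * point_count \<xi> (?band k) \<omega>) \<partial>W) = (\<Sum>k. \<integral>\<^sup>+\<omega>. ennreal ((1/2)^k) * point_count \<xi> (?band k) \<omega> \<partial>W)"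
      by (rule nn_integral_suminf) measurable
    also have "\<dots> \<le> (\<Sum>k. ennreal (2 powr \<alpha> * b * q ^ k))" by (intro suminf_le band_bound) auto
    also have "\<dots> = ennreal (\<Sum>k. 2 powr \<alpha> * b * q ^ k)"
      using q b by (intro suminf_ennreal2 summable_mult summable_geometric) auto
    finally show "(\<integral>\<^sup>+\<omega>. (\<Sum>k. ennreal ((1/2)^k) * point_count \<xi> (?band k) \<omega>) \<partial>W) \<noteq> \<infinity>"
      by (auto simp: top_unique)
  qed
  ultimately show ?thesis
  proof eventually_elim
    case (elim \<omega>)
    let ?v = "\<lambda>i. fst (\<xi> i \<omega>)" and ?I = "\<lambda>i. indicator K (snd (\<xi> i \<omega>)) :: ennreal"
    have split: "ennreal (?v i) * ?I i \<le> ennreal (?v i) * indicator ?large (\<xi> i \<omega>) + (\<Sum>k. ennreal ((1/2)^k) * indicator (?band k) (\<xi> i \<omega>))" for i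
    proof (cases "snd (\<xi> i \<omega>) \<in> K \<and> 0 < ?v i \<and> ?v i \<le> 1")
      case True
      obtain j :: nat where "(1/2)^j < ?v i" using real_arch_pow_inv[of "?v i" "1/2"] True by auto
      moreover have "(1/2::real)^Suc j \<le> (1/2)^j" by simp
      ultimately have ex: "\<exists>k::nat. (1/2)^Suc k < ?v i" by (meson le_less_trans)
      \<comment> \<open>The band that contains the weight.\<close>
      define k where "k = (LEAST k::nat. (1/2)^Suc k < ?v i)"
      have k1: "(1/2)^Suc k < ?v i" unfolding k_def using ex by (rule LeastI_ex)
      have k2: "?v i \<le> (1/2)^k"
      proof (cases k)
        case 0
        then show ?thesis using True by simp
      next
        case (Suc j)
        then have "j < k" by simp
        then have "\<not> (1/2)^Suc j < ?v i" unfolding k_def by (rule not_less_Least)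
        then show ?thesis using Suc by simp
      qed
      have "\<xi> i \<omega> \<in> ?band k" using k1 k2 True by (simp add: mem_Times_iff)
      then have "ennreal (?v i) * ?I i \<le> ennreal ((1/2)^k) * indicator (?band k) (\<xi> i \<omega>)"
        using k2 True by (simp add: ennreal_leI)
      also have "\<dots> \<le> (\<Sum>k. ennreal ((1/2)^k) * indicator (?band k) (\<xi> i \<omega>))"
      proof -
        define f where "f j = ennreal ((1/2)^j) * indicator (?band j) (\<xi> i \<omega>)" for j :: nat
        have "f k \<le> suminf f" using sum_le_suminf[of f "{k}"] by simp
        then show ?thesis unfolding f_def .
      qed
      finally show ?thesis by (rule order_trans) simp
    next
      case False
      show ?thesis
      proof (cases "snd (\<xi> i \<omega>) \<in> K \<and> 0 < ?v i")
        case True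
        then have "\<xi> i \<omega> \<in> ?large" using False by (simp add: mem_Times_iff)
        then show ?thesis using True by simp
      next
        case False
        then have z: "ennreal (?v i) * ?I i = 0" by (auto simp: ennreal_eq_0_iff split: split_indicator)
        show ?thesis unfolding z by simp
      qed
    qed
    have "(\<Sum>i. ennreal (?v i) * ?I i) \<le> (\<Sum>i. ennreal (?v i) * indicator ?large (\<xi> i \<omega>) + (\<Sum>k. ennreal ((1/2)^k) * indicator (?band k) (\<xi> i \<omega>)))"
      by (intro suminf_le split) auto
    also have "\<dots> = (\<Sum>i. ennreal (?v i) * indicator ?large (\<xi> i \<omega>)) + (\<Sum>i. \<Sum>k. ennreal ((1/2)^k) * indicator (?band k) (\<xi> i \<omega>))"
      by (rule suminf_add[symmetric]) auto
    also have "(\<Sum>i. \<Sum>k. ennreal ((1/2)^k) * indicator (?band k) (\<xi> i \<omega>)) = (\<Sum>k. ennreal ((1/2)^k) * point_count \<xi> (?band k) \<omega>)"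
      by (subst suminf_swap_ennreal) (simp add: point_count_eq ennreal_suminf_cmult)
    also have "(\<Sum>i. ennreal (?v i) * indicator ?large (\<xi> i \<omega>)) < \<infinity>"
    proof -
      have "emeasure (count_space UNIV) {i. \<xi> i \<omega> \<in> ?large} \<noteq> \<infinity>" using elim(1) unfolding point_count_def .
      then have f: "finite {i. \<xi> i \<omega> \<in> ?large}" by (simp add: emeasure_count_space split: if_splits)
      have "(\<Sum>i. ennreal (?v i) * indicator ?large (\<xi> i \<omega>)) = (\<Sum>i\<in>{i. \<xi> i \<omega> \<in> ?large}. ennreal (?v i) * indicator ?large (\<xi> i \<omega>))"
        by (rule suminf_finite[OF f]) (simp add: indicator_def)
      also have "\<dots> < \<infinity>" using f by (simp add: ennreal_sum_less_top ennreal_mult_less_top indicator_def)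
      finally show ?thesis .
    qed
    finally show ?case using elim(2) by (simp add: less_top[symmetric])
  qed
qed

end

section \<open>The clock of an atomic measure\<close>

lemma (in hunt_process) path_bounded:
  assumes w: "w \<in> space M"
  shows "bounded ((\<lambda>s. X s w) ` {0..b})"
proof -
  let ?x = "\<lambda>s. X s w"
  have loc: "\<exists>U. open U \<and> s \<in> U \<and> bounded (?x ` (U \<inter> {0..}))" if s: "0 \<le> s" for s
  proof -
    have "\<forall>\<^sub>F u in at_right s. dist (?x u) (?x s) < 1" using right_continuous[OF s w] by (intro tendstoD) auto
    then obtain d where d: "s < d" "\<And>u. s < u \<Longrightarrow> u < d \<Longrightarrow> dist (?x u) (?x s) < 1"
      unfolding eventually_at_right_field by blast
    obtain e l where e: "e < s" "\<And>u. e < u \<Longrightarrow> u < s \<Longrightarrow> 0 \<le> u \<Longrightarrow> dist (?x u) l < 1"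
    proof (cases "s = 0")
      case True
      show ?thesis by (rule that[of "-1"]) (use True in auto)
    next
      case False
      then obtain l where "(?x \<longlongrightarrow> l) (at_left s)" using left_limits[of s w] s w by auto
      then have "\<forall>\<^sub>F u in at_left s. dist (?x u) l < 1" by (intro tendstoD) auto
      then obtain e where "e < s" "\<And>u. e < u \<Longrightarrow> u < s \<Longrightarrow> dist (?x u) l < 1"
        unfolding eventually_at_left_field by blast
      then show ?thesis using that by blast
    qed
    have "?x ` ({e<..<d} \<inter> {0..}) \<subseteq> ball l 1 \<union> ball (?x s) 1"
    proof
      fix z assume "z \<in> ?x ` ({e<..<d} \<inter> {0..})"
      then obtain u where u: "z = ?x u" "e < u" "u < d" "0 \<le> u" by auto
      consider "u < s" | "u = s" | "s < u" by linarith
      then show "z \<in> ball l 1 \<union> ball (?x s) 1"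
        by cases (use u e(2)[of u] d(2)[of u] in \<open>auto simp: dist_commute\<close>)
    qed
    then have "bounded (?x ` ({e<..<d} \<inter> {0..}))" by (rule bounded_subset[rotated]) (simp add: bounded_Un)
    moreover have "s \<in> {e<..<d}" using d(1) e(1) by simp
    ultimately show ?thesis by (meson open_greaterThanLessThan)
  qed
  then obtain U where U: "\<And>s. 0 \<le> s \<Longrightarrow> open (U s) \<and> s \<in> U s \<and> bounded (?x ` (U s \<inter> {0..}))" by metis
  have "compact {0..b}" by simp
  then obtain C where C: "C \<subseteq> {0..b}" "finite C" "{0..b} \<subseteq> (\<Union>s\<in>C. U s)"
    by (rule compactE_image[of "{0..b}" "{0..b}" U]) (use U in auto)
  have "?x ` {0..b} \<subseteq> (\<Union>s\<in>C. ?x ` (U s \<inter> {0..}))" using C(3) by fastforce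
  moreover have "bounded (\<Union>s\<in>C. ?x ` (U s \<inter> {0..}))" using C(1,2) U by (intro bounded_UN) auto
  ultimately show ?thesis by (rule bounded_subset[rotated])
qed

text \<open>One realisation of the atoms, \<open>c i\<close> being the pair of weight and position. The assumptions on it are
  properties that hold almost surely for the Poisson points.\<close>

locale time_change = resistance_process \<E> \<F> \<mu> M X \<theta> P L
  for \<E> :: "('a::metric_space \<Rightarrow> real) \<Rightarrow> ('a \<Rightarrow> real) \<Rightarrow> real"
    and \<F> :: "('a \<Rightarrow> real) set" and \<mu> :: "'a measure"
    and M :: "'o measure" and X :: "real \<Rightarrow> 'o \<Rightarrow> 'a" and \<theta> :: "real \<Rightarrow> 'o \<Rightarrow> 'o" and P :: "'a \<Rightarrow> 'o measure"
    and L :: "real \<Rightarrow> 'a \<Rightarrow> 'o \<Rightarrow> real" +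
  fixes c :: "nat \<Rightarrow> real \<times> 'a"
  assumes weight_pos: "\<And>i. 0 < fst (c i)"
    and good_discounted_local: "\<And>i n x. (\<integral>\<^sup>+w. discounted_local (1 / real (Suc n)) (snd (c i)) w \<partial>P x) = ennreal (green (1 / real (Suc n)) x (snd (c i)))"
    and good_growth: "\<And>i x. AE w in P x. local_growth (snd (c i)) w"
    and mass: "\<And>r::nat. (\<Sum>i. ennreal (fst (c i)) * indicator (cball undefined (real r)) (snd (c i))) < \<infinity>"
begin

definition "y i = snd (c i)"
definition "v i = fst (c i)"

lemma v_pos: "0 < v i" unfolding v_def by (rule weight_pos)

text \<open>The clock as an extended real, which is measurable in \<open>w\<close> without any
  assumption on the path.\<close>

definition total_clock :: "real \<Rightarrow> 'o \<Rightarrow> ennreal" where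
  "total_clock s w = (\<Sum>i. ennreal (v i) * ennreal (L (max 0 s) (y i) w))"

definition nice_path :: "'o \<Rightarrow> bool" where
  "nice_path w \<longleftrightarrow> w \<in> space M \<and> (\<forall>i. regular_path (y i) w \<and> local_growth (y i) w) \<and> (\<forall>s. total_clock s w < \<infinity>)"

lemma total_clock_measurable:
  assumes [measurable]: "f \<in> borel_measurable N" "g \<in> N \<rightarrow>\<^sub>M M"
  shows "(\<lambda>x. total_clock (f x) (g x)) \<in> borel_measurable N"
proof -
  note [measurable] = L_joint_comp
  show ?thesis unfolding total_clock_def by measurable
qed

text \<open>The local time can be recovered up to a factor from its discounted value, whose expectation
  is bounded.\<close>

lemma discounted_local_ge:
  assumes w: "regular_path y' w" and k: "0 < k" and t: "0 \<le> t"
  shows "ennreal (exp (- k * t)) * ennreal (L t y' w) \<le> discounted_local k y' w"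
proof -
  have "ennreal (exp (- k * t)) * ennreal (L t y' w) = (\<integral>\<^sup>+s. ennreal (k * exp (- k * s)) * indicator {t<..} s * ennreal (L t y' w) \<partial>lborel)"
    using nn_integral_exp_tail[OF k, of t] by (simp add: nn_integral_multc)
  also have "\<dots> \<le> discounted_local k y' w" unfolding discounted_local_def
  proof (rule nn_integral_mono)
    fix s :: real
    show "ennreal (k * exp (- k * s)) * indicator {t<..} s * ennreal (L t y' w) \<le> ennreal (k * exp (- k * s)) * ennreal (L (max 0 s) y' w) * indicator {0..} s"
    proof (cases "t < s")
      case True
      then have "L t y' w \<le> L s y' w" using regular_path_mono[OF w t, of s] by simp
      then show ?thesis using True t by (simp add: max_absorb2 mult_left_mono ennreal_leI)
    qed simp
  qed
  finally show ?thesis .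
qed

text \<open>Up to a given time the path stays in a ball of some radius \<open>n\<close>, and the atoms at distance more than
  \<open>1\<close> from this ball do not contribute to the clock. The others have finite total mass and discounted local times of
  bounded expectation.\<close>

lemma AE_nice_path: "AE w in P x. nice_path w"
proof -
  note [measurable] = discounted_local_measurable
  let ?I = "\<lambda>n i. indicator (cball undefined (real n)) (y i) :: ennreal"
  have fin: "AE w in P x. (\<Sum>i. ennreal (v i) * ?I n i * discounted_local 1 (y i) w) \<noteq> \<infinity>" for n :: nat
  proof (rule nn_integral_PInf_AE)
    have "(\<integral>\<^sup>+w. (\<Sum>i. ennreal (v i) * ?I n i * discounted_local 1 (y i) w) \<partial>P x) = (\<Sum>i. ennreal (v i) * ?I n i * (\<integral>\<^sup>+w. discounted_local 1 (y i) w \<partial>P x))"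
      by (subst nn_integral_suminf) (simp_all add: nn_integral_cmult)
    also have "\<dots> \<le> (\<Sum>i. ennreal (v i) * ?I n i * ennreal (sup_const 1))"
      using good_discounted_local[where n=0 and x=x] green_le[of 1 x]
      by (intro suminf_le mult_left_mono) (simp_all add: y_def ennreal_leI)
    also have "\<dots> = (\<Sum>i. ennreal (v i) * ?I n i) * ennreal (sup_const 1)" by (rule ennreal_suminf_multc)
    also have "\<dots> < \<infinity>" using mass[of n] by (simp add: v_def y_def ennreal_mult_less_top)
    finally show "(\<integral>\<^sup>+w. (\<Sum>i. ennreal (v i) * ?I n i * discounted_local 1 (y i) w) \<partial>P x) \<noteq> \<infinity>" by simp
  qed measurable
  have "AE w in P x. \<forall>n. (\<Sum>i. ennreal (v i) * ?I n i * discounted_local 1 (y i) w) \<noteq> \<infinity>" unfolding AE_all_countable using fin by blast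
  moreover have "AE w in P x. \<forall>i. regular_path (y i) w" unfolding AE_all_countable using AE_regular_path by blast
  moreover have "AE w in P x. \<forall>i. local_growth (y i) w" unfolding AE_all_countable y_def using good_growth by blast
  moreover have "AE w in P x. w \<in> space M" using AE_space[of "P x"] by (simp add: space_P)
  ultimately show ?thesis
  proof eventually_elim
    case (elim w)
    have "total_clock s w < \<infinity>" for s
    proof -
      define t where "t = max 0 s"
      have t: "0 \<le> t" by (simp add: t_def)
      obtain b :: rat where b: "t < of_rat b" using of_rat_dense[of t "t + 1"] by auto
      have b0: "0 < (of_rat b :: real)" using b t by linarith
      have "bounded ((\<lambda>s. X s w) ` {0..of_rat b})" using elim(4) by (rule path_bounded)
      then obtain K where "\<forall>z\<in>(\<lambda>s. X s w) ` {0..of_rat b}. dist undefined z \<le> K"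
        unfolding bounded_any_center[where a=undefined] by blast
      then have K: "dist undefined (X s w) \<le> K" if "0 \<le> s" "s \<le> of_rat b" for s using that by simp
      obtain n where n: "K \<le> real n" using real_arch_simple by blast
      have zero: "L t (y i) w = 0" if i: "y i \<notin> cball undefined (real (Suc n))" for i
      proof -
        have reg: "regular_path (y i) w" using elim(2) by blast
        have "avoids (of_rat 0) (of_rat b) (of_rat 1) (y i) w"
          unfolding avoids_def
        proof (intro allI impI)
          fix q :: rat assume q: "of_rat 0 \<le> (of_rat q :: real) \<and> of_rat q < (of_rat b :: real)"
          then have q0: "max 0 (of_rat q) = (of_rat q :: real)" by simp
          have "dist undefined (y i) \<le> dist undefined (X (of_rat q) w) + dist (X (of_rat q) w) (y i)" by (rule dist_triangle)
          moreover have "dist undefined (X (of_rat q) w) \<le> real n" using K[of "of_rat q"] q n by simp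
          moreover have "real (Suc n) < dist undefined (y i)" using i by simp
          ultimately show "of_rat 1 \<le> dist (X (max 0 (of_rat q)) w) (y i)" unfolding q0 by simp
        qed
        moreover have "0 < b" using b0 by simp
        moreover have "local_growth (y i) w" using elim(3) by blast
        ultimately have "L (max 0 (of_rat b)) (y i) w = L (max 0 (of_rat 0)) (y i) w"
          unfolding local_growth_def
          by (elim allE[of _ "0::rat"] allE[of _ b] allE[of _ "1::rat"] impE) simp_all
        then have "L (of_rat b) (y i) w = 0" using b0 reg by (simp add: regular_path_def max_absorb2 less_imp_le)
        moreover have "L t (y i) w \<le> L (of_rat b) (y i) w" using regular_path_mono[OF reg t] b by simp
        moreover have "0 \<le> L t (y i) w" by (rule regular_path_nonneg[OF reg t])
        ultimately show ?thesis by simp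
      qed
      have "total_clock s w \<le> (\<Sum>i. ennreal (exp t) * (ennreal (v i) * ?I (Suc n) i * discounted_local 1 (y i) w))"
        unfolding total_clock_def t_def[symmetric]
      proof (intro suminf_le)
        fix i
        show "ennreal (v i) * ennreal (L t (y i) w) \<le> ennreal (exp t) * (ennreal (v i) * ?I (Suc n) i * discounted_local 1 (y i) w)"
        proof (cases "y i \<in> cball undefined (real (Suc n))")
          case True
          have "ennreal (L t (y i) w) = ennreal (exp t) * (ennreal (exp (- 1 * t)) * ennreal (L t (y i) w))"
            by (simp add: mult.assoc[symmetric] ennreal_mult[symmetric] exp_minus)
          also have "\<dots> \<le> ennreal (exp t) * discounted_local 1 (y i) w"
            by (rule mult_left_mono[OF discounted_local_ge]) (use elim(2) t in auto)
          finally have "ennreal (v i) * ennreal (L t (y i) w) \<le> ennreal (v i) * (ennreal (exp t) * discounted_local 1 (y i) w)"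
            by (rule mult_left_mono) simp
          moreover have "?I (Suc n) i = 1" using True by simp
          ultimately show ?thesis by (simp add: mult_ac)
        next
          case False
          then show ?thesis using zero[OF False] by simp
        qed
      qed auto
      also have "\<dots> = ennreal (exp t) * (\<Sum>i. ennreal (v i) * ?I (Suc n) i * discounted_local 1 (y i) w)" by (rule ennreal_suminf_cmult)
      also have "\<dots> < \<infinity>" using elim(1)[rule_format, of "Suc n"] by (simp add: ennreal_mult_less_top less_top)
      finally show ?thesis .
    qed
    with elim show ?case unfolding nice_path_def by blast
  qed
qed

definition atom_clock :: "nat \<Rightarrow> 'o \<Rightarrow> real \<Rightarrow> real" where "atom_clock i w s = L (max 0 s) (y i) w"

definition A :: "'o \<Rightarrow> real \<Rightarrow> real" where "A w s = enn2real (total_clock s w)"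

lemma atom_clock_clock: assumes w: "nice_path w" shows "clock_fun (atom_clock i w)"
proof -
  have r: "regular_path (y i) w" using w by (simp add: nice_path_def)
  have "mono (atom_clock i w)"
  proof (rule monoI)
    fix s t :: real assume "s \<le> t"
    then show "atom_clock i w s \<le> atom_clock i w t" unfolding atom_clock_def by (intro regular_path_mono[OF r]) auto
  qed
  moreover have "continuous_on UNIV (atom_clock i w)"
    unfolding atom_clock_def
    by (rule continuous_on_compose2[of "{0..}" "\<lambda>t. L t (y i) w"])
      (use r in \<open>auto simp: regular_path_def intro!: continuous_intros\<close>)
  moreover have "atom_clock i w s = 0" if "s \<le> 0" for s using r that by (simp add: atom_clock_def regular_path_def max_absorb1)
  ultimately show ?thesis unfolding clock_fun_def by blast
qed

lemma total_clock_eq: "total_clock s w = (\<Sum>i. ennreal (v i) * ennreal (atom_clock i w s))"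
  unfolding total_clock_def atom_clock_def ..

lemma A_eq: assumes w: "nice_path w" shows "ennreal (A w s) = total_clock s w"
proof -
  have "total_clock s w < \<top>" using w by (simp add: nice_path_def)
  then show ?thesis unfolding A_def by (rule ennreal_enn2real)
qed

lemma A_sums: assumes w: "nice_path w" shows "(\<lambda>i. v i * atom_clock i w s) sums A w s"
proof -
  have nn: "0 \<le> v i * atom_clock i w s" for i using v_pos[of i] clock_fun_nonneg[OF atom_clock_clock[OF w]] by (simp add: less_imp_le)
  have t: "total_clock s w = (\<Sum>i. ennreal (v i * atom_clock i w s))"
    unfolding total_clock_eq using v_pos clock_fun_nonneg[OF atom_clock_clock[OF w]] by (intro suminf_cong) (simp add: ennreal_mult less_imp_le)
  have sm: "summable (\<lambda>i. v i * atom_clock i w s)"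
  proof (rule summable_suminf_not_top[OF nn])
    have "total_clock s w < \<infinity>" using w by (simp only: nice_path_def)
    then show "(\<Sum>i. ennreal (v i * atom_clock i w s)) \<noteq> \<top>" unfolding t by simp
  qed
  have "total_clock s w = ennreal (\<Sum>i. v i * atom_clock i w s)" unfolding t by (rule suminf_ennreal2[OF nn sm])
  then have "A w s = (\<Sum>i. v i * atom_clock i w s)" unfolding A_def using suminf_nonneg[OF sm nn] by simp
  with sm show ?thesis by (simp add: summable_sums)
qed

text \<open>The series converges uniformly on half-lines bounded above, the terms being dominated by
  their values at the right end.\<close>

lemma A_clock: assumes w: "nice_path w" shows "clock_fun (A w)"
proof -
  have m: "A w s \<le> A w t" if "s \<le> t" for s t
    by (rule sums_le[OF _ A_sums[OF w] A_sums[OF w]])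
      (use v_pos clock_funD(1)[OF atom_clock_clock[OF w] that] in \<open>auto intro!: mult_left_mono simp: less_imp_le\<close>)
  have z: "A w s = 0" if "s \<le> 0" for s
  proof -
    have "(\<lambda>i. v i * atom_clock i w s) = (\<lambda>_. 0)" using clock_funD(3)[OF atom_clock_clock[OF w] that] by auto
    then show ?thesis using A_sums[OF w, of s] sums_unique[of "\<lambda>_. 0"] using sums_unique2[OF _ sums_zero] by simp
  qed
  have cT: "continuous_on {..<T} (A w)" for T
  proof (rule uniform_limit_theorem)
    have "uniform_limit {..<T} (\<lambda>n s. \<Sum>i<n. v i * atom_clock i w s) (\<lambda>s. \<Sum>i. v i * atom_clock i w s) sequentially"
    proof (rule Weierstrass_m_test)
      show "norm (v i * atom_clock i w s) \<le> v i * atom_clock i w T" if "s \<in> {..<T}" for i s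
        using that v_pos[of i] clock_fun_nonneg[OF atom_clock_clock[OF w], of i s] clock_funD(1)[OF atom_clock_clock[OF w], of s T i]
        by (simp add: abs_mult)
      show "summable (\<lambda>i. v i * atom_clock i w T)" using A_sums[OF w] by (rule sums_summable)
    qed
    moreover have "(\<lambda>s. \<Sum>i. v i * atom_clock i w s) = A w" by (rule ext, rule sums_unique[OF A_sums[OF w], symmetric])
    ultimately show "uniform_limit {..<T} (\<lambda>n s. \<Sum>i<n. v i * atom_clock i w s) (A w) sequentially" by simp
    show "\<forall>\<^sub>F n in sequentially. continuous_on {..<T} (\<lambda>s. \<Sum>i<n. v i * atom_clock i w s)"
      by (rule always_eventually, rule allI, rule continuous_on_sum, rule continuous_on_mult[OF continuous_on_const],
          rule continuous_on_subset[OF clock_funD(2)[OF atom_clock_clock[OF w]]], simp)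
  qed simp
  have "isCont (A w) s" for s
    using cT[of "s + 1"] continuous_on_eq_continuous_at[of "{..<s + 1}" "A w"] by simp
  then have "continuous_on UNIV (A w)" using continuous_on_eq_continuous_at[of UNIV "A w"] by simp
  with m z show ?thesis unfolding clock_fun_def mono_def by blast
qed

abbreviation "\<nu> \<equiv> atomic_measure c"

lemma nn_integral_atomic:
  assumes "f \<in> borel_measurable borel"
  shows "(\<integral>\<^sup>+x. f x \<partial>\<nu>) = (\<Sum>i. ennreal (v i) * f (y i))"
proof -
  let ?D = "density (count_space UNIV) (\<lambda>i. ennreal (fst (c i)))"
  have "(\<integral>\<^sup>+x. f x \<partial>\<nu>) = (\<integral>\<^sup>+i. f (snd (c i)) \<partial>?D)"
    unfolding atomic_measure_def by (rule nn_integral_distr) (simp_all add: assms)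
  also have "\<dots> = (\<integral>\<^sup>+i. ennreal (fst (c i)) * f (snd (c i)) \<partial>count_space UNIV)"
    by (rule nn_integral_density) simp_all
  also have "\<dots> = (\<Sum>i. ennreal (v i) * f (y i))"
    unfolding nn_integral_count_space_nat v_def y_def ..
  finally show ?thesis .
qed

lemma clock_eq: assumes w: "nice_path w" and s: "0 \<le> s" shows "clock L \<nu> s w = ennreal (A w s)"
proof -
  have wM: "w \<in> space M" using w by (simp add: nice_path_def)
  have "(\<lambda>x. ennreal (L (max 0 s) x w)) \<in> borel_measurable borel"
    using L_joint_comp[of "\<lambda>_. s" borel "\<lambda>x. x" "\<lambda>_. w"] wM by simp
  then have "(\<lambda>x. ennreal (L s x w)) \<in> borel_measurable borel" using s by (simp add: max_absorb2)
  from nn_integral_atomic[OF this] show ?thesis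
    unfolding clock_def A_eq[OF w] total_clock_def using s by (simp add: max_absorb2)
qed

lemma inverse_clock_eq:
  assumes w: "nice_path w" and t: "0 \<le> t"
  shows "inverse_clock L \<nu> t w = (if t \<in> clock_dom (A w) then ennreal (clock_inv (A w) t) else \<infinity>)"
proof -
  let ?S = "{ennreal s | s. 0 < s \<and> clock L \<nu> s w > ennreal t}"
  have S: "?S = {ennreal s | s. 0 < s \<and> t < A w s}"
    using clock_eq[OF w] t by (auto simp: ennreal_less_iff)
  show ?thesis
  proof (cases "t \<in> clock_dom (A w)")
    case True
    note iff = clock_inv_less_iff[OF A_clock[OF w] True] and nn = clock_inv_nonneg[OF A_clock[OF w] True]
    have "Inf ?S = ennreal (clock_inv (A w) t)"
    proof (rule antisym)
      show "ennreal (clock_inv (A w) t) \<le> Inf ?S"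
        unfolding S
      proof (rule Inf_greatest)
        fix z assume "z \<in> {ennreal s | s. 0 < s \<and> t < A w s}"
        then obtain s where "z = ennreal s" "t < A w s" by blast
        then show "ennreal (clock_inv (A w) t) \<le> z" using iff[of s] by (simp add: ennreal_leI)
      qed
      show "Inf ?S \<le> ennreal (clock_inv (A w) t)"
      proof (rule ennreal_le_epsilon)
        fix e :: real assume e: "0 < e"
        have "t < A w (clock_inv (A w) t + e)" using iff[of "clock_inv (A w) t + e"] e by simp
        then have "ennreal (clock_inv (A w) t + e) \<in> ?S" unfolding S using nn e by (auto intro!: exI[of _ "clock_inv (A w) t + e"])
        then have "Inf ?S \<le> ennreal (clock_inv (A w) t + e)" by (rule Inf_lower)
        also have "\<dots> = ennreal (clock_inv (A w) t) + ennreal e" using nn e by simp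
        finally show "Inf ?S \<le> ennreal (clock_inv (A w) t) + ennreal e" .
      qed
    qed
    then show ?thesis using True by (simp add: inverse_clock_def)
  next
    case False
    then have "?S = {}" unfolding S using t by (auto simp: clock_dom_def)
    then have "inverse_clock L \<nu> t w = \<infinity>" unfolding inverse_clock_def by (simp only:) simp
    then show ?thesis using False by simp
  qed
qed

lemma time_changed_eq:
  assumes w: "nice_path w" and t: "0 \<le> t"
  shows "time_changed X L \<nu> t w = (if t \<in> clock_dom (A w) then Some (X (clock_inv (A w) t) w) else None)"
proof (cases "t \<in> clock_dom (A w)")
  case True
  note e = inverse_clock_eq[OF w t]
  have "inverse_clock L \<nu> t w = ennreal (clock_inv (A w) t)" unfolding e using True by (simp only: if_True)
  moreover have "enn2real (ennreal (clock_inv (A w) t)) = clock_inv (A w) t"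
    by (rule enn2real_ennreal[OF clock_inv_nonneg[OF A_clock[OF w] True]])
  ultimately show ?thesis unfolding time_changed_def using True by simp
next
  case False
  have "inverse_clock L \<nu> t w = \<infinity>" unfolding inverse_clock_eq[OF w t] using False by (simp only: if_False)
  then show ?thesis unfolding time_changed_def using False by simp
qed

lemma atom_clock_support:
  assumes w: "nice_path w"
  shows "AE s in interval_measure (atom_clock i w). X (max 0 s) w = y i"
proof (rule clock_supported_on_level[OF atom_clock_clock[OF w]])
  have wM: "w \<in> space M" using w unfolding nice_path_def by (rule conjunct1)
  fix s :: real assume s: "0 \<le> s"
  have "\<forall>\<^sub>F u in at_right s. X u w = X (max 0 u) w"
    by (rule eventually_at_rightI[of s "s + 1"]) (use s in \<open>simp_all add: max_absorb2\<close>)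
  then have "((\<lambda>s. X (max 0 s) w) \<longlongrightarrow> X s w) (at_right s)"
    by (rule Lim_transform_eventually[OF right_continuous[OF s wM]])
  then show "((\<lambda>s. X (max 0 s) w) \<longlongrightarrow> X (max 0 s) w) (at_right s)" using s by (simp only: max_absorb2)
next
  have g: "local_growth (y i) w" using w unfolding nice_path_def by simp
  fix a b r :: rat
  assume h: "0 \<le> a" "a < b" "0 < r" "\<forall>s. of_rat a \<le> s \<and> s < of_rat b \<longrightarrow> of_rat r \<le> dist (X (max 0 s) w) (y i)"
  have "avoids (of_rat a) (of_rat b) (of_rat r) (y i) w" unfolding avoids_def using h(4) by simp
  with h(1-3) have "L (max 0 (of_rat b)) (y i) w = L (max 0 (of_rat a)) (y i) w"
    using g[unfolded local_growth_def, rule_format, of a b r] by simp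
  then show "atom_clock i w (of_rat b) = atom_clock i w (of_rat a)" unfolding atom_clock_def .
qed

section \<open>The process killed in the clock\<close>

text \<open>Each local time agrees almost surely with a function of the past, hence so does the clock.\<close>

lemma clock_event_adapted:
  assumes s: "0 \<le> s" and t: "0 \<le> t"
  shows "\<exists>\<Lambda>\<in>natural_events M X s. AE w in P x. t < A w s \<longleftrightarrow> w \<in> \<Lambda>"
proof -
  let ?S = "sigma (space M) (natural_events M X s)"
  interpret S: sigma_algebra "space M" "natural_events M X s" by (rule sigma_algebra_natural)
  have sets: "sets ?S = natural_events M X s" by (rule S.sets_measure_of_eq)
  have sp: "space ?S = space M" by (rule S.space_measure_of_eq)
  have "\<exists>g. g \<in> borel_measurable ?S \<and> (AE w in P x. L s (y i) w = g w)" for i using adapted[OF s, of "y i" x] by blast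
  then obtain g where g: "\<And>i. g i \<in> borel_measurable ?S" "\<And>i. AE w in P x. L s (y i) w = g i w" by metis
  note [measurable] = g(1)
  have m: "(\<lambda>w. \<Sum>i. ennreal (v i) * ennreal (g i w)) \<in> borel_measurable ?S" by measurable
  let ?\<Lambda> = "{w \<in> space ?S. ennreal t < (\<Sum>i. ennreal (v i) * ennreal (g i w))}"
  have "?\<Lambda> \<in> sets ?S" by (rule borel_measurable_less[OF borel_measurable_const m])
  moreover have "AE w in P x. \<forall>i. L s (y i) w = g i w" unfolding AE_all_countable using g(2) by blast
  with AE_nice_path[of x] have "AE w in P x. t < A w s \<longleftrightarrow> w \<in> ?\<Lambda>"
  proof eventually_elim
    case (elim w)
    have "w \<in> space M" using elim(1) unfolding nice_path_def by (rule conjunct1)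
    moreover have "(\<Sum>i. ennreal (v i) * ennreal (g i w)) = ennreal (A w s)"
      unfolding A_eq[OF elim(1)] total_clock_def using elim(2) s by (simp add: max_absorb2)
    ultimately show ?case unfolding sp using t by (simp add: ennreal_less_iff)
  qed
  ultimately show ?thesis unfolding sets by blast
qed

text \<open>The discounted growth of the local time after time \<open>r\<close>; by \<open>local_time_after_shift\<close> it is the
  discounted local time of the shifted path.\<close>

definition local_time_after :: "real \<Rightarrow> nat \<Rightarrow> real \<Rightarrow> 'o \<Rightarrow> ennreal" where
  "local_time_after k j r w = (\<integral>\<^sup>+u\<in>{r..}. ennreal (k * exp (- k * u) * (L (max 0 u) (y j) w - L (max 0 r) (y j) w)) \<partial>lborel)"

lemma local_time_after_measurable:
  assumes [measurable]: "f \<in> borel_measurable N" "g \<in> N \<rightarrow>\<^sub>M M"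
  shows "(\<lambda>p. local_time_after k j (f p) (g p)) \<in> borel_measurable N"
proof -
  note [measurable] = L_joint_comp
  have "(\<lambda>p. \<integral>\<^sup>+u. ennreal (k * exp (- k * u) * (L (max 0 u) (y j) (g p) - L (max 0 (f p)) (y j) (g p))) * (if f p \<le> u then 1 else 0) \<partial>lborel)
    \<in> borel_measurable N"
    by (rule lborel.borel_measurable_nn_integral, subst split_beta') measurable
  moreover have "indicator {r..} u = (if r \<le> u then 1 else 0 :: ennreal)" for r u :: real by (simp add: indicator_def)
  ultimately show ?thesis unfolding local_time_after_def by simp
qed

lemma local_time_after_shift:
  assumes w: "nice_path w" and k: "0 < k" and q: "0 \<le> q"
  shows "local_time_after k j q w = ennreal (exp (- k * q)) * discounted_local k (y j) (\<theta> q w)"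
proof -
  have r: "regular_path (y j) w" using w unfolding nice_path_def by blast
  show ?thesis unfolding local_time_after_def discounted_local_shift[OF q r k] max_absorb2[OF q] ..
qed

lemma local_time_after_eq:
  assumes w: "nice_path w" and k: "0 < k"
  shows "local_time_after k j r w = (\<integral>\<^sup>+s. ennreal (exp (- k * s)) * indicator {r<..} s \<partial>interval_measure (atom_clock j w))"
  unfolding local_time_after_def clock_exp_tail[OF atom_clock_clock[OF w] k] atom_clock_def ..

lemma local_time_after_tendsto:
  assumes w: "nice_path w" and k: "0 < k" and d: "decseq r" and l: "r \<longlonglongrightarrow> s" and gt: "\<And>n. s < r n"
  shows "incseq (\<lambda>n. local_time_after k j (r n) w)" "(SUP n. local_time_after k j (r n) w) = local_time_after k j s w"
proof -
  let ?I = "interval_measure (atom_clock j w)"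
  let ?f = "\<lambda>n u. ennreal (exp (- k * u)) * indicator {r n<..} u"
  have 1: "?f n u \<le> ?f (Suc n) u" for n u
    using decseq_SucD[OF d, of n] by (auto simp: indicator_def intro!: mult_left_mono)
  have 2: "?f n \<in> borel_measurable ?I" for n by simp
  have 3: "(\<lambda>n. ?f n u) \<longlonglongrightarrow> ennreal (exp (- k * u)) * indicator {s<..} u" for u
  proof (cases "s < u")
    case True
    have "\<forall>\<^sub>F n in sequentially. r n < u" using l True by (rule order_tendstoD(2))
    then have "\<forall>\<^sub>F n in sequentially. ?f n u = ennreal (exp (- k * u)) * indicator {s<..} u"
      by eventually_elim (use True in simp)
    then show ?thesis by (rule tendsto_eventually)
  next
    case False
    then have "\<not> r n < u" for n using gt[of n] by simp
    then show ?thesis using False by simp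
  qed
  show "incseq (\<lambda>n. local_time_after k j (r n) w)" unfolding local_time_after_eq[OF w k] by (rule nn_integral_incseq_SUP(1)[OF 1 2 3])
  show "(SUP n. local_time_after k j (r n) w) = local_time_after k j s w" unfolding local_time_after_eq[OF w k] by (rule nn_integral_incseq_SUP(2)[OF 1 2 3])
qed

text \<open>The discounted local time at the atom when the process is killed at rate \<open>b\<close> in the clock.\<close>

definition survived :: "real \<Rightarrow> real \<Rightarrow> nat \<Rightarrow> 'o \<Rightarrow> ennreal" where
  "survived k b j w = (\<integral>\<^sup>+s. ennreal (exp (- k * s) * exp (- b * A w s)) \<partial>interval_measure (atom_clock j w))"

text \<open>The Green kernel of the killed process; the second argument is the index of an atom.\<close>

definition killed_green :: "real \<Rightarrow> real \<Rightarrow> 'a \<Rightarrow> nat \<Rightarrow> ennreal" where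
  "killed_green k b x j = (\<integral>\<^sup>+w. survived k b j w \<partial>P x)"

text \<open>For a fixed starting point, \<open>\<Omega>\<close> is a measurable event of probability \<open>1\<close> on which every path is nice.
  Restricting the inverse clock to it makes measurability independent of null sets.\<close>

context
  fixes x :: 'a and \<Omega> :: "'o set"
  assumes Om_sets: "\<Omega> \<in> sets M" and Om_nice: "\<And>w. w \<in> \<Omega> \<Longrightarrow> nice_path w" and Om_full: "AE w in P x. w \<in> \<Omega>"
begin

text \<open>The event that the time-changed process is alive at time \<open>t\<close>.\<close>

definition running :: "real \<Rightarrow> 'o \<Rightarrow> bool" where
  "running t w \<longleftrightarrow> w \<in> \<Omega> \<and> t \<in> clock_dom (A w)"

text \<open>The inverse clock, with the value \<open>0\<close> after the life time.\<close>

definition tau :: "real \<Rightarrow> 'o \<Rightarrow> real" where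
  "tau t w = (if running t w then clock_inv (A w) t else 0)"

lemma Om_space: "w \<in> \<Omega> \<Longrightarrow> w \<in> space M" using Om_nice unfolding nice_path_def by blast

lemma A_clock_Om: "w \<in> \<Omega> \<Longrightarrow> clock_fun (A w)" by (rule A_clock[OF Om_nice])

lemma running_iff: "running t w \<longleftrightarrow> w \<in> \<Omega> \<and> 0 \<le> t \<and> (\<exists>n::nat. ennreal t < total_clock (real n) w)"
proof (cases "w \<in> \<Omega>")
  case True
  note n = Om_nice[OF True]
  have "(\<exists>s. t < A w s) \<longleftrightarrow> (\<exists>n::nat. t < A w (real n))"
  proof
    assume "\<exists>s. t < A w s"
    then obtain s where s: "t < A w s" by blast
    obtain n where "s \<le> real n" using real_arch_simple by blast
    then have "A w s \<le> A w (real n)" by (rule clock_funD(1)[OF A_clock_Om[OF True]])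
    with s have "t < A w (real n)" by linarith
    then show "\<exists>n::nat. t < A w (real n)" by blast
  qed blast
  then show ?thesis unfolding running_def clock_dom_def using True
    by (simp add: A_eq[OF n, symmetric] ennreal_less_iff cong: conj_cong)
qed (simp add: running_def)

lemma tau_nonneg: "0 \<le> tau t w"
  using clock_inv_nonneg[OF A_clock_Om, of w t] by (simp add: tau_def running_def)

lemma tau_less_iff: assumes r: "running t w" shows "tau t w < s \<longleftrightarrow> t < A w s"
  using clock_inv_less_iff[OF A_clock_Om, of w t s] r by (simp add: tau_def running_def)

lemma running_measurable:
  assumes [measurable]: "f \<in> borel_measurable N" "g \<in> N \<rightarrow>\<^sub>M M"
  shows "{p \<in> space N. running (f p) (g p)} \<in> sets N"
proof -
  note [measurable] = total_clock_measurable Om_sets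
  show ?thesis unfolding running_iff by measurable
qed

lemma tau_measurable:
  assumes f[measurable]: "f \<in> borel_measurable N" and g[measurable]: "g \<in> N \<rightarrow>\<^sub>M M"
  shows "(\<lambda>p. tau (f p) (g p)) \<in> borel_measurable N"
proof (rule borel_measurable_iff_less[THEN iffD2], rule allI)
  fix a :: real
  note [measurable] = total_clock_measurable running_measurable[OF f g]
  have "tau (f p) (g p) < a \<longleftrightarrow> (if running (f p) (g p) then ennreal (f p) < total_clock a (g p) else 0 < a)" for p
  proof (cases "running (f p) (g p)")
    case True
    then have "g p \<in> \<Omega>" "0 \<le> f p" unfolding running_iff by blast+
    then show ?thesis using True tau_less_iff[OF True, of a] by (simp add: A_eq[OF Om_nice, symmetric] ennreal_less_iff)
  qed (simp add: tau_def)
  then show "{p \<in> space N. tau (f p) (g p) < a} \<in> sets N" by (simp only:) measurable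
qed

text \<open>The approximation takes the value \<open>q\<close> if the clock exceeds \<open>t\<close> at \<open>q\<close> but not at the preceding
  dyadic point, which is known at time \<open>q\<close>.\<close>

lemma dyadic_level_event:
  assumes t: "0 \<le> t" and q: "q = (real i + 1) / 2 ^ m"
  shows "\<exists>\<Lambda>\<in>natural_events M X q. AE w in P x. (running t w \<and> dyadic_above m (tau t w) = q) \<longleftrightarrow> w \<in> \<Lambda>"
proof -
  let ?a = "real i / 2 ^ m"
  have aq: "0 \<le> ?a" "?a \<le> q" "0 \<le> q" unfolding q by (simp_all add: divide_right_mono)
  obtain \<Lambda>1 where 1: "\<Lambda>1 \<in> natural_events M X ?a" "AE w in P x. t < A w ?a \<longleftrightarrow> w \<in> \<Lambda>1"
    using clock_event_adapted[OF aq(1) t] by blast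
  obtain \<Lambda>2 where 2: "\<Lambda>2 \<in> natural_events M X q" "AE w in P x. t < A w q \<longleftrightarrow> w \<in> \<Lambda>2"
    using clock_event_adapted[OF aq(3) t] by blast
  interpret S: sigma_algebra "space M" "natural_events M X q" by (rule sigma_algebra_natural)
  have "\<Lambda>2 - \<Lambda>1 \<in> natural_events M X q" using 1(1) 2(1) natural_events_mono[OF aq(2)] by blast
  moreover have "AE w in P x. (running t w \<and> dyadic_above m (tau t w) = q) \<longleftrightarrow> w \<in> \<Lambda>2 - \<Lambda>1"
    using Om_full 1(2) 2(2)
  proof eventually_elim
    case (elim w)
    have *: "dyadic_above m (tau t w) = q \<longleftrightarrow> ?a \<le> tau t w \<and> tau t w < q"
    proof -
      let ?z = "tau t w * 2 ^ m"
      have z: "0 \<le> ?z" using tau_nonneg[of t w] by simp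
      have "dyadic_above m (tau t w) = q \<longleftrightarrow> nat \<lfloor>?z\<rfloor> = i"
        unfolding dyadic_above_def q by simp
      also have "\<dots> \<longleftrightarrow> \<lfloor>?z\<rfloor> = int i" using z by linarith
      also have "\<dots> \<longleftrightarrow> real i \<le> ?z \<and> ?z < real i + 1" unfolding floor_eq_iff by simp
      also have "\<dots> \<longleftrightarrow> ?a \<le> tau t w \<and> tau t w < q" unfolding q by (simp add: divide_le_eq less_divide_eq)
      finally show ?thesis .
    qed
    show ?case
    proof (cases "running t w")
      case True
      then show ?thesis unfolding * using tau_less_iff[OF True] elim(2,3) by (auto simp: not_less[symmetric])
    next
      case False
      then have "\<not> t < A w q" using elim(1) t unfolding running_def clock_dom_def by blast
      then show ?thesis using False elim(3) by blast
    qed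
  qed
  ultimately show ?thesis by blast
qed

text \<open>The approximation has countably many values, and on the event that it takes a given value
  the Markov property at that fixed time applies.\<close>

lemma markov_at_dyadic:
  fixes n j :: nat
  defines "k \<equiv> 1 / real (Suc n)"
  assumes t: "0 \<le> t"
  shows "(\<integral>\<^sup>+w. indicator {w. running t w} w * local_time_after k j (dyadic_above m (tau t w)) w \<partial>P x) =
    (\<integral>\<^sup>+w. indicator {w. running t w} w * (ennreal (exp (- k * dyadic_above m (tau t w))) * ennreal (green k (X (dyadic_above m (tau t w)) w) (y j))) \<partial>P x)"
proof -
  have k: "0 < k" unfolding k_def by simp
  define q where "q i = (real i + 1) / 2 ^ m" for i :: nat
  have q0: "0 \<le> q i" for i unfolding q_def by simp
  have q_inj: "q i = q i' \<longleftrightarrow> i = i'" for i i' unfolding q_def by simp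
  have lvl: "\<exists>i. dyadic_above m (tau t w) = q i" for w unfolding dyadic_above_def q_def by blast
  have "\<exists>\<Lambda>. \<Lambda>\<in>natural_events M X (q i) \<and> (AE w in P x. (running t w \<and> dyadic_above m (tau t w) = q i) \<longleftrightarrow> w \<in> \<Lambda>)" for i
    using dyadic_level_event[OF t q_def] by blast
  then obtain \<Lambda> where L: "\<And>i. \<Lambda> i \<in> natural_events M X (q i)"
    and eq: "\<And>i. AE w in P x. (running t w \<and> dyadic_above m (tau t w) = q i) \<longleftrightarrow> w \<in> \<Lambda> i" by metis
  have Ls: "\<Lambda> i \<in> sets M" for i by (rule natural_events_sets[OF L])
  have all: "AE w in P x. \<forall>i. (running t w \<and> dyadic_above m (tau t w) = q i) \<longleftrightarrow> w \<in> \<Lambda> i"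
    unfolding AE_all_countable using eq by blast
  have split: "(\<integral>\<^sup>+w. indicator {w. running t w} w * H (dyadic_above m (tau t w)) w \<partial>P x) = (\<Sum>i. \<integral>\<^sup>+w. H (q i) w * indicator (\<Lambda> i) w \<partial>P x)"
    if H[measurable]: "\<And>i. H (q i) \<in> borel_measurable M" for H :: "real \<Rightarrow> 'o \<Rightarrow> ennreal"
  proof -
    note [measurable] = Ls
    have "(\<integral>\<^sup>+w. indicator {w. running t w} w * H (dyadic_above m (tau t w)) w \<partial>P x) = (\<integral>\<^sup>+w. (\<Sum>i. H (q i) w * indicator (\<Lambda> i) w) \<partial>P x)"
    proof (rule nn_integral_cong_AE)
      show "AE w in P x. indicator {w. running t w} w * H (dyadic_above m (tau t w)) w = (\<Sum>i. H (q i) w * indicator (\<Lambda> i) w)"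
        using all
      proof eventually_elim
        case (elim w)
        obtain i where i: "dyadic_above m (tau t w) = q i" using lvl by blast
        have "H (q i') w * indicator (\<Lambda> i') w = (if i' = i then indicator {w. running t w} w * H (q i) w else 0)" for i'
          using elim[rule_format, of i'] unfolding i q_inj by (auto simp: indicator_def)
        then have "(\<Sum>i'. H (q i') w * indicator (\<Lambda> i') w) = indicator {w. running t w} w * H (q i) w"
          using sums_unique[OF sums_single[of i "\<lambda>_. indicator {w. running t w} w * H (q i) w"]] by (simp only:)
        then show ?case unfolding i by simp
      qed
    qed
    also have "\<dots> = (\<Sum>i. \<integral>\<^sup>+w. H (q i) w * indicator (\<Lambda> i) w \<partial>P x)"
      by (rule nn_integral_suminf) measurable
    finally show ?thesis .
  qed
  have [measurable]: "discounted_local k (y j) \<in> borel_measurable M" by (rule discounted_local_measurable)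
  have [measurable]: "(\<lambda>z. green k z (y j)) \<in> borel_measurable borel"
    by (rule borel_measurable_continuous_onI[OF green_continuous_left[OF k]])
  have each: "(\<integral>\<^sup>+w. local_time_after k j (q i) w * indicator (\<Lambda> i) w \<partial>P x) =
      (\<integral>\<^sup>+w. ennreal (exp (- k * q i)) * ennreal (green k (X (q i) w) (y j)) * indicator (\<Lambda> i) w \<partial>P x)" for i
  proof -
    note [measurable] = Ls X_measurable[OF q0[of i]] shift_measurable[OF q0[of i]]
    have "(\<integral>\<^sup>+w. local_time_after k j (q i) w * indicator (\<Lambda> i) w \<partial>P x) = (\<integral>\<^sup>+w. ennreal (exp (- k * q i)) * (discounted_local k (y j) (\<theta> (q i) w) * indicator (\<Lambda> i) w) \<partial>P x)"
    proof (rule nn_integral_cong_AE)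
      show "AE w in P x. local_time_after k j (q i) w * indicator (\<Lambda> i) w = ennreal (exp (- k * q i)) * (discounted_local k (y j) (\<theta> (q i) w) * indicator (\<Lambda> i) w)"
        using AE_nice_path by eventually_elim (simp only: local_time_after_shift[OF _ k q0] mult.assoc)
    qed
    also have "\<dots> = ennreal (exp (- k * q i)) * (\<integral>\<^sup>+w\<in>\<Lambda> i. discounted_local k (y j) (\<theta> (q i) w) \<partial>P x)"
      by (rule nn_integral_cmult) measurable
    also have "(\<integral>\<^sup>+w\<in>\<Lambda> i. discounted_local k (y j) (\<theta> (q i) w) \<partial>P x) = (\<integral>\<^sup>+w\<in>\<Lambda> i. (\<integral>\<^sup>+v. discounted_local k (y j) v \<partial>P (X (q i) w)) \<partial>P x)"
      by (rule markov[OF q0 L discounted_local_measurable])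
    also have "\<dots> = (\<integral>\<^sup>+w\<in>\<Lambda> i. ennreal (green k (X (q i) w) (y j)) \<partial>P x)"
      unfolding k_def y_def good_discounted_local ..
    also have "ennreal (exp (- k * q i)) * \<dots> = (\<integral>\<^sup>+w. ennreal (exp (- k * q i)) * (ennreal (green k (X (q i) w) (y j)) * indicator (\<Lambda> i) w) \<partial>P x)"
      by (rule nn_integral_cmult[symmetric]) measurable
    finally show ?thesis by (simp only: mult.assoc)
  qed
  have m1: "local_time_after k j (q i) \<in> borel_measurable M" for i
    using local_time_after_measurable[of "\<lambda>_. q i" M "\<lambda>w. w" k j] by simp
  have m2: "(\<lambda>w. ennreal (exp (- k * q i)) * ennreal (green k (X (q i) w) (y j))) \<in> borel_measurable M" for i
  proof -
    note [measurable] = X_measurable[OF q0[of i]]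
    show ?thesis by measurable
  qed
  show ?thesis
    using split[of "local_time_after k j", OF m1] split[of "\<lambda>r w. ennreal (exp (- k * r)) * ennreal (green k (X r w) (y j))", OF m2] each by simp
qed

lemma running_indicator_measurable:
  assumes "f \<in> borel_measurable N" "g \<in> N \<rightarrow>\<^sub>M M"
  shows "(\<lambda>p. indicator {w. running (f p) w} (g p) :: ennreal) \<in> borel_measurable N"
proof (subst measurable_cong[where g="indicator {p \<in> space N. running (f p) (g p)}"])
  show "indicator {p \<in> space N. running (f p) (g p)} \<in> borel_measurable N"
    by (rule borel_measurable_indicator[OF running_measurable[OF assms]])
qed (simp add: indicator_def)

text \<open>Approximation from above: the left-hand sides increase, and the right-hand sides converge by
  right-continuity of the path and boundedness of the Green kernel.\<close>

lemma markov_at_clock: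
  fixes n j :: nat
  defines "k \<equiv> 1 / real (Suc n)"
  assumes t: "0 \<le> t"
  shows "(\<integral>\<^sup>+w. indicator {w. running t w} w * local_time_after k j (tau t w) w \<partial>P x) =
    (\<integral>\<^sup>+w. indicator {w. running t w} w * (ennreal (exp (- k * tau t w)) * ennreal (green k (X (tau t w) w) (y j))) \<partial>P x)"
proof -
  have k: "0 < k" unfolding k_def by simp
  let ?d = "\<lambda>m w. dyadic_above m (tau t w)"
  let ?I = "\<lambda>w. indicator {w. running t w} w :: ennreal"
  let ?f = "\<lambda>m w. ?I w * local_time_after k j (?d m w) w"
  let ?g = "\<lambda>r w. ?I w * (ennreal (exp (- k * r w)) * ennreal (green k (X (max 0 (r w)) w) (y j)))"
  note [measurable_cong] = sets_P
  have id: "(\<lambda>w. w) \<in> P x \<rightarrow>\<^sub>M M" by measurable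
  have tm: "(\<lambda>w. tau t w) \<in> borel_measurable (P x)" by (rule tau_measurable[OF borel_measurable_const id])
  have dm: "?d m \<in> borel_measurable (P x)" for m
  proof -
    note [measurable] = tm
    show ?thesis unfolding dyadic_above_def by measurable
  qed
  have im: "?I \<in> borel_measurable (P x)" by (rule running_indicator_measurable[OF borel_measurable_const id])
  have gc: "(\<lambda>z. green k z (y j)) \<in> borel_measurable borel"
    by (rule borel_measurable_continuous_onI[OF green_continuous_left[OF k]])
  have fm: "?f m \<in> borel_measurable (P x)" for m
    by (rule borel_measurable_times_ennreal[OF im local_time_after_measurable[OF dm id]])
  have gm: "?g r \<in> borel_measurable (P x)" if r: "r \<in> borel_measurable (P x)" for r
  proof -
    note [measurable] = r im measurable_compose[OF X_joint_comp[OF r id] gc]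
    show ?thesis by measurable
  qed
  have inc: "?f m w \<le> ?f (Suc m) w" and lim: "(\<lambda>m. ?f m w) \<longlonglongrightarrow> ?I w * local_time_after k j (tau t w) w" for m w
  proof -
    have "?f m w \<le> ?f (Suc m) w \<and> (\<lambda>m. ?f m w) \<longlonglongrightarrow> ?I w * local_time_after k j (tau t w) w"
    proof (cases "running t w")
      case True
      then have w: "nice_path w" using Om_nice unfolding running_def by blast
      have dec: "decseq (\<lambda>m. ?d m w)" by (rule decseq_SucI) (rule dyadic_above(3)[OF tau_nonneg])
      have dl: "(\<lambda>m. ?d m w) \<longlonglongrightarrow> tau t w"
        using dyadic_above_tendsto[OF tau_nonneg[of t w]] by (rule filterlim_mono[OF _ _ order.refl]) (simp add: at_within_le_nhds)
      have inc: "incseq (\<lambda>m. local_time_after k j (?d m w) w)" and sup: "(SUP m. local_time_after k j (?d m w) w) = local_time_after k j (tau t w) w"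
        by (rule local_time_after_tendsto[OF w k dec dl dyadic_above(1)[OF tau_nonneg]])+
      have "(\<lambda>m. local_time_after k j (?d m w) w) \<longlonglongrightarrow> local_time_after k j (tau t w) w" using LIMSEQ_SUP[OF inc] unfolding sup .
      then show ?thesis using True incseq_SucD[OF inc, of m] by simp
    qed simp
    then show "?f m w \<le> ?f (Suc m) w" "(\<lambda>m. ?f m w) \<longlonglongrightarrow> ?I w * local_time_after k j (tau t w) w" by blast+
  qed
  have "(\<lambda>m. \<integral>\<^sup>+w. ?f m w \<partial>P x) \<longlonglongrightarrow> (SUP m. \<integral>\<^sup>+w. ?f m w \<partial>P x)"
    by (rule LIMSEQ_SUP[OF nn_integral_incseq_SUP(1)[OF inc fm lim]])
  then have left: "(\<lambda>m. \<integral>\<^sup>+w. ?f m w \<partial>P x) \<longlonglongrightarrow> (\<integral>\<^sup>+w. ?I w * local_time_after k j (tau t w) w \<partial>P x)"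
    unfolding nn_integral_incseq_SUP(2)[OF inc fm lim] .
  have right: "(\<lambda>m. \<integral>\<^sup>+w. ?g (?d m) w \<partial>P x) \<longlonglongrightarrow> (\<integral>\<^sup>+w. ?g (tau t) w \<partial>P x)"
  proof (rule nn_integral_dominated_convergence[where w="\<lambda>_. ennreal (sup_const k)"])
    show "?g (?d m) \<in> borel_measurable (P x)" for m by (rule gm[OF dm])
    show "?g (tau t) \<in> borel_measurable (P x)" by (rule gm[OF tm])
    show "AE w in P x. ?g (?d m) w \<le> ennreal (sup_const k)" for m
    proof (rule AE_I2)
      fix w
      have d0: "0 \<le> ?d m w" using dyadic_above(1)[OF tau_nonneg[of t w], of m] tau_nonneg[of t w] by linarith
      have "ennreal (exp (- k * ?d m w)) * ennreal (green k (X (max 0 (?d m w)) w) (y j)) \<le> 1 * ennreal (sup_const k)"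
      proof (rule mult_mono)
        show "ennreal (exp (- k * ?d m w)) \<le> 1" using k d0 by simp
        show "ennreal (green k (X (max 0 (?d m w)) w) (y j)) \<le> ennreal (sup_const k)" by (rule ennreal_leI[OF green_le[OF k]])
      qed simp_all
      then show "?g (?d m) w \<le> ennreal (sup_const k)" by (cases "running t w") simp_all
    qed
    show "(\<integral>\<^sup>+w. ennreal (sup_const k) \<partial>P x) < \<infinity>"
      using prob_space.emeasure_space_1[OF prob_space_P[of x]] by simp
    show "AE w in P x. (\<lambda>m. ?g (?d m) w) \<longlonglongrightarrow> ?g (tau t) w"
    proof (rule AE_I2)
      fix w assume "w \<in> space (P x)"
      then have w: "w \<in> space M" by (simp add: space_P)
      note t0 = tau_nonneg[of t w]
      have d: "max 0 (?d m w) = ?d m w" for m using dyadic_above(1)[OF t0, of m] t0 by simp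
      have t': "max 0 (tau t w) = tau t w" using t0 by simp
      have Xl: "(\<lambda>m. X (?d m w) w) \<longlonglongrightarrow> X (tau t w) w"
        by (rule filterlim_compose[OF right_continuous[OF t0 w] dyadic_above_tendsto[OF t0]])
      have dl: "(\<lambda>m. ?d m w) \<longlonglongrightarrow> tau t w"
        using dyadic_above_tendsto[OF t0] by (rule filterlim_mono[OF _ _ order.refl]) (simp add: at_within_le_nhds)
      have gl: "(\<lambda>m. green k (X (?d m w) w) (y j)) \<longlonglongrightarrow> green k (X (tau t w) w) (y j)"
        using continuous_on_tendsto_compose[OF green_continuous_left[OF k] Xl] by simp
      have "(\<lambda>m. ennreal (exp (- k * ?d m w) * green k (X (?d m w) w) (y j))) \<longlonglongrightarrow> ennreal (exp (- k * tau t w) * green k (X (tau t w) w) (y j))"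
        by (rule tendsto_ennrealI[OF tendsto_mult[OF tendsto_exp[OF tendsto_mult[OF tendsto_const dl]] gl]])
      then show "(\<lambda>m. ?g (?d m) w) \<longlonglongrightarrow> ?g (tau t) w"
        unfolding d t' by (cases "running t w") (simp_all add: ennreal_mult green_nonneg[OF k])
    qed
  qed simp
  have t0: "max 0 (?d m w) = ?d m w" for m w using dyadic_above(1)[OF tau_nonneg[of t w], of m] tau_nonneg[of t w] by simp
  have t1: "max 0 (tau t w) = tau t w" for w using tau_nonneg[of t w] by simp
  have "(\<integral>\<^sup>+w. ?f m w \<partial>P x) = (\<integral>\<^sup>+w. ?g (?d m) w \<partial>P x)" for m
    unfolding t0 k_def by (rule markov_at_dyadic[OF t])
  then have "(\<integral>\<^sup>+w. ?I w * local_time_after k j (tau t w) w \<partial>P x) = (\<integral>\<^sup>+w. ?g (tau t) w \<partial>P x)"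
    using LIMSEQ_unique[OF left] right by simp
  then show ?thesis unfolding t1 .
qed

text \<open>Change of variables to the measure of the clock, which is the weighted sum of the measures of
  the local times. Each of these is carried by the times at which the path is at the atom.\<close>

lemma clock_functional:
  fixes h :: "'a \<Rightarrow> ennreal"
  assumes w: "w \<in> \<Omega>" and h: "h \<in> borel_measurable borel"
  shows "(\<integral>\<^sup>+t. ennreal (exp (- b * t)) * (indicator {w. running t w} w * (ennreal (exp (- k * tau t w)) * h (X (tau t w) w))) \<partial>lborel)
    = (\<Sum>i. ennreal (v i) * (h (y i) * survived k b i w))"
proof -
  note n = Om_nice[OF w]
  note Ac = A_clock[OF n]
  define f where "f s = ennreal (exp (- k * s) * exp (- b * A w s)) * h (X (max 0 s) w)" for s
  have Xm: "(\<lambda>s. h (X (max 0 s) w)) \<in> borel_measurable borel"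
  proof -
    have "(\<lambda>s::real. X (max 0 s) w) \<in> borel_measurable borel"
      by (rule X_joint_comp) (use Om_space[OF w] in simp_all)
    then show ?thesis by (rule measurable_compose[OF _ h])
  qed
  have Am: "A w \<in> borel_measurable borel" by (rule borel_measurable_continuous_onI[OF clock_funD(2)[OF Ac]])
  have em: "(\<lambda>s. ennreal (exp (- k * s) * exp (- b * A w s))) \<in> borel_measurable borel"
  proof -
    note [measurable] = Am
    show ?thesis by measurable
  qed
  have fm: "f \<in> borel_measurable borel" unfolding f_def by (rule borel_measurable_times_ennreal[OF em Xm])
  have "(\<integral>\<^sup>+t. ennreal (exp (- b * t)) * (indicator {w. running t w} w * (ennreal (exp (- k * tau t w)) * h (X (tau t w) w))) \<partial>lborel)
     = (\<integral>\<^sup>+t\<in>clock_dom (A w). f (clock_inv (A w) t) \<partial>lborel)"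
  proof (rule nn_integral_cong)
    fix t :: real
    show "ennreal (exp (- b * t)) * (indicator {w. running t w} w * (ennreal (exp (- k * tau t w)) * h (X (tau t w) w)))
      = f (clock_inv (A w) t) * indicator (clock_dom (A w)) t"
    proof (cases "t \<in> clock_dom (A w)")
      case True
      then have r: "running t w" using w by (simp add: running_def)
      have ta: "tau t w = clock_inv (A w) t" using r by (simp add: tau_def)
      show ?thesis using True r clock_inv_nonneg[OF Ac True]
        unfolding f_def ta by (simp add: clock_at_inv[OF Ac True] max_absorb2 ennreal_mult mult_ac)
    qed (simp add: running_def)
  qed
  also have "\<dots> = (\<integral>\<^sup>+s. f s \<partial>interval_measure (A w))" by (rule clock_change_of_variables[OF Ac fm])
  also have "\<dots> = (\<Sum>i. ennreal (v i) * (\<integral>\<^sup>+s. f s \<partial>interval_measure (atom_clock i w)))"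
  proof (rule nn_integral_sum_measure[OF _ _ _ fm])
    fix B :: "real set" assume "B \<in> sets borel"
    then show "emeasure (interval_measure (A w)) B = (\<Sum>i. ennreal (v i) * emeasure (interval_measure (atom_clock i w)) B)"
      by (rule sum_clock_measure[OF Ac atom_clock_clock[OF n] less_imp_le[OF v_pos], rotated]) (simp only: A_eq[OF n] total_clock_eq)
  qed simp_all
  also have "\<dots> = (\<Sum>i. ennreal (v i) * (h (y i) * survived k b i w))"
  proof (intro suminf_cong arg_cong[where f="\<lambda>z. ennreal _ * z"])
    fix i
    have "(\<integral>\<^sup>+s. f s \<partial>interval_measure (atom_clock i w)) = (\<integral>\<^sup>+s. h (y i) * ennreal (exp (- k * s) * exp (- b * A w s)) \<partial>interval_measure (atom_clock i w))"
    proof (rule nn_integral_cong_AE)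
      show "AE s in interval_measure (atom_clock i w). f s = h (y i) * ennreal (exp (- k * s) * exp (- b * A w s))"
        using atom_clock_support[OF n] by eventually_elim (simp add: f_def mult.commute)
    qed
    also have "\<dots> = h (y i) * survived k b i w"
      unfolding survived_def by (rule nn_integral_cmult) (use em in simp)
    finally show "(\<integral>\<^sup>+s. f s \<partial>interval_measure (atom_clock i w)) = h (y i) * survived k b i w" .
  qed
  finally show ?thesis .
qed

text \<open>The part of the discounted local time that is accumulated after killing.\<close>

definition lost :: "real \<Rightarrow> real \<Rightarrow> nat \<Rightarrow> 'o \<Rightarrow> ennreal" where
  "lost k b j w = (\<integral>\<^sup>+t. ennreal (b * exp (- b * t)) * (indicator {w. running t w} w * local_time_after k j (tau t w) w) \<partial>lborel)"

lemma discounted_local_split: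
  assumes w: "w \<in> \<Omega>" and k: "0 < k" and b: "0 < b"
  shows "discounted_local k (y j) w = survived k b j w + lost k b j w"
proof -
  note n = Om_nice[OF w]
  have L0: "L 0 (y j) w = 0" using n unfolding nice_path_def regular_path_def by blast
  have reg: "regular_path (y j) w" using n unfolding nice_path_def by blast
  have "discounted_local k (y j) w = local_time_after k j 0 w" unfolding discounted_local_def local_time_after_def
    by (intro nn_integral_cong) (auto simp: L0 ennreal_mult regular_path_nonneg[OF reg] k less_imp_le split: split_indicator)
  also have "\<dots> = (\<integral>\<^sup>+s. ennreal (exp (- k * s)) \<partial>interval_measure (atom_clock j w))"
    unfolding local_time_after_eq[OF n k]
  proof (rule nn_integral_cong_AE)
    show "AE s in interval_measure (atom_clock j w). ennreal (exp (- k * s)) * indicator {0<..} s = ennreal (exp (- k * s))"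
      using clock_fun_AE_pos[OF atom_clock_clock[OF n]] by eventually_elim simp
  qed
  also have "\<dots> = survived k b j w + (\<integral>\<^sup>+t\<in>clock_dom (A w). ennreal (b * exp (- b * t)) *
        (\<integral>\<^sup>+s. ennreal (exp (- k * s)) * indicator {clock_inv (A w) t<..} s \<partial>interval_measure (atom_clock j w)) \<partial>lborel)"
    unfolding survived_def by (rule clock_killing_decomposition[OF A_clock[OF n] atom_clock_clock[OF n] b])
  also have "(\<integral>\<^sup>+t\<in>clock_dom (A w). ennreal (b * exp (- b * t)) *
        (\<integral>\<^sup>+s. ennreal (exp (- k * s)) * indicator {clock_inv (A w) t<..} s \<partial>interval_measure (atom_clock j w)) \<partial>lborel) = lost k b j w"
    unfolding lost_def local_time_after_eq[OF n k]
    by (intro nn_integral_cong) (auto simp: running_def tau_def w split: split_indicator)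
  finally show ?thesis .
qed

lemma lost_measurable: "lost k b j \<in> borel_measurable M"
proof -
  have t: "(\<lambda>p. snd p) \<in> borel_measurable (M \<Otimes>\<^sub>M lborel)" and w: "(\<lambda>p. fst p) \<in> (M \<Otimes>\<^sub>M (lborel::real measure)) \<rightarrow>\<^sub>M M" by measurable
  note [measurable] = running_indicator_measurable[OF t w] local_time_after_measurable[OF tau_measurable[OF t w] w, of k j] t
  have "(\<lambda>p. ennreal (b * exp (- b * snd p)) * (indicator {w. running (snd p) w} (fst p) * local_time_after k j (tau (snd p) (fst p)) (fst p)))
      \<in> borel_measurable (M \<Otimes>\<^sub>M lborel)" by measurable
  then show ?thesis unfolding lost_def[abs_def]
    by (intro lborel.borel_measurable_nn_integral) (simp add: split_beta')
qed

text \<open>A Stieltjes integral with varying integrator is not visibly measurable in \<open>w\<close>. As the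
  difference of two measurable functions it has a measurable version.\<close>

lemma survived_version_pos:
  fixes n j :: nat
  assumes b: "0 < b"
  shows "\<exists>g\<in>borel_measurable M. AE w in P x. survived (1 / real (Suc n)) b j w = g w"
proof (rule bexI)
  let ?k = "1 / real (Suc n)"
  let ?g = "\<lambda>w. discounted_local ?k (y j) w - lost ?k b j w"
  have k: "0 < ?k" by simp
  note [measurable] = discounted_local_measurable lost_measurable
  show "?g \<in> borel_measurable M" by measurable
  have "(\<integral>\<^sup>+w. discounted_local ?k (y j) w \<partial>P x) \<noteq> \<infinity>" unfolding y_def good_discounted_local by simp
  moreover have "discounted_local ?k (y j) \<in> borel_measurable (P x)" using discounted_local_measurable by (simp add: measurable_cong_sets[OF sets_P refl])
  ultimately have "AE w in P x. discounted_local ?k (y j) w \<noteq> \<infinity>" by (rule nn_integral_PInf_AE[rotated])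
  then show "AE w in P x. survived ?k b j w = ?g w"
    using Om_full
  proof eventually_elim
    case (elim w)
    note s = discounted_local_split[OF elim(2) k b, of j]
    have "lost ?k b j w \<noteq> \<top>" using elim(1) unfolding s by auto
    then show ?case unfolding s by (rule ennreal_add_diff_cancel_right[symmetric])
  qed
qed

lemma expected_discounted_local_split:
  assumes b: "0 < b" and k: "k = 1 / real (Suc n)"
  shows "(\<integral>\<^sup>+w. discounted_local k (y j) w \<partial>P x) = killed_green k b x j + (\<integral>\<^sup>+w. lost k b j w \<partial>P x)"
proof -
  have k0: "0 < k" unfolding k by simp
  note [measurable_cong] = sets_P
  obtain g where g[measurable]: "g \<in> borel_measurable M" and ae: "AE w in P x. survived k b j w = g w"
    using survived_version_pos[OF b, of n j] unfolding k by blast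
  note [measurable] = lost_measurable
  have "(\<integral>\<^sup>+w. discounted_local k (y j) w \<partial>P x) = (\<integral>\<^sup>+w. g w + lost k b j w \<partial>P x)"
  proof (rule nn_integral_cong_AE)
    show "AE w in P x. discounted_local k (y j) w = g w + lost k b j w"
      using ae Om_full by eventually_elim (simp only: discounted_local_split[OF _ k0 b])
  qed
  also have "\<dots> = (\<integral>\<^sup>+w. g w \<partial>P x) + (\<integral>\<^sup>+w. lost k b j w \<partial>P x)" by (rule nn_integral_add) measurable
  also have "(\<integral>\<^sup>+w. g w \<partial>P x) = killed_green k b x j"
    unfolding killed_green_def by (rule nn_integral_cong_AE) (use ae in eventually_elim, simp)
  finally show ?thesis .
qed

text \<open>The discount factors increase to \<open>1\<close> as the rate tends to \<open>0\<close>.\<close>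

lemma survived_zero:
  assumes w: "nice_path w"
  shows "survived 0 b j w = (SUP n. survived (1 / real (Suc n)) b j w)" "survived (1 / real (Suc n)) b j w \<le> survived (1 / real (Suc (Suc n))) b j w"
proof -
  let ?I = "interval_measure (atom_clock j w)"
  let ?f = "\<lambda>n s. ennreal (exp (- (1 / real (Suc n)) * s) * exp (- b * A w s))"
  have pos: "AE s in ?I. 0 < s" by (rule clock_fun_AE_pos[OF atom_clock_clock[OF w]])
  have step: "?f n s \<le> ?f (Suc n) s" if "0 < s" for n s
  proof -
    have "1 / real (Suc (Suc n)) * s \<le> 1 / real (Suc n) * s" using that by (intro mult_right_mono) (simp_all add: frac_le)
    then have "exp (- (1 / real (Suc n)) * s) \<le> exp (- (1 / real (Suc (Suc n))) * s)" by simp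
    then show ?thesis by (intro ennreal_leI mult_right_mono) simp_all
  qed
  have inc: "AE s in ?I. ?f n s \<le> ?f (Suc n) s" for n using pos by eventually_elim (rule step)
  have Am: "A w \<in> borel_measurable borel" by (rule borel_measurable_continuous_onI[OF clock_funD(2)[OF A_clock[OF w]]])
  have m: "?f n \<in> borel_measurable ?I" for n
  proof -
    note [measurable] = Am
    show ?thesis by measurable
  qed
  show "survived (1 / real (Suc n)) b j w \<le> survived (1 / real (Suc (Suc n))) b j w"
    unfolding survived_def by (rule nn_integral_mono_AE[OF inc])
  have "survived 0 b j w = (\<integral>\<^sup>+s. (SUP n. ?f n s) \<partial>?I)"
    unfolding survived_def
  proof (rule nn_integral_cong_AE)
    show "AE s in ?I. ennreal (exp (- 0 * s) * exp (- b * A w s)) = (SUP n. ?f n s)"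
      using pos
    proof eventually_elim
      case (elim s)
      have "incseq (\<lambda>n. ?f n s)" by (rule incseq_SucI) (rule step[OF elim])
      then have 1: "(\<lambda>n. ?f n s) \<longlonglongrightarrow> (SUP n. ?f n s)" by (rule LIMSEQ_SUP)
      have z: "(\<lambda>n. 1 / real (Suc n)) \<longlonglongrightarrow> 0" using LIMSEQ_inverse_real_of_nat by (simp add: inverse_eq_divide)
      have 2: "(\<lambda>n. ?f n s) \<longlonglongrightarrow> ennreal (exp (- 0 * s) * exp (- b * A w s))"
        by (rule tendsto_ennrealI[OF tendsto_mult[OF tendsto_exp[OF tendsto_mult[OF tendsto_minus[OF z] tendsto_const]] tendsto_const]])
      show ?case by (rule LIMSEQ_unique[OF 2 1])
    qed
  qed
  also have "\<dots> = (SUP n. survived (1 / real (Suc n)) b j w)"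
    unfolding survived_def by (rule nn_integral_monotone_convergence_SUP_AE[OF _ m]) (use inc in simp)
  finally show "survived 0 b j w = (SUP n. survived (1 / real (Suc n)) b j w)" .
qed

lemma survived_version:
  assumes b: "0 < b" and k: "k = 0 \<or> (\<exists>n. k = 1 / real (Suc n))"
  shows "\<exists>g\<in>borel_measurable M. AE w in P x. survived k b j w = g w"
proof (cases "k = 0")
  case True
  have "\<exists>g. g \<in> borel_measurable M \<and> (AE w in P x. survived (1 / real (Suc n)) b j w = g w)" for n
    using survived_version_pos[OF b, of n j] by blast
  then obtain g where g: "\<And>n. g n \<in> borel_measurable M" "\<And>n. AE w in P x. survived (1 / real (Suc n)) b j w = g n w" by metis
  have "AE w in P x. \<forall>n. survived (1 / real (Suc n)) b j w = g n w" unfolding AE_all_countable using g(2) by blast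
  with AE_nice_path have "AE w in P x. survived 0 b j w = (SUP n. g n w)"
  proof eventually_elim
    case (elim w)
    show ?case unfolding survived_zero(1)[OF elim(1)] using elim(2) by (simp only:)
  qed
  moreover have "(\<lambda>w. SUP n. g n w) \<in> borel_measurable M" by (rule borel_measurable_SUP) (simp_all add: g(1))
  ultimately show ?thesis unfolding True by (rule bexI)
next
  case False
  then obtain n where n: "k = 1 / real (Suc n)" using k by auto
  show ?thesis unfolding n by (rule survived_version_pos[OF b])
qed

lemma killed_green_zero_at:
  assumes b: "0 < b"
  shows "killed_green 0 b x j = (SUP n. killed_green (1 / real (Suc n)) b x j)"
    and "killed_green (1 / real (Suc n)) b x j \<le> killed_green (1 / real (Suc (Suc n))) b x j"
proof -
  have "\<exists>g. g \<in> borel_measurable M \<and> (AE w in P x. survived (1 / real (Suc n)) b j w = g w)" for n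
    using survived_version_pos[OF b, of n j] by blast
  then obtain g where g: "\<And>n. g n \<in> borel_measurable M" "\<And>n. AE w in P x. survived (1 / real (Suc n)) b j w = g n w" by metis
  have all: "AE w in P x. \<forall>n. survived (1 / real (Suc n)) b j w = g n w" unfolding AE_all_countable using g(2) by blast
  have gm: "g n \<in> borel_measurable (P x)" for n using g(1) by (simp add: measurable_cong_sets[OF sets_P refl])
  have kg: "killed_green (1 / real (Suc n)) b x j = integral\<^sup>N (P x) (g n)" for n
    unfolding killed_green_def by (rule nn_integral_cong_AE[OF g(2)])
  have inc: "AE w in P x. g n w \<le> g (Suc n) w" for n
    using all AE_nice_path
  proof eventually_elim
    case (elim w)
    show ?case using survived_zero(2)[OF elim(2), of n b j] elim(1) by (simp only:)
  qed
  show "killed_green (1 / real (Suc n)) b x j \<le> killed_green (1 / real (Suc (Suc n))) b x j"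
    unfolding kg by (rule nn_integral_mono_AE[OF inc])
  have "killed_green 0 b x j = (\<integral>\<^sup>+w. (SUP n. g n w) \<partial>P x)"
    unfolding killed_green_def
  proof (rule nn_integral_cong_AE)
    show "AE w in P x. survived 0 b j w = (SUP n. g n w)"
      using all AE_nice_path
    proof eventually_elim
      case (elim w)
      show ?case unfolding survived_zero(1)[OF elim(2)] using elim(1) by (simp only:)
    qed
  qed
  also have "\<dots> = (SUP n. killed_green (1 / real (Suc n)) b x j)"
    unfolding kg by (rule nn_integral_monotone_convergence_SUP_AE[OF _ gm]) (use inc in simp)
  finally show "killed_green 0 b x j = (SUP n. killed_green (1 / real (Suc n)) b x j)" .
qed

lemma tau_fubini:
  fixes F :: "real \<Rightarrow> 'o \<Rightarrow> ennreal"
  assumes F: "(\<lambda>p. F (snd p) (fst p)) \<in> borel_measurable (M \<Otimes>\<^sub>M lborel)" and f[measurable]: "f \<in> borel_measurable borel"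
  shows "(\<integral>\<^sup>+t. ennreal (f t) * (\<integral>\<^sup>+w. F t w \<partial>P x) \<partial>lborel) = (\<integral>\<^sup>+w. (\<integral>\<^sup>+t. ennreal (f t) * F t w \<partial>lborel) \<partial>P x)"
proof -
  interpret S: sigma_finite_measure "P x" by (rule sigma_finite_P)
  interpret pair_sigma_finite "P x" lborel ..
  have s: "sets (P x \<Otimes>\<^sub>M lborel) = sets (M \<Otimes>\<^sub>M (lborel::real measure))" by (rule sets_pair_measure_cong[OF sets_P refl])
  have F': "(\<lambda>p. F (snd p) (fst p)) \<in> borel_measurable (P x \<Otimes>\<^sub>M lborel)"
    using F by (simp only: measurable_cong_sets[OF s refl])
  have Ft: "F t \<in> borel_measurable (P x)" for t
    using measurable_compose[OF measurable_Pair2'[of t lborel "P x"] F'] by simp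
  have "(\<integral>\<^sup>+t. ennreal (f t) * (\<integral>\<^sup>+w. F t w \<partial>P x) \<partial>lborel) = (\<integral>\<^sup>+t. (\<integral>\<^sup>+w. ennreal (f t) * F t w \<partial>P x) \<partial>lborel)"
    by (simp only: nn_integral_cmult[OF Ft])
  also have "\<dots> = (\<integral>\<^sup>+w. (\<integral>\<^sup>+t. ennreal (f t) * F t w \<partial>lborel) \<partial>P x)"
  proof (rule Fubini')
    note [measurable] = F'
    have "(\<lambda>p. ennreal (f (snd p)) * F (snd p) (fst p)) \<in> borel_measurable (P x \<Otimes>\<^sub>M lborel)" by measurable
    then show "(\<lambda>(w, t). ennreal (f t) * F t w) \<in> borel_measurable (P x \<Otimes>\<^sub>M lborel)" by (simp add: split_beta')
  qed
  finally show ?thesis .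
qed

text \<open>The resolvent of the time-changed process, with an additional discount in the original time,
  expressed by the killed Green kernel.\<close>

lemma clock_resolvent:
  fixes h :: "'a \<Rightarrow> ennreal"
  assumes b: "0 < b" and k: "k = 0 \<or> (\<exists>n. k = 1 / real (Suc n))" and h: "h \<in> borel_measurable borel"
  shows "(\<integral>\<^sup>+t. ennreal (exp (- b * t)) * (\<integral>\<^sup>+w. indicator {w. running t w} w * (ennreal (exp (- k * tau t w)) * h (X (tau t w) w)) \<partial>P x) \<partial>lborel)
    = (\<Sum>i. ennreal (v i) * (h (y i) * killed_green k b x i))" (is "?l = ?r")
proof -
  let ?F = "\<lambda>t w. indicator {w. running t w} w * (ennreal (exp (- k * tau t w)) * h (X (tau t w) w))"
  have t: "(\<lambda>p. snd p) \<in> borel_measurable (M \<Otimes>\<^sub>M lborel)" and w: "(\<lambda>p. fst p) \<in> (M \<Otimes>\<^sub>M (lborel::real measure)) \<rightarrow>\<^sub>M M" by measurable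
  have X0: "X (tau t w) w = X (max 0 (tau t w)) w" for t w using tau_nonneg[of t w] by (simp only: max_absorb2)
  note tm = tau_measurable[OF t w]
  have Fm: "(\<lambda>p. ?F (snd p) (fst p)) \<in> borel_measurable (M \<Otimes>\<^sub>M lborel)"
  proof -
    note [measurable] = running_indicator_measurable[OF t w] tm measurable_compose[OF X_joint_comp[OF tm w] h]
    show ?thesis unfolding X0 by measurable
  qed
  have "\<exists>g. g \<in> borel_measurable M \<and> (AE w in P x. survived k b j w = g w)" for j
    using survived_version[OF b k, of j] by blast
  then obtain g where g: "\<And>i. g i \<in> borel_measurable M" "\<And>i. AE w in P x. survived k b i w = g i w" by metis
  have all: "AE w in P x. \<forall>i. survived k b i w = g i w" unfolding AE_all_countable using g(2) by blast
  have gm: "g n \<in> borel_measurable (P x)" for n using g(1) by (simp add: measurable_cong_sets[OF sets_P refl])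
  have kg: "killed_green k b x i = integral\<^sup>N (P x) (g i)" for i
    unfolding killed_green_def by (rule nn_integral_cong_AE[OF g(2)])
  have "?l = (\<integral>\<^sup>+w. (\<integral>\<^sup>+t. ennreal (exp (- b * t)) * ?F t w \<partial>lborel) \<partial>P x)"
    by (rule tau_fubini[OF Fm]) measurable
  also have "\<dots> = (\<integral>\<^sup>+w. (\<Sum>i. ennreal (v i) * (h (y i) * g i w)) \<partial>P x)"
  proof (rule nn_integral_cong_AE)
    show "AE w in P x. (\<integral>\<^sup>+t. ennreal (exp (- b * t)) * ?F t w \<partial>lborel) = (\<Sum>i. ennreal (v i) * (h (y i) * g i w))"
      using all Om_full
    proof eventually_elim
      case (elim w)
      show ?case unfolding clock_functional[OF elim(2) h] using elim(1) by (simp only:)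
    qed
  qed
  also have "\<dots> = (\<Sum>i. \<integral>\<^sup>+w. ennreal (v i) * (h (y i) * g i w) \<partial>P x)"
    by (rule nn_integral_suminf) (use gm in measurable)
  also have "\<dots> = ?r" unfolding kg by (simp only: nn_integral_cmult gm borel_measurable_times_ennreal borel_measurable_const)
  finally show ?thesis .
qed

lemma green_decomposition_at:
  fixes n j :: nat
  defines "k \<equiv> 1 / real (Suc n)"
  assumes b: "0 < b"
  shows "ennreal (green k x (y j)) = killed_green k b x j + ennreal b * (\<Sum>i. ennreal (v i) * (ennreal (green k (y i) (y j)) * killed_green k b x i))"
proof -
  have k: "0 < k" unfolding k_def by simp
  let ?h = "\<lambda>z. ennreal (green k z (y j))"
  have h: "?h \<in> borel_measurable borel"
    by (rule measurable_compose[OF borel_measurable_continuous_onI[OF green_continuous_left[OF k]] measurable_ennreal])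
  let ?F = "\<lambda>t w. indicator {w. running t w} w * local_time_after k j (tau t w) w"
  let ?H = "\<lambda>t w. indicator {w. running t w} w * (ennreal (exp (- k * tau t w)) * ?h (X (tau t w) w))"
  have t: "(\<lambda>p. snd p) \<in> borel_measurable (M \<Otimes>\<^sub>M lborel)" and w: "(\<lambda>p. fst p) \<in> (M \<Otimes>\<^sub>M (lborel::real measure)) \<rightarrow>\<^sub>M M" by measurable
  have Fm: "(\<lambda>p. ?F (snd p) (fst p)) \<in> borel_measurable (M \<Otimes>\<^sub>M lborel)"
    by (rule borel_measurable_times_ennreal[OF running_indicator_measurable[OF t w] local_time_after_measurable[OF tau_measurable[OF t w] w]])
  have eq: "(\<integral>\<^sup>+w. ?F t w \<partial>P x) = (\<integral>\<^sup>+w. ?H t w \<partial>P x)" for t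
  proof (cases "0 \<le> t")
    case True
    then show ?thesis unfolding k_def by (rule markov_at_clock)
  next
    case False
    then have "\<not> running t w" for w unfolding running_def clock_dom_def by blast
    then show ?thesis by simp
  qed
  have "(\<integral>\<^sup>+w. lost k b j w \<partial>P x) = (\<integral>\<^sup>+t. ennreal (b * exp (- b * t)) * (\<integral>\<^sup>+w. ?F t w \<partial>P x) \<partial>lborel)"
    unfolding lost_def by (rule tau_fubini[OF Fm, symmetric]) measurable
  also have "\<dots> = (\<integral>\<^sup>+t. ennreal b * (ennreal (exp (- b * t)) * (\<integral>\<^sup>+w. ?H t w \<partial>P x)) \<partial>lborel)"
    unfolding eq using b by (simp add: ennreal_mult mult.assoc less_imp_le)
  also have "\<dots> = ennreal b * (\<integral>\<^sup>+t. ennreal (exp (- b * t)) * (\<integral>\<^sup>+w. ?H t w \<partial>P x) \<partial>lborel)"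
  proof (rule nn_integral_cmult)
    interpret S: sigma_finite_measure "P x" by (rule sigma_finite_P)
    have id: "(\<lambda>p. fst p) \<in> borel_measurable (lborel \<Otimes>\<^sub>M P x)" and sd: "(\<lambda>p. snd p) \<in> ((lborel::real measure) \<Otimes>\<^sub>M P x) \<rightarrow>\<^sub>M M"
      using measurable_snd[of lborel "P x"] by (simp_all add: measurable_cong_sets[OF refl sets_P])
    have "(\<lambda>p. ?F (fst p) (snd p)) \<in> borel_measurable (lborel \<Otimes>\<^sub>M P x)"
      by (rule borel_measurable_times_ennreal[OF running_indicator_measurable[OF id sd] local_time_after_measurable[OF tau_measurable[OF id sd] sd]])
    then have "(\<lambda>t. \<integral>\<^sup>+w. ?F t w \<partial>P x) \<in> borel_measurable lborel"
      by (intro S.borel_measurable_nn_integral) (simp add: split_beta')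
    then show "(\<lambda>t. ennreal (exp (- b * t)) * (\<integral>\<^sup>+w. ?H t w \<partial>P x)) \<in> borel_measurable lborel"
      unfolding eq[symmetric] by measurable
  qed
  also have "(\<integral>\<^sup>+t. ennreal (exp (- b * t)) * (\<integral>\<^sup>+w. ?H t w \<partial>P x) \<partial>lborel) = (\<Sum>i. ennreal (v i) * (?h (y i) * killed_green k b x i))"
    by (rule clock_resolvent[OF b _ h]) (auto simp: k_def)
  finally have 1: "(\<integral>\<^sup>+w. lost k b j w \<partial>P x) = ennreal b * (\<Sum>i. ennreal (v i) * (?h (y i) * killed_green k b x i))" .
  have "ennreal (green k x (y j)) = (\<integral>\<^sup>+w. discounted_local k (y j) w \<partial>P x)" unfolding k_def y_def good_discounted_local ..
  also have "\<dots> = killed_green k b x j + (\<integral>\<^sup>+w. lost k b j w \<partial>P x)"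
    by (rule expected_discounted_local_split[OF b]) (simp add: k_def)
  finally show ?thesis unfolding 1 .
qed

text \<open>Positions may be repeated among the indices, so the mass of the point \<open>y j\<close> is a sum
  over all indices. The event in the definition of a transition density is measurable only for the completion; it
  agrees almost surely with a measurable one.\<close>

lemma atom_hitting_probability:
  assumes J: "jointly_continuous_transition_density (time_changed X L \<nu>) P \<nu> p" and t: "0 < t"
  shows "(\<integral>\<^sup>+w. indicator {w. running t w} w * indicator {y j} (X (tau t w) w) \<partial>P x)
    = (\<Sum>i. ennreal (v i) * indicator {y j} (y i)) * ennreal (p t x (y j))"
proof -
  let ?S = "{w \<in> space (P x). time_changed X L \<nu> t w \<in> Some ` {y j}}"
  let ?T = "{w \<in> space (P x). running t w \<and> X (tau t w) w = y j}"
  have id: "(\<lambda>w. w) \<in> P x \<rightarrow>\<^sub>M M" by (simp add: measurable_ident_sets[OF sets_P])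
  have tm: "tau t \<in> borel_measurable (P x)" using tau_measurable[OF borel_measurable_const id] .
  have X0: "X (tau t w) w = X (max 0 (tau t w)) w" for w using tau_nonneg[of t w] by (simp only: max_absorb2)
  have "{w \<in> space (P x). X (tau t w) w \<in> {y j}} \<in> sets (P x)"
    unfolding X0 by (rule measurable_sets_Collect[OF X_joint_comp[OF tm id]]) simp
  from sets.Int[OF running_measurable[OF borel_measurable_const[of t "P x"] id] this]
  have "{w \<in> space (P x). running t w} \<inter> {w \<in> space (P x). X (tau t w) w \<in> {y j}} \<in> sets (P x)" .
  moreover have "?T = {w \<in> space (P x). running t w} \<inter> {w \<in> space (P x). X (tau t w) w \<in> {y j}}" by blast
  ultimately have T: "?T \<in> sets (P x)" by (simp only:)
  have T': "?T \<in> sets (completion (P x))" by (rule sets_completionI_sets[OF T])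
  have ae0: "AE w in P x. w \<in> ?T \<longleftrightarrow> w \<in> ?S"
    using Om_full
  proof eventually_elim
    case (elim w)
    have n: "nice_path w" by (rule Om_nice[OF elim])
    show ?case unfolding mem_Collect_eq time_changed_eq[OF n less_imp_le[OF t]]
      using elim by (auto simp: running_def tau_def)
  qed
  then have ae: "AE w in completion (P x). w \<in> ?T \<longleftrightarrow> w \<in> ?S" by (rule AE_completion)
  have S: "?S \<in> sets (completion (P x))"
    by (rule completion.in_sets_AE[OF ae T']) auto
  have "emeasure (P x) ?T = emeasure (completion (P x)) ?T" using T by simp
  also have "\<dots> = emeasure (completion (P x)) ?S" by (rule emeasure_eq_AE[OF ae T' S])
  also have "\<dots> = (\<integral>\<^sup>+z\<in>{y j}. ennreal (p t x z) \<partial>\<nu>)"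
  proof (rule bspec[of "sets borel"])
    show "\<forall>A\<in>sets borel. emeasure (completion (P x)) {w \<in> space (P x). time_changed X L \<nu> t w \<in> Some ` A} = (\<integral>\<^sup>+z\<in>A. ennreal (p t x z) \<partial>\<nu>)"
      using J t unfolding jointly_continuous_transition_density_def by blast
  qed simp
  also have "\<dots> = (\<integral>\<^sup>+z. ennreal (p t x (y j)) * indicator {y j} z \<partial>\<nu>)"
    by (rule nn_integral_cong) (simp add: indicator_def)
  also have "\<dots> = (\<Sum>i. ennreal (v i) * (ennreal (p t x (y j)) * indicator {y j} (y i)))"
    by (rule nn_integral_atomic) simp
  also have "\<dots> = (\<Sum>i. ennreal (v i) * indicator {y j} (y i)) * ennreal (p t x (y j))"
    unfolding ennreal_suminf_multc[symmetric] by (simp only: mult_ac)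
  finally have 1: "emeasure (P x) ?T = (\<Sum>i. ennreal (v i) * indicator {y j} (y i)) * ennreal (p t x (y j))" .
  have "emeasure (P x) ?T = (\<integral>\<^sup>+w. indicator ?T w \<partial>P x)" using T by simp
  also have "\<dots> = (\<integral>\<^sup>+w. indicator {w. running t w} w * indicator {y j} (X (tau t w) w) \<partial>P x)"
    by (rule nn_integral_cong) (simp add: indicator_def)
  finally show ?thesis unfolding 1 by (rule HOL.sym)
qed

lemma killed_green_laplace_at:
  assumes J: "jointly_continuous_transition_density (time_changed X L \<nu>) P \<nu> p" and b: "0 < b"
  shows "(\<Sum>i. ennreal (v i) * indicator {y j} (y i)) * killed_green 0 b x j
    = (\<Sum>i. ennreal (v i) * indicator {y j} (y i)) * laplace (\<lambda>t. ennreal (p t x (y j))) b"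
proof -
  let ?n = "\<Sum>i. ennreal (v i) * indicator {y j} (y i)"
  let ?F = "\<lambda>t. \<integral>\<^sup>+w. indicator {w. running t w} w * (ennreal (exp (- 0 * tau t w)) * indicator {y j} (X (tau t w) w)) \<partial>P x"
  have "(\<Sum>i. ennreal (v i) * (indicator {y j} (y i) * killed_green 0 b x i)) = ?n * killed_green 0 b x j"
  proof -
    have "ennreal (v i) * (indicator {y j} (y i) * killed_green 0 b x i) = ennreal (v i) * indicator {y j} (y i) * killed_green 0 b x j" for i
    proof (cases "y i = y j")
      case True
      then have "killed_green 0 b x i = killed_green 0 b x j" unfolding killed_green_def survived_def atom_clock_def by simp
      then show ?thesis by (simp add: mult.assoc)
    qed simp
    then show ?thesis by (simp only: ennreal_suminf_multc)
  qed
  moreover have "(\<integral>\<^sup>+t. ennreal (exp (- b * t)) * ?F t \<partial>lborel) = (\<Sum>i. ennreal (v i) * (indicator {y j} (y i) * killed_green 0 b x i))"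
    by (rule clock_resolvent[OF b]) simp_all
  moreover have "(\<integral>\<^sup>+t. ennreal (exp (- b * t)) * ?F t \<partial>lborel) = (\<integral>\<^sup>+t. ?n * (ennreal (exp (- b * t)) * ennreal (p t x (y j)) * indicator {0<..} t) \<partial>lborel)"
  proof (rule nn_integral_cong_AE)
    have "AE t in lborel. t \<noteq> (0::real)" by (rule AE_lborel_singleton)
    then show "AE t in lborel. ennreal (exp (- b * t)) * ?F t = ?n * (ennreal (exp (- b * t)) * ennreal (p t x (y j)) * indicator {0<..} t)"
    proof eventually_elim
      case (elim t)
      show ?case
      proof (cases "0 < t")
        case True
        then show ?thesis using atom_hitting_probability[OF J True, of j] by (simp add: mult_ac)
      next
        case False
        then have "\<not> running t w" for w using elim unfolding running_def clock_dom_def by auto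
        then show ?thesis using False by simp
      qed
    qed
  qed
  moreover have "\<dots> = ?n * laplace (\<lambda>t. ennreal (p t x (y j))) b"
    unfolding laplace_def
  proof (rule nn_integral_cmult)
    have "continuous_on ({0<..} \<times> UNIV \<times> UNIV) (\<lambda>(t, x, y). p t x y)"
      using J unfolding jointly_continuous_transition_density_def by blast
    then have "continuous_on {0<..} (\<lambda>t. (\<lambda>(t, x, y). p t x y) (t, x, y j))"
      by (rule continuous_on_compose2) (auto intro!: continuous_intros)
    then have "continuous_on {0<..} (\<lambda>t. p t x (y j))" by simp
    then have "(\<lambda>t. indicator {0<..} t *\<^sub>R p t x (y j)) \<in> borel_measurable borel"
      by (rule borel_measurable_continuous_on_indicator[rotated]) simp
    then have [measurable]: "(\<lambda>t. ennreal (indicator {0<..} t *\<^sub>R p t x (y j))) \<in> borel_measurable borel" by simp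
    have "(\<lambda>t. ennreal (exp (- b * t)) * ennreal (p t x (y j)) * indicator {0<..} t) = (\<lambda>t. ennreal (exp (- b * t)) * ennreal (indicator {0<..} t *\<^sub>R p t x (y j)))"
      by (rule ext) (simp add: indicator_def)
    then show "(\<lambda>t. ennreal (exp (- b * t)) * ennreal (p t x (y j)) * indicator {0<..} t) \<in> borel_measurable lborel"
      by (simp only:) measurable
  qed
  ultimately show ?thesis by simp
qed

end

section \<open>The transition density at the atoms\<close>

text \<open>Such a set discharges the hypotheses of the preceding lemmas.\<close>

lemma nice_path_set: "\<exists>\<Omega>. \<Omega> \<in> sets M \<and> (\<forall>w\<in>\<Omega>. nice_path w) \<and> (AE w in P x. w \<in> \<Omega>)"
proof -
  obtain N where N: "{w \<in> space (P x). \<not> nice_path w} \<subseteq> N" "emeasure (P x) N = 0" "N \<in> sets (P x)"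
    using AE_nice_path[of x] by (rule AE_E)
  have "space M - N \<in> sets M" using N(3) sets.compl_sets[of N M] by (simp add: sets_P)
  moreover have "\<forall>w\<in>space M - N. nice_path w" using N(1) by (auto simp: space_P)
  moreover have "AE w in P x. w \<in> space M - N"
    by (rule AE_I[OF _ N(2,3)]) (auto simp: space_P)
  ultimately show ?thesis by blast
qed

lemma green_decomposition:
  fixes n j :: nat
  defines "k \<equiv> 1 / real (Suc n)"
  assumes b: "0 < b"
  shows "ennreal (green k x (y j)) = killed_green k b x j + ennreal b * (\<Sum>i. ennreal (v i) * (ennreal (green k (y i) (y j)) * killed_green k b x i))"
proof -
  obtain \<Omega> where O: "\<Omega> \<in> sets M" "\<And>w. w \<in> \<Omega> \<Longrightarrow> nice_path w" "AE w in P x. w \<in> \<Omega>" using nice_path_set[of x] by blast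
  show ?thesis unfolding k_def by (rule green_decomposition_at[OF O b])
qed

lemma killed_green_zero:
  assumes b: "0 < b"
  shows "killed_green 0 b x j = (SUP n. killed_green (1 / real (Suc n)) b x j)"
proof -
  obtain \<Omega> where O: "\<Omega> \<in> sets M" "\<And>w. w \<in> \<Omega> \<Longrightarrow> nice_path w" "AE w in P x. w \<in> \<Omega>" using nice_path_set[of x] by blast
  show ?thesis by (rule killed_green_zero_at(1)[OF O b])
qed

lemma killed_green_mono:
  assumes b: "0 < b"
  shows "killed_green (1 / real (Suc n)) b x j \<le> killed_green (1 / real (Suc (Suc n))) b x j"
proof -
  obtain \<Omega> where O: "\<Omega> \<in> sets M" "\<And>w. w \<in> \<Omega> \<Longrightarrow> nice_path w" "AE w in P x. w \<in> \<Omega>" using nice_path_set[of x] by blast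
  show ?thesis by (rule killed_green_zero_at(2)[OF O b])
qed

text \<open>The mass of \<open>\<nu>\<close> at the point \<open>y j\<close>.\<close>

definition multiplicity :: "nat \<Rightarrow> ennreal" where
  "multiplicity j = (\<Sum>i. ennreal (v i) * indicator {y j} (y i))"

lemma multiplicity: "ennreal (v j) \<le> multiplicity j" "multiplicity j < \<infinity>" "0 < multiplicity j"
proof -
  have "(\<Sum>i\<in>{j}. ennreal (v i) * indicator {y j} (y i)) \<le> multiplicity j"
    unfolding multiplicity_def by (rule sum_le_suminf) simp_all
  then show 1: "ennreal (v j) \<le> multiplicity j" by simp
  show "0 < multiplicity j" by (rule less_le_trans[OF _ 1]) (simp add: v_pos)
  obtain r :: nat where r: "dist undefined (y j) \<le> real r" using real_arch_simple by blast
  have "multiplicity j \<le> (\<Sum>i. ennreal (fst (c i)) * indicator (cball undefined (real r)) (snd (c i)))"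
    unfolding multiplicity_def v_def[symmetric] y_def[symmetric]
  proof (rule suminf_le)
    show "ennreal (v i) * indicator {y j} (y i) \<le> ennreal (v i) * indicator (cball undefined (real r)) (y i)" for i
      using r by (intro mult_left_mono) (simp_all add: indicator_def)
  qed simp_all
  also have "\<dots> < \<infinity>" by (rule mass)
  finally show "multiplicity j < \<infinity>" .
qed

context
  fixes p
  assumes J: "jointly_continuous_transition_density (time_changed X L \<nu>) P \<nu> p"
begin

lemma p_continuous:
  assumes "\<And>z. z \<in> S \<Longrightarrow> 0 < f z" "continuous_on S f" "continuous_on S g" "continuous_on S h"
  shows "continuous_on S (\<lambda>z. p (f z) (g z) (h z))"
proof -
  have "continuous_on ({0<..} \<times> UNIV \<times> UNIV) (\<lambda>(t, x, y). p t x y)"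
    using J unfolding jointly_continuous_transition_density_def by blast
  then have "continuous_on S (\<lambda>z. (\<lambda>(t, x, y). p t x y) (f z, g z, h z))"
    by (rule continuous_on_compose2) (use assms in \<open>auto intro!: continuous_on_Pair\<close>)
  then show ?thesis by simp
qed

lemma p_nonneg: "0 < t \<Longrightarrow> 0 \<le> p t x z"
  using J unfolding jointly_continuous_transition_density_def by blast

lemma p_atom_le:
  assumes t: "0 < t"
  shows "p t x (y j) \<le> 1 / v j"
proof -
  obtain \<Omega> where O: "\<Omega> \<in> sets M" "\<And>w. w \<in> \<Omega> \<Longrightarrow> nice_path w" "AE w in P x. w \<in> \<Omega>" using nice_path_set[of x] by blast
  have "ennreal (v j) * ennreal (p t x (y j)) \<le> multiplicity j * ennreal (p t x (y j))"
    by (rule mult_right_mono[OF multiplicity(1)]) simp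
  also have "\<dots> = (\<integral>\<^sup>+w. indicator {w. running \<Omega> t w} w * indicator {y j} (X (tau \<Omega> t w) w) \<partial>P x)"
    unfolding multiplicity_def by (rule atom_hitting_probability[OF O J t, symmetric])
  also have "\<dots> \<le> (\<integral>\<^sup>+w. 1 \<partial>P x)" by (rule nn_integral_mono) (simp add: indicator_def)
  also have "\<dots> = 1" using prob_space.emeasure_space_1[OF prob_space_P[of x]] by simp
  finally have "v j * p t x (y j) \<le> 1"
    using v_pos[of j] p_nonneg[OF t, of x "y j"] by (simp add: ennreal_mult[symmetric] less_imp_le)
  then show ?thesis using v_pos[of j] by (simp add: field_simps)
qed

text \<open>Both sides, multiplied by the mass of the atom, are the resolvent of the time-changed process
  evaluated at this point; the mass is positive and finite.\<close>

lemma killed_green_laplace: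
  assumes b: "0 < b"
  shows "killed_green 0 b x j = laplace (\<lambda>t. ennreal (p t x (y j))) b"
proof -
  obtain \<Omega> where O: "\<Omega> \<in> sets M" "\<And>w. w \<in> \<Omega> \<Longrightarrow> nice_path w" "AE w in P x. w \<in> \<Omega>" using nice_path_set[of x] by blast
  have "multiplicity j * killed_green 0 b x j = multiplicity j * laplace (\<lambda>t. ennreal (p t x (y j))) b"
    unfolding multiplicity_def by (rule killed_green_laplace_at[OF O J b])
  moreover have "multiplicity j \<noteq> 0" "multiplicity j \<noteq> \<top>" using multiplicity(2,3)[of j] by auto
  ultimately show ?thesis unfolding ennreal_mult_cancel_left by blast
qed

lemma killed_green_finite:
  assumes b: "0 < b"
  shows "killed_green 0 b x j < \<infinity>"
proof -
  have "killed_green 0 b x j \<le> (\<integral>\<^sup>+t. ennreal (1 / (b * v j)) * (ennreal (b * exp (- b * t)) * indicator {0<..} t) \<partial>lborel)"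
    unfolding killed_green_laplace[OF b] laplace_def
  proof (rule nn_integral_mono)
    fix t :: real
    show "ennreal (exp (- b * t)) * ennreal (p t x (y j)) * indicator {0<..} t \<le> ennreal (1 / (b * v j)) * (ennreal (b * exp (- b * t)) * indicator {0<..} t)"
    proof (cases "0 < t")
      case True
      have "exp (- b * t) * p t x (y j) \<le> exp (- b * t) * (1 / v j)" by (rule mult_left_mono[OF p_atom_le[OF True]]) simp
      also have "\<dots> = 1 / (b * v j) * (b * exp (- b * t))" using b by simp
      finally have "ennreal (exp (- b * t) * p t x (y j)) \<le> ennreal (1 / (b * v j) * (b * exp (- b * t)))" by (rule ennreal_leI)
      then show ?thesis using True b v_pos[of j] p_nonneg[OF True, of x "y j"] by (simp add: ennreal_mult[symmetric] less_imp_le)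
    qed simp
  qed
  also have "\<dots> = ennreal (1 / (b * v j)) * ennreal (exp (- b * 0))"
    by (subst nn_integral_cmult) (simp_all only: nn_integral_exp_tail[OF b], measurable)
  finally show ?thesis by (simp add: ennreal_mult_less_top order.strict_trans1)
qed

lemma killed_green_tendsto:
  assumes b: "0 < b"
  shows "(\<lambda>n. killed_green (1 / real (Suc n)) b x j) \<longlonglongrightarrow> killed_green 0 b x j"
proof -
  have "incseq (\<lambda>n. killed_green (1 / real (Suc n)) b x j)" by (rule incseq_SucI) (rule killed_green_mono[OF b])
  then show ?thesis unfolding killed_green_zero[OF b] by (rule LIMSEQ_SUP)
qed

lemma kernel_prod_tendsto:
  assumes a: "0 < a" and b: "0 < b"
  shows "(\<lambda>n. kernel_prod (\<lambda>m. ennreal (v m)) (\<lambda>i. killed_green (1 / real (Suc n)) a (y i)) (\<lambda>i. killed_green (1 / real (Suc n)) b (y i)) i j)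
    \<longlonglongrightarrow> kernel_prod (\<lambda>m. ennreal (v m)) (\<lambda>i. killed_green 0 a (y i)) (\<lambda>i. killed_green 0 b (y i)) i j"
proof -
  let ?f = "\<lambda>n m. killed_green (1 / real (Suc n)) a (y i) m * ennreal (v m) * killed_green (1 / real (Suc n)) b (y m) j"
  have inc: "incseq (\<lambda>n. ?f n m)" for m
    by (rule incseq_SucI) (intro mult_mono killed_green_mono a b order.refl, simp_all)
  have lim: "(\<lambda>n. ?f n m) \<longlonglongrightarrow> killed_green 0 a (y i) m * ennreal (v m) * killed_green 0 b (y m) j" for m
  proof -
    have fa: "killed_green 0 a (y i) m \<noteq> \<top>" and fb: "killed_green 0 b (y m) j \<noteq> \<top>"
      using killed_green_finite[OF a, of "y i" m] killed_green_finite[OF b, of "y m" j] by auto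
    have "(\<lambda>n. killed_green (1 / real (Suc n)) a (y i) m * ennreal (v m)) \<longlonglongrightarrow> killed_green 0 a (y i) m * ennreal (v m)"
      by (rule tendsto_mult_ennreal[OF killed_green_tendsto[OF a] tendsto_const]) (simp add: fa)
    then show ?thesis
      by (rule tendsto_mult_ennreal[OF _ killed_green_tendsto[OF b]]) (simp add: fa fb ennreal_mult_eq_top_iff)
  qed
  have sup: "(SUP n. ?f n m) = killed_green 0 a (y i) m * ennreal (v m) * killed_green 0 b (y m) j" for m
    by (rule LIMSEQ_unique[OF LIMSEQ_SUP[OF inc] lim])
  have "(\<Sum>m. killed_green 0 a (y i) m * ennreal (v m) * killed_green 0 b (y m) j) = (SUP n. \<Sum>m. ?f n m)"
    unfolding sup[symmetric] by (rule ennreal_suminf_SUP_eq[OF inc])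
  moreover have "incseq (\<lambda>n. \<Sum>m. ?f n m)"
  proof (rule incseq_SucI)
    show "(\<Sum>m. ?f n m) \<le> (\<Sum>m. ?f (Suc n) m)" for n
      by (rule suminf_le[OF incseq_SucD[OF inc]]) simp_all
  qed
  ultimately show ?thesis unfolding kernel_prod_def by (simp only: LIMSEQ_SUP)
qed

lemma killed_green_perturbation:
  fixes n :: nat
  defines "k \<equiv> 1 / real (Suc n)"
  assumes b: "0 < b"
  shows "ennreal (green k (y i) (y j)) = killed_green k b (y i) j
    + ennreal b * kernel_prod (\<lambda>m. ennreal (v m)) (\<lambda>i. killed_green k b (y i)) (\<lambda>i j. ennreal (green k (y i) (y j))) i j"
proof -
  have "killed_green k b (y i) m * ennreal (v m) * ennreal (green k (y m) (y j)) = ennreal (v m) * (ennreal (green k (y m) (y j)) * killed_green k b (y i) m)" for m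
    by (simp only: mult_ac)
  then show ?thesis unfolding kernel_prod_def k_def using green_decomposition[OF b, of n "y i" j] by (simp only:)
qed

text \<open>The perturbation equation gives symmetry and the resolvent equation for each positive discount,
  where the unperturbed kernel is finite. Both survive the monotone limit, whereas
  the unperturbed kernel may become infinite.\<close>

lemma atoms_symmetric_chain: "symmetric_chain (\<lambda>i j t. p t (y i) (y j)) v (\<lambda>b i j. killed_green 0 b (y i) j)"
proof
  fix i j :: nat and t :: real
  show "0 < t \<Longrightarrow> 0 \<le> p t (y i) (y j)" by (rule p_nonneg)
  show "continuous_on {0<..} (\<lambda>t. p t (y i) (y j))" by (rule p_continuous) (simp_all add: continuous_on_id)
  show "0 < v i" by (rule v_pos)
  show "\<exists>B. \<forall>t>0. p t (y i) (y i) \<le> B" using p_atom_le by blast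
next
  fix b :: real and i j :: nat assume b: "0 < b"
  show "killed_green 0 b (y i) j = laplace (\<lambda>t. ennreal (p t (y i) (y j))) b" by (rule killed_green_laplace[OF b])
  show "killed_green 0 b (y i) j < \<infinity>" by (rule killed_green_finite[OF b])
  have "killed_green (1 / real (Suc n)) b (y i) j = killed_green (1 / real (Suc n)) b (y j) i" for n
  proof (rule perturbed_kernel_symmetric[where u="\<lambda>i j. ennreal (green (1 / real (Suc n)) (y i) (y j))" and V="\<lambda>i. killed_green (1 / real (Suc n)) b (y i)"])
    show "ennreal (green (1 / real (Suc n)) (y i) (y j)) = ennreal (green (1 / real (Suc n)) (y j) (y i))" for i j
      by (subst green_sym) simp_all
    show "ennreal (green (1 / real (Suc n)) (y i) (y j)) < \<infinity>" for i j by simp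
  qed (rule killed_green_perturbation[OF b])
  then show "killed_green 0 b (y i) j = killed_green 0 b (y j) i" unfolding killed_green_zero[OF b] by (simp only:)
next
  fix b e :: real and i j :: nat assume e: "0 < e" and eb: "e < b"
  have b: "0 < b" using e eb by linarith
  let ?a = "\<lambda>n. (\<lambda>i. killed_green (1 / real (Suc n)) b (y i))" and ?b = "\<lambda>n. (\<lambda>i. killed_green (1 / real (Suc n)) e (y i))"
  have "?b n i j = ?a n i j + ennreal (b - e) * kernel_prod (\<lambda>m. ennreal (v m)) (?a n) (?b n) i j" for n
  proof (rule perturbed_kernel_resolvent_equation[where u="\<lambda>i j. ennreal (green (1 / real (Suc n)) (y i) (y j))", OF _ _ _ _ e eb])
    show "ennreal (green (1 / real (Suc n)) (y i) (y j)) = ennreal (green (1 / real (Suc n)) (y j) (y i))" for i j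
      by (subst green_sym) simp_all
    show "ennreal (green (1 / real (Suc n)) (y i) (y j)) < \<infinity>" for i j by simp
  qed (rule killed_green_perturbation[OF b], rule killed_green_perturbation[OF e])
  moreover have "(\<lambda>n. ?a n i j + ennreal (b - e) * kernel_prod (\<lambda>m. ennreal (v m)) (?a n) (?b n) i j)
     \<longlonglongrightarrow> killed_green 0 b (y i) j + ennreal (b - e) * kernel_prod (\<lambda>m. ennreal (v m)) (\<lambda>i. killed_green 0 b (y i)) (\<lambda>i. killed_green 0 e (y i)) i j"
    by (rule tendsto_add[OF killed_green_tendsto[OF b] ennreal_tendsto_cmult[OF _ kernel_prod_tendsto[OF b e]]]) simp
  ultimately have "(\<lambda>n. ?b n i j) \<longlonglongrightarrow> killed_green 0 b (y i) j + ennreal (b - e) * kernel_prod (\<lambda>m. ennreal (v m)) (\<lambda>i. killed_green 0 b (y i)) (\<lambda>i. killed_green 0 e (y i)) i j"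
    by (simp only:)
  from LIMSEQ_unique[OF killed_green_tendsto[OF e] this]
  show "killed_green 0 e (y i) j = killed_green 0 b (y i) j + ennreal (b - e) * kernel_prod (\<lambda>m. ennreal (v m)) (\<lambda>i. killed_green 0 b (y i)) (\<lambda>i. killed_green 0 e (y i)) i j" .
qed

context
  assumes dense: "\<And>z e. 0 < e \<Longrightarrow> \<exists>i. dist z (y i) < e"
begin

text \<open>Inequalities between continuous functions need to be checked only at the atoms.\<close>

lemma le_of_atoms:
  assumes "continuous_on UNIV f" "continuous_on UNIV g" and le: "\<And>i. f (y i) \<le> (g (y i) :: real)"
  shows "f x \<le> g x"
proof -
  have "\<exists>i. dist x (y i) < inverse (real (Suc n))" for n by (rule dense) simp
  then obtain i where i: "\<And>n. dist x (y (i n)) < inverse (real (Suc n))" by metis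
  have "(\<lambda>n. dist (y (i n)) x) \<longlonglongrightarrow> 0"
    by (rule tendsto_sandwich[OF _ _ tendsto_const LIMSEQ_inverse_real_of_nat])
      (use i in \<open>auto simp: dist_commute less_imp_le\<close>)
  then have l: "(\<lambda>n. y (i n)) \<longlonglongrightarrow> x" by (rule iffD2[OF tendsto_dist_iff])
  have "(\<lambda>n. f (y (i n))) \<longlonglongrightarrow> f x" by (rule continuous_on_tendsto_compose[OF assms(1) l]) simp_all
  moreover have "(\<lambda>n. g (y (i n))) \<longlonglongrightarrow> g x" by (rule continuous_on_tendsto_compose[OF assms(2) l]) simp_all
  ultimately show ?thesis by (rule LIMSEQ_le) (use le in blast)
qed

lemma heat_kernel_antimono:
  assumes s: "0 < s" and st: "s \<le> t"
  shows "p t x x \<le> p s x x"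
proof (rule le_of_atoms[where f="\<lambda>x. p t x x" and g="\<lambda>x. p s x x"])
  show "continuous_on UNIV (\<lambda>x. p t x x)" "continuous_on UNIV (\<lambda>x. p s x x)"
    using s st by (auto intro!: p_continuous simp: continuous_on_id)
  show "p t (y i) (y i) \<le> p s (y i) (y i)" for i
    by (rule symmetric_chain.diag_antimono[OF atoms_symmetric_chain s st])
qed

lemma heat_kernel_diag_lower:
  assumes s: "0 < s"
  shows "v k * (p s x (y k))\<^sup>2 \<le> p (2 * s) x x"
proof (rule le_of_atoms[where f="\<lambda>x. v k * (p s x (y k))\<^sup>2" and g="\<lambda>x. p (2 * s) x x"])
  show "continuous_on UNIV (\<lambda>x. v k * (p s x (y k))\<^sup>2)"
    by (intro continuous_on_mult continuous_on_const continuous_on_power p_continuous continuous_on_id s)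
  show "continuous_on UNIV (\<lambda>x. p (2 * s) x x)" by (rule p_continuous) (simp_all add: s continuous_on_id)
  show "v k * (p s (y i) (y k))\<^sup>2 \<le> p (2 * s) (y i) (y i)" for i
    by (rule symmetric_chain.diag_lower[OF atoms_symmetric_chain s])
qed

text \<open>Otherwise the process would spend no time in any ball, but a path
  stays in some ball up to time \<open>1\<close>.\<close>

lemma green_not_zero: "\<exists>z. green 1 x z \<noteq> 0"
proof (rule ccontr)
  assume "\<not> ?thesis"
  then have z: "green 1 x z = 0" for z by blast
  have "AE w in P x. discounted_occ 1 (cball x (real n)) w = 0" for n :: nat
  proof -
    have "(\<integral>\<^sup>+w. discounted_occ 1 (cball x (real n)) w \<partial>P x) = 0" by (subst expected_discounted_occ) (simp_all add: z)
    moreover have "discounted_occ 1 (cball x (real n)) \<in> borel_measurable (P x)"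
      using discounted_occ_measurable[of "cball x (real n)" 1] by (simp add: measurable_cong_sets[OF sets_P refl])
    ultimately show ?thesis by (simp add: nn_integral_0_iff_AE)
  qed
  then have "AE w in P x. \<forall>n::nat. discounted_occ 1 (cball x (real n)) w = 0" unfolding AE_all_countable by blast
  then have "AE w in P x. False"
    using AE_space[of "P x"]
  proof eventually_elim
    case (elim w)
    have w: "w \<in> space M" using elim(2) by (simp add: space_P)
    obtain K where "\<forall>z\<in>(\<lambda>s. X s w) ` {0..1}. dist x z \<le> K"
      using path_bounded[OF w, of 1] unfolding bounded_any_center[where a=x] by blast
    then have K: "dist x (X s w) \<le> K" if "0 \<le> s" "s \<le> 1" for s using that by simp
    obtain n :: nat where n: "K \<le> real n" using real_arch_simple by blast
    have "ennreal (exp (- 1)) = (\<integral>\<^sup>+s. ennreal (exp (- 1)) * indicator {0..1::real} s \<partial>lborel)"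
      using nn_integral_cmult_indicator[of "{0..1::real}" lborel "ennreal (exp (- 1))"] by simp
    also have "\<dots> \<le> discounted_occ 1 (cball x (real n)) w" unfolding discounted_occ_def
    proof (rule nn_integral_mono)
      fix s :: real
      show "ennreal (exp (- 1)) * indicator {0..1} s \<le> ennreal (exp (- 1 * s)) * indicator (cball x (real n)) (X (max 0 s) w) * indicator {0..} s"
      proof (cases "s \<in> {0..1}")
        case True
        then have "X (max 0 s) w \<in> cball x (real n)" using K[of s] n by (simp add: max_absorb2)
        then show ?thesis using True by (simp add: ennreal_leI)
      qed simp
    qed
    finally show False using elim(1) by simp
  qed
  then show False using prob_space.AE_False[OF prob_space_P] by blast
qed

text \<open>If the kernel vanishes at some time on the diagonal, it vanishes at all times, and then so
  does the Green kernel.\<close>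

lemma heat_kernel_pos:
  assumes T: "0 < T"
  shows "0 < p T x x"
proof (rule ccontr)
  assume "\<not> ?thesis"
  then have zT: "p T x x = 0" using p_nonneg[OF T, of x x] by simp
  have atom0: "p s x (y k) = 0" if "0 < s" "p (2 * s) x x = 0" for s k
  proof -
    have "v k * (p s x (y k))\<^sup>2 \<le> 0" using heat_kernel_diag_lower[OF that(1), of k x] that(2) by simp
    then show ?thesis using v_pos[of k] by (simp add: mult_le_0_iff)
  qed
  have half: "p s x x = 0" if s: "0 < s" and z: "p (2 * s) x x = 0" for s
  proof -
    have "p s x x \<le> 0"
      by (rule le_of_atoms[where f="\<lambda>z. p s x z" and g="\<lambda>z. 0", OF p_continuous continuous_on_const])
        (use s atom0[OF s z] in \<open>simp_all add: continuous_on_id continuous_on_const\<close>)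
    then show ?thesis using p_nonneg[OF s, of x x] by simp
  qed
  \<comment> \<open>Zeros on the diagonal propagate to half the time, and from there to all later times.\<close>
  have small: "p (T / 2 ^ m) x x = 0" for m :: nat
  proof (induction m)
    case (Suc m)
    show ?case by (rule half) (use T Suc in simp_all)
  qed (simp add: zT)
  have diag0: "p t x x = 0" if t: "0 < t" for t
  proof -
    have "(\<lambda>m. T * (1/2::real) ^ m) \<longlonglongrightarrow> T * 0" by (intro tendsto_mult tendsto_const LIMSEQ_power_zero) simp
    then have "\<forall>\<^sub>F m in sequentially. T * (1/2::real) ^ m < t" using t by (intro order_tendstoD(2)[of _ "T * 0"]) simp_all
    then obtain m where "T * (1/2::real) ^ m < t" by (auto simp: eventually_sequentially)
    then have m: "T / 2 ^ m \<le> t" by (simp add: power_divide)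
    have "p t x x \<le> p (T / 2 ^ m) x x" by (rule heat_kernel_antimono) (use T m in simp_all)
    then show ?thesis using small[of m] p_nonneg[OF t, of x x] by simp
  qed
  have p0: "p t x (y k) = 0" if "0 < t" for t k by (rule atom0[OF that diag0]) (use that in simp)
  have k0: "killed_green 0 1 x k = 0" for k
  proof -
    have "laplace (\<lambda>t. ennreal (p t x (y k))) 1 = (\<integral>\<^sup>+t. 0 \<partial>(lborel::real measure))"
      unfolding laplace_def by (rule nn_integral_cong) (simp add: p0 split: split_indicator)
    then show ?thesis using killed_green_laplace[of 1 x k] by simp
  qed
  have k1: "killed_green 1 1 x k = 0" for k
  proof -
    have "killed_green (1 / real (Suc 0)) 1 x k \<le> killed_green 0 1 x k"
      unfolding killed_green_zero[OF zero_less_one] by (rule SUP_upper) simp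
    then show ?thesis by (simp add: k0)
  qed
  have "green 1 x (y j) = 0" for j
    using green_decomposition[of 1 0 x j] green_nonneg[of 1 x "y j"] by (simp add: k1)
  then have a: "green 1 x (y j) \<le> 0" for j by simp
  have "green 1 x z \<le> 0" for z
  proof (rule le_of_atoms[where f="\<lambda>z. green 1 x z" and g="\<lambda>z. 0", OF _ continuous_on_const a])
    have "continuous_on UNIV (\<lambda>z. green 1 z x)" by (rule green_continuous_left) simp
    moreover have "green 1 z x = green 1 x z" for z by (rule green_sym) simp
    ultimately show "continuous_on UNIV (\<lambda>z. green 1 x z)" by simp
  qed
  then show False using green_not_zero[of x] green_nonneg[of 1 x] by (meson antisym zero_less_one)
qed

theorem diagonal_bounds:
  assumes G: "compact G" and i: "y i \<in> G"
  shows "\<exists>c>0. \<forall>t. 0 < t \<and> t < 1 \<longrightarrow> c \<le> (INF x\<in>G. p t x x) \<and> (INF x\<in>G. p t x x) \<le> 1 / v i"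
proof -
  have "continuous_on G (\<lambda>x. p 1 x x)" by (rule p_continuous) (simp_all add: continuous_on_id)
  then obtain x0 where x0: "x0 \<in> G" "\<And>x. x \<in> G \<Longrightarrow> p 1 x0 x0 \<le> p 1 x x"
    using continuous_attains_inf[OF G] i by blast
  have "p 1 x0 x0 \<le> (INF x\<in>G. p t x x) \<and> (INF x\<in>G. p t x x) \<le> 1 / v i" if t: "0 < t \<and> t < 1" for t
  proof
    show "p 1 x0 x0 \<le> (INF x\<in>G. p t x x)"
    proof (rule cINF_greatest)
      show "G \<noteq> {}" using i by blast
      fix x assume "x \<in> G"
      then show "p 1 x0 x0 \<le> p t x x" using x0(2)[of x] heat_kernel_antimono[of t 1 x] t by linarith
    qed
    have "bdd_below ((\<lambda>x. p t x x) ` G)" by (rule bdd_belowI2[where m=0]) (use p_nonneg t in simp)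
    then have "(INF x\<in>G. p t x x) \<le> p t (y i) (y i)" using i by (rule cINF_lower)
    also have "\<dots> \<le> 1 / v i" using t by (intro p_atom_le) simp
    finally show "(INF x\<in>G. p t x x) \<le> 1 / v i" .
  qed
  then show ?thesis using heat_kernel_pos[of 1 x0] by (intro exI[of _ "p 1 x0 x0"]) simp
qed

end

end

end

section \<open>The bounds for the random measure\<close>

theorem theorem4p7:
  fixes \<E> :: "('a::metric_space \<Rightarrow> real) \<Rightarrow> ('a \<Rightarrow> real) \<Rightarrow> real"
    and \<F> :: "('a \<Rightarrow> real) set"
    and \<mu> :: "'a measure"
    and \<rho> :: 'a
    and M :: "'o measure"
    and X :: "real \<Rightarrow> 'o \<Rightarrow> 'a"
    and \<theta> :: "real \<Rightarrow> 'o \<Rightarrow> 'o"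
    and P :: "'a \<Rightarrow> 'o measure"
    and L :: "real \<Rightarrow> 'a \<Rightarrow> 'o \<Rightarrow> real"
    and \<alpha> :: real
    and W :: "'w measure"
    and \<xi> :: "nat \<Rightarrow> 'w \<Rightarrow> real \<times> 'a"
    and \<nu> :: "'w \<Rightarrow> 'a measure"
    and p :: "'w \<Rightarrow> real \<Rightarrow> 'a \<Rightarrow> 'a \<Rightarrow> real"
    and G :: "'a set"
  assumes "resistance_space \<E> \<F> \<mu>"
    and "recurrent_form \<E> \<F> \<mu>"
    and "hunt_process M X \<theta> P"
    and "associated_process \<E> \<F> \<mu> X P"
    and "local_times \<mu> M X \<theta> P L"
    and "UVD \<E> \<F> \<mu>"
    and "0 < \<alpha>" and "\<alpha> < 1"
    and "poisson_point_process W \<xi> (fin_intensity \<alpha> \<mu>)"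
    and "\<And>i \<omega>. \<omega> \<in> space W \<Longrightarrow> 0 < fst (\<xi> i \<omega>)"
    and "\<And>\<omega>. \<nu> \<omega> = atomic_measure (\<lambda>i. \<xi> i \<omega>)"
    and "AE \<omega> in W. jointly_continuous_transition_density (time_changed X L (\<nu> \<omega>)) P (\<nu> \<omega>) (p \<omega>)"
    and "compact G" and "emeasure \<mu> G > 0"
  shows "\<exists>(c\<^sub>1 :: 'w \<Rightarrow> real) (c\<^sub>2 :: 'w \<Rightarrow> real) (t\<^sub>F :: real). 0 < t\<^sub>F \<and>
    (AE \<omega> in W. 0 < c\<^sub>1 \<omega> \<and>
       (\<forall>t. 0 < t \<and> t < t\<^sub>F \<longrightarrow>
          c\<^sub>1 \<omega> \<le> (INF x\<in>G. p \<omega> t x x) \<and> (INF x\<in>G. p \<omega> t x x) \<le> c\<^sub>2 \<omega>))"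
proof -
  interpret R: resistance_process \<E> \<F> \<mu> M X \<theta> P L
    by (intro resistance_process.intro resistance_process_axioms.intro assms)
  interpret N: fin_points W \<xi> \<alpha> \<mu>
    by (intro fin_points.intro fin_points_axioms.intro assms R.sigma_finite_mu R.sets_borel)
  let ?good = "\<lambda>z. (\<forall>n x. (\<integral>\<^sup>+w. R.discounted_local (1 / real (Suc n)) z w \<partial>P x) = ennreal (R.green (1 / real (Suc n)) x z)) \<and>
    (\<forall>x. AE w in P x. R.local_growth z w)"
  have "AE z in \<mu>. \<forall>n x. (\<integral>\<^sup>+w. R.discounted_local (1 / real (Suc n)) z w \<partial>P x) = ennreal (R.green (1 / real (Suc n)) x z)"
    unfolding AE_all_countable by (intro allI R.expected_discounted_local) simp
  then have "AE z in \<mu>. ?good z" using R.AE_local_growth by eventually_elim blast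
  then obtain Z where Z: "{z \<in> space \<mu>. \<not> ?good z} \<subseteq> Z" "emeasure \<mu> Z = 0" "Z \<in> sets \<mu>" by (rule AE_E)
  have "Z \<in> null_sets \<mu>" using Z(2,3) by (rule null_setsI)
  then have avoid: "AE \<omega> in W. \<forall>i. snd (\<xi> i \<omega>) \<notin> Z" by (rule N.avoid_null_set)
  have mass: "AE \<omega> in W. \<forall>r::nat. (\<Sum>i. ennreal (fst (\<xi> i \<omega>)) * indicator (cball undefined (real r)) (snd (\<xi> i \<omega>))) < \<infinity>"
    unfolding AE_all_countable
    by (intro allI N.locally_finite_mass R.bounded_finite_measure) simp_all
  obtain D :: "'a set" where D: "countable D" "\<And>x e. 0 < e \<Longrightarrow> \<exists>d\<in>D. dist x d < e" using R.separable by blast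
  have hit: "AE \<omega> in W. \<forall>d\<in>D. \<forall>n. \<exists>i. snd (\<xi> i \<omega>) \<in> ball d (inverse (real (Suc n)))"
    unfolding AE_ball_countable[OF D(1)] AE_all_countable
  proof (intro ballI allI)
    fix d :: 'a and n :: nat
    show "AE \<omega> in W. \<exists>i. snd (\<xi> i \<omega>) \<in> ball d (inverse (real (Suc n)))"
      by (rule N.hits_set[OF _ R.full_support R.bounded_finite_measure]) simp_all
  qed
  have hitG: "AE \<omega> in W. \<exists>i. snd (\<xi> i \<omega>) \<in> G"
    by (rule N.hits_set[OF borel_compact[OF \<open>compact G\<close>] \<open>emeasure \<mu> G > 0\<close> R.bounded_finite_measure[OF compact_imp_bounded[OF \<open>compact G\<close>]]])
  let ?bounds = "\<lambda>\<omega> a b. 0 < a \<and> (\<forall>t. 0 < t \<and> t < 1 \<longrightarrow> a \<le> (INF x\<in>G. p \<omega> t x x) \<and> (INF x\<in>G. p \<omega> t x x) \<le> b)"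
  \<comment> \<open>The almost sure properties make the realisation an instance of the deterministic situation.\<close>
  have ex: "AE \<omega> in W. \<exists>a b. ?bounds \<omega> a b"
    using AE_space avoid mass hit hitG assms(12)
  proof eventually_elim
    case (elim \<omega>)
    have good: "?good (snd (\<xi> i \<omega>))" for i using elim(2) Z(1) by (auto simp: R.space_mu)
    interpret T: time_change \<E> \<F> \<mu> M X \<theta> P L "\<lambda>i. \<xi> i \<omega>"
    proof
      show "0 < fst (\<xi> i \<omega>)" for i by (rule assms(10)[OF elim(1)])
      show "(\<integral>\<^sup>+w. R.discounted_local (1 / real (Suc n)) (snd (\<xi> i \<omega>)) w \<partial>P x) = ennreal (R.green (1 / real (Suc n)) x (snd (\<xi> i \<omega>)))" for i n x
        using good by blast
      show "AE w in P x. R.local_growth (snd (\<xi> i \<omega>)) w" for i x using good by blast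
      show "(\<Sum>i. ennreal (fst (\<xi> i \<omega>)) * indicator (cball undefined (real r)) (snd (\<xi> i \<omega>))) < \<infinity>" for r :: nat
        using elim(3) by blast
    qed
    have J: "jointly_continuous_transition_density (time_changed X L (atomic_measure (\<lambda>i. \<xi> i \<omega>))) P (atomic_measure (\<lambda>i. \<xi> i \<omega>)) (p \<omega>)"
      using elim(6) unfolding assms(11) .
    have dense: "\<exists>i. dist z (T.y i) < e" if e: "0 < e" for z e
    proof -
      obtain d where d: "d \<in> D" "dist z d < e / 2" using D(2)[of "e / 2" z] e by auto
      obtain n where n: "inverse (real (Suc n)) < e / 2" using reals_Archimedean[of "e / 2"] e by auto
      obtain i where "snd (\<xi> i \<omega>) \<in> ball d (inverse (real (Suc n)))" using elim(4) d(1) by blast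
      then have "dist d (T.y i) < e / 2" using n by (simp add: T.y_def)
      then have "dist z (T.y i) < e" using d(2) dist_triangle[of z "T.y i" d] by linarith
      then show ?thesis by blast
    qed
    obtain i where "snd (\<xi> i \<omega>) \<in> G" using elim(5) by blast
    then have "T.y i \<in> G" by (simp only: T.y_def)
    from T.diagonal_bounds[OF J dense \<open>compact G\<close> this] show ?case by blast
  qed
  \<comment> \<open>The bounds are chosen separately for each realisation.\<close>
  define c where "c \<omega> = (SOME ab. ?bounds \<omega> (fst ab) (snd ab))" for \<omega>
  have "AE \<omega> in W. ?bounds \<omega> (fst (c \<omega>)) (snd (c \<omega>))"
    using ex
  proof eventually_elim
    case (elim \<omega>)
    then obtain a b where "?bounds \<omega> a b" by blast
    then have "?bounds \<omega> (fst (a, b)) (snd (a, b))" by simp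
    then show ?case unfolding c_def by (rule someI)
  qed
  then show ?thesis
    by (intro exI[of _ "\<lambda>\<omega>. fst (c \<omega>)"] exI[of _ "\<lambda>\<omega>. snd (c \<omega>)"] exI[of _ "1::real"] conjI zero_less_one)
qed

end
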